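(* Let $f_1,\dots,f_r$ be pairwise non-associated irreducible germs at the origin of holomorphic functions on $\mathbb{C}^2$, vanishing at the origin (the equations of the $r$ branches of a plane curve germ). Let $\mathcal{P}(s_1,\dots,s_r)=\prod_i L_i(s_1+1,\dots,s_r+1)$, where $L_i=L_i(x_1,\dots,x_r)$ runs through the (inhomogeneous) linear forms, one for each distinct hyperplane, vanishing on the $(r-1)$-dimensional faces of quasiadjunction of $f_1,\dots,f_r$ (i.e. on the $(r-1)$-dimensional faces of the polytopes of quasiadjunction $\mathcal{P}(\mathcal{A})$). Then every polynomial $b\in\mathcal{B}_{f_1,\dots,f_r}$ in the multivariable Bernstein ideal of $f_1,\dots,f_r$ is divisible by $\mathcal{P}$ in $\mathbb{C}[s_1,\dots,s_r]$.
   Context: Bernstein ideal: let $\mathcal{D}$ be the ring of germs at $0\in\mathbb{C}^2$ of holomorphic linear differential operators. $\mathcal{B}_{f_1,\dots,f_r}\subset\mathbb{C}[s_1,\dots,s_r]$ is the ideal of all polynomials $b(s_1,\dots,s_r)$ for which there exists $P\in\mathcal{D}[s_1,\dots,s_r]$ with $$P\cdot f_1^{s_1+1}\cdots f_r^{s_r+1}=b(s_1,\dots,s_r)\,f_1^{s_1}\cdots f_r^{s_r}.$$ Ideals and polytopes of quasiadjunction: for integers $m_i\ge 1$, $0\le j_i<m_i$, let $V_{m_1,\dots,m_r}$ be the germ of complete intersection surface singularity $z_1^{m_1}=f_1(x,y),\dots,z_r^{m_r}=f_r(x,y)$. The ideal of quasiadjunction $\mathcal{A}(j_1,\dots,j_r|m_1,\dots,m_r)\subset\mathcal{O}_{\mathbb{C}^2,0}$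 is the ideal of germs $\phi$ such that the 2-form $$\omega_\phi=\frac{\phi\, z_1^{j_1}\cdots z_r^{j_r}\,dx\wedge dy}{z_1^{m_1-1}\cdots z_r^{m_r-1}}$$ extends to a holomorphic form on a resolution of the singularity of $V_{m_1,\dots,m_r}$. Let $\mathcal{U}=\{x\in\mathbb{R}^r:0\le x_i<1\}$. For an ideal of quasiadjunction $\mathcal{A}$, the polytope of quasiadjunction $\mathcal{P}(\mathcal{A})$ is the unique (relatively open) polytope in $\mathcal{U}$ such that $\mathcal{A}\subseteq\mathcal{A}(j_1,\dots,j_r|m_1,\dots,m_r)$ if and only if $\left(\frac{j_1+1}{m_1},\dots,\frac{j_r+1}{m_r}\right)\in\mathcal{P}(\mathcal{A})$ (for such points lying in $\mathcal{U}$). Explicitly: let $\pi$ be an embedded resolution of $f_1\cdots f_r=0$ with exceptional curves $E_k$, and put $a_{i,k}=\mathrm{mult}_{E_k}\pi^*(f_i)$, $c_k=\mathrm{mult}_{E_k}\pi^*(dx\wedge dy)$, $e_k(\phi)=\mathrm{mult}_{E_k}\pi^*(\phi)$. Then $\mathcal{P}(\mathcal{A})$ is the set of $x\in\mathcal{U}$ with $$\sum_i a_{i,k}x_i>\sum_i a_{i,k}-e_k(\phi)-c_k-1\quad\text{for all }k\text{ and all }\phi\in\mathcal{A}.$$ A face of quasiadjunction is a face of the boundary (inside $\mathcal{U}$) of some $\mathcal{P}(\mathcal{A})$, i.e. a boundary face cut out by these inequalities; the walls of the cube $\mathcal{U}$ are not counted. *)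

theory Defs
  imports
    "HOL-Analysis.Analysis"
    "HOL-Computational_Algebra.Factorial_Ring"
    "HOL-Library.Poly_Mapping"
begin

section \<open>Germs at the origin of holomorphic functions of two variables\<close>

text \<open>Complex differentiability, i.e. a complex-linear Frechet derivative, at every point of \<open>S\<close>;
  only used for open \<open>S\<close>.\<close>

definition hol2_on :: "(complex \<times> complex \<Rightarrow> complex) \<Rightarrow> (complex \<times> complex) set \<Rightarrow> bool"
    (infix \<open>hol2'_on\<close> 50)
  where "f hol2_on S \<longleftrightarrow>
    (\<forall>p\<in>S. \<exists>a b. (f has_derivative (\<lambda>(u, v). a * u + b * v)) (at p))"

lemma hol2_on_subset: "f hol2_on S \<Longrightarrow> T \<subseteq> S \<Longrightarrow> f hol2_on T"
  by (auto simp: hol2_on_def)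

lemma hol2_on_const: "(\<lambda>p. c) hol2_on S"
  unfolding hol2_on_def
  by (intro ballI exI[of _ 0]) (simp add: case_prod_unfold)

lemma hol2_on_add: "f hol2_on S \<Longrightarrow> g hol2_on S \<Longrightarrow> (\<lambda>p. f p + g p) hol2_on S"
  unfolding hol2_on_def
proof
  fix p assume "\<forall>p\<in>S. \<exists>a b. (f has_derivative (\<lambda>(u, v). a * u + b * v)) (at p)"
    "\<forall>p\<in>S. \<exists>a b. (g has_derivative (\<lambda>(u, v). a * u + b * v)) (at p)" "p \<in> S"
  then obtain a b a' b' where "(f has_derivative (\<lambda>(u, v). a * u + b * v)) (at p)"
    "(g has_derivative (\<lambda>(u, v). a' * u + b' * v)) (at p)" by blast
  from has_derivative_add[OF this]
  have "((\<lambda>p. f p + g p) has_derivative (\<lambda>(u, v). (a + a') * u + (b + b') * v)) (at p)"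
    by (simp add: case_prod_unfold algebra_simps)
  then show "\<exists>a b. ((\<lambda>p. f p + g p) has_derivative (\<lambda>(u, v). a * u + b * v)) (at p)" by blast
qed

lemma hol2_on_mult: "f hol2_on S \<Longrightarrow> g hol2_on S \<Longrightarrow> (\<lambda>p. f p * g p) hol2_on S"
  unfolding hol2_on_def
proof
  fix p assume "\<forall>p\<in>S. \<exists>a b. (f has_derivative (\<lambda>(u, v). a * u + b * v)) (at p)"
    "\<forall>p\<in>S. \<exists>a b. (g has_derivative (\<lambda>(u, v). a * u + b * v)) (at p)" "p \<in> S"
  then obtain a b a' b' where "(f has_derivative (\<lambda>(u, v). a * u + b * v)) (at p)"
    "(g has_derivative (\<lambda>(u, v). a' * u + b' * v)) (at p)" by blast
  from has_derivative_mult[OF this]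
  have "((\<lambda>p. f p * g p) has_derivative
      (\<lambda>(u, v). (f p * a' + a * g p) * u + (f p * b' + b * g p) * v)) (at p)"
    by (simp add: case_prod_unfold algebra_simps)
  then show "\<exists>a b. ((\<lambda>p. f p * g p) has_derivative (\<lambda>(u, v). a * u + b * v)) (at p)" by blast
qed

lemma hol2_on_minus: "f hol2_on S \<Longrightarrow> (\<lambda>p. - f p) hol2_on S"
  using hol2_on_mult[OF hol2_on_const[of "-1" S], of f] by simp

definition hol2_at0 :: "(complex \<times> complex \<Rightarrow> complex) \<Rightarrow> bool"
  where "hol2_at0 f \<longleftrightarrow> (\<exists>V. open V \<and> 0 \<in> V \<and> f hol2_on V)"

definition germ_rel ::
    "(complex \<times> complex \<Rightarrow> complex) \<Rightarrow> (complex \<times> complex \<Rightarrow> complex) \<Rightarrow> bool"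
  where "germ_rel f g \<longleftrightarrow> hol2_at0 f \<and> hol2_at0 g \<and> (\<forall>\<^sub>F p in nhds 0. f p = g p)"

quotient_type germ = "complex \<times> complex \<Rightarrow> complex" / partial: germ_rel
proof (rule part_equivpI)
  show "\<exists>f. germ_rel f f"
    unfolding germ_rel_def hol2_at0_def
    by (rule exI[of _ "\<lambda>p. 0"]) (use hol2_on_const open_UNIV in auto)
  show "symp germ_rel"
    by (auto simp: symp_def germ_rel_def eq_commute)
  show "transp germ_rel"
    unfolding transp_def germ_rel_def by (auto elim: eventually_elim2)
qed

lemma hol2_at0_const: "hol2_at0 (\<lambda>p. c)"
  unfolding hol2_at0_def using hol2_on_const open_UNIV by blast

lemma hol2_at0_binop:
  assumes "hol2_at0 f" "hol2_at0 g"
    and "\<And>S. f hol2_on S \<Longrightarrow> g hol2_on S \<Longrightarrow> (\<lambda>p. h (f p) (g p)) hol2_on S"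
  shows "hol2_at0 (\<lambda>p. h (f p) (g p))"
proof -
  obtain U V where "open U" "0 \<in> U" "f hol2_on U" "open V" "0 \<in> V" "g hol2_on V"
    using assms(1,2) by (auto simp: hol2_at0_def)
  then show ?thesis
    unfolding hol2_at0_def
    by (intro exI[of _ "U \<inter> V"]) (auto intro!: assms(3) intro: hol2_on_subset)
qed

lemmas hol2_at0_add = hol2_at0_binop[where h = "(+)", OF _ _ hol2_on_add]
lemmas hol2_at0_mult = hol2_at0_binop[where h = "(*)", OF _ _ hol2_on_mult]

lemma hol2_at0_minus: "hol2_at0 f \<Longrightarrow> hol2_at0 (\<lambda>p. - f p)"
  unfolding hol2_at0_def using hol2_on_minus by blast

instantiation germ :: comm_ring_1
begin

lift_definition zero_germ :: germ is "\<lambda>p. 0"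
  by (simp add: germ_rel_def hol2_at0_const)

lift_definition one_germ :: germ is "\<lambda>p. 1"
  by (simp add: germ_rel_def hol2_at0_const)

lift_definition plus_germ :: "germ \<Rightarrow> germ \<Rightarrow> germ" is "\<lambda>f g p. f p + g p"
  unfolding germ_rel_def by (auto intro: hol2_at0_add elim: eventually_elim2)

lift_definition times_germ :: "germ \<Rightarrow> germ \<Rightarrow> germ" is "\<lambda>f g p. f p * g p"
  unfolding germ_rel_def by (auto intro: hol2_at0_mult elim: eventually_elim2)

lift_definition uminus_germ :: "germ \<Rightarrow> germ" is "\<lambda>f p. - f p"
  unfolding germ_rel_def by (auto intro: hol2_at0_minus elim: eventually_mono)

definition minus_germ :: "germ \<Rightarrow> germ \<Rightarrow> germ"
  where "minus_germ f g = f + (- g)"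

instance
proof
  fix a b c :: germ
  show "a + b + c = a + (b + c)"
    by transfer (simp add: germ_rel_def hol2_at0_add add.assoc)
  show "a + b = b + a"
    by transfer (simp add: germ_rel_def hol2_at0_add add.commute)
  show "0 + a = a"
    by transfer (simp add: germ_rel_def)
  show "- a + a = 0"
    by transfer (simp add: germ_rel_def hol2_at0_const)
  show "a - b = a + - b"
    by (simp add: minus_germ_def)
  show "a * b * c = a * (b * c)"
    by transfer (simp add: germ_rel_def hol2_at0_mult mult.assoc)
  show "a * b = b * a"
    by transfer (simp add: germ_rel_def hol2_at0_mult mult.commute)
  show "1 * a = a"
    by transfer (simp add: germ_rel_def)
  show "(a + b) * c = a * c + b * c"
    by transfer (simp add: germ_rel_def hol2_at0_add hol2_at0_mult distrib_right)
  show "(0::germ) \<noteq> 1"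
    by transfer (auto simp: germ_rel_def dest: eventually_nhds_x_imp_x)
qed

end

lift_definition germ_at0 :: "germ \<Rightarrow> complex" is "\<lambda>f. f 0"
  by (auto simp: germ_rel_def dest: eventually_nhds_x_imp_x)

text \<open>\<^term>\<open>rep_germ g\<close> is some function representing \<open>g\<close>; it is determined, and holomorphic, only
  near the origin, so it is used below only on neighbourhoods that may be shrunk.\<close>

lemma germ_rel_rep_germ: "germ_rel (rep_germ g) (rep_germ g)"
  using Quotient_germ by (simp add: Quotient_rep_reflp)


section \<open>The Bernstein ideal\<close>

definition pd1 :: "(complex \<times> complex \<Rightarrow> complex) \<Rightarrow> complex \<times> complex \<Rightarrow> complex"
  where "pd1 u = (\<lambda>(x, y). deriv (\<lambda>t. u (t, y)) x)"

definition pd2 :: "(complex \<times> complex \<Rightarrow> complex) \<Rightarrow> complex \<times> complex \<Rightarrow> complex"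
  where "pd2 u = (\<lambda>(x, y). deriv (\<lambda>t. u (x, t)) y)"

text \<open>Polynomials in variables indexed by \<open>'n\<close> over \<open>'a\<close> are finitely supported maps from
  exponent vectors to coefficients.  With \<open>'n\<close> finite, the number \<open>r\<close> of variables is \<open>CARD('n)\<close>.\<close>

type_synonym ('n, 'a) mpol = "('n \<Rightarrow>\<^sub>0 nat) \<Rightarrow>\<^sub>0 'a"

definition mpol_var :: "'n \<Rightarrow> ('n, complex) mpol"
  where "mpol_var i = Poly_Mapping.single (Poly_Mapping.single i 1) 1"

definition mpol_const :: "complex \<Rightarrow> ('n, complex) mpol"
  where "mpol_const c = Poly_Mapping.single 0 c"

text \<open>The value at \<open>s\<close> of a polynomial whose coefficients are mapped to \<open>\<complex>\<close> by \<open>h\<close>.\<close>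

definition mpol_eval :: "('a::zero \<Rightarrow> complex) \<Rightarrow> ('n::finite, 'a) mpol \<Rightarrow> ('n \<Rightarrow> complex) \<Rightarrow> complex"
  where "mpol_eval h q s =
    (\<Sum>\<mu>\<in>Poly_Mapping.keys q. h (Poly_Mapping.lookup q \<mu>) * (\<Prod>i\<in>UNIV. s i ^ Poly_Mapping.lookup \<mu> i))"

text \<open>An element of \<open>\<D>[s]\<close> in normal form: the coefficient of
  \<open>\<partial>\<^sub>x\<^sup>k \<partial>\<^sub>y\<^sup>l\<close> is a polynomial in \<open>s\<close> over the ring of germs.\<close>

type_synonym 'n diffop = "(nat \<times> nat) \<Rightarrow>\<^sub>0 ('n, germ) mpol"

definition diffop_apply :: "'n::finite diffop \<Rightarrow> ('n \<Rightarrow> complex)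
    \<Rightarrow> (complex \<times> complex \<Rightarrow> complex) \<Rightarrow> complex \<times> complex \<Rightarrow> complex"
  where "diffop_apply P s u p =
    (\<Sum>(k, l)\<in>Poly_Mapping.keys P.
       mpol_eval (\<lambda>g. rep_germ g p) (Poly_Mapping.lookup P (k, l)) s * (pd1 ^^ k) ((pd2 ^^ l) u) p)"

text \<open>The powers \<open>f\<^sub>i\<^sup>s\<close> are multivalued.  The identity
  \<open>P \<cdot> \<Prod> f\<^sub>i\<^bsup>s\<^sub>i+1\<^esup> = b(s) \<Prod> f\<^sub>i\<^bsup>s\<^sub>i\<^esup>\<close> is required near the origin for every local choice
  of branches \<open>\<l> i\<close> of \<open>log f\<^sub>i\<close> on an open set \<open>W\<close> (which then avoids the zeros of the \<open>f\<^sub>i\<close>).\<close>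

definition bernstein_ideal :: "('n::finite \<Rightarrow> germ) \<Rightarrow> ('n, complex) mpol set"
  where "bernstein_ideal f = {b. \<exists>P :: 'n diffop. \<exists>V. open V \<and> 0 \<in> V \<and>
    (\<forall>W \<l>. open W \<and> W \<subseteq> V \<and>
        (\<forall>i. \<l> i hol2_on W \<and> (\<forall>p\<in>W. exp (\<l> i p) = rep_germ (f i) p)) \<longrightarrow>
      (\<forall>s. \<forall>p\<in>W.
        diffop_apply P s (\<lambda>q. exp (\<Sum>i\<in>UNIV. (s i + 1) * \<l> i q)) p =
        mpol_eval (\<lambda>c. c) b s * exp (\<Sum>i\<in>UNIV. s i * \<l> i p)))}"


section \<open>Resolutions of the surface singularities\<close>

type_synonym 'n ambient = "(complex \<times> complex) \<times> (complex ^ 'n)"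

definition hol2_ambient_on :: "(complex \<times> complex \<Rightarrow> 'n::finite ambient) \<Rightarrow> (complex \<times> complex) set \<Rightarrow> bool"
  where "hol2_ambient_on \<sigma> D \<longleftrightarrow>
    (\<lambda>q. fst (fst (\<sigma> q))) hol2_on D \<and> (\<lambda>q. snd (fst (\<sigma> q))) hol2_on D \<and>
    (\<forall>i. (\<lambda>q. snd (\<sigma> q) $ i) hol2_on D)"

text \<open>A local holomorphic parametrisation of \<open>V\<close> as a two-dimensional submanifold: a holomorphic
  immersion that is a homeomorphism onto an open subset of \<open>V\<close>.\<close>

definition local_param ::
    "'n::finite ambient set \<Rightarrow> (complex \<times> complex) set \<Rightarrow> (complex \<times> complex \<Rightarrow> 'n ambient) \<Rightarrow> bool"
  where "local_param V D \<sigma> \<longleftrightarrow>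
    open D \<and> hol2_ambient_on \<sigma> D \<and>
    (\<forall>q\<in>D. inj (frechet_derivative \<sigma> (at q))) \<and>
    openin (top_of_set V) (\<sigma> ` D) \<and>
    (\<exists>\<tau>. homeomorphism D (\<sigma> ` D) \<sigma> \<tau>)"

definition regular_locus :: "'n::finite ambient set \<Rightarrow> 'n ambient set"
  where "regular_locus V = {v. \<exists>D \<sigma>. local_param V D \<sigma> \<and> v \<in> \<sigma> ` D}"

type_synonym 'a atlas = "('a set \<times> ('a \<Rightarrow> complex \<times> complex)) set"

definition complex_surface :: "'a topology \<Rightarrow> 'a atlas \<Rightarrow> bool"
  where "complex_surface X At \<longleftrightarrow>
    Hausdorff_space X \<and> second_countable X \<and>
    (\<Union>(Q, \<kappa>)\<in>At. Q) = topspace X \<and>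
    (\<forall>(Q, \<kappa>)\<in>At. openin X Q \<and> open (\<kappa> ` Q) \<and>
       homeomorphic_map (subtopology X Q) (top_of_set (\<kappa> ` Q)) \<kappa>) \<and>
    (\<forall>(Q, \<kappa>)\<in>At. \<forall>(Q', \<kappa>')\<in>At.
       (\<lambda>q. fst (\<kappa>' (inv_into Q \<kappa> q))) hol2_on \<kappa> ` (Q \<inter> Q') \<and>
       (\<lambda>q. snd (\<kappa>' (inv_into Q \<kappa> q))) hol2_on \<kappa> ` (Q \<inter> Q'))"

text \<open>A proper holomorphic surjection from a complex surface which is biholomorphic over the regular
  locus \<open>V\<^sub>r\<^sub>e\<^sub>g\<close>, with the preimage of \<open>V\<^sub>r\<^sub>e\<^sub>g\<close> dense.  In charts, biholomorphic means that the
  restriction is a bijection onto \<open>V\<^sub>r\<^sub>e\<^sub>g\<close> given by local parametrisations of \<open>V\<close>.\<close>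

definition resolution :: "'n::finite ambient set \<Rightarrow> 'a topology \<Rightarrow> 'a atlas \<Rightarrow> ('a \<Rightarrow> 'n ambient) \<Rightarrow> bool"
  where "resolution V X At \<rho> \<longleftrightarrow>
    complex_surface X At \<and>
    (\<forall>(Q, \<kappa>)\<in>At. hol2_ambient_on (\<lambda>q. \<rho> (inv_into Q \<kappa> q)) (\<kappa> ` Q)) \<and>
    \<rho> ` topspace X = V \<and>
    proper_map X (top_of_set V) \<rho> \<and>
    X closure_of {x \<in> topspace X. \<rho> x \<in> regular_locus V} = topspace X \<and>
    inj_on \<rho> {x \<in> topspace X. \<rho> x \<in> regular_locus V} \<and>
    (\<forall>(Q, \<kappa>)\<in>At. local_param V (\<kappa> ` {x \<in> Q. \<rho> x \<in> regular_locus V}) (\<lambda>q. \<rho> (inv_into Q \<kappa> q)))"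


section \<open>Ideals, polytopes and faces of quasiadjunction\<close>

definition cover_surface ::
    "('n::finite \<Rightarrow> germ) \<Rightarrow> ('n \<Rightarrow> nat) \<Rightarrow> 'n ambient set \<Rightarrow> 'n ambient set"
  where "cover_surface f m N = {w \<in> N. \<forall>i. snd w $ i ^ m i = rep_germ (f i) (fst w)}"

text \<open>The pullback of \<open>\<omega>\<^sub>\<phi>\<close> under \<open>\<rho>\<close>, a priori defined where no \<open>z\<^sub>i\<close> vanishes, extends
  holomorphically: in a chart with coordinates \<open>(u, v)\<close> it is \<open>g du \<and> dv\<close> with \<open>g\<close> holomorphic,
  where \<open>dx \<and> dy\<close> contributes the Jacobian determinant.\<close>

definition form_extends :: "germ \<Rightarrow> ('n::finite \<Rightarrow> nat) \<Rightarrow> ('n \<Rightarrow> nat)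
    \<Rightarrow> 'a atlas \<Rightarrow> ('a \<Rightarrow> 'n ambient) \<Rightarrow> bool"
  where "form_extends \<phi> j m At \<rho> \<longleftrightarrow> (\<forall>(Q, \<kappa>)\<in>At. \<exists>g. g hol2_on \<kappa> ` Q \<and>
    (let x = \<lambda>q. fst (fst (\<rho> (inv_into Q \<kappa> q)));
         y = \<lambda>q. snd (fst (\<rho> (inv_into Q \<kappa> q)));
         z = \<lambda>i q. snd (\<rho> (inv_into Q \<kappa> q)) $ i
     in \<forall>q\<in>\<kappa> ` Q. (\<forall>i. z i q \<noteq> 0) \<longrightarrow>
          g q = rep_germ \<phi> (x q, y q) * (\<Prod>i\<in>UNIV. z i q ^ j i) / (\<Prod>i\<in>UNIV. z i q ^ (m i - 1))
                * (pd1 x q * pd2 y q - pd2 x q * pd1 y q)))"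

text \<open>Taking the points of the resolution from \<^typ>\<open>real\<close> is no restriction, since
  a second countable Hausdorff space has at most the cardinality of the continuum.\<close>

definition quasiadj_ideal :: "('n::finite \<Rightarrow> germ) \<Rightarrow> ('n \<Rightarrow> nat) \<Rightarrow> ('n \<Rightarrow> nat) \<Rightarrow> germ set"
  where "quasiadj_ideal f j m = {\<phi>. \<exists>N (X :: real topology) At \<rho>.
    open N \<and> 0 \<in> N \<and>
    rep_germ \<phi> hol2_on fst ` N \<and> (\<forall>i. rep_germ (f i) hol2_on fst ` N) \<and>
    resolution (cover_surface f m N) X At \<rho> \<and> form_extends \<phi> j m At \<rho>}"

definition quasiadj_ideals :: "('n::finite \<Rightarrow> germ) \<Rightarrow> germ set set"
  where "quasiadj_ideals f = {quasiadj_ideal f j m | j m. \<forall>i. m i \<ge> 1 \<and> j i < m i}"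

definition cube :: "(real ^ 'n::finite) set"
  where "cube = {x. \<forall>i. 0 \<le> x $ i \<and> x $ i < 1}"

definition rel_open_polytope :: "(real ^ 'n::finite) set \<Rightarrow> bool"
  where "rel_open_polytope P \<longleftrightarrow>
    (\<exists>H :: ((real ^ 'n) \<times> real) set. finite H \<and> P = {x \<in> cube. \<forall>(a, c)\<in>H. a \<bullet> x > c})"

text \<open>This determines \<open>P\<close> up to points on the walls of the cube,
  because the points \<open>((j\<^sub>i + 1) / m\<^sub>i)\<^sub>i\<close> are exactly the rational points of the half-open cube
  \<open>{x. \<forall>i. 0 < x\<^sub>i \<le> 1}\<close>.  In particular the closure of \<open>P\<close> is determined.\<close>

definition is_quasiadj_polytope ::
    "('n::finite \<Rightarrow> germ) \<Rightarrow> germ set \<Rightarrow> (real ^ 'n) set \<Rightarrow> bool"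
  where "is_quasiadj_polytope f \<A> P \<longleftrightarrow> rel_open_polytope P \<and>
    (\<forall>j m. (\<forall>i. m i \<ge> 1 \<and> j i < m i) \<and> (\<chi> i. (real (j i) + 1) / real (m i)) \<in> cube \<longrightarrow>
       (\<A> \<subseteq> quasiadj_ideal f j m \<longleftrightarrow> (\<chi> i. (real (j i) + 1) / real (m i)) \<in> P))"

text \<open>Faces contained in a wall \<open>x\<^sub>i = 0\<close> or \<open>x\<^sub>i = 1\<close> of the cube are not counted.\<close>

definition quasiadj_face :: "('n::finite \<Rightarrow> germ) \<Rightarrow> (real ^ 'n) set \<Rightarrow> bool"
  where "quasiadj_face f F \<longleftrightarrow> (\<exists>\<A>\<in>quasiadj_ideals f. \<exists>P. is_quasiadj_polytope f \<A> P \<and>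
    F face_of closure P \<and> F \<noteq> {} \<and> F \<noteq> closure P \<and>
    (\<forall>i. \<not> F \<subseteq> {x. x $ i = 0} \<and> \<not> F \<subseteq> {x. x $ i = 1}))"

definition quasiadj_hyperplanes :: "('n::finite \<Rightarrow> germ) \<Rightarrow> (real ^ 'n) set set"
  where "quasiadj_hyperplanes f =
    {affine hull F | F. quasiadj_face f F \<and> aff_dim F = int CARD('n) - 1}"

text \<open>For the linear form \<open>L(x) = a \<bullet> x - c\<close>, the polynomial \<open>L(s\<^sub>1 + 1, \<dots>, s\<^sub>r + 1)\<close>.\<close>

definition shifted_form :: "real ^ 'n::finite \<Rightarrow> real \<Rightarrow> ('n, complex) mpol"
  where "shifted_form a c =
    (\<Sum>i\<in>UNIV. mpol_const (of_real (a $ i)) * (mpol_var i + 1)) - mpol_const (of_real c)"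

end

theory Submission
  imports Defs "HOL-Complex_Analysis.Complex_Analysis"
begin

text \<open>
Pulling \<open>\<omega>\<^sub>\<phi>\<close> back to a resolution and changing variables shows that \<open>\<phi>\<close> lies in the ideal of quasiadjunction
\<open>\<A>(j|m)\<close> if and only if \<open>\<bar>\<phi>\<bar>^2 \<Prod>\<bar>f\<^sub>i\<bar>\<^bsup>2(x\<^sub>i-1)\<^esup>\<close> with \<open>x\<^sub>i = (j\<^sub>i+1)/m\<^sub>i\<close> is locally integrable at the origin;
the extension of the form from integrability is an \<open>L^2\<close> division theorem. By an induction over blow-ups
this integrability is equivalent to finitely many inequalities \<open>\<alpha>\<bullet>(x-1) + k > 0\<close> with integral \<open>\<alpha>\<close>, \<open>k\<close>, where
\<open>\<alpha>\<close> is bounded independently of \<open>\<phi>\<close>. Hence at each point of a face of a polytope \<open>\<P>(\<A>)\<close> off the walls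
some \<open>\<phi>\<close> in \<open>\<A>\<close> has one of these expressions equal to zero: integrability fails there, but holds at
nearby points of the polytope.

If \<open>P f\<^bsup>s+1\<^esup> = b(s) f\<^sup>s\<close>, multiply by the conjugate of \<open>\<phi> f\<^sup>s\<close>, which is constant for holomorphic derivatives, and integrate by
parts against \<open>\<phi>\<close> times a power of a bump function. This is legitimate for large real \<open>s\<close> and extends to \<open>s = x - 1\<close> by
analytic continuation along the diagonal. For the integral \<open>I(s)\<close> of \<open>\<bar>\<phi>\<bar>^2\<bar>f\<bar>\<^bsup>2s\<^esup>\<close> against the bump it gives
\<open>\<bar>b(s)\<bar> I(s) <= C (e I(s) + 1/e)\<close> for all \<open>e > 0\<close>, with \<open>C\<close> independent of \<open>x\<close> in the unit cube. So \<open>I\<close> stays bounded when \<open>x\<close>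
approaches a point where \<open>b(x-1)\<close> does not vanish, and Fatou's lemma gives integrability at that point.
Therefore \<open>b(x-1) = 0\<close> on the face, and a polynomial vanishing on an open piece of a
hyperplane is divisible by the linear form.
\<close>

text \<open>No resolution of the surface is constructed. An element \<open>\<phi>\<close> of one
  ideal comes with a resolution, and the surface depends on \<open>m\<close> but not on
  \<open>j\<close>; so this resolution serves for every other \<open>j\<close> with the same
  \<open>m\<close>. This is why the points compared inside a cube share one denominator. An ideal
  has infinitely many elements and each contributes its own inequalities. Uniformity over them has
  two sources: the vectors \<open>\<alpha>\<close> are bounded before \<open>h\<close> is chosen, so
  only the constant \<open>k\<close> depends on \<open>h\<close>, and \<open>k\<close> is an
  integer, so at a given point the positive values of all expressions stay away from zero. The
  estimate gains something because the operator acts on f^(s+1): after multiplication by the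
  conjugate the integrand has size X * Y with X^2 the integrand of I(s) and Y = |f|^(s+1), which is
  bounded for s >= -1. The inequality X * Y <= eps * X^2 + Y^2 / eps returns I(s) with a small
  factor, which is absorbed where b does not vanish. The functions of integration by parts must not
  depend on s; otherwise neither the continuation in s nor the uniform constant would be
  available.\<close>

type_synonym cfun = "complex \<times> complex => complex"

abbreviation L1_on :: "('a::euclidean_space => 'b::{banach, second_countable_topology}) => 'a set => bool" (infix "L1'_on" 46)
 where "f L1_on S == f absolutely_integrable_on S"

section \<open>Holomorphic functions of two variables\<close>

lemma hol2_on_cong:
 assumes "open S" "!!p. p \<in> S ==> f p = g p" "f hol2_on S"
 shows "g hol2_on S"
 unfolding hol2_on_def
proof
 fix p assume p: "p \<in> S"
 then obtain a b where "(f has_derivative (%(u, v). a * u + b * v)) (at p)"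
  using assms(3) by (auto simp: hol2_on_def)
 from has_derivative_transform_within_open[OF this assms(1) p assms(2)]
 show "EX a b. (g has_derivative (%(u, v). a * u + b * v)) (at p)" by blast
qed

lemma hol2_on_continuous: "f hol2_on S ==> continuous_on S f"
 unfolding hol2_on_def by (meson continuous_at_imp_continuous_on has_derivative_continuous)

lemma hol2_on_fst: "fst hol2_on S"
 unfolding hol2_on_def
 by (intro ballI exI[of _ 1] exI[of _ 0]) (auto intro!: derivative_eq_intros simp: case_prod_unfold)

lemma hol2_on_snd: "snd hol2_on S"
 unfolding hol2_on_def
 by (intro ballI exI[of _ 0] exI[of _ 1]) (auto intro!: derivative_eq_intros simp: case_prod_unfold)

lemma hol2_on_compose:
 assumes "f hol2_on S" "X hol2_on T" "Y hol2_on T" "!!q. q \<in> T ==> (X q, Y q) \<in> S"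
 shows "(%q. f (X q, Y q)) hol2_on T"
 unfolding hol2_on_def
proof
 fix q assume q: "q \<in> T"
 obtain a b where f: "(f has_derivative (%(u, v). a * u + b * v)) (at (X q, Y q))"
  using assms(1)[unfolded hol2_on_def, rule_format, OF assms(4)[OF q]] by blast
 obtain c d where X: "(X has_derivative (%(u, v). c * u + d * v)) (at q)"
  using assms(2) q by (auto simp: hol2_on_def)
 obtain c' d' where Y: "(Y has_derivative (%(u, v). c' * u + d' * v)) (at q)"
  using assms(3) q by (auto simp: hol2_on_def)
 from has_derivative_compose[OF has_derivative_Pair[OF X Y] f]
 have "((%q. f (X q, Y q)) has_derivative
   (%(u, v). (a * c + b * c') * u + (a * d + b * d') * v)) (at q)"
  by (simp add: case_prod_unfold algebra_simps)
 then show "EX a b. ((%q. f (X q, Y q)) has_derivative (%(u, v). a * u + b * v)) (at q)" by blast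
qed

lemma hol2_on_compose1:
 assumes "g holomorphic_on A" "open A" "X hol2_on T" "!!q. q \<in> T ==> X q \<in> A"
 shows "(%q. g (X q)) hol2_on T"
 unfolding hol2_on_def
proof
 fix q assume q: "q \<in> T"
 obtain a where f: "(g has_derivative (%u. a * u)) (at (X q))"
  using assms(1,2,4) q by (metis holomorphic_on_open has_field_derivative_def)
 obtain c d where X: "(X has_derivative (%(u, v). c * u + d * v)) (at q)"
  using assms(3) q by (auto simp: hol2_on_def)
 from has_derivative_compose[OF X f]
 have "((%q. g (X q)) has_derivative (%(u, v). (a * c) * u + (a * d) * v)) (at q)"
  by (simp add: case_prod_unfold algebra_simps)
 then show "EX a b. ((%q. g (X q)) has_derivative (%(u, v). a * u + b * v)) (at q)" by blast
qed

lemma hol2_on_compose_curve: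
 assumes "f hol2_on S" "X holomorphic_on T" "Y holomorphic_on T" "open T"
  "!!q. q \<in> T ==> (X q, Y q) \<in> S"
 shows "(%q. f (X q, Y q)) holomorphic_on T"
proof -
 have "EX f'. ((%q. f (X q, Y q)) has_field_derivative f') (at q)" if q: "q \<in> T" for q
 proof -
  obtain a b where f: "(f has_derivative (%(u, v). a * u + b * v)) (at (X q, Y q))"
   using assms(1)[unfolded hol2_on_def, rule_format, OF assms(5)[OF q]] by blast
  obtain c where X: "(X has_derivative (%u. c * u)) (at q)"
   using assms q by (metis holomorphic_on_open has_field_derivative_def)
  obtain d where Y: "(Y has_derivative (%u. d * u)) (at q)"
   using assms q by (metis holomorphic_on_open has_field_derivative_def)
  from has_derivative_compose[OF has_derivative_Pair[OF X Y] f]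
  have "((%q. f (X q, Y q)) has_derivative (%u. (a * c + b * d) * u)) (at q)"
   by (simp add: case_prod_unfold algebra_simps)
  then show ?thesis by (auto simp: has_field_derivative_def)
 qed
 then show ?thesis using assms(4) by (simp add: holomorphic_on_open)
qed

lemma hol2_on_diff: "f hol2_on S ==> g hol2_on S ==> (%p. f p - g p) hol2_on S"
 using hol2_on_add[OF _ hol2_on_minus, of f S g] by simp

lemma hol2_on_power: "f hol2_on S ==> (%p. f p ^ n) hol2_on S"
 by (induction n) (auto intro: hol2_on_const hol2_on_mult)

lemma hol2_on_sum: "(!!i. i \<in> I ==> f i hol2_on S) ==> (%p. \<Sum>i\<in>I. f i p) hol2_on S"
 by (induction I rule: infinite_finite_induct) (auto intro: hol2_on_const hol2_on_add)

lemma hol2_on_prod: "(!!i. i \<in> I ==> f i hol2_on S) ==> (%p. \<Prod>i\<in>I. f i p) hol2_on S"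
 by (induction I rule: infinite_finite_induct) (auto intro: hol2_on_const hol2_on_mult)

lemma hol2_on_inverse:
 assumes "f hol2_on S" "!!p. p \<in> S ==> f p ~= 0"
 shows "(%p. inverse (f p)) hol2_on S"
 by (rule hol2_on_compose1[of inverse "- {0}"]) (use assms in "auto intro!: holomorphic_intros")

lemma hol2_on_divide:
 assumes "f hol2_on S" "g hol2_on S" "!!p. p \<in> S ==> g p ~= 0"
 shows "(%p. f p / g p) hol2_on S"
 using hol2_on_mult[OF assms(1) hol2_on_inverse[OF assms(2,3)]] by (simp add: divide_inverse)

lemma hol2_on_exp: "f hol2_on S ==> (%p. exp (f p)) hol2_on S"
 by (rule hol2_on_compose1[of exp UNIV]) (auto intro!: holomorphic_intros)

lemmas hol2_intros = hol2_on_const hol2_on_add hol2_on_mult hol2_on_minus hol2_on_fst hol2_on_snd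
 hol2_on_diff hol2_on_power hol2_on_sum hol2_on_prod hol2_on_divide hol2_on_exp

lemma open_slice1: "open S ==> open {x. (x, y) \<in> S}"
 using open_vimage[of S "%x. (x, y)"] by (simp add: continuous_on_Pair vimage_def)

lemma open_slice2: "open S ==> open {y. (x, y) \<in> S}"
 using open_vimage[of S "%y. (x, y)"] by (simp add: continuous_on_Pair vimage_def)

lemma hol2_on_slice1:
 assumes "f hol2_on S" "open S"
 shows "(%x. f (x, y)) holomorphic_on {x. (x, y) \<in> S}"
 by (rule hol2_on_compose_curve[OF assms(1)])
  (use assms(2) open_slice1 in "auto intro!: holomorphic_intros")

lemma hol2_on_slice2:
 assumes "f hol2_on S" "open S"
 shows "(%y. f (x, y)) holomorphic_on {y. (x, y) \<in> S}"
 by (rule hol2_on_compose_curve[OF assms(1)])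
  (use assms(2) open_slice2 in "auto intro!: holomorphic_intros")

lemma hol2_on_has_derivative:
 assumes "f hol2_on S" "p \<in> S"
 shows "(f has_derivative (%(u, v). pd1 f p * u + pd2 f p * v)) (at p)"
proof -
 obtain a b where f: "(f has_derivative (%(u, v). a * u + b * v)) (at p)"
  using assms by (auto simp: hol2_on_def)
 obtain x y where p: "p = (x, y)" by force
 have "((%t. (t, y)) has_derivative (%h. (h, 0))) (at x)"
  by (auto intro!: derivative_eq_intros)
 from has_derivative_compose[OF this] f p
 have "((%t. f (t, y)) has_derivative (%h. a * h)) (at x)" by fastforce
 then have "((%t. f (t, y)) has_field_derivative a) (at x)" by (simp add: has_field_derivative_def)
 then have a: "a = pd1 f p" by (simp add: pd1_def p DERIV_imp_deriv)
 have "((%t. (x, t)) has_derivative (%h. (0, h))) (at y)"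
  by (auto intro!: derivative_eq_intros)
 from has_derivative_compose[OF this] f p
 have "((%t. f (x, t)) has_derivative (%h. b * h)) (at y)" by fastforce
 then have "((%t. f (x, t)) has_field_derivative b) (at y)" by (simp add: has_field_derivative_def)
 then have "b = pd2 f p" by (simp add: pd2_def p DERIV_imp_deriv)
 with a f show ?thesis by simp
qed

lemma has_derivative_pd:
 assumes "(f has_derivative (%(u, v). a * u + b * v)) (at p)"
 shows "pd1 f p = a" "pd2 f p = b"
proof -
 have "f hol2_on {p}" using assms by (auto simp: hol2_on_def)
 from hol2_on_has_derivative[OF this]
 have "(%(u, v). pd1 f p * u + pd2 f p * v) = (%(u, v). a * u + b * v)"
  using has_derivative_unique assms by blast
 from fun_cong[OF this, of "(1,0)"] fun_cong[OF this, of "(0,1)"]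
 show "pd1 f p = a" "pd2 f p = b" by auto
qed

section \<open>Cauchy integrals with parameters and joint holomorphy\<close>

definition circlepath' :: "real => real => complex"
 where "circlepath' r t = 2 * pi * \<i> * r * exp (2 * of_real pi * \<i> * t)"

lemma continuous_on_circlepath': "continuous_on A g ==> continuous_on A (%x. circlepath' r (g x))"
 unfolding circlepath'_def by (intro continuous_intros)

lemma contour_integral_circlepath_eq:
 "contour_integral (circlepath z r) f = integral {0..1} (%t. f (circlepath z r t) * circlepath' r t)"
 unfolding contour_integral_integral
 by (rule integral_cong) (use vector_derivative_circlepath in "simp add: circlepath'_def mult.assoc")

lemma circlepath_continuous: "continuous_on A (circlepath z r)"
 unfolding circlepath by (intro continuous_intros)

lemma circlepath_in_sphere: "0 <= r ==> t \<in> {0..1} ==> circlepath z r t \<in> sphere z r"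
 using path_image_circlepath_nonneg[of r z] by (auto simp: path_image_def)

lemma continuous_on_contour_integral_param:
 fixes k :: "'a::topological_space => complex => complex"
 assumes "continuous_on (U \<times> sphere z r) (%(u, w). k u w)" "0 <= r"
 shows "continuous_on U (%u. contour_integral (circlepath z r) (k u))"
 unfolding contour_integral_circlepath_eq cbox_interval[symmetric]
proof (rule integral_continuous_on_param)
 have "continuous_on (U \<times> cbox 0 1) (%(u, t). (u, circlepath z r t))"
  by (auto simp: case_prod_unfold intro!: continuous_intros continuous_on_compose2[OF circlepath_continuous[of UNIV]])
 then have "continuous_on (U \<times> cbox 0 1) ((%(u, w). k u w) \<circ> (%(u, t). (u, circlepath z r t)))"
  by (rule continuous_on_compose)
   (rule continuous_on_subset[OF assms(1)], use assms(2) circlepath_in_sphere in auto)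
 then show "continuous_on (U \<times> cbox 0 1) (%(x, t). k x (circlepath z r t) * circlepath' r t)"
  by (auto simp: case_prod_unfold o_def intro!: continuous_intros continuous_on_circlepath')
qed

text \<open>Cauchy's formula on a circle around \<open>y0\<close> writes the derivative as a contour
  integral of \<open>f\<close> against a kernel that is continuous in all variables, so joint
  continuity of \<open>f\<close> passes to its derivative.\<close>

lemma continuous_on_deriv_param:
 fixes f :: "cfun"
 assumes "continuous_on (A \<times> B) f" "open B" "!!a. a \<in> A ==> (%y. f (a, y)) holomorphic_on B"
 shows "continuous_on (A \<times> B) (%(a, y). deriv (%y. f (a, y)) y)"
proof -
 have *: "continuous_on (A \<times> ball y0 r) (%(a, y). deriv (%y. f (a, y)) y)"
  if r: "r > 0" "cball y0 r \<subseteq> B" for y0 r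
 proof (rule continuous_on_eq)
  have "continuous_on ((A \<times> ball y0 r) \<times> sphere y0 r) (%q. f (fst (fst q), snd q))"
   by (rule continuous_on_compose2[OF assms(1)]) (use r in "auto intro!: continuous_intros")
  then have "continuous_on (A \<times> ball y0 r) (%q. contour_integral (circlepath y0 r)
      (%w. f (fst q, w) / (w - snd q)^2))"
   using r by (intro continuous_on_contour_integral_param)
    (auto simp: case_prod_unfold intro!: continuous_intros)
  then show "continuous_on (A \<times> ball y0 r) (%q. 1 / (2 * of_real pi * \<i>) * contour_integral (circlepath y0 r)
      (%w. f (fst q, w) / (w - snd q)^2))"
   by (intro continuous_intros)
  fix q assume q: "q \<in> A \<times> ball y0 r"
  obtain a y where qq: "q = (a, y)" by force
  have h: "(%y. f (a, y)) holomorphic_on B" using assms(3) q qq by auto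
  have h1: "(%y. f (a, y)) holomorphic_on ball y0 r" "continuous_on (cball y0 r) (%y. f (a, y))"
   using r holomorphic_on_subset[OF h] ball_subset_cball[of y0 r]
   by (blast, blast intro: holomorphic_on_imp_continuous_on)
  have "((%u. f (a, u) / (u - y)^(Suc 1)) has_contour_integral (2 * pi * \<i>) / fact 1 * (deriv ^^ 1) (%y. f (a, y)) y)
     (circlepath y0 r)"
   by (rule Cauchy_has_contour_integral_higher_derivative_circlepath)
    (use q qq r h1 in auto)
  then show "1 / (2 * of_real pi * \<i>) * contour_integral (circlepath y0 r)
      (%w. f (fst q, w) / (w - snd q)^2) = (case q of (a, y) => deriv (%y. f (a, y)) y)"
   by (simp add: qq contour_integral_unique numeral_2_eq_2)
 qed
 have "continuous (at q within A \<times> B) (%(a, y). deriv (%y. f (a, y)) y)" if q: "q \<in> A \<times> B" for q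
 proof -
  obtain a y where qq: "q = (a, y)" by force
  obtain r where r: "r > 0" "cball y r \<subseteq> B" using open_contains_cball_eq[OF assms(2)] q qq by blast
  have "continuous (at q within A \<times> ball y r) (%(a, y). deriv (%y. f (a, y)) y)"
   using *[OF r] q qq r(1) by (simp add: continuous_on_eq_continuous_within)
  moreover have "at q within A \<times> ball y r = at q within A \<times> B"
   by (rule at_within_nhd[of q "UNIV \<times> ball y r"]) (use r qq in "auto intro: open_Times")
  ultimately show ?thesis by simp
 qed
 then show ?thesis by (simp add: continuous_on_eq_continuous_within)
qed

text \<open>By Cauchy's formula the partial derivative in y is jointly continuous. Together with a
  partial derivative in x at the point itself this suffices for total differentiability, and the
  resulting differential is complex linear.\<close>

lemma osgood:
 assumes S: "open S" and f: "continuous_on S f"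
  and 1: "!!y. (%x. f (x, y)) holomorphic_on {x. (x, y) \<in> S}"
  and 2: "!!x. (%y. f (x, y)) holomorphic_on {y. (x, y) \<in> S}"
 shows "f hol2_on S"
 unfolding hol2_on_def
proof
 fix p assume p: "p \<in> S"
 obtain x0 y0 where pp: "p = (x0, y0)" by force
 obtain A B where AB: "open A" "open B" "x0 \<in> A" "y0 \<in> B" "A \<times> B \<subseteq> S"
  using S p pp by (metis open_prod_elim mem_Sigma_iff)
 obtain r where r: "r > 0" "ball y0 r \<subseteq> B" using AB by (meson openE)
 let ?B = "ball y0 r"
 have sub: "A \<times> ?B \<subseteq> S" using AB r by blast
 have c: "continuous_on (A \<times> ?B) (%(a, y). deriv (%y. f (a, y)) y)"
  by (rule continuous_on_deriv_param)
   (use sub in "auto intro: continuous_on_subset[OF f] holomorphic_on_subset[OF 2]")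
 have "((%(x, y). f (x, y)) has_derivative (%(tx, ty). deriv (%x. f (x, y0)) x0 * tx +
   blinfun_apply (blinfun_mult_right (deriv (%y. f (x0, y)) y0)) ty)) (at (x0, y0) within A \<times> ?B)"
 proof (rule has_derivative_partialsI)
  have "(%x. f (x, y0)) holomorphic_on A"
   by (rule holomorphic_on_subset[OF 1]) (use sub r in auto)
  then have "((%x. f (x, y0)) has_field_derivative deriv (%x. f (x, y0)) x0) (at x0)"
   using AB holomorphic_derivI by blast
  then show "((%x. f (x, y0)) has_derivative (*) (deriv (%x. f (x, y0)) x0)) (at x0 within A)"
   by (simp add: has_field_derivative_def has_derivative_at_withinI)
  show "((%y. f (x, y)) has_derivative blinfun_apply (blinfun_mult_right (deriv (%y. f (x, y)) y))) (at y within ?B)"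
   if "x \<in> A" "y \<in> ?B" for x y
  proof -
   have "(%y. f (x, y)) holomorphic_on ?B"
    by (rule holomorphic_on_subset[OF 2]) (use sub that in auto)
   then have "((%y. f (x, y)) has_field_derivative deriv (%y. f (x, y)) y) (at y)"
    using that holomorphic_derivI open_ball by blast
   then show ?thesis by (simp add: has_field_derivative_def has_derivative_at_withinI)
  qed
  have "continuous_on (A \<times> ?B) (%(x, y). blinfun_mult_right (deriv (%y. f (x, y)) y))"
   using c unfolding case_prod_unfold
   by (rule bounded_linear.continuous_on[OF bounded_linear_blinfun_mult_right])
  then show "continuous (at (x0, y0) within A \<times> ?B) (%(x, y). blinfun_mult_right (deriv (%y. f (x, y)) y))"
   using AB r by (simp add: continuous_on_eq_continuous_within)
 qed (use r in auto)
 moreover have "at (x0, y0) within A \<times> ?B = at (x0, y0)"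
  by (rule at_within_open) (use AB r in "auto intro: open_Times")
 ultimately have "(f has_derivative (%(u, v). deriv (%x. f (x, y0)) x0 * u + deriv (%y. f (x0, y)) y0 * v)) (at p)"
  by (simp add: pp case_prod_unfold)
 then show "EX a b. (f has_derivative (%(u, v). a * u + b * v)) (at p)" by blast
qed

text \<open>Differentiation under the integral sign, on convex open subsets of \<open>B\<close>;
  these suffice because differentiability is local.\<close>

lemma contour_integral_param_holomorphic:
 assumes k: "continuous_on (sphere a r \<times> B) k" and r: "r >= 0" and B: "open B"
  and h: "!!w. w \<in> sphere a r ==> (%y. k (w, y)) holomorphic_on B"
 shows "(%y. contour_integral (circlepath a r) (%w. k (w, y))) holomorphic_on B"
proof -
 have *: "(%y. contour_integral (circlepath a r) (%w. k (w, y))) holomorphic_on U"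
  if U: "convex U" "U \<subseteq> B" "open U" for U
  unfolding contour_integral_circlepath_eq cbox_interval[symmetric]
 proof (rule leibniz_rule_holomorphic[where fx = "%y t. deriv (%y. k (circlepath a r t, y)) y * circlepath' r t"])
  fix y t assume y: "y \<in> U" and t: "t \<in> cbox 0 (1::real)"
  have "((%y. k (circlepath a r t, y)) has_field_derivative deriv (%y. k (circlepath a r t, y)) y) (at y within U)"
   using holomorphic_derivI[OF h[OF circlepath_in_sphere[OF r]] B, of t y] t y U(2)
   by (auto intro: has_field_derivative_at_within)
  then show "((%y. k (circlepath a r t, y) * circlepath' r t) has_field_derivative
    deriv (%y. k (circlepath a r t, y)) y * circlepath' r t) (at y within U)"
   by (rule DERIV_cmult_right)
 next
  fix y assume y: "y \<in> U"
  have "continuous_on (cbox 0 1) (%t. k (circlepath a r t, y))"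
   by (rule continuous_on_compose2[OF k])
    (use y U r circlepath_in_sphere in "auto intro!: continuous_intros circlepath_continuous")
  then show "(%t. k (circlepath a r t, y) * circlepath' r t) integrable_on cbox 0 1"
   by (intro integrable_continuous continuous_intros continuous_on_circlepath')
 next
  have "continuous_on (sphere a r \<times> B) (%(w, y). deriv (%y. k (w, y)) y)"
   by (rule continuous_on_deriv_param[OF k B h])
  then have "continuous_on (U \<times> cbox 0 1) (%q. (%(w, y). deriv (%y. k (w, y)) y) (circlepath a r (snd q), fst q))"
   by (rule continuous_on_compose2)
    (use U r circlepath_in_sphere in "auto intro!: continuous_intros continuous_on_compose2[OF circlepath_continuous[of UNIV]]")
  then show "continuous_on (U \<times> cbox 0 1) (%(y, t). deriv (%y. k (circlepath a r t, y)) y * circlepath' r t)"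
   by (auto simp: case_prod_unfold intro!: continuous_intros continuous_on_circlepath')
 qed (use U in auto)
 have "EX U. open U & y \<in> U & (%y. contour_integral (circlepath a r) (%w. k (w, y))) holomorphic_on U" if "y \<in> B" for y
  using * B that by (meson centre_in_ball convex_ball openE open_ball)
 then have "(%y. contour_integral (circlepath a r) (%w. k (w, y))) field_differentiable (at y)" if "y \<in> B" for y
  using that holomorphic_on_imp_differentiable_at by blast
 then show ?thesis by (simp add: holomorphic_on_def field_differentiable_at_within)
qed

text \<open>The tool by which quotients become jointly holomorphic: \<open>k\<close> needs to be
  known only on the circle, where a denominator can be kept away from zero. In x the kernel 1/(w -
  x) is differentiated, in y the numerator, and Osgood's lemma combines the two.\<close>

lemma cauchy_transform_hol2:
 assumes k: "continuous_on (sphere a r \<times> B) k" and r: "r > 0" and B: "open B"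
  and h: "!!w. w \<in> sphere a r ==> (%y. k (w, y)) holomorphic_on B"
 shows "(%(x, y). contour_integral (circlepath a r) (%w. k (w, y) / (w - x))) hol2_on ball a r \<times> B"
proof (rule osgood)
 show "open (ball a r \<times> B)" using B by (simp add: open_Times)
 have "continuous_on ((ball a r \<times> B) \<times> sphere a r) (%q. k (snd q, snd (fst q)))"
  by (rule continuous_on_compose2[OF k]) (auto intro!: continuous_intros)
 then have "continuous_on ((ball a r \<times> B) \<times> sphere a r) (%(q, w). k (w, snd q) / (w - fst q))"
  using r by (auto simp: case_prod_unfold intro!: continuous_intros)
 from continuous_on_contour_integral_param[OF this] r
 show "continuous_on (ball a r \<times> B) (%(x, y). contour_integral (circlepath a r) (%w. k (w, y) / (w - x)))"
  by (simp add: case_prod_unfold)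
 show "(%x. case (x, y) of (x, y) => contour_integral (circlepath a r) (%w. k (w, y) / (w - x)))
    holomorphic_on {x. (x, y) \<in> ball a r \<times> B}" for y
 proof (cases "y \<in> B")
  case True
  have c: "continuous_on (sphere a r) (%w. k (w, y))"
   by (rule continuous_on_compose2[OF k]) (use True in "auto intro!: continuous_intros")
  have "EX f'. ((%x. contour_integral (circlepath a r) (%w. k (w, y) / (w - x))) has_field_derivative f') (at x)"
   if "x \<in> ball a r" for x
  proof -
   have "((%x. contour_integral (circlepath a r) (%w. k (w, y) / (w - x))) has_field_derivative
    (of_nat 1 * contour_integral (circlepath a r) (%u. k (u, y) / (u - x) ^ Suc 1))) (at x)"
   proof (rule Cauchy_next_derivative_circlepath(2))
    show "((%u. k (u, y) / (u - w) ^ 1) has_contour_integral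
     contour_integral (circlepath a r) (%u. k (u, y) / (u - w))) (circlepath a r)" if "w \<in> ball a r" for w
     unfolding power_one_right
     by (rule has_contour_integral_integral, rule contour_integrable_continuous_circlepath)
      (use that r c in "auto intro!: continuous_intros")
   qed (use c that r in auto)
   then show ?thesis by blast
  qed
  then have "(%x. contour_integral (circlepath a r) (%w. k (w, y) / (w - x))) holomorphic_on ball a r"
   by (simp only: holomorphic_on_open[OF open_ball]) blast
  then show ?thesis using True by (simp add: ball_def)
 qed (simp add: holomorphic_on_def)
 show "(%y. case (x, y) of (x, y) => contour_integral (circlepath a r) (%w. k (w, y) / (w - x)))
    holomorphic_on {y. (x, y) \<in> ball a r \<times> B}" for x
 proof (cases "x \<in> ball a r")
  case True
  have "(%y. contour_integral (circlepath a r) (%w. (%(w, y). k (w, y) / (w - x)) (w, y))) holomorphic_on B"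
   by (rule contour_integral_param_holomorphic)
    (use r True k h B in "auto simp: case_prod_unfold intro!: continuous_intros holomorphic_intros")
  then show ?thesis using True by simp
 qed (simp add: holomorphic_on_def)
qed

lemma hol2_on_swap:
 assumes "f hol2_on S"
 shows "(%(x, y). f (y, x)) hol2_on prod.swap ` S"
proof -
 have "(%q. f (snd q, fst q)) hol2_on prod.swap ` S"
 proof (rule hol2_on_compose[OF assms hol2_on_snd hol2_on_fst])
  fix q :: "complex \<times> complex" assume "q \<in> prod.swap ` S"
  then obtain p where "p \<in> S" "q = prod.swap p" by blast
  then show "(snd q, fst q) \<in> S" by (cases p) simp
 qed
 then show ?thesis by (simp add: case_prod_unfold)
qed

lemma open_swap: "open S ==> open (prod.swap ` (S :: (complex \<times> complex) set))"
proof -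
 assume "open S"
 have "prod.swap ` S = (%p. (snd p, fst p)) -` S"
 proof (intro set_eqI iffI)
  fix p assume "p \<in> (%p. (snd p, fst p)) -` S"
  then have "prod.swap (snd p, fst p) \<in> prod.swap ` S" by blast
  then show "p \<in> prod.swap ` S" by simp
 qed auto
 then show ?thesis using open_vimage[OF \<open>open S\<close>, of "%p. (snd p, fst p)"]
  by (simp add: continuous_on_Pair continuous_on_fst continuous_on_snd)
qed

text \<open>Osgood's lemma once more. In y this is the derivative of a holomorphic function; in x it
  is a Cauchy integral over a circle in the y-plane with x as a parameter.\<close>

lemma hol2_on_pd2:
 assumes f: "f hol2_on S" and S: "open S"
 shows "pd2 f hol2_on S"
proof (rule osgood[OF S])
 have eq: "pd2 f = (%(x, y). deriv (%y. f (x, y)) y)" by (simp add: pd2_def)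
 show "continuous_on S (pd2 f)"
 proof -
  have "continuous (at p) (pd2 f)" if p: "p \<in> S" for p
  proof -
   obtain A B where AB: "open A" "open B" "p \<in> A \<times> B" "A \<times> B \<subseteq> S" by (rule open_prod_elim[OF S p])
   have "continuous_on (A \<times> B) (pd2 f)"
    unfolding eq by (rule continuous_on_deriv_param)
    (use AB in "auto intro: continuous_on_subset[OF hol2_on_continuous[OF f]] holomorphic_on_subset[OF hol2_on_slice2[OF f S]]")
   then show ?thesis using AB by (metis continuous_on_eq_continuous_at open_Times)
  qed
  then show ?thesis by (simp add: continuous_at_imp_continuous_on)
 qed
 show "(%y. pd2 f (x, y)) holomorphic_on {y. (x, y) \<in> S}" for x
  using holomorphic_deriv[OF hol2_on_slice2[OF f S] open_slice2[OF S], of x] by (simp add: eq)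
 show "(%x. pd2 f (x, y)) holomorphic_on {x. (x, y) \<in> S}" for y
 proof -
  have "(%x. pd2 f (x, y)) field_differentiable at x" if "(x, y) \<in> S" for x
  proof -
   obtain A B where AB: "open A" "open B" "(x, y) \<in> A \<times> B" "A \<times> B \<subseteq> S" by (rule open_prod_elim[OF S \<open>(x, y) \<in> S\<close>])
   obtain r where r: "r > 0" "cball y r \<subseteq> B" using open_contains_cball_eq[OF AB(2)] AB(3) by blast
   have sp: "(x', w) \<in> S" if "w \<in> sphere y r" "x' \<in> A" for x' w
    using that AB r sphere_cball[of y r] by blast
   have "(%x'. contour_integral (circlepath y r) (%w. (%(w, x'). f (x', w) / (w - y)^2) (w, x'))) holomorphic_on A"
   proof (rule contour_integral_param_holomorphic)
    have "continuous_on (sphere y r \<times> A) (%q. f (snd q, fst q))"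
     by (rule continuous_on_compose2[OF hol2_on_continuous[OF f]])
      (use sp in "auto intro!: continuous_intros simp del: mem_sphere")
    then show "continuous_on (sphere y r \<times> A) (%(w, x'). f (x', w) / (w - y)^2)"
     using r by (auto simp: case_prod_unfold intro!: continuous_intros)
    show "(%ya. case (w, ya) of (w, x') => f (x', w) / (w - y)^2) holomorphic_on A" if "w \<in> sphere y r" for w
     using that r sp[OF that] by (auto intro!: holomorphic_intros holomorphic_on_subset[OF hol2_on_slice1[OF f S]])
   qed (use AB r in auto)
   then have "(%x'. 1 / (2 * of_real pi * \<i>) * contour_integral (circlepath y r) (%w. f (x', w) / (w - y)^2)) holomorphic_on A"
    by (intro holomorphic_intros) auto
   moreover have "1 / (2 * of_real pi * \<i>) * contour_integral (circlepath y r) (%w. f (x', w) / (w - y)^2) = pd2 f (x', y)"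
    if "x' \<in> A" for x'
   proof -
    have h: "(%y. f (x', y)) holomorphic_on B" using AB that by (auto intro: holomorphic_on_subset[OF hol2_on_slice2[OF f S]])
    have h1: "(%y. f (x', y)) holomorphic_on ball y r" "continuous_on (cball y r) (%y. f (x', y))"
     using r holomorphic_on_subset[OF h] ball_subset_cball[of y r]
     by (blast, blast intro: holomorphic_on_imp_continuous_on)
    have "((%u. f (x', u) / (u - y)^(Suc 1)) has_contour_integral (2 * pi * \<i>) / fact 1 * (deriv ^^ 1) (%y. f (x', y)) y)
       (circlepath y r)"
     by (rule Cauchy_has_contour_integral_higher_derivative_circlepath)
      (use r h1 in auto)
    then show ?thesis by (simp add: eq contour_integral_unique numeral_2_eq_2)
   qed
   ultimately have "(%x. pd2 f (x, y)) holomorphic_on A"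
    by (metis (no_types, lifting) holomorphic_transform)
   then show ?thesis using AB by (simp add: holomorphic_on_imp_differentiable_at)
  qed
  then show ?thesis by (simp add: holomorphic_on_def field_differentiable_at_within)
 qed
qed

lemma hol2_on_pd1:
 assumes f: "f hol2_on S" and S: "open S"
 shows "pd1 f hol2_on S"
proof -
 have "pd2 (%(x, y). f (y, x)) hol2_on prod.swap ` S"
  by (intro hol2_on_pd2 hol2_on_swap f open_swap S)
 from hol2_on_swap[OF this] show ?thesis
  by (simp add: pd1_def pd2_def image_image)
qed

section \<open>Polydiscs, germs and divisibility\<close>

definition PD :: "real => (complex \<times> complex) set" where "PD r = ball 0 r \<times> ball 0 r"

lemma open_PD [simp]: "open (PD r)" by (simp add: PD_def open_Times)

lemma zero_in_PD [simp]: "0 \<in> PD r \<longleftrightarrow> r > 0" by (simp add: PD_def zero_prod_def)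

lemma PD_mono: "r <= r' ==> PD r \<subseteq> PD r'" by (auto simp: PD_def)

lemma PD_subset_open:
 assumes "open U" "0 \<in> U"
 obtains r where "r > 0" "PD r \<subseteq> U"
proof -
 obtain A B where AB: "open A" "open B" "(0::complex, 0::complex) \<in> A \<times> B" "A \<times> B \<subseteq> U"
  by (rule open_prod_elim[OF assms(1), of "(0, 0)"]) (use assms(2) in "auto simp: zero_prod_def")
 then obtain r1 r2 where "r1 > 0" "ball 0 r1 \<subseteq> A" "r2 > 0" "ball 0 r2 \<subseteq> B"
  by (meson mem_Sigma_iff openE)
 then show thesis using AB by (intro that[of "min r1 r2"]) (auto simp: PD_def subset_iff)
qed

lemma eventually_nhds_0_PD: "(\<forall>\<^sub>F p in nhds 0. P p) \<longleftrightarrow> (EX r>0. ALL p:PD r. P p)"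
proof
 assume "\<forall>\<^sub>F p in nhds 0. P p"
 then obtain U where U: "open U" "0 \<in> U" "ALL p:U. P p" by (auto simp: eventually_nhds)
 obtain r where "r > 0" "PD r \<subseteq> U" by (rule PD_subset_open[OF U(1,2)])
 then show "EX r>0. ALL p:PD r. P p" using U(3) by (intro exI[of _ r]) auto
next
 assume "EX r>0. ALL p:PD r. P p"
 then obtain r where "r > 0" "ALL p:PD r. P p" by blast
 then show "\<forall>\<^sub>F p in nhds 0. P p"
  unfolding eventually_nhds by (intro exI[of _ "PD r"]) auto
qed

lemma hol2_at0_PD: "hol2_at0 f \<longleftrightarrow> (EX r>0. f hol2_on PD r)"
 unfolding hol2_at0_def by (metis PD_subset_open hol2_on_subset open_PD zero_in_PD)

lemma hol2_at0_continuous: "hol2_at0 f ==> isCont f 0"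
 unfolding hol2_at0_def using hol2_on_continuous continuous_on_eq_continuous_at by blast

text \<open>Restrict to the complex line through \<open>p0\<close> and \<open>p\<close>: convexity
  makes the set \<open>A\<close> of admissible parameters connected, and the one-variable identity
  theorem applies from \<open>t = 0\<close> to \<open>t = 1\<close>.\<close>

lemma hol2_identity:
 assumes f: "f hol2_on S" and S: "open S" "convex S" and T: "open T" "T \<subseteq> S" "p0 \<in> T"
  and 0: "!!p. p \<in> T ==> f p = 0" and p: "p \<in> S"
 shows "f p = 0"
proof -
 define X where "X = (%t::complex. fst p0 + t * (fst p - fst p0))"
 define Y where "Y = (%t::complex. snd p0 + t * (snd p - snd p0))"
 have cont: "continuous_on UNIV (%t. (X t, Y t))"
  unfolding X_def Y_def by (intro continuous_intros)
 define A where "A = {t. (X t, Y t) \<in> S}"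
 define B where "B = {t. (X t, Y t) \<in> T}"
 have opA: "open A" and opB: "open B"
  using open_vimage[OF S(1) cont] open_vimage[OF T(1) cont] by (auto simp: A_def B_def vimage_def)
 have "convex A"
  unfolding convex_alt
 proof (intro ballI allI impI)
  fix t s u assume t: "t \<in> A" and s: "s \<in> A" and u: "0 <= u & u <= (1::real)"
  have "(1 - u) *\<^sub>R (X t, Y t) + u *\<^sub>R (X s, Y s) \<in> S"
   using S(2) t s u unfolding convex_alt A_def by blast
  also have "(1 - u) *\<^sub>R (X t, Y t) + u *\<^sub>R (X s, Y s) =
    (X ((1 - u) *\<^sub>R t + u *\<^sub>R s), Y ((1 - u) *\<^sub>R t + u *\<^sub>R s))"
   by (auto simp: X_def Y_def scaleR_conv_of_real algebra_simps)
  finally show "(1 - u) *\<^sub>R t + u *\<^sub>R s \<in> A" by (simp add: A_def)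
 qed
 have "(%t. f (X t, Y t)) holomorphic_on A"
  by (rule hol2_on_compose_curve[OF f]) (auto simp: X_def Y_def A_def[symmetric] opA intro!: holomorphic_intros, auto simp: A_def X_def Y_def)
 then have "f (X 1, Y 1) = (%_. 0) (1::complex)"
  by (rule analytic_continuation_open[OF opB opA, rotated 3])
   (use T 0 p \<open>convex A\<close> in "auto simp: A_def B_def X_def Y_def convex_connected intro!: exI[of _ 0]")
 then show ?thesis by (simp add: X_def Y_def)
qed

text \<open>For fixed y the quotient is holomorphic by removal of the singularity. On a circle of
  radius \<open>r'\<close> it equals f(w,y)/w, so Cauchy's formula exhibits it as a transform that
  is holomorphic in both variables.\<close>

lemma hol2_div_fst:
 assumes f: "f hol2_on ball 0 r \<times> B" and B: "open B" and 0: "!!y. y \<in> B ==> f (0, y) = 0"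
 obtains g where "g hol2_on ball 0 r \<times> B" "!!p. p \<in> ball 0 r \<times> B ==> f p = fst p * g p"
proof -
 \<comment> \<open>The terms \<open>f (0, y)\<close>, which is zero on \<open>B\<close>, and
   \<open>x - 0\<close> are kept to match the shape of the removable singularity lemma.\<close>
 define g where "g = (%(x, y). if x = 0 then deriv (%x. f (x, y)) 0 else (f (x, y) - f (0, y)) / (x - 0))"
 have op: "open (ball (0::complex) r \<times> B)" using B by (simp add: open_Times)
 have h: "(%x. g (x, y)) holomorphic_on ball 0 r" if "y \<in> B" for y
  unfolding g_def split
  by (rule pole_lemma_open) (use that in "auto intro: holomorphic_on_subset[OF hol2_on_slice1[OF f op]]")
 have loc: "g hol2_on ball 0 r' \<times> B" if r': "0 < r'" "r' < r" for r'
 proof (rule hol2_on_cong)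
  show "open (ball (0::complex) r' \<times> B)" using B by (simp add: open_Times)
  have 1: "(%(x, y). contour_integral (circlepath 0 r') (%w. (%(w, y). f (w, y) / w) (w, y) / (w - x))) hol2_on ball 0 r' \<times> B"
  proof (rule cauchy_transform_hol2)
   show "continuous_on (sphere 0 r' \<times> B) (%(w, y). f (w, y) / w)"
    using r' by (auto simp: case_prod_unfold intro!: continuous_intros continuous_on_subset[OF hol2_on_continuous[OF f]])
   show "(%y. case (w, y) of (w, y) => f (w, y) / w) holomorphic_on B" if "w \<in> sphere 0 r'" for w
    using that r' by (auto intro!: holomorphic_intros holomorphic_on_subset[OF hol2_on_slice2[OF f op]])
  qed (use r' B in auto)
  then show "(%q. 1 / (2 * of_real pi * \<i>) * (%(x, y). contour_integral (circlepath 0 r') (%w. f (w, y) / w / (w - x))) q) hol2_on ball 0 r' \<times> B"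
   by (intro hol2_on_mult hol2_on_const) simp
  fix p :: "complex \<times> complex" assume p: "p \<in> ball 0 r' \<times> B"
  obtain x y where pp: "p = (x, y)" by force
  have "((%w. g (w, y) / (w - x)) has_contour_integral (2 * of_real pi * \<i> * g (x, y))) (circlepath 0 r')"
   by (rule Cauchy_integral_circlepath_simple)
    (use h[of y] p pp r' in "auto intro!: holomorphic_on_subset[OF h]")
  then have "contour_integral (circlepath 0 r') (%w. g (w, y) / (w - x)) = 2 * of_real pi * \<i> * g (x, y)"
   by (rule contour_integral_unique)
  moreover have "contour_integral (circlepath 0 r') (%w. g (w, y) / (w - x)) =
    contour_integral (circlepath 0 r') (%w. f (w, y) / w / (w - x))"
   by (rule contour_integral_cong) (use r' p pp 0 in "auto simp: g_def path_image_circlepath")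
  ultimately show "1 / (2 * of_real pi * \<i>) * (%(x, y). contour_integral (circlepath 0 r') (%w. f (w, y) / w / (w - x))) p = g p"
   by (simp add: pp)
 qed
 have "g hol2_on ball 0 r \<times> B"
  unfolding hol2_on_def
 proof
  fix p :: "complex \<times> complex" assume p: "p \<in> ball 0 r \<times> B"
  obtain r' where r': "norm (fst p) < r'" "r' < r" using p dense[of "norm (fst p)" r] by auto
  then have "g hol2_on ball 0 r' \<times> B" by (intro loc) (auto intro: le_less_trans[OF norm_ge_zero])
  then show "EX a b. (g has_derivative (%(u, v). a * u + b * v)) (at p)"
   unfolding hol2_on_def using p r' by (metis SigmaE SigmaI fst_conv mem_ball_0)
 qed
 moreover have "f p = fst p * g p" if "p \<in> ball 0 r \<times> B" for p
  using that 0 by (auto simp: g_def)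
 ultimately show thesis using that by blast
qed

lemma swap_Times: "prod.swap ` (A \<times> B) = B \<times> A" by (fact product_swap)

lemma hol2_div_snd:
 assumes f: "f hol2_on B \<times> ball 0 r" and B: "open B" and 0: "!!x. x \<in> B ==> f (x, 0) = 0"
 obtains g where "g hol2_on B \<times> ball 0 r" "!!p. p \<in> B \<times> ball 0 r ==> f p = snd p * g p"
proof -
 have "(%(x, y). f (y, x)) hol2_on ball 0 r \<times> B"
  using hol2_on_swap[OF f] by (simp add: swap_Times)
 then obtain g where g: "g hol2_on ball 0 r \<times> B" "!!p. p \<in> ball 0 r \<times> B ==> (%(x, y). f (y, x)) p = fst p * g p"
  by (rule hol2_div_fst) (use 0 B in auto)
 show thesis
 proof (rule that)
  show "(%(x, y). g (y, x)) hol2_on B \<times> ball 0 r" using hol2_on_swap[OF g(1)] by (simp add: swap_Times)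
  show "f p = snd p * (%(x, y). g (y, x)) p" if "p \<in> B \<times> ball 0 r" for p
   using g(2)[of "prod.swap p"] that by auto
 qed
qed

lemma holomorphic_order_0:
 assumes u: "u holomorphic_on ball 0 r" and z: "z \<in> ball 0 r" "u z ~= 0"
 obtains n v s where "s > 0" "s <= r" "v holomorphic_on ball 0 s" "!!w. w \<in> ball 0 s ==> u w = w ^ n * v w"
  "!!w. w \<in> ball 0 s ==> v w ~= (0::complex)"
proof -
 have r: "r > 0" using z(1) by (metis ball_empty empty_iff not_less)
 show thesis
 proof (cases "u 0 = 0")
  case True
  have c: "0 \<in> ball 0 r" using r by simp
  have nc: "~ u constant_on ball 0 r"
   using True z r unfolding constant_on_def by (metis centre_in_ball)
  obtain v s n where v: "0 < n"  "0 < s"  "ball (0::complex) s \<subseteq> ball 0 r" "v holomorphic_on ball 0 s"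
      "!!w. w \<in> ball 0 s ==> u w = (w - 0)^n * v w" "!!w. w \<in> ball 0 s ==> v w ~= 0"
   by (rule holomorphic_factor_zero_nonconstant[OF u open_ball convex_connected[OF convex_ball] c True nc]) (rule that, assumption+)
  show thesis
   by (rule that[of s v n]) (use v r in "auto simp: ball_subset_ball_iff")
 next
  case False
  have "isCont u 0" using holomorphic_on_imp_continuous_on[OF u] r by (simp add: continuous_on_eq_continuous_at)
  from continuous_at_avoid[OF this False]
  obtain s where s: "s > 0" "!!w. dist 0 w < s ==> u w ~= 0" by blast
  show thesis
   by (rule that[of "min r s" u 0]) (use s r u in "auto simp: dist_commute intro: holomorphic_on_subset")
 qed
qed

text \<open>Powers of x cannot be split off forever: on a slice y = y1 on which \<open>f\<close> is
  not identically zero the order in x is a finite \<open>n\<close>, so the power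
  \<open>Suc n\<close> is impossible.\<close>

lemma hol2_order_fst:
 assumes f: "f hol2_on PD r" and p: "p \<in> PD r" "f p ~= 0"
 obtains k g y where "g hol2_on PD r" "!!q. q \<in> PD r ==> f q = fst q ^ k * g q" "y \<in> ball 0 r" "g (0, y) ~= 0"
proof -
 obtain x1 y1 where pp: "p = (x1, y1)" by force
 have b: "x1 \<in> ball 0 r" "y1 \<in> ball 0 r" using p pp by (auto simp: PD_def)
 have "(%x. f (x, y1)) holomorphic_on ball 0 r"
  by (rule holomorphic_on_subset[OF hol2_on_slice1[OF f]]) (use b in \<open>auto simp: PD_def\<close>, metis PD_def open_PD)
 then obtain n v s where v: "s > 0" "s <= r" "v holomorphic_on ball 0 s" "!!w. w \<in> ball 0 s ==> f (w, y1) = w ^ n * v w"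
  "!!w. w \<in> ball 0 s ==> v w ~= 0"
  by (rule holomorphic_order_0[OF _ b(1)]) (use p pp in auto)
 note found = that
 show thesis
 proof (rule ccontr)
  assume "~ thesis"
  then have *: "g (0, y) = 0" if "g hol2_on PD r" "!!q. q \<in> PD r ==> f q = fst q ^ k * g q" "y \<in> ball 0 r" for g k y
   using that found by blast
  \<comment> \<open>If every cofactor vanished on x = 0, each of them could be divided by x again,
    so all powers of x would divide \<open>f\<close>.\<close>
  have "EX g. g hol2_on PD r & (ALL q:PD r. f q = fst q ^ k * g q)" for k
  proof (induction k)
   case (Suc k)
   then obtain g where g: "g hol2_on PD r" "!!q. q \<in> PD r ==> f q = fst q ^ k * g q" by blast
   obtain g' where "g' hol2_on ball 0 r \<times> ball 0 r" "!!p. p \<in> ball 0 r \<times> ball 0 r ==> g p = fst p * g' p"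
    by (rule hol2_div_fst[of g r "ball 0 r"]) (use g *[OF g] in "auto simp: PD_def")
   then show ?case using g(2) by (intro exI[of _ g']) (auto simp: PD_def)
  qed (use f in auto)
  then obtain g where g: "g hol2_on PD r" "!!q. q \<in> PD r ==> f q = fst q ^ Suc n * g q" by blast
  have eq: "v x = x * g (x, y1)" if "x \<in> ball 0 s - {0}" for x
  proof -
   have "(x, y1) \<in> PD r" using that b v by (auto simp: PD_def)
   from g(2)[OF this] v(4)[of x] that show ?thesis by simp
  qed
  have "(%x. g (x, y1)) holomorphic_on ball 0 r"
   by (rule holomorphic_on_subset[OF hol2_on_slice1[OF g(1)]]) (use b in \<open>auto simp: PD_def\<close>, metis PD_def open_PD)
  then have "isCont (%x. g (x, y1)) 0"
   using v(1,2) holomorphic_on_imp_continuous_on by (force simp: continuous_on_eq_continuous_at)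
  then have "isCont (%x. x * g (x, y1)) 0" by (intro continuous_intros)
  then have "(%x. x * g (x, y1)) \<midarrow>0\<rightarrow> 0" by (simp add: isCont_def)
  moreover have "v \<midarrow>0\<rightarrow> v 0"
   using holomorphic_on_imp_continuous_on[OF v(3)] v(1) by (simp add: continuous_on_eq_continuous_at isCont_def)
  then have "(%x. x * g (x, y1)) \<midarrow>0\<rightarrow> v 0"
   by (rule Lim_transform_within_open[of _ _ _ _ "ball 0 s"]) (use v eq in auto)
  ultimately have "0 = v 0" by (rule LIM_unique)
  then show False using v by auto
 qed
qed

text \<open>The inverse function theorem is applied to (x, y) -> (x, G(x, y)), and
  \<open>\<psi>\<close> is the second component of the inverse along the x-axis. It is holomorphic
  because the derivative of the inverse is the inverse of a complex linear map.\<close>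

lemma implicit_function_hol2:
 assumes G: "hol2_at0 G" and G0: "G 0 = 0" and d: "pd2 G 0 ~= 0"
 obtains \<psi> r where "r > 0" "\<psi> holomorphic_on ball 0 r" "\<psi> 0 = 0" "!!x. x \<in> ball 0 r ==> G (x, \<psi> x) = 0"
proof -
 obtain U where U: "open U" "0 \<in> U" "G hol2_on U" using G by (auto simp: hol2_at0_def)
 define f where "f = (%p. (fst p, G p))"
 define F where "F = (%p (u, v). (u, pd1 G p * u + pd2 G p * v))"
 have bl: "bounded_linear (F p)" for p
  unfolding F_def case_prod_unfold
  by (intro bounded_linear_Pair bounded_linear_add bounded_linear_fst bounded_linear_compose[OF bounded_linear_mult_right] bounded_linear_snd)
 define f' where "f' = (%p. Blinfun (F p))"
 have f': "blinfun_apply (f' p) = F p" for p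
  unfolding f'_def by (rule bounded_linear_Blinfun_apply[OF bl])
 define I where "I = (%(u, w). (u, (w - pd1 G 0 * u) / pd2 G 0))"
 have blI: "bounded_linear I"
  unfolding I_def case_prod_unfold
  by (intro bounded_linear_Pair bounded_linear_sub bounded_linear_fst bounded_linear_compose[OF bounded_linear_mult_right] bounded_linear_snd
   bounded_linear_compose[OF bounded_linear_divide])
 have inv: "Blinfun I o\<^sub>L f' 0 = id_blinfun"
 proof (rule blinfun_eqI)
  fix q
  have "blinfun_apply (Blinfun I o\<^sub>L f' 0) q = I (F 0 q)"
   by (simp add: bounded_linear_Blinfun_apply[OF blI] f')
  also have "\<dots> = q" using d by (simp add: F_def I_def case_prod_unfold)
  finally show "blinfun_apply (Blinfun I o\<^sub>L f' 0) q = blinfun_apply id_blinfun q" by simp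
 qed
 have der: "(f has_derivative blinfun_apply (f' p)) (at p)" if "p \<in> U" for p
  unfolding f' F_def f_def case_prod_unfold
  using has_derivative_Pair[OF has_derivative_fst[OF has_derivative_ident] hol2_on_has_derivative[OF U(3) that]]
  by (simp add: case_prod_unfold)
 have cont: "continuous_on U f'"
 proof (rule continuous_on_blinfun_componentwise)
  fix i :: "complex \<times> complex"
  show "continuous_on U (%p. blinfun_apply (f' p) i)"
   unfolding f' F_def case_prod_unfold
   by (intro continuous_intros hol2_on_continuous[OF hol2_on_pd1[OF U(3,1)]] hol2_on_continuous[OF hol2_on_pd2[OF U(3,1)]])
 qed
 obtain U' V g g' where g: "open U'" "U' \<subseteq> U" "0 \<in> U'" "open V" "f 0 \<in> V" "homeomorphism U' V f g"
  "!!y. y \<in> V ==> (g has_derivative (g' y)) (at y)"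
  "!!y. y \<in> V ==> g' y = inv (blinfun_apply (f'(g y)))"
  "!!y. y \<in> V ==> bij (blinfun_apply (f'(g y)))"
  by (rule inverse_function_theorem[OF U(1) der cont U(2) inv]) blast+
 have "0 \<in> V" using g(5) G0 by (simp add: f_def zero_prod_def)
 then obtain r where r: "r > 0" "PD r \<subseteq> V" using PD_subset_open g(4) by blast
 define \<psi> where "\<psi> = (%x. snd (g (x, 0)))"
 have fg: "f (g y) = y" if "y \<in> V" for y using g(6) that by (simp add: homeomorphism_def)
 have inV: "(x, 0) \<in> V" if "x \<in> ball 0 r" for x using that r by (auto simp: PD_def)
 have gx: "g (x, 0) = (x, \<psi> x)" "G (x, \<psi> x) = 0" if "x \<in> ball 0 r" for x
 proof -
  have *: "fst (g (x, 0)) = x" "G (g (x, 0)) = 0" using fg[OF inV[OF that]] by (auto simp: f_def)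
  then show 1: "g (x, 0) = (x, \<psi> x)" by (simp add: \<psi>_def prod_eq_iff)
  show "G (x, \<psi> x) = 0" using *(2) 1 by simp
 qed
 have "EX c. (\<psi> has_field_derivative c) (at x)" if x: "x \<in> ball 0 r" for x
 proof -
  let ?q = "g (x, 0)"
  have bij: "bij (F ?q)" using g(9)[OF inV[OF x]] by (simp add: f')
  have b: "pd2 G ?q ~= 0"
  proof
   assume "pd2 G ?q = 0"
   then have "F ?q (0, 1) = F ?q (0, 0)" by (simp add: F_def)
   then show False using bij by (auto simp: bij_def dest: injD)
  qed
  have invF: "inv (F ?q) (h, 0) = (h, - pd1 G ?q / pd2 G ?q * h)" for h
   by (rule inv_f_eq) (use bij b in "auto simp: bij_def F_def")
  have "((%x. (x, 0::complex)) has_derivative (%h. (h, 0))) (at x)"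
   by (auto intro!: derivative_eq_intros)
  from has_derivative_compose[OF this g(7)[OF inV[OF x]]]
  have "((%x. g (x, 0)) has_derivative (%h. inv (F ?q) (h, 0))) (at x)"
   by (simp add: g(8)[OF inV[OF x]] f')
  from has_derivative_snd[OF this]
  have "(\<psi> has_derivative (%h. - pd1 G ?q / pd2 G ?q * h)) (at x)" by (simp add: invF \<psi>_def)
  then show ?thesis unfolding has_field_derivative_def by blast
 qed
 then have "\<psi> holomorphic_on ball 0 r" by (simp only: holomorphic_on_open[OF open_ball]) blast
 moreover have "\<psi> 0 = 0"
 proof -
  have "g (f 0) = 0" using g(3,6) by (auto simp: homeomorphism_def)
  moreover have "f 0 = (0, 0)" by (simp add: f_def G0)
  ultimately show ?thesis by (simp add: \<psi>_def)
 qed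
 ultimately show thesis using that r gx by blast
qed

text \<open>Taylor expansion in y: subtract the value on the x-axis from the remainder, divide by y,
  repeat. The coefficients are restrictions of the successive remainders and hence holomorphic in
  x.\<close>

lemma hol2_expand_snd:
 assumes "g hol2_on PD r"
 obtains a R where "!!i. i < d ==> a i holomorphic_on ball 0 r" "R hol2_on PD r"
  "!!x y. (x, y) \<in> PD r ==> g (x, y) = (\<Sum>i<d. a i x * y ^ i) + y ^ d * R (x, y)"
proof -
 have "EX a R. (ALL i<d. a i holomorphic_on ball 0 r) & R hol2_on PD r &
  (ALL x y. (x, y) \<in> PD r --> g (x, y) = (\<Sum>i<d. a i x * y ^ i) + y ^ d * R (x, y))"
 proof (induction d)
  case 0
  then show ?case using assms by (intro exI[of _ "%_ _. 0"] exI[of _ g]) auto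
 next
  case (Suc d)
  then obtain a R where aR: "ALL i<d. a i holomorphic_on ball 0 r" "R hol2_on PD r"
   "!!x y. (x, y) \<in> PD r ==> g (x, y) = (\<Sum>i<d. a i x * y ^ i) + y ^ d * R (x, y)" by blast
  let ?b = "%x. R (x, 0)"
  have hb: "?b holomorphic_on ball 0 r"
  proof (cases "r > 0")
   case True
   then show ?thesis
    by (intro holomorphic_on_subset[OF hol2_on_slice1[OF aR(2) open_PD]]) (auto simp: PD_def)
  next
   case False
   then have "ball 0 r = ({} :: complex set)" by simp
   then show ?thesis by (simp only: holomorphic_on_def) blast
  qed
  have "(%p. R p - ?b (fst p)) hol2_on ball 0 r \<times> ball 0 r"
   using aR(2) unfolding PD_def
   by (intro hol2_on_diff hol2_on_compose1[OF hb open_ball hol2_on_fst]) auto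
  then obtain R' where R': "R' hol2_on ball 0 r \<times> ball 0 r"
    "!!p. p \<in> ball 0 r \<times> ball 0 r ==> R p - ?b (fst p) = snd p * R' p"
   by (rule hol2_div_snd) auto
  have "g (x, y) = (\<Sum>i<Suc d. (a(d := ?b)) i x * y ^ i) + y ^ Suc d * R' (x, y)" if "(x, y) \<in> PD r" for x y
  proof -
   have "R (x, y) = ?b x + y * R' (x, y)" using R'(2)[of "(x, y)"] that by (simp add: PD_def algebra_simps)
   then show ?thesis using aR(3)[OF that] by (simp add: algebra_simps)
  qed
  then show ?case using aR(1) hb R'(1)
   by (intro exI[of _ "a(d := ?b)"] exI[of _ R']) (auto simp: PD_def less_Suc_eq)
 qed
 then show thesis using that by blast
qed

section \<open>Change of variables\<close>

abbreviation jac :: "(cfun) => (cfun) => cfun"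
 where "jac X Y q \<equiv> pd1 X q * pd2 Y q - pd2 X q * pd1 Y q"

text \<open>Expansion along the first rows. It serves to evaluate the real Jacobian determinant of a
  holomorphic map of the plane.\<close>

lemma det_4:
 fixes A :: "'a::comm_ring_1^4^4"
 defines "m \<equiv> %i. vec_nth (vec_nth A i)"
 shows "det A =
  m 1 1 * (m 2 2 * (m 3 3 * m 4 4 - m 3 4 * m 4 3) - m 2 3 * (m 3 2 * m 4 4 - m 3 4 * m 4 2) + m 2 4 * (m 3 2 * m 4 3 - m 3 3 * m 4 2))
 - m 1 2 * (m 2 1 * (m 3 3 * m 4 4 - m 3 4 * m 4 3) - m 2 3 * (m 3 1 * m 4 4 - m 3 4 * m 4 1) + m 2 4 * (m 3 1 * m 4 3 - m 3 3 * m 4 1))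
 + m 1 3 * (m 2 1 * (m 3 2 * m 4 4 - m 3 4 * m 4 2) - m 2 2 * (m 3 1 * m 4 4 - m 3 4 * m 4 1) + m 2 4 * (m 3 1 * m 4 2 - m 3 2 * m 4 1))
 - m 1 4 * (m 2 1 * (m 3 2 * m 4 3 - m 3 3 * m 4 2) - m 2 2 * (m 3 1 * m 4 3 - m 3 3 * m 4 1) + m 2 3 * (m 3 1 * m 4 2 - m 3 2 * m 4 1))"
proof -
 have f1: "finite {2::4, 3, 4}" "1 ~: {2::4, 3, 4}" by auto
 have f2: "finite {3::4, 4}" "2 ~: {3::4, 4}" by auto
 have f3: "finite {4::4}" "3 ~: {4::4}" by auto
 show ?thesis
  unfolding det_def UNIV_4 m_def
  unfolding sum_over_permutations_insert[OF f1]
  unfolding sum_over_permutations_insert[OF f2]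
  unfolding sum_over_permutations_insert[OF f3]
  unfolding permutes_sing
  by (simp add: sign_swap_id permutation_swap_id permutation_compose sign_compose sign_id swap_id_eq) (simp add: algebra_simps)
qed

definition cc_of_vec :: "real^4 => complex \<times> complex"
 where "cc_of_vec v = (Complex (vec_nth v 1) (vec_nth v 2), Complex (vec_nth v 3) (vec_nth v 4))"

definition vec_of_cc :: "complex \<times> complex => real^4"
 where "vec_of_cc p = (\<chi> i. if i = 1 then Re (fst p) else if i = 2 then Im (fst p) else if i = 3 then Re (snd p) else Im (snd p))"

lemma vec_of_cc_nth [simp]:
 "vec_of_cc p $ 1 = Re (fst p)" "vec_of_cc p $ 2 = Im (fst p)"
 "vec_of_cc p $ 3 = Re (snd p)" "vec_of_cc p $ 4 = Im (snd p)"
 by (simp_all add: vec_of_cc_def)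

lemma cc_of_vec_inverse [simp]: "vec_of_cc (cc_of_vec v) = v"
 by (simp add: vec_eq_iff forall_4 cc_of_vec_def)

lemma vec_of_cc_inverse [simp]: "cc_of_vec (vec_of_cc p) = p"
 by (simp add: cc_of_vec_def)

lemma bounded_linear_cc_of_vec: "bounded_linear cc_of_vec"
 by (rule linear_conv_bounded_linear[THEN iffD1], rule linearI) (auto simp: cc_of_vec_def complex_eq_iff)

lemma bounded_linear_vec_of_cc: "bounded_linear vec_of_cc"
 by (rule linear_conv_bounded_linear[THEN iffD1], rule linearI) (auto simp: vec_eq_iff forall_4)

lemma Basis_cc: "(Basis :: (complex \<times> complex) set) = {(1, 0), (\<i>, 0), (0, 1), (0, \<i>)}"
 by (auto simp: Basis_prod_def Basis_complex_def)

lemma Basis_vec4: "(Basis :: (real^4) set) = {axis 1 1, axis 2 1, axis 3 1, axis 4 1}"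
 by (auto simp: Basis_vec_def UNIV_4)

lemma axis4_neq: "(i :: 4) ~= j ==> axis i (1::real) ~= axis j 1"
 by (simp add: axis_eq_axis)

lemma borel_measurable_linear_iso:
 "cc_of_vec \<in> borel_measurable borel" "vec_of_cc \<in> borel_measurable borel"
 using bounded_linear_cc_of_vec bounded_linear_vec_of_cc
 by (auto intro: borel_measurable_continuous_onI linear_continuous_on)

text \<open>Boxes have the same side lengths in both spaces, and their volumes determine
  \<open>lborel\<close>.\<close>

lemma distr_cc_of_vec: "distr lborel lborel cc_of_vec = lborel"
proof (rule lborel_eqI[symmetric])
 fix l u :: "complex \<times> complex"
 assume le: "!!b. b \<in> Basis ==> l \<bullet> b <= u \<bullet> b"
 have eq: "cc_of_vec -` box l u = box (vec_of_cc l) (vec_of_cc u)"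
  by (auto simp: mem_box_cart forall_4 mem_box Basis_cc cc_of_vec_def inner_prod_def inner_complex_def)
 have le': "Re (fst l) <= Re (fst u)" "Im (fst l) <= Im (fst u)" "Re (snd l) <= Re (snd u)" "Im (snd l) <= Im (snd u)"
  using le[of "(1,0)"] le[of "(\<i>,0)"] le[of "(0,1)"] le[of "(0,\<i>)"]
  by (auto simp: Basis_cc inner_prod_def inner_complex_def)
 have "emeasure (distr lborel lborel cc_of_vec) (box l u) = emeasure lborel (box (vec_of_cc l) (vec_of_cc u))"
  using borel_measurable_linear_iso by (subst emeasure_distr) (auto simp: eq)
 also have "\<dots> = (\<Prod>b\<in>Basis. (vec_of_cc u - vec_of_cc l) \<bullet> b)"
  by (rule emeasure_lborel_box) (use le' in "auto simp: Basis_vec4 inner_axis")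
 also have "(\<Prod>b\<in>Basis. (vec_of_cc u - vec_of_cc l) \<bullet> b) = (\<Prod>b\<in>Basis. (u - l) \<bullet> b)"
  by (simp add: Basis_vec4 Basis_cc axis4_neq inner_axis inner_prod_def inner_complex_def)
 finally show "emeasure (distr lborel lborel cc_of_vec) (box l u) = (\<Prod>b\<in>Basis. (u - l) \<bullet> b)" .
qed simp

lemma distr_vec_of_cc: "distr lborel lborel vec_of_cc = lborel"
proof -
 have "distr lborel lborel vec_of_cc = distr (distr lborel lborel cc_of_vec) lborel vec_of_cc"
  by (simp add: distr_cc_of_vec)
 also have "\<dots> = distr lborel lborel (vec_of_cc \<circ> cc_of_vec)"
  by (rule distr_distr) (use borel_measurable_linear_iso in auto)
 also have "vec_of_cc \<circ> cc_of_vec = (%v. v)" by auto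
 finally show ?thesis by simp
qed

lemma distr_lebesgue_iso:
 fixes T :: "'a::euclidean_space => 'b::euclidean_space"
 assumes "distr lborel lborel T = lborel" "T \<in> borel_measurable borel"
 shows "distr lebesgue lebesgue T = lebesgue" "T \<in> measurable lebesgue lebesgue"
proof -
 have T: "T \<in> measurable lborel lborel" using assms(2) by simp
 have d: "distr lebesgue lborel T = lborel"
  using distr_completion[OF T] assms(1) by simp
 have T': "T \<in> measurable lebesgue lborel" using T by (rule measurable_completion)
 have "completion (distr lebesgue lborel T) = distr lebesgue (completion lborel) T"
  by (rule completion.completion_distr_eq[OF T']) (simp add: d)
 then show "distr lebesgue lebesgue T = lebesgue" by (simp add: d)
 show "T \<in> measurable lebesgue lebesgue"
  by (rule completion.measurable_completion2[OF T']) (simp add: d)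
qed

lemma absolutely_integrable_iso:
 fixes T :: "'a::euclidean_space => 'b::euclidean_space" and f :: "'b => real"
 assumes T: "distr lborel lborel T = lborel" "T \<in> borel_measurable borel"
  and T': "distr lborel lborel T' = lborel" "T' \<in> borel_measurable borel"
  and i: "!!x. T' (T x) = x" "!!x. T (T' x) = x"
 shows "f L1_on S \<longleftrightarrow> (%x. f (T x)) L1_on T -` S"
proof
 assume "f L1_on S"
 then have "integrable (distr lebesgue lebesgue T) (%x. indicator S x *\<^sub>R f x)"
  by (simp add: set_integrable_def distr_lebesgue_iso[OF T])
 from integrable_distr[OF distr_lebesgue_iso(2)[OF T] this]
 show "(%x. f (T x)) L1_on T -` S"
  by (simp add: set_integrable_def indicator_vimage[of T, unfolded o_def] indicator_def)
next
 assume "(%x. f (T x)) L1_on T -` S"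
 then have "integrable (distr lebesgue lebesgue T') (%x. indicator (T -` S) x *\<^sub>R f (T x))"
  by (simp add: set_integrable_def distr_lebesgue_iso[OF T'])
 from integrable_distr[OF distr_lebesgue_iso(2)[OF T'] this]
 show "f L1_on S"
  by (simp add: set_integrable_def i indicator_def)
qed

text \<open>The source of the factor \<open>(cmod (jac X Y q))^2\<close> in every change of
  variables: the real determinant is the sum of the squares of the real and imaginary parts of the
  complex one.\<close>

lemma det_complex_linear:
 "\<bar>det (matrix (%v. vec_of_cc ((%(u, v). (a * u + b * v, c * u + d * v)) (cc_of_vec v))))\<bar>
  = (cmod (a * d - b * c))^2"
proof -
 have ax: "cc_of_vec (axis 1 1) = (1, 0)" "cc_of_vec (axis 2 1) = (\<i>, 0)"
  "cc_of_vec (axis 3 1) = (0, 1)" "cc_of_vec (axis 4 1) = (0, \<i>)"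
  by (auto simp: cc_of_vec_def axis_def complex_eq_iff)
 have "det (matrix (%v. vec_of_cc ((%(u, v). (a * u + b * v, c * u + d * v)) (cc_of_vec v))))
   = (Re (a * d - b * c))^2 + (Im (a * d - b * c))^2"
  unfolding det_4 matrix_def
  by (simp add: ax) (simp add: power2_eq_square algebra_simps)
 then show ?thesis by (simp add: cmod_power2)
qed

context
 fixes X Y :: "cfun" and D S :: "(complex \<times> complex) set" and w :: "complex \<times> complex => real"
 assumes X: "X hol2_on D" and Y: "Y hol2_on D" and SD: "S \<subseteq> D"
begin

private abbreviation "g \<equiv> %v. vec_of_cc (X (cc_of_vec v), Y (cc_of_vec v))"
private abbreviation "g' \<equiv> %p v. vec_of_cc ((%(u, v). (pd1 X (cc_of_vec p) * u + pd2 X (cc_of_vec p) * v,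
   pd1 Y (cc_of_vec p) * u + pd2 Y (cc_of_vec p) * v)) (cc_of_vec v))"

private lemma der: "v \<in> cc_of_vec -` S ==> (g has_derivative g' v) (at v within A)"
proof -
 assume "v \<in> cc_of_vec -` S"
 then have v: "cc_of_vec v \<in> D" using SD by auto
 have "((%q. (X q, Y q)) has_derivative (%(u, v'). (pd1 X (cc_of_vec v) * u + pd2 X (cc_of_vec v) * v',
   pd1 Y (cc_of_vec v) * u + pd2 Y (cc_of_vec v) * v'))) (at (cc_of_vec v))"
  using has_derivative_Pair[OF hol2_on_has_derivative[OF X v] hol2_on_has_derivative[OF Y v]]
  by (simp add: case_prod_unfold)
 from bounded_linear.has_derivative[OF bounded_linear_vec_of_cc
  has_derivative_compose[OF bounded_linear_imp_has_derivative[OF bounded_linear_cc_of_vec] this]]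
 show ?thesis by (simp add: has_derivative_at_withinI)
qed

private lemma det_g': "\<bar>det (matrix (g' v))\<bar> = (cmod (jac X Y (cc_of_vec v)))^2"
 by (rule det_complex_linear)

private lemma image_g: "cc_of_vec -` ((%q. (X q, Y q)) ` S) = g ` (cc_of_vec -` S)"
proof (intro set_eqI iffI)
 fix v assume "v \<in> cc_of_vec -` ((%q. (X q, Y q)) ` S)"
 then obtain q where q: "q \<in> S" "cc_of_vec v = (X q, Y q)" by auto
 then have "v = vec_of_cc (X q, Y q)" by (metis cc_of_vec_inverse)
 then have "v = g (vec_of_cc q)" by simp
 moreover have "vec_of_cc q \<in> cc_of_vec -` S" using q by simp
 ultimately show "v \<in> g ` (cc_of_vec -` S)" by blast
qed auto

private lemma iso: "f L1_on A \<longleftrightarrow> (%v. f (cc_of_vec v)) L1_on cc_of_vec -` A"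
 for f :: "complex \<times> complex => real"
 by (rule absolutely_integrable_iso[OF distr_cc_of_vec _ distr_vec_of_cc]) (use borel_measurable_linear_iso in auto)

text \<open>Injectivity plays no part in this direction: overlapping sheets only make the pulled
  back integral larger than the integral over the image.\<close>

lemma absolutely_integrable_image:
 assumes "(%q. w (X q, Y q) * (cmod (jac X Y q))^2) L1_on S"
 shows "w L1_on (%q. (X q, Y q)) ` S"
 unfolding iso image_g
proof (rule absolutely_integrable_on_image_real[OF der])
 have "(%q. (cmod (jac X Y q))^2 * w (X q, Y q)) L1_on S"
  using assms by (simp only: mult.commute)
 from iso[THEN iffD1, OF this]
 have "(%v. (cmod (jac X Y (cc_of_vec v)))^2 * w (X (cc_of_vec v), Y (cc_of_vec v))) L1_on cc_of_vec -` S" .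
 then show "(%v. \<bar>det (matrix (g' v))\<bar> * w (cc_of_vec (g v))) L1_on cc_of_vec -` S"
  by (simp only: det_g' vec_of_cc_inverse)
qed

text \<open>Here injectivity matters, because the pulled back integral counts each point of the
  image as often as it is attained.\<close>

lemma absolutely_integrable_pullback:
 assumes w: "w L1_on (%q. (X q, Y q)) ` S"
  and inj: "inj_on (%q. (X q, Y q)) S" and S: "S \<in> sets lebesgue"
 shows "(%q. w (X q, Y q) * (cmod (jac X Y q))^2) L1_on S"
proof -
 have S': "cc_of_vec -` S \<in> sets lebesgue"
  using measurable_sets[OF distr_lebesgue_iso(2)[OF distr_cc_of_vec] S] borel_measurable_linear_iso by simp
 have inj': "inj_on g (cc_of_vec -` S)"
 proof (rule inj_onI)
  fix u v assume "u \<in> cc_of_vec -` S" "v \<in> cc_of_vec -` S" "g u = g v"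
  then have "cc_of_vec u = cc_of_vec v"
   using inj by (metis inj_onD vec_of_cc_inverse vimageD)
  then show "u = v" by (metis cc_of_vec_inverse)
 qed
 have "(%v. w (cc_of_vec v)) L1_on g ` (cc_of_vec -` S)"
  using w by (simp only: iso image_g)
 \<comment> \<open>The change of variables theorem concerns vector valued integrands, so the real
   weight is regarded as a vector of length one.\<close>
 then have "((%x. vec x :: real^1) \<circ> (%v. w (cc_of_vec v))) L1_on g ` (cc_of_vec -` S)"
  by (rule absolutely_integrable_linear) (rule linear_conv_bounded_linear[THEN iffD1], rule linear_vec)
 then have "(%v. vec (w (cc_of_vec v)) :: real^1) L1_on g ` (cc_of_vec -` S)"
  by (simp only: o_def)
 from absolutely_integrable_change_of_variables[OF S' der inj', THEN iffD1, OF _ this]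
 have "(%v. \<bar>det (matrix (g' v))\<bar> *\<^sub>R (vec (w (cc_of_vec (g v))) :: real^1)) L1_on cc_of_vec -` S" .
 then have "((%x. x $ 1) \<circ> (%v. \<bar>det (matrix (g' v))\<bar> *\<^sub>R (vec (w (cc_of_vec (g v))) :: real^1))) L1_on cc_of_vec -` S"
  by (rule absolutely_integrable_linear) (rule bounded_linear_vec_nth)
 then have "(%v. (cmod (jac X Y (cc_of_vec v)))^2 * w (X (cc_of_vec v), Y (cc_of_vec v))) L1_on cc_of_vec -` S"
  by (simp only: o_def det_g' vec_of_cc_inverse vector_scaleR_component vec_component real_scaleR_def)
 then have "(%q. (cmod (jac X Y q))^2 * w (X q, Y q)) L1_on S"
  by (rule iso[THEN iffD2])
 then show ?thesis by (simp only: mult.commute)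
qed

end

section \<open>Integrability of powers of the coordinates\<close>

lemma absolutely_integrable_iff_nn_integral:
 fixes w :: "'a::euclidean_space => real"
 assumes "(%x. indicator S x * w x) \<in> borel_measurable borel" "!!x. x \<in> S ==> 0 <= w x"
 shows "w L1_on S \<longleftrightarrow> (\<integral>\<^sup>+x. ennreal (indicator S x * w x) \<partial>lborel) < \<infinity>"
proof -
 have "w L1_on S \<longleftrightarrow> integrable lborel (%x. indicator S x * w x)"
  unfolding set_integrable_def real_scaleR_def
  by (rule integrable_completion) (use assms(1) in simp)
 also have "\<dots> \<longleftrightarrow> (\<integral>\<^sup>+x. ennreal (norm (indicator S x * w x)) \<partial>lborel) < \<infinity>"
  using assms(1) by (simp add: integrable_iff_bounded)
 also have "(%x. ennreal (norm (indicator S x * w x))) = (%x. ennreal (indicator S x * w x))"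
  using assms(2) by (auto simp: indicator_def)
 finally show ?thesis .
qed

lemma nn_integral_prod_cc:
 fixes f g :: "complex => real"
 assumes [measurable]: "f \<in> borel_measurable borel" "g \<in> borel_measurable borel"
  and "!!x. 0 <= f x" "!!x. 0 <= g x"
 shows "(\<integral>\<^sup>+p. ennreal (f (fst p) * g (snd p)) \<partial>lborel) = (\<integral>\<^sup>+x. ennreal (f x) \<partial>lborel) * (\<integral>\<^sup>+y. ennreal (g y) \<partial>lborel)"
proof -
 have "(\<integral>\<^sup>+p. ennreal (f (fst p) * g (snd p)) \<partial>lborel)
   = (\<integral>\<^sup>+p. ennreal (f (fst p)) * ennreal (g (snd p)) \<partial>(lborel \<Otimes>\<^sub>M lborel))"
  using assms by (simp add: lborel_prod ennreal_mult)
 also have "\<dots> = (\<integral>\<^sup>+x. \<integral>\<^sup>+y. ennreal (f x) * ennreal (g y) \<partial>lborel \<partial>lborel)"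
  by (subst lborel.nn_integral_fst[symmetric]) auto
 also have "\<dots> = (\<integral>\<^sup>+x. ennreal (f x) \<partial>lborel) * (\<integral>\<^sup>+y. ennreal (g y) \<partial>lborel)"
  by (simp add: nn_integral_cmult nn_integral_multc)
 finally show ?thesis .
qed

context
 fixes r a :: real assumes r: "r > 0"
begin

private definition "A n = ball 0 (r / 2 ^ n) - ball (0::complex) (r / 2 ^ Suc n)"

private lemma A_borel [measurable]: "A n \<in> sets borel" by (simp add: A_def)

private lemma A_disjoint: "x \<in> A n ==> x \<in> A m ==> n = m"
proof (induction n m rule: linorder_wlog)
 case (le n m)
 show ?case
 proof (rule ccontr)
  assume "n ~= m"
  then have "r / 2 ^ m <= r / 2 ^ Suc n" using le r by (intro divide_left_mono power_increasing) auto
  then show False using le by (auto simp: A_def)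
 qed
qed auto

private lemma emeasure_A: "emeasure lborel (A n) = ennreal (3 / 4 * pi * (r / 2 ^ n)^2)"
proof -
 have "emeasure lborel (A n) = emeasure lborel (ball (0::complex) (r / 2 ^ n)) - emeasure lborel (ball (0::complex) (r / 2 ^ Suc n))"
  unfolding A_def by (rule emeasure_Diff) (use r in "auto simp: emeasure_ball intro!: subset_ball divide_left_mono")
 also have "\<dots> = ennreal (pi * (r / 2 ^ n)^2 - pi * (r / 2 ^ Suc n)^2)"
  using r by (simp add: emeasure_ball unit_ball_vol_2 ennreal_minus)
 also have "pi * (r / 2 ^ n)^2 - pi * (r / 2 ^ Suc n)^2 = 3 / 4 * pi * (r / 2 ^ n)^2"
  by (simp add: power_divide field_simps)
 finally show ?thesis .
qed

private lemma powr_half: "(r / 2 ^ n) powr b = r powr b * (2 powr (- b)) ^ n"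
proof -
 have "(r / 2 ^ n) powr b = r powr b / (2 powr real n) powr b" using r by (simp add: powr_divide powr_realpow)
 also have "\<dots> = r powr b * 2 powr (- (real n * b))" by (simp add: powr_powr powr_minus divide_inverse)
 also have "2 powr (- (real n * b)) = (2 powr (- b)) ^ n" by (simp add: powr_power mult.commute)
 finally show ?thesis .
qed

private lemma powr_mult_square: "(r / 2 ^ n) powr (2 * a) * (r / 2 ^ n)^2 = r powr (2 * a + 2) * (2 powr (- (2 * a + 2))) ^ n"
proof -
 have "(r / 2 ^ n) powr (2 * a) * (r / 2 ^ n)^2 = (r / 2 ^ n) powr (2 * a + 2)"
  using r by (simp add: powr_add)
 then show ?thesis by (simp only: powr_half)
qed

text \<open>On the dyadic annulus \<open>A n\<close> the integrand is comparable to its value at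
  radius r/2^n and the area is 3/4 pi (r/2^n)^2. The integral is therefore dominated by a geometric
  series of ratio 2^(-(2a+2)), which is less than 1 for a > -1.\<close>

lemma nn_integral_disc_powr_finite:
 assumes a: "a > -1"
 shows "(\<integral>\<^sup>+x. ennreal (indicator (ball (0::complex) r) x * cmod x powr (2 * a)) \<partial>lborel) < \<infinity>"
proof -
 \<comment> \<open>Within one annulus |x| varies by a factor of at most 2: for \<open>a >= 0\<close>
   the outer radius bounds the integrand, for \<open>a < 0\<close> the inner one, at the cost of
   2^(-2a).\<close>
 define K where "K = max 1 (2 powr (- 2 * a))"
 have K: "K >= 1" by (simp add: K_def)
 have le: "ennreal (indicator (ball 0 r) x * cmod x powr (2 * a)) <=
   suminf (%n. ennreal (K * (r / 2 ^ n) powr (2 * a)) * indicator (A n) x)" for x :: complex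
 proof (cases "x \<in> ball 0 r & x ~= 0")
  case True
  have "EX n. r / 2 ^ n <= cmod x"
  proof -
   obtain n where "(1/2::real) ^ n < cmod x / r" using real_arch_pow_inv[of "cmod x / r" "1/2"] True r by auto
   then show ?thesis using r by (intro exI[of _ n]) (simp add: field_simps power_divide)
  qed
  define n where "n = (LEAST n. r / 2 ^ n <= cmod x)"
  have n: "r / 2 ^ n <= cmod x" unfolding n_def by (rule LeastI_ex) fact
  have "n ~= 0" using n True by (intro notI) simp
  then obtain m where m: "n = Suc m" by (cases n) auto
  have m': "cmod x < r / 2 ^ m" using not_less_Least[of m "%n. r / 2 ^ n <= cmod x"] m by (auto simp: n_def[symmetric])
  have xA: "x \<in> A m" using n m m' by (auto simp: A_def)
  have "cmod x powr (2 * a) <= K * (r / 2 ^ m) powr (2 * a)"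
  proof (cases "a >= 0")
   case True
   have "cmod x powr (2 * a) <= (r / 2 ^ m) powr (2 * a)" using m' True by (intro powr_mono2) auto
   also have "\<dots> <= K * (r / 2 ^ m) powr (2 * a)" using K by (simp add: mult_le_cancel_right1)
   finally show ?thesis .
  next
   case False
   have "cmod x powr (2 * a) <= (r / 2 ^ m / 2) powr (2 * a)"
    using n m False r by (intro powr_mono2') (auto simp: field_simps)
   also have "\<dots> = 2 powr (- 2 * a) * (r / 2 ^ m) powr (2 * a)"
    using r powr_divide[of "r / 2 ^ m" 2 "2 * a"] by (simp add: powr_minus_divide)
   also have "\<dots> <= K * (r / 2 ^ m) powr (2 * a)" by (intro mult_right_mono) (auto simp: K_def)
   finally show ?thesis .
  qed
  then have "ennreal (indicator (ball 0 r) x * cmod x powr (2 * a)) <= ennreal (K * (r / 2 ^ m) powr (2 * a)) * indicator (A m) x"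
   using True xA by (simp add: ennreal_leI)
  also have "\<dots> = (\<Sum>n\<in>{m}. ennreal (K * (r / 2 ^ n) powr (2 * a)) * indicator (A n) x)"
   by (simp only: sum.insert finite.emptyI empty_iff not_False_eq_True sum.empty add_0_right)
  also have "\<dots> <= suminf (%n. ennreal (K * (r / 2 ^ n) powr (2 * a)) * indicator (A n) x)"
   by (rule sum_le_suminf) auto
  finally show ?thesis .
 qed (auto simp: indicator_def)
 define q where "q = 2 powr (- (2 * a + 2))"
 have q: "0 < q" "q < 1" using a by (auto simp: q_def powr_less_one)
 have "(\<integral>\<^sup>+x. ennreal (indicator (ball (0::complex) r) x * cmod x powr (2 * a)) \<partial>lborel)
   <= (\<integral>\<^sup>+x. suminf (%n. ennreal (K * (r / 2 ^ n) powr (2 * a)) * indicator (A n) x) \<partial>lborel)"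
  by (rule nn_integral_mono) (rule le)
 also have "\<dots> = suminf (%n. ennreal (K * (r / 2 ^ n) powr (2 * a)) * emeasure lborel (A n))"
  by (subst nn_integral_suminf) (auto simp: nn_integral_cmult)
 also have "\<dots> = suminf (%n. ennreal (K * (3 / 4 * pi) * r powr (2 * a + 2) * q ^ n))"
 proof (rule suminf_cong)
  fix n
  have "ennreal (K * (r / 2 ^ n) powr (2 * a)) * emeasure lborel (A n)
    = ennreal (K * (3 / 4 * pi) * ((r / 2 ^ n) powr (2 * a) * (r / 2 ^ n)^2))"
   unfolding emeasure_A using K by (subst ennreal_mult[symmetric]) (auto simp: mult_ac)
  then show "ennreal (K * (r / 2 ^ n) powr (2 * a)) * emeasure lborel (A n)
    = ennreal (K * (3 / 4 * pi) * r powr (2 * a + 2) * q ^ n)"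
   by (simp only: powr_mult_square q_def mult.assoc)
 qed
 also have "\<dots> < \<infinity>"
 proof -
  have "summable (%n. K * (3 / 4 * pi) * r powr (2 * a + 2) * q ^ n)"
   by (intro summable_mult summable_geometric) (use q in simp)
  then have "suminf (%n. ennreal (K * (3 / 4 * pi) * r powr (2 * a + 2) * q ^ n)) ~= top"
   by (rule ennreal_suminf_neq_top) (use q K in simp)
  then show ?thesis by (simp only: less_top infinity_ennreal_def)
 qed
 finally show ?thesis .
qed

text \<open>Now the ratio of the geometric series is at least 1, so every annulus contributes at
  least the constant \<open>c\<close>, and the first \<open>N\<close> of them already give N *
  c.\<close>

lemma nn_integral_disc_powr_infinite:
 assumes a: "a <= -1"
 shows "(\<integral>\<^sup>+x. ennreal (indicator (ball (0::complex) r) x * cmod x powr (2 * a)) \<partial>lborel) = \<infinity>" (is "?I = _")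
proof (rule ccontr)
 assume "?I ~= \<infinity>"
 then obtain v where v: "?I = ennreal v" "v >= 0" by (cases ?I) auto
 define c where "c = 3 / 4 * pi * r powr (2 * a + 2)"
 have c: "c > 0" using r by (simp add: c_def)
 have "real N * c <= v" for N
 proof -
  have le: "(\<Sum>n<N. ennreal ((r / 2 ^ n) powr (2 * a)) * indicator (A n) x) <=
   ennreal (indicator (ball 0 r) x * cmod x powr (2 * a))" for x :: complex
  proof (cases "EX m<N. x \<in> A m")
   case True
   then obtain m where m: "m < N" "x \<in> A m" by blast
   then have i: "indicator (A n) x = (if n = m then 1 else 0 :: ennreal)" for n
    using A_disjoint[OF _ m(2), of n] m(2) by (cases "x \<in> A n") auto
   have "(\<Sum>n<N. ennreal ((r / 2 ^ n) powr (2 * a)) * indicator (A n) x) = ennreal ((r / 2 ^ m) powr (2 * a))"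
    unfolding i using m(1) by (simp add: if_distrib[of "(*) _"] cong: if_cong)
   moreover have x: "cmod x < r / 2 ^ m" "x ~= 0" using m(2) r by (auto simp: A_def)
   have "r / 2 ^ m <= r" using r by (simp add: field_simps)
   then have "x \<in> ball 0 r" using x(1) by simp
   moreover have "(r / 2 ^ m) powr (2 * a) <= cmod x powr (2 * a)"
    using x a by (intro powr_mono2') auto
   ultimately show ?thesis by (simp add: ennreal_leI)
  next
   case False
   then have "(\<Sum>n<N. ennreal ((r / 2 ^ n) powr (2 * a)) * indicator (A n) x) = 0" by (intro sum.neutral) auto
   then show ?thesis by simp
  qed
  have "ennreal (real N * c) = (\<Sum>n<N. ennreal c)" using c by (simp add: ennreal_mult ennreal_of_nat_eq_real_of_nat)
  also have "\<dots> <= (\<Sum>n<N. ennreal ((r / 2 ^ n) powr (2 * a)) * emeasure lborel (A n))"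
  proof (rule sum_mono)
   fix n
   have "1 <= (2 powr (- (2 * a + 2))) ^ n" using a by (intro one_le_power) (simp add: ge_one_powr_ge_zero)
   then have "c <= 3 / 4 * pi * ((r / 2 ^ n) powr (2 * a) * (r / 2 ^ n)^2)"
    unfolding powr_mult_square c_def mult.assoc[symmetric]
    using mult_left_mono[of 1 _ "3 / 4 * pi * r powr (2 * a + 2)"] by simp
   then show "ennreal c <= ennreal ((r / 2 ^ n) powr (2 * a)) * emeasure lborel (A n)"
    unfolding emeasure_A by (subst ennreal_mult[symmetric]) (auto simp: mult_ac intro!: ennreal_leI)
  qed
  also have "\<dots> = (\<integral>\<^sup>+x. (\<Sum>n<N. ennreal ((r / 2 ^ n) powr (2 * a)) * indicator (A n) x) \<partial>lborel)"
   by (subst nn_integral_sum) (auto simp: nn_integral_cmult)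
  also have "\<dots> <= ?I" by (rule nn_integral_mono) (rule le)
  finally show ?thesis using v by simp
 qed
 moreover obtain N where "v / c < real N" using reals_Archimedean2 by blast
 ultimately show False using c by (simp add: field_simps) (meson not_le)
qed

end

lemma monomial_absolutely_integrable:
 assumes r: "r > 0" and ab: "a > -1" "b > -1"
 shows "(%p. cmod (fst p) powr (2 * a) * cmod (snd p) powr (2 * b)) L1_on PD r"
proof -
 let ?f = "%a x. indicator (ball 0 r) x * cmod x powr (2 * a)"
 have fm: "?f a \<in> borel_measurable borel" for a
  by (rule borel_measurable_times, rule borel_measurable_indicator, simp, measurable)
 have "(\<integral>\<^sup>+p. ennreal (?f a (fst p) * ?f b (snd p)) \<partial>lborel) < \<infinity>"
  using nn_integral_disc_powr_finite[OF r ab(1)] nn_integral_disc_powr_finite[OF r ab(2)]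
  by (subst nn_integral_prod_cc) (auto simp: ennreal_mult_less_top fm)
 moreover have eq: "?f a (fst p) * ?f b (snd p) = indicator (PD r) p * (cmod (fst p) powr (2 * a) * cmod (snd p) powr (2 * b))" for p
  by (auto simp: indicator_def PD_def mem_Times_iff)
 moreover have "(%p. ?f a (fst p) * ?f b (snd p)) \<in> borel_measurable borel"
  unfolding borel_prod[symmetric]
  by (rule borel_measurable_times measurable_compose[OF measurable_fst fm] measurable_compose[OF measurable_snd fm])+
 ultimately show ?thesis
  by (subst absolutely_integrable_iff_nn_integral) (simp_all add: eq)
qed

text \<open>By Tonelli the integral is a product in which the second disc contributes only its area.
  As this is positive, the first factor must be finite.\<close>

lemma strip_exponent:
 fixes y :: complex
 assumes e: "e > 0" and i: "(%p. cmod (fst p) powr (2 * a)) L1_on ball 0 e \<times> ball y e"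
 shows "a > -1"
proof (rule ccontr)
 assume "~ a > -1"
 let ?f = "%x. indicator (ball 0 e) x * cmod x powr (2 * a)"
 have fm: "?f \<in> borel_measurable borel"
  by (rule borel_measurable_times, rule borel_measurable_indicator, simp, measurable)
 let ?g = "indicator (ball y e) :: complex => real"
 have eq: "?f (fst p) * ?g (snd p) = indicator (ball 0 e \<times> ball y e) p * cmod (fst p) powr (2 * a)" for p
  by (auto simp: indicator_def mem_Times_iff)
 have gm: "?g \<in> borel_measurable borel" by (rule borel_measurable_indicator) simp
 have m: "(%p. ?f (fst p) * ?g (snd p)) \<in> borel_measurable borel"
  unfolding borel_prod[symmetric]
  by (rule borel_measurable_times measurable_compose[OF measurable_fst fm] measurable_compose[OF measurable_snd gm])+
 have "(\<integral>\<^sup>+p. ennreal (?f (fst p) * ?g (snd p)) \<partial>lborel) < \<infinity>"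
  using i m by (subst (asm) absolutely_integrable_iff_nn_integral) (simp_all add: eq)
 then have "\<infinity> * (\<integral>\<^sup>+x. ennreal (?g x) \<partial>lborel) < \<infinity>"
  using nn_integral_disc_powr_infinite[OF e, of a] \<open>~ a > -1\<close> by (subst (asm) nn_integral_prod_cc) (auto simp: fm gm)
 then have "(\<integral>\<^sup>+x. ennreal (?g x) \<partial>lborel) = 0" by (simp add: ennreal_top_mult split: if_splits)
 moreover have "(\<integral>\<^sup>+x. ennreal (?g x) \<partial>lborel) = emeasure lborel (ball y e)"
  by (simp only: ennreal_indicator) (rule nn_integral_indicator, simp)
 ultimately show False using e by (simp add: emeasure_ball unit_ball_vol_2)
qed

lemma pd_fst_snd: "pd1 fst q = 1" "pd2 fst q = 0" "pd1 snd q = 0" "pd2 snd q = 1"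
 by (cases q, simp add: pd1_def pd2_def)+

lemma absolutely_integrable_swap:
 fixes w :: "complex \<times> complex => real"
 assumes w: "w L1_on S" and S: "open S"
 shows "(%(x, y). w (y, x)) L1_on prod.swap ` S"
proof -
 have j: "jac snd fst q = -1" for q by (simp add: pd_fst_snd)
 have im: "(%q. (snd q, fst q)) ` prod.swap ` S = S" by (simp add: image_image)
 have "(%q. w (snd q, fst q) * (cmod (jac snd fst q))^2) L1_on prod.swap ` S"
 proof (rule absolutely_integrable_pullback[of snd UNIV fst "prod.swap ` S" w])
  show "inj_on (%q. (snd q, fst q)) (prod.swap ` S)" by (auto simp: inj_on_def)
  show "prod.swap ` S \<in> sets lebesgue" using open_swap[OF S] by simp
 qed (use w im in "simp_all add: hol2_on_fst hol2_on_snd")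
 then show ?thesis by (simp add: j case_prod_unfold)
qed

section \<open>Local integrability\<close>

text \<open>Since \<open>0 powr x = 0\<close> for every \<open>x\<close>, the weight is finite
  everywhere and vanishes on the zeros of each \<open>F i\<close>, even for nonpositive
  exponents.\<close>

definition wt :: "(cfun) => ('n::finite => cfun)
  => ('n => real) => complex \<times> complex => real"
 where "wt h F t p = (cmod (h p))^2 * (\<Prod>i\<in>UNIV. cmod (F i p) powr (2 * t i))"

definition lint :: "(complex \<times> complex => real) => bool"
 where "lint w \<longleftrightarrow> (EX U. open U & 0 \<in> U & w L1_on U)"

definition pos :: "(('n::finite => nat) \<times> int) set => ('n => real) => bool"
 where "pos C t \<longleftrightarrow> (ALL (\<alpha>, k):C. (\<Sum>i\<in>UNIV. real (\<alpha> i) * t i) + of_int k > 0)"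

text \<open>The pairs \<open>(\<alpha>, k)\<close> in \<open>C\<close> play the role of the exceptional curves \<open>E\<close>: there \<open>\<alpha> i\<close> is the multiplicity of
 \<open>F i\<close>, and \<open>k\<close> is the multiplicity of \<open>h dx & dy\<close> plus one.\<close>

definition describes :: "nat => ('n::finite => cfun) => (cfun)
  => (('n => nat) \<times> int) set => (complex \<times> complex) set => bool"
 where "describes K F h C U \<longleftrightarrow> finite C & (ALL (\<alpha>, k):C. ALL i. \<alpha> i <= K) & open U & 0 \<in> U &
  (ALL t. (pos C t --> wt h F t L1_on U) & (lint (wt h F t) --> pos C t))"

text \<open>The quantifiers carry the uniformity: \<open>K\<close> precedes \<open>h\<close>, so all
  vectors \<open>\<alpha>\<close> range over one finite set while \<open>C\<close> varies with
  \<open>h\<close>; and for each \<open>h\<close> one neighbourhood \<open>U\<close> serves all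
  exponents \<open>t\<close>, which makes limits in \<open>t\<close> possible.\<close>

definition polyhedral :: "nat => ('n::finite => cfun) => bool"
 where "polyhedral K F \<longleftrightarrow> (ALL h. hol2_at0 h --> (EX C U. describes K F h C U))"

lemma describesD:
 assumes "describes K F h C U"
 shows "finite C" "!!\<alpha> k i. (\<alpha>, k) \<in> C ==> \<alpha> i <= K" "open U" "0 \<in> U"
  "!!t. pos C t ==> wt h F t L1_on U" "!!t. lint (wt h F t) ==> pos C t"
 using assms by (auto simp: describes_def)

lemma describesI:
 assumes "finite C" "!!\<alpha> k i. (\<alpha>, k) \<in> C ==> \<alpha> i <= K" "open U" "0 \<in> U"
  "!!t. pos C t ==> wt h F t L1_on U" "!!t. lint (wt h F t) ==> pos C t"
 shows "describes K F h C U"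
 unfolding describes_def using assms by auto

lemma wt_nonneg: "0 <= wt h F t p"
 by (simp add: wt_def prod_nonneg)

lemma absolutely_integrable_open_subset:
 fixes w :: "'a::euclidean_space => real"
 assumes "w L1_on S" "T \<subseteq> S" "open T"
 shows "w L1_on T"
 by (rule set_integrable_subset[OF assms(1)]) (use assms in auto)

lemma lint_PD:
 assumes "lint w" obtains r0 where "r0 > 0" "!!r. r <= r0 ==> w L1_on PD r"
proof -
 obtain U where U: "open U" "0 \<in> U" "w L1_on U" using assms by (auto simp: lint_def)
 obtain r where r: "r > 0" "PD r \<subseteq> U" by (rule PD_subset_open[OF U(1,2)])
 show thesis
  by (rule that[OF r(1)], rule absolutely_integrable_open_subset[OF U(3)]) (use r(2) PD_mono in "auto intro: order_trans")
qed

lemma absolutely_integrable_cong: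
 fixes w :: "'a::euclidean_space => real"
 assumes "w L1_on S" "!!x. x \<in> S ==> w x = w' x"
 shows "w' L1_on S"
 by (rule absolutely_integrable_spike[OF assms(1) negligible_empty]) (use assms(2) in auto)

lemma polyhedral_mono: "polyhedral K F ==> K <= K' ==> polyhedral K' F"
 unfolding polyhedral_def
proof (intro allI impI)
 fix h assume K: "ALL h. hol2_at0 h --> (EX C U. describes K F h C U)" "K <= K'" and h: "hol2_at0 h"
 from K(1)[rule_format, OF h] obtain C U where CU: "describes K F h C U" by auto
 have "describes K' F h C U"
  by (rule describesI) (use describesD[OF CU] K(2) in "blast intro: order_trans")+
 then show "EX C U. describes K' F h C U" by auto
qed

section \<open>Normal crossings\<close>

lemma measurable_cmod_hol2:
 assumes "f hol2_on U" "open U"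
 shows "(%p. cmod (f p)) \<in> borel_measurable (lebesgue_on U)"
 by (rule continuous_imp_measurable_on_sets_lebesgue)
  (use assms hol2_on_continuous in "auto intro!: continuous_intros")

lemma measurable_wt:
 assumes "h hol2_on U" "!!i. F i hol2_on U" "open U"
 shows "wt h F t \<in> borel_measurable (lebesgue_on U)"
proof -
 have [measurable]: "(%p. cmod (h p)) \<in> borel_measurable (lebesgue_on U)"
  "(%p. cmod (F i p)) \<in> borel_measurable (lebesgue_on U)" for i
  using assms by (auto intro: measurable_cmod_hol2)
 show ?thesis unfolding wt_def[abs_def] by measurable
qed

lemma dominated_absolutely_integrable:
 fixes w g :: "'a::euclidean_space => real"
 assumes w: "w \<in> borel_measurable (lebesgue_on U)" and U: "open U" and g: "g L1_on U"
  and N: "negligible N" and le: "!!p. p \<in> U - N ==> \<bar>w p\<bar> <= g p"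
 shows "w L1_on U"
proof -
 have Nl: "N \<in> sets lebesgue" using N negligible_imp_sets by blast
 have US: "U \<in> sets lebesgue" "U - N \<in> sets lebesgue" using U Nl by auto
 have "w L1_on U - N"
 proof (rule measurable_bounded_by_integrable_imp_absolutely_integrable[OF _ US(2)])
  show "w \<in> borel_measurable (lebesgue_on (U - N))"
   using w US by (metis Diff_subset measurable_restrict_mono)
  show "g integrable_on U - N"
   using set_integrable_subset[OF g US(2)] by (simp add: absolutely_integrable_on_def)
 qed (use le in auto)
 moreover have "w L1_on U \<longleftrightarrow> w L1_on U - N"
  by (rule absolutely_integrable_spike_set_eq) (auto intro: negligible_subset[OF N])
 ultimately show ?thesis by simp
qed

lemma negligible_axes: "negligible {p :: complex \<times> complex. fst p = 0 | snd p = 0}"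
proof -
 have "negligible {p :: complex \<times> complex. p \<bullet> (1, 0) = 0}"
  by (rule negligible_standard_hyperplane) (simp add: Basis_cc)
 then have 1: "negligible {p :: complex \<times> complex. fst p = 0}"
  by (rule negligible_subset) (auto simp: inner_prod_def)
 have "negligible {p :: complex \<times> complex. p \<bullet> (0, 1) = 0}"
  by (rule negligible_standard_hyperplane) (simp add: Basis_cc)
 then have 2: "negligible {p :: complex \<times> complex. snd p = 0}"
  by (rule negligible_subset) (auto simp: inner_prod_def)
 have "{p :: complex \<times> complex. fst p = 0 | snd p = 0} = {p. fst p = 0} Un {p. snd p = 0}" by auto
 then show ?thesis using negligible_Un[OF 1 2] by simp
qed

text \<open>Split off the order along x = 0, then the order along y = 0. What remains is not
  identically zero on either axis, and after shrinking its only possible zero on the axes is the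
  origin.\<close>

lemma hol2_monomial_factor:
 assumes f: "hol2_at0 f" and nz: "~ (\<forall>\<^sub>F p in nhds 0. f p = 0)"
 obtains a b h r where "r > 0" "h hol2_on PD r" "!!p. p \<in> PD r ==> f p = fst p ^ a * snd p ^ b * h p"
  "!!z. z \<in> ball 0 r - {0} ==> h (0, z) ~= 0 & h (z, 0) ~= 0"
proof -
 obtain r where r: "r > 0" "f hol2_on PD r" using f hol2_at0_PD by blast
 obtain p where p: "p \<in> PD r" "f p ~= 0"
  using nz r(1) unfolding eventually_nhds_0_PD by blast
 obtain a g y where g: "g hol2_on PD r" "!!q. q \<in> PD r ==> f q = fst q ^ a * g q" "y \<in> ball 0 r" "g (0, y) ~= 0"
  by (rule hol2_order_fst[OF r(2) p]) blast
 have sw: "prod.swap ` PD r = PD r" by (simp add: PD_def swap_Times)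
 have g': "(%(x, y). g (y, x)) hol2_on PD r" using hol2_on_swap[OF g(1)] by (simp add: sw)
 have "(y, 0) \<in> PD r" using g(3) r(1) by (simp add: PD_def)
 then obtain b h' x where h': "h' hol2_on PD r" "!!q. q \<in> PD r ==> (%(x, y). g (y, x)) q = fst q ^ b * h' q"
   "x \<in> ball 0 r" "h' (0, x) ~= 0"
  using g(4) by (elim hol2_order_fst[OF g']) auto
 define h where "h = (%(x, y). h' (y, x))"
 have h: "h hol2_on PD r" using hol2_on_swap[OF h'(1)] by (simp add: sw h_def)
 have gh: "g q = snd q ^ b * h q" if "q \<in> PD r" for q
  using h'(2)[of "prod.swap q"] that by (cases q) (auto simp: h_def PD_def)
 have hx: "h (x, 0) ~= 0" using h'(4) by (simp add: h_def)
 have hy: "h (0, y) ~= 0" using g(4) gh[of "(0, y)"] g(3) r(1) by (auto simp: PD_def)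
 have s1: "(%z. h (z, 0)) holomorphic_on ball 0 r" "(%z. h (0, z)) holomorphic_on ball 0 r"
  using hol2_on_slice1[OF h open_PD, of 0] hol2_on_slice2[OF h open_PD, of 0] r(1)
  by (auto elim!: holomorphic_on_subset simp: PD_def)
 obtain n v s where v: "s > 0" "s <= r" "!!w. w \<in> ball 0 s ==> h (w, 0) = w ^ n * v w" "!!w. w \<in> ball 0 s ==> v w ~= 0"
  by (rule holomorphic_order_0[OF s1(1) h'(3) hx]) blast
 obtain n' v' s' where v': "s' > 0" "s' <= r" "!!w. w \<in> ball 0 s' ==> h (0, w) = w ^ n' * v' w" "!!w. w \<in> ball 0 s' ==> v' w ~= 0"
  by (rule holomorphic_order_0[OF s1(2) g(3) hy]) blast
 show thesis
 proof (rule that[of "min s s'" h a b])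
  show "0 < min s s'" using v v' by simp
  show "h hol2_on PD (min s s')" using h by (rule hol2_on_subset) (use v v' in "auto intro!: PD_mono")
  show "f p = fst p ^ a * snd p ^ b * h p" if "p \<in> PD (min s s')" for p
  proof -
   have "min s s' <= r" using v(2) by simp
   then have "p \<in> PD r" using that PD_mono by blast
   then show ?thesis using g(2) gh by simp
  qed
  show "h (0, z) ~= 0 & h (z, 0) ~= 0" if "z \<in> ball 0 (min s s') - {0}" for z
   using that v v' by auto
 qed
qed

lemma order_unique:
 fixes c c' :: "complex => complex"
 assumes "isCont c 0" "isCont c' 0" "c 0 ~= 0" "c' 0 ~= 0"
  and "e > 0" and eq: "!!z. z ~= 0 ==> cmod z < e ==> z ^ A * c z = z ^ k * c' z"
 shows "A = k"
proof -
 have *: False if cc: "isCont c 0" "isCont c' 0" "c 0 ~= 0" and l: "A < k"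
  and eq: "!!z. z ~= 0 ==> cmod z < e ==> z ^ A * c z = z ^ k * c' z" for c c' :: "complex => complex" and A k
 proof -
  have e2: "c z = z ^ (k - A) * c' z" if "z \<in> ball 0 e - {0}" for z
   using eq[of z] that l by (simp add: power_diff field_simps)
  have "isCont (%z. z ^ (k - A) * c' z) 0" using cc by (intro continuous_intros)
  then have "(%z. z ^ (k - A) * c' z) \<midarrow>0\<rightarrow> 0" using l by (simp add: isCont_def power_0_left)
  moreover have "c \<midarrow>0\<rightarrow> c 0" using cc by (simp add: isCont_def)
  then have "(%z. z ^ (k - A) * c' z) \<midarrow>0\<rightarrow> c 0"
   by (rule Lim_transform_within_open[of _ _ _ _ "ball 0 e"]) (use e2 assms(5) in auto)
  ultimately have "0 = c 0" by (rule LIM_unique)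
  then show False using cc by simp
 qed
 show ?thesis
 proof (rule linorder_cases[of A k])
  assume "A < k" then show ?thesis using *[of c c' A k] assms by blast
 next
  assume "k < A" then show ?thesis using *[of c' c k A] assms by (metis (no_types))
 qed
qed

lemma isCont_slices:
 assumes "f hol2_on PD r" "x \<in> ball 0 r" "y \<in> ball 0 r"
 shows "isCont (%z. f (z, y)) x" "isCont (%z. f (x, z)) y" "isCont f (x, y)"
proof -
 show 3: "isCont f (x, y)"
  proof -
  have "(x, y) \<in> PD r" using assms(2,3) by (simp add: PD_def)
  then show ?thesis using hol2_on_continuous[OF assms(1)] continuous_on_eq_continuous_at[OF open_PD] by blast
 qed
 have "isCont (%z. (z, y)) x" "isCont (%z. (x, z)) y" by (intro continuous_intros)+
 then show "isCont (%z. f (z, y)) x" "isCont (%z. f (x, z)) y"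
  using 3 isCont_o2[of x "%z. (z, y)" f] isCont_o2[of y "%z. (x, z)" f] by auto
qed

text \<open>The factors of a monomial times a unit are again of this kind. Split the largest
  monomial off each \<open>F i\<close>; the total exponents are found by letting x or y tend to zero
  on a line off the origin, where the remaining factors do not vanish.\<close>

lemma monomial_factors:
 fixes F :: "'n::finite => cfun"
 assumes F: "!!i. hol2_at0 (F i)" and u: "hol2_at0 u" "u 0 ~= 0"
  and eq: "\<forall>\<^sub>F p in nhds 0. (\<Prod>i\<in>UNIV. F i p) = fst p ^ k * snd p ^ d * u p"
 obtains \<alpha> \<beta> :: "'n => nat" and H r where "r > 0" "!!i. H i hol2_on PD r" "!!i p. p \<in> PD r ==> H i p ~= 0"
  "!!i p. p \<in> PD r ==> F i p = fst p ^ \<alpha> i * snd p ^ \<beta> i * H i p" "!!i. \<alpha> i <= k" "!!i. \<beta> i <= d"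
proof -
 obtain r1 where r1: "r1 > 0" "u hol2_on PD r1" using u(1) hol2_at0_PD by blast
 obtain r2 where r2: "r2 > 0" "!!p. p \<in> PD r2 ==> (\<Prod>i\<in>UNIV. F i p) = fst p ^ k * snd p ^ d * u p"
  using eq unfolding eventually_nhds_0_PD by blast
 obtain e where e: "e > 0" "!!q. dist 0 q < e ==> u q ~= 0"
  using continuous_at_avoid[OF hol2_at0_continuous[OF u(1)] u(2)] by blast
 obtain r3 where r3: "r3 > 0" "PD r3 \<subseteq> ball 0 e" using PD_subset_open[of "ball 0 e"] e(1) by auto
 have nz: "~ (\<forall>\<^sub>F p in nhds 0. F i p = 0)" for i
 proof
  assume "\<forall>\<^sub>F p in nhds 0. F i p = 0"
  then obtain r4 where r4: "r4 > 0" "!!p. p \<in> PD r4 ==> F i p = 0" unfolding eventually_nhds_0_PD by blast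
  define z where "z = complex_of_real (min (min r1 r2) (min r3 r4) / 2)"
  have z: "z ~= 0" "cmod z < r1" "cmod z < r2" "cmod z < r3" "cmod z < r4"
   using r1(1) r2(1) r3(1) r4(1) by (auto simp: z_def)
  have "(\<Prod>i\<in>UNIV. F i (z, z)) = 0" using r4(2)[of "(z, z)"] z by (auto simp: PD_def intro!: prod_zero)
  moreover have "(z, z) \<in> PD r3" using z by (simp add: PD_def)
  then have "u (z, z) ~= 0" using r3(2) by (intro e(2)) auto
  ultimately show False using r2(2)[of "(z, z)"] z by (simp add: PD_def)
 qed
 have "ALL i. EX a b h r. r > 0 & h hol2_on PD r & (ALL p:PD r. F i p = fst p ^ a * snd p ^ b * h p) &
  (ALL z:ball 0 r - {0}. h (0, z) ~= 0 & h (z, 0) ~= 0)"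
 proof
  fix i
  show "EX a b h r. r > 0 & h hol2_on PD r & (ALL p:PD r. F i p = fst p ^ a * snd p ^ b * h p) &
  (ALL z:ball 0 r - {0}. h (0, z) ~= 0 & h (z, 0) ~= 0)"
   by (rule hol2_monomial_factor[OF F nz, of i]) blast
 qed
 then obtain \<alpha> \<beta> H \<rho> where H: "!!i. \<rho> i > 0" "!!i. H i hol2_on PD (\<rho> i)"
  "!!i p. p \<in> PD (\<rho> i) ==> F i p = fst p ^ \<alpha> i * snd p ^ \<beta> i * H i p"
  "!!i z. z \<in> ball 0 (\<rho> i) - {0} ==> H i (0, z) ~= 0 & H i (z, 0) ~= 0"
  by metis
 define r where "r = min (Min (range \<rho>)) (min r1 (min r2 r3))"
 have r: "r > 0" "!!i. r <= \<rho> i" "r <= r1" "r <= r2" "r <= r3"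
  using H(1) r1(1) r2(1) r3(1) by (auto simp: r_def min_le_iff_disj)
 define G where "G = (%p. \<Prod>i\<in>UNIV. H i p)"
 have Hr: "H i hol2_on PD r" for i using H(2)[of i] by (rule hol2_on_subset) (intro PD_mono r)
 have G: "G hol2_on PD r" unfolding G_def by (intro hol2_on_prod Hr)
 have ur: "u hol2_on PD r" using r1(2) by (rule hol2_on_subset) (intro PD_mono r)
 have u0: "u p ~= 0" if "p \<in> PD r" for p
 proof -
  have "p \<in> ball 0 e" using that r3(2) PD_mono[OF r(5)] by blast
  then show ?thesis by (intro e(2)) (simp only: mem_ball)
 qed
 define A where "A = (\<Sum>i\<in>UNIV. \<alpha> i)"
 define B where "B = (\<Sum>i\<in>UNIV. \<beta> i)"
 have main: "fst p ^ A * snd p ^ B * G p = fst p ^ k * snd p ^ d * u p" if "p \<in> PD r" for p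
 proof -
  have "(\<Prod>i\<in>UNIV. F i p) = (\<Prod>i\<in>UNIV. fst p ^ \<alpha> i * snd p ^ \<beta> i * H i p)"
   by (intro prod.cong refl H(3)) (use that PD_mono r(2) in auto)
  also have "\<dots> = fst p ^ A * snd p ^ B * G p"
   by (simp add: prod.distrib power_sum A_def B_def G_def)
  finally show ?thesis using r2(2)[of p] that PD_mono[of r r2] r by auto
 qed
 define z where "z = complex_of_real (r / 2)"
 have z: "z ~= 0" "cmod z < r" using r(1) by (auto simp: z_def)
 have Gz: "G (0, z) ~= 0" "G (z, 0) ~= 0" using H(4)[of z] z r(2) by (auto simp: G_def intro: less_le_trans)
 have zr: "z \<in> ball 0 r" "0 \<in> ball (0::complex) r" using z r(1) by auto
 have Ak: "A = k"
 proof (rule order_unique[OF _ _ _ _ r(1)])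
  show "isCont (%x. z ^ B * G (x, z)) 0" "isCont (%x. z ^ d * u (x, z)) 0"
   using isCont_slices(1)[OF G zr(2,1)] isCont_slices(1)[OF ur zr(2,1)] by (auto intro!: continuous_intros)
  show "z ^ B * G (0, z) ~= 0" "z ^ d * u (0, z) ~= 0" using z Gz u0[of "(0, z)"] r(1) by (auto simp: PD_def)
  show "x ^ A * (z ^ B * G (x, z)) = x ^ k * (z ^ d * u (x, z))" if "x ~= 0" "cmod x < r" for x
   using main[of "(x, z)"] that z by (simp add: PD_def mult.assoc)
 qed
 have Bd: "B = d"
 proof (rule order_unique[OF _ _ _ _ r(1)])
  show "isCont (%x. z ^ A * G (z, x)) 0" "isCont (%x. z ^ k * u (z, x)) 0"
   using isCont_slices(2)[OF G zr] isCont_slices(2)[OF ur zr] by (auto intro!: continuous_intros)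
  show "z ^ A * G (z, 0) ~= 0" "z ^ k * u (z, 0) ~= 0" using z Gz u0[of "(z, 0)"] r(1) by (auto simp: PD_def)
  show "x ^ B * (z ^ A * G (z, x)) = x ^ d * (z ^ k * u (z, x))" if "x ~= 0" "cmod x < r" for x
   using main[of "(z, x)"] that z by (simp add: PD_def mult_ac)
 qed
 \<comment> \<open>Off the axes the monomials cancel. Approaching the origin along the diagonal
   gives \<open>G 0 = u 0\<close>, so no cofactor \<open>H i\<close> vanishes at the origin.\<close>
 have Gu: "G (w, w) = u (w, w)" if "w \<in> ball 0 r - {0}" for w
  using main[of "(w, w)"] that by (simp add: PD_def Ak Bd)
 have diag: "isCont (%w::complex. (w, w)) 0" by (intro continuous_intros)
 have limG: "(%w. G (w, w)) \<midarrow>0\<rightarrow> G (0, 0)"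
  using isCont_o2[OF diag isCont_slices(3)[OF G zr(2) zr(2)]] by (simp only: isCont_def)
 have limu: "(%w. u (w, w)) \<midarrow>0\<rightarrow> u (0, 0)"
  using isCont_o2[OF diag isCont_slices(3)[OF ur zr(2) zr(2)]] by (simp only: isCont_def)
 have "(%w. u (w, w)) \<midarrow>0\<rightarrow> G (0, 0)"
  by (rule Lim_transform_within_open[OF limG, of "ball 0 r"]) (use Gu r(1) in auto)
 from LIM_unique[OF this limu] have "G (0, 0) = u (0, 0)" .
 then have "G 0 ~= 0" using u(2) by (simp add: zero_prod_def)
 then have "EX e>0. ALL q. dist 0 q < e --> G q ~= 0"
  using continuous_at_avoid[of 0 G 0] isCont_slices(3)[OF G zr(2) zr(2)] by (simp add: zero_prod_def)
 then obtain e' where e': "e' > 0" "!!q. dist 0 q < e' ==> G q ~= 0" by blast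
 obtain r5 where r5: "r5 > 0" "PD r5 \<subseteq> ball 0 e'" using PD_subset_open[of "ball 0 e'"] e'(1) by auto
 have *: "PD (min r r5) \<subseteq> PD r" "PD (min r r5) \<subseteq> PD r5" by (auto intro!: PD_mono)
 show thesis
 proof (rule that[of "min r r5" H \<alpha> \<beta>])
  show "min r r5 > 0" using r r5 by simp
  show "H i hol2_on PD (min r r5)" for i by (rule hol2_on_subset[OF Hr *(1)])
  show "H i p ~= 0" if "p \<in> PD (min r r5)" for i p
  proof -
   have "p \<in> ball 0 e'" using that * r5(2) by blast
   then have "dist 0 p < e'" by (simp only: mem_ball)
   from e'(2)[OF this] show ?thesis by (simp add: G_def)
  qed
  show "F i p = fst p ^ \<alpha> i * snd p ^ \<beta> i * H i p" if "p \<in> PD (min r r5)" for i p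
   using H(3)[of p i] that * PD_mono[OF r(2)[of i]] by auto
  show "\<alpha> i <= k" for i unfolding Ak[symmetric] A_def by (rule member_le_sum) auto
  show "\<beta> i <= d" for i unfolding Bd[symmetric] B_def by (rule member_le_sum) auto
 qed
qed

text \<open>Look near a point (0, y) of the axis other than the origin. There \<open>G\<close> and
  the power of the second coordinate are bounded below, so |x|^(2a) is dominated by a multiple of
  \<open>w\<close> and hence integrable across x = 0.\<close>

lemma exponent_necessary:
 assumes s: "s > 0" and w: "w L1_on PD s" and G: "continuous_on (PD s) G"
  and G0: "!!p. 0 <= G p" "!!z. z \<in> ball 0 s - {0} ==> G (0, z) ~= 0"
  and eq: "!!p. p \<in> PD s ==> fst p ~= 0 ==> snd p ~= 0 ==>
   w p = G p * cmod (fst p) powr (2 * a) * cmod (snd p) powr (2 * b)"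
 shows "a > -1"
proof -
 define y where "y = complex_of_real (s / 2)"
 have y: "y ~= 0" "cmod y < s" using s by (auto simp: y_def)
 define Q where "Q = (%p. G p * cmod (snd p) powr (2 * b))"
 define T where "T = PD s Int {p. snd p ~= 0}"
 have T: "open T" unfolding T_def
  by (intro open_Int open_PD open_Collect_neq continuous_intros)
 have "continuous_on T Q" unfolding Q_def T_def
  by (intro continuous_intros continuous_on_subset[OF G]) auto
 moreover have yT: "(0, y) \<in> T" using y s by (simp add: T_def PD_def)
 ultimately have c: "isCont Q (0, y)" using T continuous_on_eq_continuous_at by blast
 define c0 where "c0 = Q (0, y) / 2"
 have "Q (0, y) > 0" using y s G0(1)[of "(0, y)"] G0(2)[of y] by (auto simp: Q_def intro!: mult_pos_pos)
 then have c0: "c0 > 0" "c0 < Q (0, y)" by (auto simp: c0_def)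
 have "\<forall>\<^sub>F p in nhds (0, y). c0 < Q p"
 proof -
  have "(Q \<longlongrightarrow> Q (0, y)) (nhds (0, y))" using c by (simp add: isCont_def tendsto_at_iff_tendsto_nhds)
  then show ?thesis using c0(2) by (rule order_tendstoD(1))
 qed
 moreover have "\<forall>\<^sub>F p in nhds (0, y). p \<in> T" using T yT by (rule eventually_nhds_in_open)
 ultimately have "\<forall>\<^sub>F p in nhds (0, y). c0 < Q p & p \<in> T" by (rule eventually_conj)
 then obtain S where S: "open S" "(0, y) \<in> S" "!!p. p \<in> S ==> c0 < Q p & p \<in> T"
  unfolding eventually_nhds by auto
 obtain A B where AB: "open A" "open B" "(0, y) \<in> A \<times> B" "A \<times> B \<subseteq> S"
  by (rule open_prod_elim[OF S(1,2)])
 obtain e1 where e1: "e1 > 0" "ball 0 e1 \<subseteq> A" using AB(1,3) by (auto elim: openE)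
 obtain e2 where e2: "e2 > 0" "ball y e2 \<subseteq> B" using AB(2,3) by (auto elim: openE)
 define e where "e = min e1 e2"
 define V where "V = ball (0::complex) e \<times> ball y e"
 have e: "e > 0" "V \<subseteq> S" using e1 e2 AB(4) unfolding V_def e_def by (auto simp: subset_iff)
 have V: "open V" by (simp add: V_def open_Times)
 have wV: "w L1_on V"
  by (rule absolutely_integrable_open_subset[OF w _ V]) (use e(2) S(3) in "auto simp: T_def")
 have "(%p. cmod (fst p) powr (2 * a)) L1_on V"
 proof (rule dominated_absolutely_integrable[OF _ V _ negligible_axes])
  have "(%p. cmod (fst p)) \<in> borel_measurable (lebesgue_on V)"
   by (rule measurable_cmod_hol2[OF hol2_on_fst V])
  then show "(%p. cmod (fst p) powr (2 * a)) \<in> borel_measurable (lebesgue_on V)" by measurable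
  show "(%p. w p * (1 / c0)) L1_on V"
   using wV by (rule set_integrable_mult_left)
  fix p assume p: "p \<in> V - {p. fst p = 0 | snd p = 0}"
  then have pS: "c0 < Q p" "p \<in> PD s" using S(3)[of p] e(2) by (auto simp: T_def)
  have "w p = Q p * cmod (fst p) powr (2 * a)" using eq[OF pS(2)] p by (simp add: Q_def)
  also have "\<dots> >= c0 * cmod (fst p) powr (2 * a)" using pS by (intro mult_right_mono) auto
  finally show "\<bar>cmod (fst p) powr (2 * a)\<bar> <= w p * (1 / c0)" using c0(1) by (simp add: field_simps)
 qed
 then show ?thesis unfolding V_def by (rule strip_exponent[OF e(1)])
qed

text \<open>The two axes give the two inequalities. The cofactor \<open>g\<close> of
  \<open>h\<close> may vanish along further curves through the origin: this does not spoil
  integrability, and it cannot mask necessity, which is tested on the axes off the origin, where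
  \<open>g\<close> is not zero.\<close>

lemma polyhedral_normal_crossing:
 fixes F :: "'n::finite => cfun"
 assumes F: "!!i. hol2_at0 (F i)" and u: "hol2_at0 u" "u 0 ~= 0"
  and eq: "\<forall>\<^sub>F p in nhds 0. (\<Prod>i\<in>UNIV. F i p) = fst p ^ k * snd p ^ d * u p"
 shows "polyhedral (max k d) F"
 unfolding polyhedral_def
proof (intro allI impI)
 fix h assume h: "hol2_at0 h"
 show "EX C U. describes (max k d) F h C U"
 proof (cases "\<forall>\<^sub>F p in nhds 0. h p = 0")
  case True
  then obtain r where r: "r > 0" "!!p. p \<in> PD r ==> h p = 0" unfolding eventually_nhds_0_PD by auto
  \<comment> \<open>The weight of \<open>h = 0\<close> is integrable for every \<open>t\<close>, so
    the empty set of inequalities is the right one.\<close>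
  have "describes (max k d) F h {} (PD r)"
  proof (rule describesI)
   fix t
   have "(%p. 0) L1_on PD r" by simp
   then show "wt h F t L1_on PD r"
    by (rule absolutely_integrable_cong) (use r(2) in "simp add: wt_def")
  qed (use r in "auto simp: pos_def")
  then show ?thesis by auto
 next
  case False
  obtain \<alpha> \<beta> :: "'n => nat" and H r where H: "r > 0" "!!i. H i hol2_on PD r" "!!i p. p \<in> PD r ==> H i p ~= 0"
   "!!i p. p \<in> PD r ==> F i p = fst p ^ \<alpha> i * snd p ^ \<beta> i * H i p" "!!i. \<alpha> i <= k" "!!i. \<beta> i <= d"
   by (rule monomial_factors[OF F u eq]) blast
  obtain a b g r' where g: "r' > 0" "g hol2_on PD r'" "!!p. p \<in> PD r' ==> h p = fst p ^ a * snd p ^ b * g p"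
   "!!z. z \<in> ball 0 r' - {0} ==> g (0, z) ~= 0 & g (z, 0) ~= 0"
   by (rule hol2_monomial_factor[OF h False]) blast
  define \<rho> where "\<rho> = min r r'"
  have \<rho>: "\<rho> > 0" "PD \<rho> \<subseteq> PD r" "PD \<rho> \<subseteq> PD r'" using H(1) g(1) by (auto simp: \<rho>_def intro!: PD_mono)
  define A where "A = (%t. (\<Sum>i\<in>UNIV. real (\<alpha> i) * t i) + real a)"
  define B where "B = (%t. (\<Sum>i\<in>UNIV. real (\<beta> i) * t i) + real b)"
  define G where "G = (%t p. (cmod (g p))^2 * (\<Prod>i\<in>UNIV. cmod (H i p) powr (2 * t i)))"
  have wtG: "wt h F t p = G t p * cmod (fst p) powr (2 * A t) * cmod (snd p) powr (2 * B t)"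
   if p: "p \<in> PD \<rho>" "fst p ~= 0" "snd p ~= 0" for t p
  proof -
   let ?x = "cmod (fst p)" and ?y = "cmod (snd p)"
   have xy: "?x > 0" "?y > 0" using p by auto
   have 1: "cmod (F i p) powr (2 * t i) = ?x powr (2 * (real (\<alpha> i) * t i)) * ?y powr (2 * (real (\<beta> i) * t i)) * cmod (H i p) powr (2 * t i)" for i
   proof -
    have "cmod (F i p) = ?x powr (\<alpha> i) * ?y powr (\<beta> i) * cmod (H i p)"
     using H(4)[of p i] p \<rho> xy by (auto simp: norm_mult norm_power powr_realpow)
    then show ?thesis using xy by (simp add: powr_mult powr_powr mult_ac)
   qed
   have 2: "(cmod (h p))^2 = ?x powr (2 * real a) * ?y powr (2 * real b) * (cmod (g p))^2"
   proof -
    have "?x powr (2 * real a) = (?x ^ a)^2" "?y powr (2 * real b) = (?y ^ b)^2"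
     using xy by (simp_all add: powr_realpow[symmetric] powr_powr powr_power mult.commute)
    then show ?thesis using g(3)[of p] p \<rho> by (auto simp: norm_mult norm_power power_mult_distrib)
   qed
   have "wt h F t p = (?x powr (2 * real a) * (\<Prod>i\<in>UNIV. ?x powr (2 * (real (\<alpha> i) * t i)))) *
    (?y powr (2 * real b) * (\<Prod>i\<in>UNIV. ?y powr (2 * (real (\<beta> i) * t i)))) * G t p"
    unfolding wt_def 1 2 G_def by (simp add: prod.distrib)
   also have "?x powr (2 * real a) * (\<Prod>i\<in>UNIV. ?x powr (2 * (real (\<alpha> i) * t i))) = ?x powr (2 * A t)"
   proof -
    have e: "2 * A t = 2 * real a + (\<Sum>i\<in>UNIV. 2 * (real (\<alpha> i) * t i))" by (simp add: A_def sum_distrib_left algebra_simps)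
    show ?thesis unfolding e using xy by (simp add: powr_add powr_sum)
   qed
   also have "?y powr (2 * real b) * (\<Prod>i\<in>UNIV. ?y powr (2 * (real (\<beta> i) * t i))) = ?y powr (2 * B t)"
   proof -
    have e: "2 * B t = 2 * real b + (\<Sum>i\<in>UNIV. 2 * (real (\<beta> i) * t i))" by (simp add: B_def sum_distrib_left algebra_simps)
    show ?thesis unfolding e using xy by (simp add: powr_add powr_sum)
   qed
   finally show ?thesis by (simp add: mult_ac)
  qed
  have contG: "continuous_on (PD \<rho>) (G t)" for t
   unfolding G_def using \<rho> H(3)
   by (intro continuous_intros continuous_on_subset[OF hol2_on_continuous[OF H(2)]] continuous_on_subset[OF hol2_on_continuous[OF g(2)]]) auto
  have G0: "0 <= G t p" for t p by (simp add: G_def prod_nonneg)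
  have Gnz: "G t (0, z) ~= 0" "G t (z, 0) ~= 0" if "z \<in> ball 0 \<rho> - {0}" for t z
  proof -
   have "(0, z) \<in> PD r" "(z, 0) \<in> PD r" using that H(1) by (auto simp: PD_def \<rho>_def)
   then show "G t (0, z) ~= 0" "G t (z, 0) ~= 0"
    using that g(4)[of z] H(3) by (auto simp: G_def \<rho>_def)
  qed
  \<comment> \<open>Here \<open>a\<close> and \<open>b\<close> are the orders of \<open>h\<close>
    along the axes; the added 1 turns the condition that an exponent exceeds -1 into
    positivity.\<close>
  define C where "C = {(\<alpha>, int a + 1), (\<beta>, int b + 1)}"
  have posC: "pos C t \<longleftrightarrow> A t > -1 & B t > -1" for t by (auto simp: pos_def C_def A_def B_def)
  have "describes (max k d) F h C (PD (\<rho> / 2))"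
  proof (rule describesI)
   fix t assume "pos C t"
   then have AB: "A t > -1" "B t > -1" by (auto simp: posC)
   have "compact (cball (0::complex) (\<rho>/2) \<times> cball (0::complex) (\<rho>/2))" by (intro compact_Times) auto
   moreover have "cball (0::complex) (\<rho>/2) \<times> cball (0::complex) (\<rho>/2) \<subseteq> PD \<rho>" using \<rho>(1) by (auto simp: PD_def)
   ultimately have "bounded (G t ` (cball (0::complex) (\<rho>/2) \<times> cball (0::complex) (\<rho>/2)))"
    by (intro compact_imp_bounded compact_continuous_image continuous_on_subset[OF contG])
   then obtain M where M: "!!p. p \<in> cball (0::complex) (\<rho>/2) \<times> cball (0::complex) (\<rho>/2) ==> norm (G t p) <= M"
    unfolding bounded_iff by auto
   show "wt h F t L1_on PD (\<rho> / 2)"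
   proof (rule dominated_absolutely_integrable[OF _ open_PD _ negligible_axes])
    have sub: "PD (\<rho> / 2) \<subseteq> PD \<rho>" using \<rho>(1) by (intro PD_mono) simp
    have "h hol2_on PD \<rho>"
     by (rule hol2_on_cong[of _ "%p. fst p ^ a * snd p ^ b * g p"])
      (use g(2,3) \<rho> in "auto intro!: hol2_intros intro: hol2_on_subset")
    moreover have "F i hol2_on PD \<rho>" for i
     by (rule hol2_on_cong[of _ "%p. fst p ^ \<alpha> i * snd p ^ \<beta> i * H i p"])
      (use H(2,4) \<rho> in "auto intro!: hol2_intros intro: hol2_on_subset")
    ultimately show "wt h F t \<in> borel_measurable (lebesgue_on (PD (\<rho> / 2)))"
     by (intro measurable_wt open_PD) (auto intro: hol2_on_subset[OF _ sub])
    have "(%p. cmod (fst p) powr (2 * A t) * cmod (snd p) powr (2 * B t)) L1_on PD (\<rho> / 2)"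
     by (rule monomial_absolutely_integrable) (use AB \<rho> in auto)
    then show "(%p. M * (cmod (fst p) powr (2 * A t) * cmod (snd p) powr (2 * B t))) L1_on PD (\<rho> / 2)"
     by (rule set_integrable_mult_right)
    fix p assume p: "p \<in> PD (\<rho> / 2) - {p. fst p = 0 | snd p = 0}"
    have "G t p <= M" using M[of p] p by (auto simp: PD_def mem_Times_iff)
    then show "\<bar>wt h F t p\<bar> <= M * (cmod (fst p) powr (2 * A t) * cmod (snd p) powr (2 * B t))"
     using wtG[of p t] p sub by (auto simp: abs_of_nonneg wt_nonneg mult.assoc intro!: mult_right_mono)
   qed
  next
   fix t assume "lint (wt h F t)"
   then obtain s0 where s0: "s0 > 0" "!!s. s <= s0 ==> wt h F t L1_on PD s" by (rule lint_PD) blast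
   define s where "s = min s0 \<rho>"
   have s: "s > 0" "s <= s0" "s <= \<rho>" "PD s \<subseteq> PD \<rho>" using s0 \<rho> by (auto simp: s_def intro!: PD_mono)
   have "A t > -1"
    by (rule exponent_necessary[OF s(1) s0(2)[OF s(2)] continuous_on_subset[OF contG s(4)] G0])
     (use s Gnz wtG in auto)
   moreover have "B t > -1"
   proof (rule exponent_necessary[OF s(1)])
    have "prod.swap ` PD s = PD s" by (simp add: PD_def swap_Times)
    then show "(%(x, y). wt h F t (y, x)) L1_on PD s"
     using absolutely_integrable_swap[OF s0(2)[OF s(2)] open_PD] by simp
    have "continuous_on (PD s) (%p. G t (snd p, fst p))"
     by (rule continuous_on_compose2[OF contG]) (use s(3) in "auto intro!: continuous_intros simp: PD_def")
    then show "continuous_on (PD s) (%(x, y). G t (y, x))" by (simp add: case_prod_unfold)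
    show "(case p of (x, y) => wt h F t (y, x)) = (%(x, y). G t (y, x)) p * cmod (fst p) powr (2 * B t) * cmod (snd p) powr (2 * A t)"
     if "p \<in> PD s" "fst p ~= 0" "snd p ~= 0" for p
     using wtG[of "(snd p, fst p)" t] that s(3) by (auto simp: PD_def case_prod_unfold)
   qed (use Gnz G0 s in "auto simp: case_prod_unfold")
   ultimately show "pos C t" by (simp add: posC)
  qed (use H(5,6) \<rho> in "auto simp: C_def le_max_iff_disj")
  then show ?thesis by auto
 qed
qed

section \<open>Descent along maps of the plane\<close>

lemma differentiable_on_hol2_pair:
 assumes "X hol2_on D" "Y hol2_on D" "S \<subseteq> D"
 shows "(%q. (X q, Y q)) differentiable_on S"
 unfolding differentiable_on_def differentiable_def
proof
 fix q assume "q \<in> S"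
 then have q: "q \<in> D" using assms(3) by auto
 from has_derivative_at_withinI[OF has_derivative_Pair[OF hol2_on_has_derivative[OF assms(1) q] hol2_on_has_derivative[OF assms(2) q]], of S]
 show "EX D. ((%q. (X q, Y q)) has_derivative D) (at q within S)" by blast
qed

lemma image_sets_lebesgue:
 assumes "X hol2_on D" "Y hol2_on D" "S \<subseteq> D" "S \<in> sets lebesgue"
 shows "(%q. (X q, Y q)) ` S \<in> sets lebesgue"
 by (rule differentiable_image_in_sets_lebesgue[OF assms(4) _ differentiable_on_hol2_pair[OF assms(1,2,3)]]) simp

text \<open>The labels \<open>\<iota>\<close> cut the complement of the critical set into finitely
  many measurable pieces on which the map is injective. On the critical set the pulled back
  integrand is zero.\<close>

lemma absolutely_integrable_pullback_finite:
 fixes w :: "complex \<times> complex => real"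
 assumes XY: "X hol2_on V" "Y hol2_on V" and V: "open V" and fin: "finite (\<iota> ` V)"
  and lev: "!!j. {q \<in> V. jac X Y q ~= 0 & \<iota> q = j} \<in> sets lebesgue"
  and inj: "!!j. inj_on (%q. (X q, Y q)) {q \<in> V. jac X Y q ~= 0 & \<iota> q = j}"
  and w: "w L1_on W" and sub: "!!q. q \<in> V ==> jac X Y q ~= 0 ==> (X q, Y q) \<in> W"
 shows "(%q. w (X q, Y q) * (cmod (jac X Y q))^2) L1_on V"
proof -
 let ?S = "%j. {q \<in> V. jac X Y q ~= 0 & \<iota> q = j}"
 let ?f = "%q. w (X q, Y q) * (cmod (jac X Y q))^2"
 have "?f L1_on ?S j" for j
 proof (rule absolutely_integrable_pullback[OF XY _ _ inj lev])
  show "w L1_on (%q. (X q, Y q)) ` ?S j"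
   by (rule set_integrable_subset[OF w image_sets_lebesgue[OF XY _ lev]]) (use sub in auto)
 qed auto
 then have "?f L1_on (\<Union>j\<in>\<iota> ` V. ?S j)"
  by (intro set_integrable_UN fin lev)
 moreover have "?f L1_on V \<longleftrightarrow> ?f L1_on (\<Union>j\<in>\<iota> ` V. ?S j)"
  by (rule absolutely_integrable_spike_set_eq) (auto intro!: negligible_subset[OF negligible_empty])
 ultimately show ?thesis by simp
qed

lemma hol2_pair_neighbourhood:
 assumes X: "hol2_at0 X" "X 0 = 0" and Y: "hol2_at0 Y" "Y 0 = 0" and W: "open W" "0 \<in> W"
 obtains V where "open V" "0 \<in> V" "X hol2_on V" "Y hol2_on V" "!!q. q \<in> V ==> (X q, Y q) \<in> W"
proof -
 obtain U where U: "open U" "0 \<in> U" "X hol2_on U" using X by (auto simp: hol2_at0_def)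
 obtain U' where U': "open U'" "0 \<in> U'" "Y hol2_on U'" using Y by (auto simp: hol2_at0_def)
 define V where "V = (U Int U') Int (%q. (X q, Y q)) -` W"
 have "open V" unfolding V_def
  by (intro continuous_open_preimage W open_Int U U' continuous_on_Pair)
   (auto intro: continuous_on_subset[OF hol2_on_continuous] U U')
 moreover have "0 \<in> V" using U U' X Y W by (auto simp: V_def zero_prod_def)
 moreover have "X hol2_on V" "Y hol2_on V" using U(3) U'(3) by (auto simp: V_def intro: hol2_on_subset)
 ultimately show thesis using that by (auto simp: V_def)
qed

lemma hol2_at0_compose:
 assumes "hol2_at0 X" "X 0 = 0" "hol2_at0 Y" "Y 0 = 0" "hol2_at0 h"
 shows "hol2_at0 (%q. h (X q, Y q))"
proof -
 obtain W where W: "open W" "0 \<in> W" "h hol2_on W" using assms(5) by (auto simp: hol2_at0_def)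
 obtain V where V: "open V" "0 \<in> V" "X hol2_on V" "Y hol2_on V" "!!q. q \<in> V ==> (X q, Y q) \<in> W"
  by (rule hol2_pair_neighbourhood[OF assms(1-4) W(1,2)]) blast
 have "(%q. h (X q, Y q)) hol2_on V" by (rule hol2_on_compose[OF W(3) V(3,4,5)])
 then show ?thesis using V by (auto simp: hol2_at0_def)
qed

lemma hol2_on_jac: "X hol2_on V ==> Y hol2_on V ==> open V ==> jac X Y hol2_on V"
 by (intro hol2_on_diff hol2_on_mult hol2_on_pd1 hol2_on_pd2)

lemma hol2_at0_jac:
 assumes "hol2_at0 X" "hol2_at0 Y" shows "hol2_at0 (jac X Y)"
proof -
 obtain U where U: "open U" "0 \<in> U" "X hol2_on U" using assms by (auto simp: hol2_at0_def)
 obtain U' where U': "open U'" "0 \<in> U'" "Y hol2_on U'" using assms by (auto simp: hol2_at0_def)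
 have "jac X Y hol2_on (U Int U')"
  by (rule hol2_on_jac) (use U U' in "auto intro: hol2_on_subset")
 then show ?thesis using U U' unfolding hol2_at0_def by (intro exI[of _ "U Int U'"]) auto
qed

text \<open>Captures a map with finitely many sheets by measurable labels of the sheets. Only points
  with nonzero Jacobian count, so curves may be contracted, as in a blow-up.\<close>

definition finitely_injective :: "(cfun) => (cfun) => bool"
 where "finitely_injective X Y \<longleftrightarrow> (EX V (\<iota> :: complex \<times> complex => int). open V & 0 \<in> V & finite (range \<iota>) &
  (ALL j. {q. \<iota> q = j} \<in> sets lebesgue) & (ALL j. inj_on (%q. (X q, Y q)) {q \<in> V. jac X Y q ~= 0 & \<iota> q = j}))"

lemma finitely_injectiveI:
 assumes "open V" "0 \<in> V" "!!q q'. q \<in> V ==> q' \<in> V ==> jac X Y q ~= 0 ==> jac X Y q' ~= 0 ==> X q = X q' ==> Y q = Y q' ==> q = q'"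
 shows "finitely_injective X Y"
 unfolding finitely_injective_def
proof (intro exI conjI allI)
 show "finite (range (%q :: complex \<times> complex. 0 :: int))" by simp
 show "{q :: complex \<times> complex. (0 :: int) = j} \<in> sets lebesgue" for j by (cases "j = 0") auto
 show "inj_on (%q. (X q, Y q)) {q \<in> V. jac X Y q ~= 0 & 0 = j}" for j :: int
  by (rule inj_onI) (use assms(3) in blast)
qed (use assms in auto)

text \<open>Integrability of the weight downstairs amounts to integrability of its pullbacks times
  |jac|^2 in finitely many charts: images need no injectivity, pullbacks have finitely many sheets.
  The requirement \<open>cover\<close> allows arbitrary shrinking of the charts, since the
  neighbourhoods found there depend on \<open>h\<close>; it expresses compactness of the exceptional
  curve.\<close>

lemma polyhedral_descend:
 fixes F :: "'n::finite => cfun"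
 assumes F: "!!i. hol2_at0 (F i)"
  and M: "!!X Y. (X, Y) \<in> M ==> hol2_at0 X & hol2_at0 Y & X 0 = 0 & Y 0 = 0 & finitely_injective X Y"
  and cover: "!!N. (!!m. m \<in> M ==> open (N m) & 0 \<in> N m) ==>
   EX M0 U. M0 \<subseteq> M & finite M0 & open U & 0 \<in> U & U - {0} \<subseteq> (\<Union>m\<in>M0. (%q. (fst m q, snd m q)) ` N m)"
  and P: "!!X Y. (X, Y) \<in> M ==> polyhedral K (%i q. F i (X q, Y q))"
 shows "polyhedral K F"
 unfolding polyhedral_def
proof (intro allI impI)
 fix h assume h: "hol2_at0 h"
 \<comment> \<open>The Jacobian is absorbed into \<open>h\<close>, as the pullback of the form h dx
   & dy requires; so the hypothesis on the charts must hold for all \<open>h\<close>.\<close>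
 define hm where "hm = (%(m :: cfun \<times> cfun) q. h (fst m q, snd m q) * jac (fst m) (snd m) q)"
 define Fm where "Fm = (%(m :: cfun \<times> cfun) i q. F i (fst m q, snd m q))"
 have wtm: "wt (hm m) (Fm m) t q = wt h F t (fst m q, snd m q) * (cmod (jac (fst m) (snd m) q))^2" for m t q
  by (simp add: wt_def hm_def Fm_def norm_mult power_mult_distrib mult_ac)
 have "ALL m:M. EX C U. describes K (Fm m) (hm m) C U"
 proof
  fix m assume m: "m \<in> M"
  obtain X Y where XY: "m = (X, Y)" by force
  have "hol2_at0 (hm m)" unfolding hm_def XY fst_conv snd_conv
   by (intro hol2_at0_mult hol2_at0_compose hol2_at0_jac h) (use M m XY in auto)
  moreover have "polyhedral K (Fm m)" using P m by (simp add: Fm_def XY)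
  ultimately show "EX C U. describes K (Fm m) (hm m) C U" unfolding polyhedral_def by auto
 qed
 then obtain C U where CU: "!!m. m \<in> M ==> describes K (Fm m) (hm m) (C m) (U m)" by metis
 have "ALL m:M. EX N. open N & 0 \<in> N & N \<subseteq> U m & fst m hol2_on N & snd m hol2_on N"
 proof
  fix m assume m: "m \<in> M"
  obtain X Y where XY: "m = (X, Y)" by force
  obtain V where V: "open V" "0 \<in> V" "X hol2_on V" "Y hol2_on V"
   by (rule hol2_pair_neighbourhood[of X Y UNIV]) (use M[of X Y] m XY in auto)
  show "EX N. open N & 0 \<in> N & N \<subseteq> U m & fst m hol2_on N & snd m hol2_on N"
   using V describesD(3,4)[OF CU[OF m]]
   by (intro exI[of _ "V Int U m"]) (auto simp: XY intro: hol2_on_subset)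
 qed
 then obtain N where N: "!!m. m \<in> M ==> open (N m) & 0 \<in> N m & N m \<subseteq> U m & fst m hol2_on N m & snd m hol2_on N m"
  by metis
 obtain M0 U0 where M0: "M0 \<subseteq> M" "finite M0" "open U0" "0 \<in> U0"
   "U0 - {0} \<subseteq> (\<Union>m\<in>M0. (%q. (fst m q, snd m q)) ` N m)"
  using cover[of N] N by auto
 define CC where "CC = (\<Union>m\<in>M0. C m)"
 have "describes K F h CC U0"
 proof (rule describesI)
  show "finite CC" using M0 describesD(1)[OF CU] by (auto simp: CC_def)
  show "\<alpha> i <= K" if "(\<alpha>, k) \<in> CC" for \<alpha> k i
   using that M0 describesD(2)[OF CU] by (auto simp: CC_def)
  fix t assume pos: "pos CC t"
  have sets: "(%q. (fst m q, snd m q)) ` N m \<in> sets lebesgue" if "m \<in> M0" for m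
  proof -
   have "m \<in> M" using that M0(1) by auto
   from N[OF this] show ?thesis by (intro image_sets_lebesgue[of _ "N m"]) auto
  qed
  have "wt h F t L1_on (%q. (fst m q, snd m q)) ` N m" if "m \<in> M0" for m
  proof (rule absolutely_integrable_image)
   have m: "m \<in> M" using that M0 by auto
   show "fst m hol2_on N m" "snd m hol2_on N m" using N[OF m] by auto
   have "pos (C m) t" using pos that by (auto simp: pos_def CC_def)
   then have "wt (hm m) (Fm m) t L1_on U m" by (rule describesD(5)[OF CU[OF m]])
   then have "wt (hm m) (Fm m) t L1_on N m"
    by (rule absolutely_integrable_open_subset) (use N[OF m] in auto)
   then show "(%q. wt h F t (fst m q, snd m q) * (cmod (jac (fst m) (snd m) q))^2) L1_on N m"
    by (rule absolutely_integrable_cong) (rule wtm)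
  qed auto
  then have "wt h F t L1_on (\<Union>m\<in>M0. (%q. (fst m q, snd m q)) ` N m)"
   by (intro set_integrable_UN M0 sets)
  then have "wt h F t L1_on (U0 - {0})"
   by (rule absolutely_integrable_open_subset) (use M0 in "auto simp: open_delete")
  \<comment> \<open>The charts cover only a punctured neighbourhood; the missing point is a null
    set.\<close>
  moreover have "wt h F t L1_on U0 \<longleftrightarrow> wt h F t L1_on (U0 - {0})"
   by (rule absolutely_integrable_spike_set_eq) (auto intro: negligible_subset[OF negligible_sing])
  ultimately show "wt h F t L1_on U0" by simp
 next
  fix t assume "lint (wt h F t)"
  then obtain W where W: "open W" "0 \<in> W" "wt h F t L1_on W" by (auto simp: lint_def)
  have "pos (C m) t" if "m \<in> M0" for m
  proof -
   have m: "m \<in> M" using that M0 by auto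
   obtain X Y where XY: "m = (X, Y)" by force
   obtain V1 where V1: "open V1" "0 \<in> V1" "X hol2_on V1" "Y hol2_on V1" "!!q. q \<in> V1 ==> (X q, Y q) \<in> W"
    by (rule hol2_pair_neighbourhood[of X Y W]) (use M[of X Y] m XY W in auto)
   obtain V2 and \<iota> :: "complex \<times> complex => int" where V2: "open V2" "0 \<in> V2" "finite (range \<iota>)"
    "!!j. {q. \<iota> q = j} \<in> sets lebesgue" "!!j. inj_on (%q. (X q, Y q)) {q \<in> V2. jac X Y q ~= 0 & \<iota> q = j}"
    using M[of X Y] m XY unfolding finitely_injective_def by auto
   define V where "V = V1 Int V2"
   have V: "open V" "0 \<in> V" "X hol2_on V" "Y hol2_on V" using V1 V2 by (auto simp: V_def intro: hol2_on_subset)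
   have "(%q. wt h F t (X q, Y q) * (cmod (jac X Y q))^2) L1_on V"
   proof (rule absolutely_integrable_pullback_finite[OF V(3,4,1) _ _ _ W(3)])
    show "finite (\<iota> ` V)" using V2(3) by (rule finite_subset[rotated]) auto
    have "open {q \<in> V. jac X Y q ~= 0}"
    proof -
     have "{q \<in> V. jac X Y q ~= 0} = V Int jac X Y -` (- {0})" by auto
     moreover have "open (V Int jac X Y -` (- {0}))"
      by (rule continuous_open_preimage[OF hol2_on_continuous[OF hol2_on_jac[OF V(3,4,1)]] V(1)]) auto
     ultimately show ?thesis by simp
    qed
    then have "{q \<in> V. jac X Y q ~= 0} \<in> sets lebesgue" by auto
    then have *: "{q \<in> V. jac X Y q ~= 0} Int {q. \<iota> q = j} \<in> sets lebesgue" for j using V2(4) by (rule sets.Int)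
    have "{q \<in> V. jac X Y q ~= 0 & \<iota> q = j} = {q \<in> V. jac X Y q ~= 0} Int {q. \<iota> q = j}" for j by auto
    then show "{q \<in> V. jac X Y q ~= 0 & \<iota> q = j} \<in> sets lebesgue" for j using *[of j] by simp
    show "inj_on (%q. (X q, Y q)) {q \<in> V. jac X Y q ~= 0 & \<iota> q = j}" for j
     by (rule inj_on_subset[OF V2(5)[of j]]) (auto simp: V_def)
   qed (use V1 in "auto simp: V_def")
   then have "wt (hm m) (Fm m) t L1_on V"
    by (rule absolutely_integrable_cong) (simp add: wtm XY)
   then have "lint (wt (hm m) (Fm m) t)" using V unfolding lint_def by auto
   then show ?thesis by (rule describesD(6)[OF CU[OF m]])
  qed
  then show "pos CC t" by (auto simp: pos_def CC_def)
 qed (use M0 in auto)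
 then show "EX C U. describes K F h C U" by auto
qed

lemma hol2_at0I: "open U ==> 0 \<in> U ==> f hol2_on U ==> hol2_at0 f"
 unfolding hol2_at0_def by blast

lemma polyhedral_shear:
 fixes F :: "'n::finite => cfun"
 assumes F: "!!i. hol2_at0 (F i)" and \<psi>: "\<psi> holomorphic_on ball 0 r" "r > 0" "\<psi> 0 = 0"
  and P: "polyhedral K (%i q. F i (fst q, snd q + \<psi> (fst q)))"
 shows "polyhedral K F"
proof (rule polyhedral_descend[OF F, where M = "{(fst, %q. snd q + \<psi> (fst q))}"])
 let ?D = "ball (0::complex) r \<times> (UNIV :: complex set)"
 have D: "open ?D" "0 \<in> ?D" using \<psi> by (auto simp: open_Times zero_prod_def)
 have h1: "(%q. \<psi> (fst q)) hol2_on ?D"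
  by (rule hol2_on_compose1[OF \<psi>(1) open_ball hol2_on_fst]) auto
 have h: "(%q. snd q + \<psi> (fst q)) hol2_on ?D" by (intro hol2_on_add hol2_on_snd h1)
 fix X Y :: cfun assume "(X, Y) \<in> {(fst, %q. snd q + \<psi> (fst q))}"
 then have XY: "X = fst" "Y = (%q. snd q + \<psi> (fst q))" by auto
 show "hol2_at0 X & hol2_at0 Y & X 0 = 0 & Y 0 = 0 & finitely_injective X Y"
  using \<psi>(3) D h hol2_at0I[OF D h] hol2_at0I[OF D hol2_on_fst]
  by (auto simp: XY intro!: finitely_injectiveI[of UNIV] prod_eqI)
 show "polyhedral K (%i q. F i (X q, Y q))" using P by (simp add: XY)
next
 fix N :: "cfun \<times> cfun => (complex \<times> complex) set" assume "!!m. m \<in> {(fst, %q. snd q + \<psi> (fst q))} ==> open (N m) & 0 \<in> N m"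
 then have N: "open (N (fst, %q. snd q + \<psi> (fst q)))" "0 \<in> N (fst, %q. snd q + \<psi> (fst q))" by auto
 let ?N = "N (fst, %q. snd q + \<psi> (fst q))"
 let ?D = "ball (0::complex) r \<times> (UNIV :: complex set)"
 define U where "U = ?D Int (%q. (fst q, snd q - \<psi> (fst q))) -` ?N"
 have h1: "(%q. \<psi> (fst q)) hol2_on ?D"
  by (rule hol2_on_compose1[OF \<psi>(1) open_ball hol2_on_fst]) auto
 have "open U" unfolding U_def
  by (intro continuous_open_preimage N continuous_intros hol2_on_continuous[OF h1] open_Times) auto
 moreover have "0 \<in> U" using \<psi> N by (auto simp: U_def zero_prod_def)
 moreover have "U \<subseteq> (%q. (fst q, snd q + \<psi> (fst q))) ` ?N"
 proof
  fix p assume "p \<in> U"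
  then show "p \<in> (%q. (fst q, snd q + \<psi> (fst q))) ` ?N"
   by (intro image_eqI[of _ _ "(fst p, snd p - \<psi> (fst p))"]) (auto simp: U_def)
 qed
 ultimately show "EX M0 U. M0 \<subseteq> {(fst, %q. snd q + \<psi> (fst q))} & finite M0 & open U & 0 \<in> U &
   U - {0} \<subseteq> (\<Union>m\<in>M0. (%q. (fst m q, snd m q)) ` N m)"
  by (intro exI[of _ "{(fst, %q. snd q + \<psi> (fst q))}"] exI[of _ U]) auto
qed

text \<open>The plane cut into \<open>m\<close> equal angular sectors, which separate the m-th roots
  of a number. The default value of \<open>Ln 0\<close> adds at most one further label.\<close>

definition sector :: "nat => complex => int"
 where "sector m w = \<lfloor>(Im (Ln w) + pi) * real m / (2 * pi)\<rfloor>"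

lemma sector_measurable: "{w. sector m w = j} \<in> sets borel"
proof -
 have "(%w. (Im (Ln w) + pi) * real m / (2 * pi)) \<in> borel_measurable borel" by measurable
 then have "(%w. (Im (Ln w) + pi) * real m / (2 * pi)) -` {of_int j..<of_int (j + 1)} Int space borel \<in> sets borel"
  by (rule measurable_sets) simp
 moreover have "(%w. (Im (Ln w) + pi) * real m / (2 * pi)) -` {of_int j..<of_int (j + 1)} = {w. sector m w = j}"
  by (auto simp: sector_def floor_eq_iff)
 ultimately show ?thesis by simp
qed

lemma finite_range_sector: "finite (range (sector m))"
proof -
 have "sector m w \<in> {0..int m} Un {sector m 0}" for w
 proof (cases "w = 0")
  case False
  then have "0 <= Im (Ln w) + pi" "Im (Ln w) + pi <= 2 * pi"
   using mpi_less_Im_Ln[OF False] Im_Ln_le_pi[OF False] by auto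
  then have "0 <= (Im (Ln w) + pi) * real m / (2 * pi)"
    "(Im (Ln w) + pi) * real m / (2 * pi) <= 2 * pi * real m / (2 * pi)"
   by simp (rule divide_right_mono, rule mult_right_mono, use \<open>Im (Ln w) + pi <= 2 * pi\<close> in simp_all)
  then have "0 <= sector m w" "sector m w <= int m" unfolding sector_def by (simp_all add: floor_le_iff)
  then show ?thesis by simp
 qed simp
 then have "range (sector m) \<subseteq> {0..int m} Un {sector m 0}" by blast
 then show ?thesis by (rule finite_subset) simp
qed

text \<open>Two m-th roots of the same nonzero number have arguments differing by 2 pi n / m, so
  their sectors differ by exactly \<open>n\<close>.\<close>

lemma sector_inj:
 assumes m: "m >= 1" and eq: "w ^ m = w' ^ m" and s: "sector m w = sector m w'"
 shows "w = w'"
proof (cases "w = 0")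
 case True
 then have "w' ^ m = 0" using eq m by (simp add: power_0_left)
 then show ?thesis using True by simp
next
 case False
 then have False': "w' ~= 0"
 proof (intro notI)
  assume "w' = 0"
  then have "w ^ m = 0" using eq m by (simp add: power_0_left)
  then show False using False by simp
 qed
 have "exp (of_nat m * Ln w) = exp (of_nat m * Ln w')"
  using False False' eq by (simp add: exp_of_nat_mult)
 then obtain n :: int where n: "of_nat m * Ln w = of_nat m * Ln w' + (of_int (2 * n) * pi) * \<i>"
  unfolding exp_eq by blast
 have Re: "real m * Re (Ln w) = real m * Re (Ln w')" using arg_cong[OF n, of Re] by simp
 have Im: "real m * Im (Ln w) = real m * Im (Ln w') + 2 * real_of_int n * pi" using arg_cong[OF n, of Im] by simp
 have "(Im (Ln w) + pi) * real m / (2 * pi) = (Im (Ln w') + pi) * real m / (2 * pi) + of_int n"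
  using Im by (simp add: field_simps)
 then have "sector m w = sector m w' + n" by (simp add: sector_def)
 then have "n = 0" using s by simp
 then have "Ln w = Ln w'" using Re Im m by (simp add: complex_eq_iff)
 then show ?thesis using False False' by (metis exp_Ln)
qed

lemma polyhedral_ramify:
 fixes F :: "'n::finite => cfun"
 assumes F: "!!i. hol2_at0 (F i)" and e: "e >= 1"
  and P: "polyhedral K (%i q. F i (fst q ^ e, snd q))"
 shows "polyhedral K F"
proof (rule polyhedral_descend[OF F, where M = "{(%q. fst q ^ e, snd)}"])
 fix X Y :: cfun assume "(X, Y) \<in> {(%q. fst q ^ e, snd)} "
 then have XY: "X = (%q. fst q ^ e)" "Y = snd" by auto
 have "finitely_injective X Y"
  unfolding finitely_injective_def
 proof (intro exI conjI allI)
  show "finite (range (%q :: complex \<times> complex. sector e (fst q)))"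
   by (rule finite_subset[OF _ finite_range_sector[of e]]) auto
  show "{q :: complex \<times> complex. sector e (fst q) = j} \<in> sets lebesgue" for j
  proof -
   have "{w. sector e w = j} \<times> (UNIV :: complex set) \<in> sets (borel \<Otimes>\<^sub>M borel)"
    by (intro pair_measureI sector_measurable) auto
   moreover have "{q :: complex \<times> complex. sector e (fst q) = j} = {w. sector e w = j} \<times> UNIV" by auto
   ultimately have "{q :: complex \<times> complex. sector e (fst q) = j} \<in> sets borel" by (simp only: borel_prod)
   then show ?thesis by simp
  qed
  show "inj_on (%q. (X q, Y q)) {q \<in> UNIV. jac X Y q ~= 0 & sector e (fst q) = j}" for j
   by (rule inj_onI) (use sector_inj[OF e] in "auto simp: XY intro!: prod_eqI")
 qed auto
 then show "hol2_at0 X & hol2_at0 Y & X 0 = 0 & Y 0 = 0 & finitely_injective X Y"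
  using e by (auto simp: XY intro!: hol2_at0I[of UNIV] hol2_intros)
 show "polyhedral K (%i q. F i (X q, Y q))" using P by (simp add: XY)
next
 fix N :: "cfun \<times> cfun => (complex \<times> complex) set" assume "!!m. m \<in> {(%q. fst q ^ e, snd)} ==> open (N m) & 0 \<in> N m"
 then have "open (N (%q. fst q ^ e, snd))" "0 \<in> N (%q. fst q ^ e, snd)" by auto
 then obtain r where r: "r > 0" "PD r \<subseteq> N (%q. fst q ^ e, snd)" by (rule PD_subset_open)
 have "PD (min r (r ^ e)) \<subseteq> (%q. (fst q ^ e, snd q)) ` N (%q. fst q ^ e, snd)"
 proof
  fix p assume p: "p \<in> PD (min r (r ^ e))"
  obtain w where w: "fst p = w ^ e" using exists_complex_root[of e "fst p"] e by auto
  have "cmod w ^ e < r ^ e" using p by (simp add: PD_def mem_Times_iff w norm_power)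
  then have "cmod w < r" using r(1) by (auto intro: power_less_imp_less_base)
  then have "(w, snd p) \<in> PD r" using p by (auto simp: PD_def mem_Times_iff)
  then show "p \<in> (%q. (fst q ^ e, snd q)) ` N (%q. fst q ^ e, snd)"
   using r(2) w by (intro image_eqI[of _ _ "(w, snd p)"]) (auto simp: prod_eq_iff)
 qed
 then show "EX M0 U. M0 \<subseteq> {(%q. fst q ^ e, snd)} & finite M0 & open U & 0 \<in> U &
   U - {0} \<subseteq> (\<Union>m\<in>M0. (%q. (fst m q, snd m q)) ` N m)"
  using r(1) by (intro exI[of _ "{(%q. fst q ^ e, snd)}"] exI[of _ "PD (min r (r ^ e))"]) auto
qed

text \<open>One chart for each slope \<open>l\<close> and one for the vertical direction. The family
  is infinite, but each choice of neighbourhoods has a finite subfamily whose images cover, by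
  compactness of a disc of slopes.\<close>

lemma polyhedral_blowup:
 fixes F :: "'n::finite => cfun"
 assumes F: "!!i. hol2_at0 (F i)"
  and P: "!!l. polyhedral K (%i q. F i (fst q, fst q * (snd q + l)))"
  and Pinf: "polyhedral K (%i q. F i (fst q * snd q, snd q))"
 shows "polyhedral K F"
proof -
 define c :: "complex => (cfun) \<times> (cfun)"
  where "c = (%l. (fst, %q. fst q * (snd q + l)))"
 define d :: "(cfun) \<times> (cfun)"
  where "d = (%q. fst q * snd q, snd)"
 show ?thesis
 proof (rule polyhedral_descend[OF F, where M = "insert d (range c)"])
  fix X Y :: cfun assume XY: "(X, Y) \<in> insert d (range c)"
  show "hol2_at0 X & hol2_at0 Y & X 0 = 0 & Y 0 = 0 & finitely_injective X Y"
  proof (cases "(X, Y) = d")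
   case True
   have j: "jac (%q. fst q * snd q) snd q = snd q" for q :: "complex \<times> complex"
   proof -
    have "((%q. fst q * snd q) has_derivative (%(u, v). snd q * u + fst q * v)) (at q)"
     by (auto intro!: derivative_eq_intros simp: case_prod_unfold)
    from has_derivative_pd[OF this] show ?thesis by (simp add: pd_fst_snd)
   qed
   have "finitely_injective (%q. fst q * snd q) snd"
    by (rule finitely_injectiveI[of UNIV]) (auto simp: j intro!: prod_eqI)
   then show ?thesis using True
    by (auto simp: d_def intro!: hol2_at0I[of UNIV] hol2_intros)
  next
   case False
   then obtain l where l: "(X, Y) = c l" using XY by auto
   have j: "jac fst (%q. fst q * (snd q + l)) q = fst q" for q :: "complex \<times> complex"
   proof -
    have "((%q. fst q * (snd q + l)) has_derivative (%(u, v). (snd q + l) * u + fst q * v)) (at q)"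
     by (auto intro!: derivative_eq_intros simp: case_prod_unfold)
    from has_derivative_pd[OF this] show ?thesis by (simp add: pd_fst_snd)
   qed
   have "finitely_injective fst (%q. fst q * (snd q + l))"
    by (rule finitely_injectiveI[of UNIV]) (auto simp: j intro!: prod_eqI)
   then show ?thesis using l
    by (auto simp: c_def intro!: hol2_at0I[of UNIV] hol2_intros)
  qed
  show "polyhedral K (%i q. F i (X q, Y q))" using XY P Pinf by (auto simp: c_def d_def)
 next
  fix N :: "cfun \<times> cfun => (complex \<times> complex) set" assume "!!m. m \<in> insert d (range c) ==> open (N m) & 0 \<in> N m"
  then have N: "open (N d)" "0 \<in> N d" "!!l. open (N (c l))" "!!l. 0 \<in> N (c l)" by auto
  obtain \<eta> where \<eta>: "\<eta> > 0" "PD \<eta> \<subseteq> N d" by (rule PD_subset_open[OF N(1,2)])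
  have "ALL l. EX e>0. PD e \<subseteq> N (c l)" using PD_subset_open[OF N(3,4)] by metis
  then obtain e where e: "!!l. e l > 0" "!!l. PD (e l) \<subseteq> N (c l)" by metis
  \<comment> \<open>Slopes y/x of modulus at most 2/\<eta> are left to the finite charts. All other
    points satisfy |x/y| < \<eta> and lie in the chart at infinity, whose neighbourhood contains
    \<open>PD \<eta>\<close>.\<close>
  have cov: "cball (0::complex) (2 / \<eta>) \<subseteq> (\<Union>l\<in>UNIV. ball l (e l))"
  proof
   fix x show "x \<in> (\<Union>l\<in>UNIV. ball l (e l))" by (rule UN_I[of x]) (use e(1) in auto)
  qed
  obtain L where L: "finite L" "cball (0::complex) (2 / \<eta>) \<subseteq> (\<Union>l\<in>L. ball l (e l))"
   by (rule compactE_image[OF compact_cball _ cov]) auto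
  have Lne: "L ~= {}" using L(2) \<eta>(1) by (auto simp: subset_iff dest!: spec[of _ 0])
  define \<delta> where "\<delta> = min \<eta> (Min (e ` L))"
  have \<delta>: "\<delta> > 0" "\<delta> <= \<eta>" "!!l. l \<in> L ==> \<delta> <= e l" using \<eta>(1) e(1) L(1) Lne by (auto simp: \<delta>_def min_le_iff_disj)
  have "PD \<delta> - {0} \<subseteq> (\<Union>m\<in>insert d (c ` L). (%q. (fst m q, snd m q)) ` N m)"
  proof
   fix p assume p: "p \<in> PD \<delta> - {0}"
   obtain x y where xy: "p = (x, y)" by force
   have b: "cmod x < \<delta>" "cmod y < \<delta>" "x ~= 0 | y ~= 0" using p by (auto simp: xy PD_def zero_prod_def)
   show "p \<in> (\<Union>m\<in>insert d (c ` L). (%q. (fst m q, snd m q)) ` N m)"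
   proof (cases "x ~= 0 & cmod y <= 2 / \<eta> * cmod x")
    case True
    then have "y / x \<in> cball 0 (2 / \<eta>)" by (simp add: norm_divide divide_le_eq)
    then obtain l where l: "l \<in> L" "y / x \<in> ball l (e l)" using L(2) by blast
    have "(x, y / x - l) \<in> PD (e l)" using l b \<delta>(3)[OF l(1)] by (auto simp: PD_def dist_norm norm_minus_commute)
    then have "(x, y / x - l) \<in> N (c l)" using e(2) by auto
    moreover have "p = (fst (c l) (x, y / x - l), snd (c l) (x, y / x - l))" using True by (simp add: c_def xy)
    ultimately show ?thesis using l(1) by blast
   next
    case False
    have "0 <= 2 / \<eta> * cmod x" using \<eta>(1) by simp
    with False have y: "y ~= 0" "2 / \<eta> * cmod x < cmod y | x = 0" using b(3) by (auto simp: not_le)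
    have "cmod x / cmod y < \<eta>"
    proof (cases "x = 0")
     case xnz: False
     then have "2 * cmod x < cmod y * \<eta>" using y(2) \<eta>(1) by (simp add: field_simps)
     moreover have "cmod x > 0" using xnz by simp
     ultimately have "cmod x < cmod y * \<eta>" by linarith
     then show ?thesis using y(1) by (simp add: divide_less_eq mult.commute)
    qed (use \<eta> in simp)
    then have "(x / y, y) \<in> PD \<eta>" using b \<delta>(2) by (auto simp: PD_def norm_divide)
    then have "(x / y, y) \<in> N d" using \<eta>(2) by auto
    moreover have "p = (fst d (x / y, y), snd d (x / y, y))" using y by (simp add: d_def xy)
    ultimately show ?thesis by blast
   qed
  qed
  then show "EX M0 U. M0 \<subseteq> insert d (range c) & finite M0 & open U & 0 \<in> U &
    U - {0} \<subseteq> (\<Union>m\<in>M0. (%q. (fst m q, snd m q)) ` N m)"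
   using L(1) \<delta>(1) by (intro exI[of _ "insert d (c ` L)"] exI[of _ "PD \<delta>"]) auto
 qed
qed

section \<open>Induction on the order of regularity\<close>

lemma higher_deriv_expand:
 assumes R: "R holomorphic_on ball 0 r" "r > 0"
  and u: "!!y. y \<in> ball 0 r ==> u y = (\<Sum>i<n. c i * y ^ i) + y ^ n * R y"
 shows "i < n ==> (deriv ^^ i) u 0 = fact i * c i" "(deriv ^^ n) u 0 = fact n * R 0"
proof -
 have "R analytic_on {0}" using R by (meson analytic_at centre_in_ball open_ball)
 then have R': "R has_fps_expansion fps_expansion R 0" by (rule analytic_at_imp_has_fps_expansion_0)
 let ?E = "(\<Sum>i<n. fps_const (c i) * fps_X ^ i) + fps_X ^ n * fps_expansion R 0"
 have E1: "(%y. (\<Sum>i<n. c i * y ^ i) + y ^ n * R y) has_fps_expansion ?E"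
  by (intro fps_expansion_intros R')
 have ev: "\<forall>\<^sub>F y in nhds 0. u y = (\<Sum>i<n. c i * y ^ i) + y ^ n * R y"
  using eventually_nhds_in_open[of "ball 0 r" "0::complex"] R(2) by (auto elim!: eventually_mono intro!: u)
 have E: "u has_fps_expansion ?E"
  using has_fps_expansion_cong[OF ev refl] E1 by simp
 have nth: "fps_nth ?E i = (if i < n then c i else fps_nth (fps_expansion R 0) (i - n))" for i
 proof -
  have "fps_nth (\<Sum>i<n. fps_const (c i) * fps_X ^ i) i = (\<Sum>j<n. if j = i then c j else 0)"
   by (simp add: fps_sum_nth fps_X_power_nth if_distrib cong: if_cong)
  also have "\<dots> = (if i < n then c i else 0)" by simp
  finally show ?thesis by (simp add: fps_X_power_mult_nth)
 qed
 show "i < n ==> (deriv ^^ i) u 0 = fact i * c i"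
  using fps_nth_fps_expansion[OF E, of i] unfolding nth by (simp add: field_simps)
 show "(deriv ^^ n) u 0 = fact n * R 0"
  using fps_nth_fps_expansion[OF E, of n] unfolding nth by (simp add: field_simps fps_expansion_def)
qed

lemma funpow_pd2: "(pd2 ^^ i) g (x, y) = (deriv ^^ i) (%t. g (x, t)) y"
 by (induction i arbitrary: y) (simp_all add: pd2_def)

lemma hol2_on_funpow_pd2: "g hol2_on S ==> open S ==> (pd2 ^^ i) g hol2_on S"
 by (induction i) (auto intro: hol2_on_pd2)

lemma hol2_on_funpow_pd1: "g hol2_on S ==> open S ==> (pd1 ^^ i) g hol2_on S"
 by (induction i) (auto intro: hol2_on_pd1)

lemma eventually_compose_pair:
 assumes "\<forall>\<^sub>F p in nhds 0. P p" "hol2_at0 X" "X 0 = 0" "hol2_at0 Y" "Y 0 = 0"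
 shows "\<forall>\<^sub>F q in nhds 0. P (X q, Y q)"
proof -
 obtain W where W: "open W" "0 \<in> W" "!!p. p \<in> W ==> P p" using assms(1) by (auto simp: eventually_nhds)
 obtain V where V: "open V" "0 \<in> V" "X hol2_on V" "Y hol2_on V" "!!q. q \<in> V ==> (X q, Y q) \<in> W"
  by (rule hol2_pair_neighbourhood[OF assms(2-5) W(1,2)]) blast
 then show ?thesis using W(3) unfolding eventually_nhds by blast
qed

lemma hol2_at0_of_1: "\<psi> holomorphic_on ball 0 r ==> r > 0 ==> hol2_at0 X ==> X 0 = 0 ==> hol2_at0 (%q. \<psi> (X q))"
proof -
 assume \<psi>: "\<psi> holomorphic_on ball 0 r" "r > 0" and X: "hol2_at0 X" "X 0 = 0"
 have "(%p. \<psi> (fst p)) hol2_on (ball 0 r \<times> UNIV)"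
  by (rule hol2_on_compose1[OF \<psi>(1) open_ball hol2_on_fst]) auto
 then have "hol2_at0 (%p. \<psi> (fst p))"
  by (rule hol2_at0I[rotated 2]) (use \<psi> in "auto simp: open_Times zero_prod_def")
 from hol2_at0_compose[OF X hol2_at0_const[of 0] _ this] show ?thesis by simp
qed

lemma hol2_at0_fst: "hol2_at0 fst" and hol2_at0_snd: "hol2_at0 snd"
 by (auto intro: hol2_at0I[of UNIV] hol2_on_fst hol2_on_snd)

lemma hol2_at0_power: "hol2_at0 f ==> hol2_at0 (%p. f p ^ n)"
 by (induction n) (auto intro: hol2_at0_const hol2_at0_mult)

lemma hol2_at0_sum: "(!!i. i \<in> I ==> hol2_at0 (f i)) ==> hol2_at0 (%p. \<Sum>i\<in>I. f i p)"
 by (induction I rule: infinite_finite_induct) (auto intro: hol2_at0_const hol2_at0_add)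

lemma hol2_at0_prod: "(!!i. i \<in> I ==> hol2_at0 (f i)) ==> hol2_at0 (%p. \<Prod>i\<in>I. f i p)"
 by (induction I rule: infinite_finite_induct) (auto intro: hol2_at0_const hol2_at0_mult)

lemmas hol2_at0_intros = hol2_at0_const hol2_at0_add hol2_at0_mult hol2_at0_fst hol2_at0_snd hol2_at0_power
 hol2_at0_sum hol2_at0_prod

definition y_regular :: "nat => (cfun) => bool"
 where "y_regular d g \<longleftrightarrow> (EX v s. s > 0 & v holomorphic_on ball 0 s & v 0 ~= 0 & (ALL y:ball 0 s. g (0, y) = y ^ d * v y))"

text \<open>The power of x records the exceptional curve created so far and is left unrestricted;
  the induction is on the order \<open>d\<close> of the remaining factor on x = 0. The type argument
  only fixes the index type.\<close>

definition resolvable :: "nat => 'n::finite itself => bool"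
 where "resolvable d _ \<longleftrightarrow> (ALL (F :: 'n => cfun) k g.
  (ALL i. hol2_at0 (F i)) --> hol2_at0 g --> (\<forall>\<^sub>F p in nhds 0. (\<Prod>i\<in>UNIV. F i p) = fst p ^ k * g p) --> y_regular d g -->
  (EX K. polyhedral K F))"

lemma resolvableD:
 fixes F :: "'n::finite => cfun"
 assumes "resolvable d TYPE('n)" "!!i. hol2_at0 (F i)" "hol2_at0 g"
  "\<forall>\<^sub>F p in nhds 0. (\<Prod>i\<in>UNIV. F i p) = fst p ^ k * g p" "y_regular d g"
 shows "EX K. polyhedral K F"
 using assms unfolding resolvable_def by auto

lemma polyhedral_fst_power:
 fixes F :: "'n::finite => cfun"
 assumes "!!i. hol2_at0 (F i)" "hol2_at0 u" "u 0 ~= 0"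
  "\<forall>\<^sub>F p in nhds 0. (\<Prod>i\<in>UNIV. F i p) = fst p ^ k * u p"
 shows "polyhedral k F"
 using polyhedral_normal_crossing[OF assms(1-3), where k = k and d = 0] assms(4) by simp

text \<open>The Newton polygon is a single edge of slope \<open>p\<close>. A blow-up lowers
  \<open>p\<close> by one in the chart of slope 0 and gives normal crossings in the others. When
  \<open>p = 1\<close>, the zeros on the exceptional curve are the roots of a polynomial of degree
  \<open>d\<close> that has no term of degree d - 1 and is not a monomial; so all multiplicities
  drop below \<open>d\<close>.\<close>

lemma resolvable_newton:
 fixes F :: "'n::finite => cfun"
 assumes IH: "!!d'. d' < d ==> resolvable d' TYPE('n)" and d: "d >= 1" and p: "p >= 1"
  and F: "!!i. hol2_at0 (F i)"
  and c: "!!i. i < d ==> c i holomorphic_on ball 0 r" "r > 0" "!!z. z \<in> ball 0 r ==> c (d - 1) z = 0"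
  and i0: "i0 < d" "c i0 0 ~= 0" and R: "hol2_at0 R" "R 0 ~= 0"
  and eq: "\<forall>\<^sub>F q in nhds 0. (\<Prod>i\<in>UNIV. F i q) =
   fst q ^ k * ((\<Sum>i<d. fst q ^ (p * (d - i)) * c i (fst q) * snd q ^ i) + snd q ^ d * R q)"
 shows "EX K. polyhedral K F"
 using p F R eq
proof (induction p arbitrary: F k R rule: less_induct)
 case (less p F k R)
 note p = less.prems(1) and F = less.prems(2) and R = less.prems(3,4) and eq = less.prems(5)
 have c_at0: "hol2_at0 (%q. c i (X q))" if "i < d" "hol2_at0 X" "X 0 = 0" for i X
  by (rule hol2_at0_of_1[OF c(1)[OF that(1)] c(2) that(2,3)])
 \<comment> \<open>the chart at infinity\<close>
 have Finf: "hol2_at0 (%q. F i (fst q * snd q, snd q))" for i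
  by (rule hol2_at0_compose[OF _ _ _ _ F]) (auto intro!: hol2_at0_intros)
 have pinf: "polyhedral (max k (k + d)) (%i q. F i (fst q * snd q, snd q))"
 proof (rule polyhedral_normal_crossing[OF Finf])
  define u where "u = (%q. (\<Sum>i<d. fst q ^ (p * (d - i)) * snd q ^ ((p - 1) * (d - i)) * c i (fst q * snd q)) + R (fst q * snd q, snd q))"
  show "hol2_at0 u" unfolding u_def
   by (intro hol2_at0_intros c_at0 hol2_at0_compose[OF _ _ _ _ R(1)]) auto
  show "u 0 ~= 0"
  proof -
   have "(\<Sum>i<d. 0 ^ (p * (d - i)) * 0 ^ ((p - 1) * (d - i)) * c i 0) = 0"
    using p by (intro sum.neutral) auto
   then show ?thesis using R(2) by (simp add: u_def zero_prod_def)
  qed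
  have "\<forall>\<^sub>F q in nhds 0. (\<Prod>i\<in>UNIV. F i (fst q * snd q, snd q)) = fst (fst q * snd q, snd q) ^ k *
   ((\<Sum>i<d. fst (fst q * snd q, snd q) ^ (p * (d - i)) * c i (fst (fst q * snd q, snd q)) * snd (fst q * snd q, snd q) ^ i) + snd (fst q * snd q, snd q) ^ d * R (fst q * snd q, snd q))"
   by (rule eventually_compose_pair[OF eq]) (auto intro!: hol2_at0_intros)
  then show "\<forall>\<^sub>F q in nhds 0. (\<Prod>i\<in>UNIV. F i (fst q * snd q, snd q)) = fst q ^ k * snd q ^ (k + d) * u q"
  proof (rule eventually_mono)
   fix q :: "complex \<times> complex"
   obtain x y where q: "q = (x, y)" by force
   have t: "(x * y) ^ (p * (d - i)) * c i (x * y) * y ^ i = y ^ d * (x ^ (p * (d - i)) * y ^ ((p - 1) * (d - i)) * c i (x * y))"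
    if "i < d" for i
   proof -
    \<comment> \<open>This identity lets y^d be taken out of every term at once; the analogous one
      in the other charts takes out x^d.\<close>
    have "p * (d - i) + i = d + (p - 1) * (d - i)" using p less_imp_add_positive[OF that] by (cases p) auto
    then have "y ^ (p * (d - i)) * y ^ i = y ^ d * y ^ ((p - 1) * (d - i))" by (simp flip: power_add)
    then show ?thesis by (simp add: power_mult_distrib mult_ac)
   qed
   have s: "(\<Sum>i<d. (x * y) ^ (p * (d - i)) * c i (x * y) * y ^ i) = y ^ d * (\<Sum>i<d. x ^ (p * (d - i)) * y ^ ((p - 1) * (d - i)) * c i (x * y))"
    unfolding sum_distrib_left by (rule sum.cong[OF refl]) (rule t, simp)
   assume "(\<Prod>i\<in>UNIV. F i (fst q * snd q, snd q)) = fst (fst q * snd q, snd q) ^ k *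
   ((\<Sum>i<d. fst (fst q * snd q, snd q) ^ (p * (d - i)) * c i (fst (fst q * snd q, snd q)) * snd (fst q * snd q, snd q) ^ i) + snd (fst q * snd q, snd q) ^ d * R (fst q * snd q, snd q))"
   then have "(\<Prod>i\<in>UNIV. F i (fst q * snd q, snd q)) = (x * y) ^ k * ((\<Sum>i<d. (x * y) ^ (p * (d - i)) * c i (x * y) * y ^ i) + y ^ d * R (x * y, y))"
    by (simp add: q)
   also have "\<dots> = fst q ^ k * snd q ^ (k + d) * u q"
    unfolding s by (simp add: q u_def power_mult_distrib power_add ring_distribs mult_ac)
   finally show "(\<Prod>i\<in>UNIV. F i (fst q * snd q, snd q)) = fst q ^ k * snd q ^ (k + d) * u q" .
  qed
 qed
 \<comment> \<open>the chart centred at slope \<open>l\<close>\<close>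
 define G where "G = (%l q. (\<Sum>i<d. fst q ^ ((p - 1) * (d - i)) * c i (fst q) * (snd q + l) ^ i) + (snd q + l) ^ d * R (fst q, fst q * (snd q + l)))"
 have Fl: "hol2_at0 (%q. F i (fst q, fst q * (snd q + l)))" for i l
  by (rule hol2_at0_compose[OF _ _ _ _ F]) (auto intro!: hol2_at0_intros)
 have G: "hol2_at0 (G l)" for l unfolding G_def
  by (intro hol2_at0_intros c_at0 hol2_at0_compose[OF _ _ _ _ R(1)]) auto
 have eql: "\<forall>\<^sub>F q in nhds 0. (\<Prod>i\<in>UNIV. F i (fst q, fst q * (snd q + l))) = fst q ^ (k + d) * G l q" for l
 proof -
  have "\<forall>\<^sub>F q in nhds 0. (\<Prod>i\<in>UNIV. F i (fst q, fst q * (snd q + l))) = fst (fst q, fst q * (snd q + l)) ^ k *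
   ((\<Sum>i<d. fst (fst q, fst q * (snd q + l)) ^ (p * (d - i)) * c i (fst (fst q, fst q * (snd q + l))) * snd (fst q, fst q * (snd q + l)) ^ i) + snd (fst q, fst q * (snd q + l)) ^ d * R (fst q, fst q * (snd q + l)))"
   by (rule eventually_compose_pair[OF eq]) (auto intro!: hol2_at0_intros)
  then show ?thesis
  proof (rule eventually_mono)
   fix q :: "complex \<times> complex"
   obtain x y where q: "q = (x, y)" by force
   have t: "x ^ (p * (d - i)) * c i x * (x * (y + l)) ^ i = x ^ d * (x ^ ((p - 1) * (d - i)) * c i x * (y + l) ^ i)"
    if "i < d" for i
   proof -
    have "p * (d - i) + i = d + (p - 1) * (d - i)" using p less_imp_add_positive[OF that] by (cases p) auto
    then have "x ^ (p * (d - i)) * x ^ i = x ^ d * x ^ ((p - 1) * (d - i))" by (simp flip: power_add)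
    then show ?thesis by (simp add: power_mult_distrib mult_ac)
   qed
   have s: "(\<Sum>i<d. x ^ (p * (d - i)) * c i x * (x * (y + l)) ^ i) = x ^ d * (\<Sum>i<d. x ^ ((p - 1) * (d - i)) * c i x * (y + l) ^ i)"
    unfolding sum_distrib_left by (rule sum.cong[OF refl]) (rule t, simp)
   assume "(\<Prod>i\<in>UNIV. F i (fst q, fst q * (snd q + l))) = fst (fst q, fst q * (snd q + l)) ^ k *
   ((\<Sum>i<d. fst (fst q, fst q * (snd q + l)) ^ (p * (d - i)) * c i (fst (fst q, fst q * (snd q + l))) * snd (fst q, fst q * (snd q + l)) ^ i) + snd (fst q, fst q * (snd q + l)) ^ d * R (fst q, fst q * (snd q + l)))"
   then have "(\<Prod>i\<in>UNIV. F i (fst q, fst q * (snd q + l))) = x ^ k * ((\<Sum>i<d. x ^ (p * (d - i)) * c i x * (x * (y + l)) ^ i) + (x * (y + l)) ^ d * R (x, x * (y + l)))"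
    by (simp add: q)
   also have "\<dots> = fst q ^ (k + d) * G l q"
    unfolding s power_mult_distrib[of x "y + l" d] q G_def fst_conv snd_conv power_add
    by (simp only: distrib_left mult.assoc)
   finally show "(\<Prod>i\<in>UNIV. F i (fst q, fst q * (snd q + l))) = fst q ^ (k + d) * G l q" .
  qed
 qed
 have unit: "polyhedral (k + d) (%i q. F i (fst q, fst q * (snd q + l)))" if "G l 0 ~= 0" for l
  by (rule polyhedral_fst_power[OF Fl G that eql])
 have "EX Z. finite Z & (ALL l. l ~: Z --> G l 0 ~= 0) & (ALL l:Z. EX K. polyhedral K (%i q. F i (fst q, fst q * (snd q + l))))"
 proof (cases "p = 1")
  \<comment> \<open>For \<open>p > 1\<close> every lower term vanishes on the exceptional curve,
    which leaves l^d R(0): only the slope 0 is not yet a normal crossing, and there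
    \<open>p - 1\<close> takes the place of \<open>p\<close>.\<close>
  case False
  then have p2: "p - 1 >= 1" "p - 1 < p" using p by auto
  have "G l 0 = l ^ d * R 0" for l
  proof -
   have "(\<Sum>i<d. 0 ^ ((p - 1) * (d - i)) * c i 0 * l ^ i) = 0" using p2 by (intro sum.neutral) auto
   then show ?thesis by (simp add: G_def zero_prod_def)
  qed
  moreover have "EX K. polyhedral K (%i q. F i (fst q, fst q * (snd q + 0)))"
  proof (rule less.IH[OF p2(2) p2(1)])
   show "hol2_at0 (%q. F i (fst q, fst q * (snd q + 0)))" for i by (rule Fl)
   show "hol2_at0 (%q. R (fst q, fst q * snd q))"
    by (intro hol2_at0_compose[OF _ _ _ _ R(1)] hol2_at0_intros) auto
   show "\<forall>\<^sub>F q in nhds 0. (\<Prod>i\<in>UNIV. F i (fst q, fst q * (snd q + 0))) = fst q ^ (k + d) *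
     ((\<Sum>i<d. fst q ^ ((p - 1) * (d - i)) * c i (fst q) * snd q ^ i) + snd q ^ d * R (fst q, fst q * snd q))"
    using eql[of 0] by (simp add: G_def)
  qed (use R in "auto simp: zero_prod_def")
  ultimately show ?thesis using R(2) by (intro exI[of _ "{0}"]) auto
 next
  case True
  define P where "P = (\<Sum>i<d. monom (c i 0) i) + monom (R 0) d"
  have coeffP: "coeff P i = (if i < d then c i 0 else if i = d then R 0 else 0)" for i
  proof -
   have "coeff (\<Sum>i<d. monom (c i 0) i) i = (\<Sum>j<d. if j = i then c j 0 else 0)" by (simp add: coeff_sum)
   also have "\<dots> = (if i < d then c i 0 else 0)" by simp
   finally show ?thesis by (auto simp: P_def)
  qed
  have degP: "degree P = d"
   by (rule antisym) (use R(2) in "auto intro!: degree_le le_degree simp: coeffP")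
  have P0: "P ~= 0" using R(2) coeffP[of d] by auto
  have GP: "G l (0, y) = poly P (y + l)" for l y
   using True by (simp add: G_def P_def poly_sum poly_monom zero_prod_def mult.commute)
  \<comment> \<open>If the multiplicity were \<open>d\<close>, then P = R(0) (y - l)^d. The missing
    term of degree d - 1 forces l = 0, and then P would be a monomial, against
    \<open>c i0 0 ~= 0\<close>.\<close>
  have ord: "order l P < d" for l
  proof (rule ccontr)
   assume "~ order l P < d"
   then have od: "order l P = d" using order_degree[OF P0, of l] degP by simp
   obtain q where q: "P = [:- l, 1:] ^ d * q" using order_decomp[OF P0, of l] od by auto
   have "q ~= 0" using P0 q by auto
   then have "degree P = d + degree q" using q by (simp add: degree_mult_eq degree_linear_power)
   then have "degree q = 0" using degP by simp
   then obtain b where b: "q = [:b:]" by (meson degree_eq_zeroE)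
   have cf: "coeff P i = b * (of_nat (d choose i) * (- l) ^ (d - i))" if "i <= d" for i
    using coeff_linear_poly_power[OF that, of "- l" 1] by (simp add: q b mult.commute)
   have bR: "b = R 0" using cf[of d] coeffP[of d] by simp
   have "coeff P (d - 1) = 0" using c(3)[of 0] c(2) d by (simp add: coeffP)
   then have "l = 0" using cf[of "d - 1"] d bR R(2) by auto
   then have "coeff P i0 = 0" using cf[of i0] i0(1) by simp
   then show False using i0 by (simp add: coeffP)
  qed
  have "EX K. polyhedral K (%i q. F i (fst q, fst q * (snd q + l)))" for l
  proof (rule resolvableD[OF IH[OF ord] Fl G eql])
   obtain q where q: "P = [:- l, 1:] ^ order l P * q" "~ [:- l, 1:] dvd q" using order_decomp[OF P0] by blast
   have "G l (0, y) = y ^ order l P * poly q (y + l)" for y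
    by (subst GP, subst q(1)) simp
   moreover have "poly q l ~= 0" using q(2) by (simp add: poly_eq_0_iff_dvd)
   ultimately show "y_regular (order l P) (G l)"
    unfolding y_regular_def
    by (intro exI[of _ "%y. poly q (y + l)"] exI[of _ 1]) (auto intro!: holomorphic_intros)
  qed
  moreover have "finite {l. G l 0 = 0}"
   using poly_roots_finite[OF P0] GP[of _ 0] by (simp add: zero_prod_def)
  ultimately show ?thesis by (intro exI[of _ "{l. G l 0 = 0}"]) auto
 qed
 then obtain Z where Z: "finite Z" "!!l. l ~: Z ==> G l 0 ~= 0" "ALL l:Z. EX K. polyhedral K (%i q. F i (fst q, fst q * (snd q + l)))"
  by auto
 from bchoice[OF Z(3)] obtain Kl where Kl: "!!l. l \<in> Z ==> polyhedral (Kl l) (%i q. F i (fst q, fst q * (snd q + l)))"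
  by auto
 \<comment> \<open>Slopes outside the finite set \<open>Z\<close> share the bound
   \<open>k + d\<close>; the sum covers the rest, so one \<open>K\<close> serves infinitely many
   charts.\<close>
 define K where "K = (k + d) + (\<Sum>l\<in>Z. Kl l)"
 have "polyhedral K F"
 proof (rule polyhedral_blowup[OF F])
  show "polyhedral K (%i q. F i (fst q, fst q * (snd q + l)))" for l
  proof (cases "l \<in> Z")
   case True
   have "Kl l <= K" using Z(1) True by (auto simp: K_def intro: member_le_sum trans_le_add2)
   then show ?thesis using Kl[OF True] polyhedral_mono by blast
  next
   case False
   have "k + d <= K" by (simp add: K_def)
   then show ?thesis using unit[OF Z(2)[OF False]] polyhedral_mono by blast
  qed
  have "max k (k + d) <= K" by (simp add: K_def)
  then show "polyhedral K (%i q. F i (fst q * snd q, snd q))" using pinf polyhedral_mono by blast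
 qed
 then show ?case by auto
qed

text \<open>After straightening a curve of maximal contact the term of degree d - 1 in y disappears.
  Either the other lower terms vanish too and the crossing is normal, or a ramified base change
  turns the smallest slope of the Newton polygon into an integer and the case of a single edge
  applies.\<close>

lemma resolvable_all: "resolvable d TYPE('n::finite)"
proof (induction d rule: less_induct)
 case (less d)
 show ?case
  unfolding resolvable_def
 proof (intro allI impI)
  fix F :: "'n => cfun" and k g
  assume F: "ALL i. hol2_at0 (F i)" and g: "hol2_at0 g"
   and eq: "\<forall>\<^sub>F p in nhds 0. (\<Prod>i\<in>UNIV. F i p) = fst p ^ k * g p" and "y_regular d g"
  then obtain v s where v: "s > 0" "v holomorphic_on ball 0 s" "v 0 ~= 0" "!!y. y \<in> ball 0 s ==> g (0, y) = y ^ d * v y"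
   unfolding y_regular_def by auto
  have F: "hol2_at0 (F i)" for i using F by simp
  show "EX K. polyhedral K F"
  proof (cases "d = 0")
   case True
   then have "g 0 ~= 0" using v(1,3) v(4)[of 0] by (simp add: zero_prod_def)
   then show ?thesis using polyhedral_fst_power[OF F g _ eq] by auto
  next
   case False
   then have d: "d >= 1" by simp
   obtain r0 where r0: "r0 > 0" "g hol2_on PD r0" using g hol2_at0_PD by blast
   have dg: "(deriv ^^ i) (%t. g (0, t)) 0 = (if i < d then 0 else fact d * v 0)" if "i <= d" for i
    using higher_deriv_expand[where R = v and r = s and u = "%t. g (0, t)" and n = d and c = "%_. 0"] v that by auto
   \<comment> \<open>maximal contact: a smooth curve along which \<open>\<partial>\<^sub>y\<^bsup>d-1\<^esup> g\<close> vanishes becomes the new x-axis\<close>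
   define D where "D = (pd2 ^^ (d - 1)) g"
   have D: "hol2_at0 D" using hol2_on_funpow_pd2[OF r0(2) open_PD] r0(1) by (auto simp: D_def hol2_at0_PD)
   have D0: "D 0 = 0" using dg[of "d - 1"] d by (simp add: D_def zero_prod_def funpow_pd2)
   have "pd2 D 0 = (pd2 ^^ Suc (d - 1)) g (0, 0)" by (simp add: D_def zero_prod_def)
   also have "\<dots> ~= 0" unfolding funpow_pd2 using dg[of d] d v(3) by simp
   finally obtain \<psi> r1 where \<psi>: "r1 > 0" "\<psi> holomorphic_on ball 0 r1" "\<psi> 0 = 0" "!!x. x \<in> ball 0 r1 ==> D (x, \<psi> x) = 0"
    by (rule implicit_function_hol2[OF D D0]) blast
   have hY: "hol2_at0 (%q. snd q + \<psi> (fst q))"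
    by (intro hol2_at0_add hol2_at0_snd hol2_at0_of_1[OF \<psi>(2,1)] hol2_at0_fst) simp
   define F1 where "F1 = (%i q. F i (fst q, snd q + \<psi> (fst q)))"
   define g1 where "g1 = (%q. g (fst q, snd q + \<psi> (fst q)))"
   have F1: "hol2_at0 (F1 i)" for i unfolding F1_def
    by (rule hol2_at0_compose[OF hol2_at0_fst _ hY _ F]) (simp_all add: \<psi>)
   have g1: "hol2_at0 g1" unfolding g1_def
    by (rule hol2_at0_compose[OF hol2_at0_fst _ hY _ g]) (simp_all add: \<psi>)
   have eq1: "\<forall>\<^sub>F q in nhds 0. (\<Prod>i\<in>UNIV. F1 i q) = fst q ^ k * g1 q"
    using eventually_compose_pair[OF eq hol2_at0_fst _ hY] \<psi>(3) by (simp add: F1_def g1_def)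
   have goal1: "EX K. polyhedral K F" if "EX K. polyhedral K F1"
   proof -
    from that obtain K where "polyhedral K F1" by auto
    then have "polyhedral K F" by (intro polyhedral_shear[where F = F, OF F \<psi>(2,1,3)]) (simp add: F1_def)
    then show ?thesis by auto
   qed
   obtain r2 where r2: "r2 > 0" "g1 hol2_on PD r2" using g1 hol2_at0_PD by blast
   obtain a R where a: "!!i. i < d ==> a i holomorphic_on ball 0 r2" and R: "R hol2_on PD r2"
    and gR: "!!x y. (x, y) \<in> PD r2 ==> g1 (x, y) = (\<Sum>i<d. a i x * y ^ i) + y ^ d * R (x, y)"
    by (rule hol2_expand_snd[OF r2(2), where d = d]) blast
   have Rs: "(%y. R (x, y)) holomorphic_on ball 0 r2" if "x \<in> ball 0 r2" for x
    by (rule holomorphic_on_subset[OF hol2_on_slice2[OF R open_PD]]) (use that in "auto simp: PD_def")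
   have ag: "(deriv ^^ i) (%t. g1 (x, t)) 0 = fact i * a i x" if "i < d" "x \<in> ball 0 r2" for i x
    by (rule higher_deriv_expand(1)[OF Rs[OF that(2)] r2(1) _ that(1)]) (use gR that(2) in "auto simp: PD_def")
   have Rg: "(deriv ^^ d) (%t. g1 (0, t)) 0 = fact d * R (0, 0)"
    by (rule higher_deriv_expand(2)[OF Rs r2(1)]) (use gR r2(1) in "auto simp: PD_def")
   have g10: "(%t. g1 (0, t)) = (%t. g (0, t))" by (simp add: g1_def \<psi>(3))
   have R0: "R 0 ~= 0" using Rg dg[of d] v(3) by (simp add: g10 zero_prod_def)
   \<comment> \<open>The restriction to x = 0 is unchanged by the shear and has order exactly
     \<open>d\<close>, so the lower coefficients vanish at 0.\<close>
   have a0: "a i 0 = 0" if "i < d" for i using ag[OF that, of 0] dg[of i] that r2(1) by (simp add: g10)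
   define r3 where "r3 = min r1 r2"
   have r3: "r3 > 0" "ball 0 r3 \<subseteq> ball (0::complex) r1" "ball 0 r3 \<subseteq> ball (0::complex) r2"
    using \<psi>(1) r2(1) by (auto simp: r3_def)
   \<comment> \<open>This coefficient is, up to a factorial, the derivative \<open>D\<close> along
     the curve y = \<psi>(x), where \<open>D\<close> vanishes by the choice of
     \<open>\<psi>\<close>.\<close>
   have ad: "a (d - 1) x = 0" if "x \<in> ball 0 r3" for x
   proof -
    have x: "x \<in> ball 0 r1" "x \<in> ball 0 r2" using that r3 by auto
    have "(deriv ^^ (d - 1)) (%t. g1 (x, t)) 0 = (deriv ^^ (d - 1)) (%t. g (x, t)) (\<psi> x)"
     by (subst (2) higher_deriv_shift_0) (simp add: g1_def o_def add.commute)
    also have "\<dots> = D (x, \<psi> x)" by (simp add: D_def funpow_pd2)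
    also have "\<dots> = 0" by (rule \<psi>(4)[OF x(1)])
    finally show ?thesis using ag[OF _ x(2), of "d - 1"] d by simp
   qed
   have Rat0: "hol2_at0 R" using R r2(1) hol2_at0_PD by blast
   have ev: "\<forall>\<^sub>F q in nhds 0. g1 q = (\<Sum>i<d. a i (fst q) * snd q ^ i) + snd q ^ d * R q"
    unfolding eventually_nhds_0_PD using gR r2(1) by (intro exI[of _ r2]) auto
   show ?thesis
   proof (cases "ALL i<d. ALL x:ball 0 r3. a i x = 0")
    case True
    have "\<forall>\<^sub>F q in nhds 0. (\<Prod>i\<in>UNIV. F1 i q) = fst q ^ k * snd q ^ d * R q"
    proof -
     have "\<forall>\<^sub>F q in nhds 0. q \<in> PD r3" using r3(1) by (intro eventually_nhds_in_open) auto
     with ev eq1 show ?thesis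
     proof eventually_elim
      case (elim q)
      then have "(\<Sum>i<d. a i (fst q) * snd q ^ i) = 0" using True by (intro sum.neutral) (auto simp: PD_def mem_Times_iff)
      then show ?case using elim by simp
     qed
    qed
    from polyhedral_normal_crossing[OF F1 Rat0 R0 this] show ?thesis using goal1 by auto
   next
    case False
    define I where "I = {i. i < d & (EX x:ball 0 r3. a i x ~= 0)}"
    have I: "finite I" "I ~= {}" using False by (auto simp: I_def)
    have "ALL i:I. EX n v s. s > 0 & v holomorphic_on ball 0 s & v 0 ~= 0 & (ALL w:ball 0 s. a i w = w ^ n * v w)"
    proof
     fix i assume "i \<in> I"
     then obtain x where x: "i < d" "x \<in> ball 0 r3" "a i x ~= 0" by (auto simp: I_def)
     have ha: "a i holomorphic_on ball 0 r3" using a[OF x(1)] r3(3) by (rule holomorphic_on_subset)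
     obtain n v s where "s > 0" "v holomorphic_on ball 0 s" "!!w. w \<in> ball 0 s ==> a i w = w ^ n * v w"
      "!!w. w \<in> ball 0 s ==> v w ~= 0"
      by (rule holomorphic_order_0[OF ha x(2,3)]) blast
     then show "EX n v s. s > 0 & v holomorphic_on ball 0 s & v 0 ~= 0 & (ALL w:ball 0 s. a i w = w ^ n * v w)"
      by (intro exI[of _ n] exI[of _ v] exI[of _ s]) auto
    qed
    then obtain n v s where nvs: "!!i. i \<in> I ==> s i > 0" "!!i. i \<in> I ==> v i holomorphic_on ball 0 (s i)"
      "!!i. i \<in> I ==> v i 0 ~= 0" "!!i w. i \<in> I ==> w \<in> ball 0 (s i) ==> a i w = w ^ n i * v i w"
     by metis
    have n1: "n i >= 1" if "i \<in> I" for i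
    proof (rule ccontr)
     assume "~ n i >= 1"
     then have "n i = 0" by simp
     then have "a i 0 = v i 0" using nvs(4)[OF that, of 0] nvs(1)[OF that] by simp
     then show False using a0[of i] nvs(3)[OF that] that by (auto simp: I_def)
    qed
    \<comment> \<open>after the base change \<open>x = w\<^bsup>E\<^esup>\<close> the slopes of the Newton polygon are integers\<close>
    define E :: nat where "E = fact d"
    have E: "E >= 1" by (simp add: E_def)
    define P where "P = (%i. E * n i div (d - i))"
    have P: "E * n i = (d - i) * P i" "P i >= 1" if "i \<in> I" for i
    proof -
     have "i < d" using that by (auto simp: I_def)
     then have "d - i dvd E" unfolding E_def by (intro dvd_fact) auto
     then show *: "E * n i = (d - i) * P i" by (simp add: P_def dvd_mult2)
     have "E * n i >= 1" using E n1[OF that] by simp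
     then show "P i >= 1" using * by (cases "P i") auto
    qed
    \<comment> \<open>The smallest slope: the power w^(p(d-i)) can be taken out of every
      coefficient, and it is attained at \<open>i0\<close>, so the rescaled coefficient
      \<open>c i0\<close> does not vanish at 0.\<close>
    define p where "p = Min (P ` I)"
    have p: "p >= 1" "!!i. i \<in> I ==> p <= P i" using I P(2) by (auto simp: p_def)
    have "p \<in> P ` I" unfolding p_def by (rule Min_in) (use I in auto)
    then obtain i0 where i0: "i0 \<in> I" "p = P i0" by auto
    \<comment> \<open>The bound 1 ensures |w^E| <= |w|, so that the base change maps the disc into
      itself.\<close>
    define s0 where "s0 = min 1 (min r3 (Min (s ` I)))"
    have s0: "s0 > 0" "s0 <= 1" "s0 <= r3" "!!i. i \<in> I ==> s0 <= s i" using r3(1) nvs(1) I by (auto simp: s0_def min_le_iff_disj)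
    have small: "w ^ E \<in> ball 0 s0" if "w \<in> ball 0 s0" for w :: complex
    proof -
     have "cmod w ^ E <= cmod w ^ 1" using that s0 E by (intro power_decreasing) auto
     then show ?thesis using that by (simp add: norm_power)
    qed
    define c where "c = (%i w. if i \<in> I then w ^ ((d - i) * (P i - p)) * v i (w ^ E) else 0)"
    have ac: "a i (w ^ E) = w ^ (p * (d - i)) * c i w" if "i < d" "w \<in> ball 0 s0" for i w
    proof (cases "i \<in> I")
     case True
     have "w ^ E \<in> ball 0 (s i)" using small[OF that(2)] s0(4)[OF True] by auto
     then have "a i (w ^ E) = w ^ (E * n i) * v i (w ^ E)" using nvs(4)[OF True] by (simp add: power_mult)
     moreover have "E * n i = p * (d - i) + (d - i) * (P i - p)"
      using P(1)[OF True] p(2)[OF True] by (metis add_mult_distrib2 le_add_diff_inverse mult.commute)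
     ultimately show ?thesis using True by (simp add: c_def power_add)
    next
     case False
     then have "a i (w ^ E) = 0" using small[OF that(2)] s0(3) that(1) by (auto simp: I_def)
     then show ?thesis using False by (simp add: c_def)
    qed
    define F2 where "F2 = (%i q. F1 i (fst q ^ E, snd q))"
    have XE: "hol2_at0 (%q. fst q ^ E)" "(%q :: complex \<times> complex. fst q ^ E) 0 = 0" using E by (auto intro!: hol2_at0_intros)
    have F2: "hol2_at0 (F2 i)" for i unfolding F2_def
     by (rule hol2_at0_compose[OF XE hol2_at0_snd _ F1]) simp
    have "EX K. polyhedral K F2"
    proof (rule resolvable_newton[OF less.IH d p(1) F2, where c = c and r = s0 and ?i0.0 = i0 and k = "E * k" and R = "%q. R (fst q ^ E, snd q)"])
     show "c i holomorphic_on ball 0 s0" if "i < d" for i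
     proof (cases "i \<in> I")
      case True
      have "ball 0 s0 \<subseteq> ball (0::complex) (s i)" using s0(4)[OF True] by auto
      then have sub: "(%w. w ^ E) ` ball (0::complex) s0 \<subseteq> ball 0 (s i)" using small by blast
      have "(v i \<circ> (%w. w ^ E)) holomorphic_on ball 0 s0"
       by (rule holomorphic_on_compose_gen[OF _ nvs(2)[OF True] sub]) (intro holomorphic_intros)
      then have "(%w. w ^ ((d - i) * (P i - p)) * v i (w ^ E)) holomorphic_on ball 0 s0"
       by (intro holomorphic_intros) (simp add: o_def)
      then show ?thesis using True by (simp add: c_def[abs_def])
     qed (simp add: c_def[abs_def])
     have "d - 1 ~: I" using ad by (auto simp: I_def)
     then show "c (d - 1) z = 0" for z by (simp add: c_def)
     show "i0 < d" using i0(1) by (simp add: I_def)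
     show "c i0 0 ~= 0" using i0 nvs(3)[OF i0(1)] E by (simp add: c_def power_0_left)
     show "hol2_at0 (%q. R (fst q ^ E, snd q))" by (rule hol2_at0_compose[OF XE hol2_at0_snd _ Rat0]) simp
     show "R (fst (0 :: complex \<times> complex) ^ E, snd (0 :: complex \<times> complex)) ~= 0" using R0 E by (simp add: zero_prod_def power_0_left)
     have "\<forall>\<^sub>F q in nhds 0. (\<Prod>i\<in>UNIV. F1 i q) = fst q ^ k * ((\<Sum>i<d. a i (fst q) * snd q ^ i) + snd q ^ d * R q)"
      using ev eq1 by eventually_elim simp
     from eventually_compose_pair[OF this XE hol2_at0_snd]
     have 1: "\<forall>\<^sub>F q in nhds 0. (\<Prod>i\<in>UNIV. F2 i q) = (fst q ^ E) ^ k * ((\<Sum>i<d. a i (fst q ^ E) * snd q ^ i) + snd q ^ d * R (fst q ^ E, snd q))"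
      by (simp add: F2_def)
     have 2: "\<forall>\<^sub>F q in nhds 0. q \<in> PD s0" using s0(1) by (intro eventually_nhds_in_open) auto
     from 1 2 show "\<forall>\<^sub>F q in nhds 0. (\<Prod>i\<in>UNIV. F2 i q) =
      fst q ^ (E * k) * ((\<Sum>i<d. fst q ^ (p * (d - i)) * c i (fst q) * snd q ^ i) + snd q ^ d * R (fst q ^ E, snd q))"
     proof eventually_elim
      case (elim q)
      have "(\<Sum>i<d. a i (fst q ^ E) * snd q ^ i) = (\<Sum>i<d. fst q ^ (p * (d - i)) * c i (fst q) * snd q ^ i)"
       by (rule sum.cong) (use ac elim(2) in "auto simp: PD_def mem_Times_iff")
      then show ?case using elim(1) by (simp add: power_mult)
     qed
    qed (use s0 in auto)
    then obtain K where "polyhedral K F2" by auto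
    then have "polyhedral K F1" by (intro polyhedral_ramify[where F = F1, OF F1 E]) (simp add: F2_def)
    then show ?thesis using goal1 by auto
   qed
  qed
 qed
qed

text \<open>Only powers of x are taken out of the product. Powers of y may remain in
  \<open>g\<close>, which just has to be nonzero somewhere on x = 0 to be regular of some order
  there.\<close>

theorem polyhedral_exists:
 fixes F :: "'n::finite => cfun"
 assumes F: "!!i. hol2_at0 (F i)" and nz: "!!i. ~ (\<forall>\<^sub>F p in nhds 0. F i p = 0)"
 shows "EX K. polyhedral K F"
proof -
 have "ALL i. EX a b h r. r > 0 & h hol2_on PD r & (ALL p:PD r. F i p = fst p ^ a * snd p ^ b * h p) &
  (ALL z:ball 0 r - {0}. h (0, z) ~= 0)"
 proof
  fix i
  show "EX a b h r. r > 0 & h hol2_on PD r & (ALL p:PD r. F i p = fst p ^ a * snd p ^ b * h p) &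
  (ALL z:ball 0 r - {0}. h (0, z) ~= 0)"
   by (rule hol2_monomial_factor[OF F nz, of i]) blast
 qed
 then obtain \<alpha> \<beta> H \<rho> where H: "!!i. \<rho> i > 0" "!!i. H i hol2_on PD (\<rho> i)"
  "!!i p. p \<in> PD (\<rho> i) ==> F i p = fst p ^ \<alpha> i * snd p ^ \<beta> i * H i p"
  "!!i z. z \<in> ball 0 (\<rho> i) - {0} ==> H i (0, z) ~= 0"
  by metis
 define r where "r = Min (range \<rho>)"
 have r: "r > 0" "!!i. r <= \<rho> i" using H(1) by (auto simp: r_def)
 define g where "g = (%p. \<Prod>i\<in>UNIV. snd p ^ \<beta> i * H i p)"
 have g: "g hol2_on PD r" unfolding g_def
  by (intro hol2_on_prod hol2_on_mult hol2_on_power hol2_on_snd hol2_on_subset[OF H(2)] PD_mono r)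
 have eq: "(\<Prod>i\<in>UNIV. F i p) = fst p ^ (\<Sum>i\<in>UNIV. \<alpha> i) * g p" if "p \<in> PD r" for p
 proof -
  have "(\<Prod>i\<in>UNIV. F i p) = (\<Prod>i\<in>UNIV. fst p ^ \<alpha> i * (snd p ^ \<beta> i * H i p))"
  proof (intro prod.cong refl)
   fix i
   have "p \<in> PD (\<rho> i)" using that PD_mono[OF r(2)[of i]] by blast
   from H(3)[OF this] show "F i p = fst p ^ \<alpha> i * (snd p ^ \<beta> i * H i p)" by simp
  qed
  then show ?thesis by (simp add: prod.distrib power_sum g_def)
 qed
 define z where "z = complex_of_real (r / 2)"
 have z: "z \<in> ball 0 r" "z ~= 0" using r(1) by (auto simp: z_def)
 have gz: "g (0, z) ~= 0" using H(4)[of z] z r(2) by (auto simp: g_def intro: less_le_trans)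
 have hg: "(%y. g (0, y)) holomorphic_on ball 0 r"
  by (rule holomorphic_on_subset[OF hol2_on_slice2[OF g open_PD]]) (use r in "auto simp: PD_def")
 obtain n v s where v: "s > 0" "v holomorphic_on ball 0 s" "!!w. w \<in> ball 0 s ==> g (0, w) = w ^ n * v w"
  "!!w. w \<in> ball 0 s ==> v w ~= 0"
  by (rule holomorphic_order_0[OF hg z(1) gz]) blast
 show ?thesis
 proof (rule resolvableD[OF resolvable_all F])
  show "hol2_at0 g" using g r(1) hol2_at0_PD by blast
  show "\<forall>\<^sub>F p in nhds 0. (\<Prod>i\<in>UNIV. F i p) = fst p ^ (\<Sum>i\<in>UNIV. \<alpha> i) * g p"
   unfolding eventually_nhds_0_PD using eq r(1) by blast
  show "y_regular n g" unfolding y_regular_def using v by (intro exI[of _ v] exI[of _ s]) auto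
 qed
qed

section \<open>Forms on resolutions\<close>

lemma germ_at0_eq: "germ_at0 f = rep_germ f 0"
 by (simp add: germ_at0_def)

lemma hol2_at0_rep_germ: "hol2_at0 (rep_germ f)"
 using germ_rel_rep_germ by (auto simp: germ_rel_def)

lemma rep_germ_nonzero:
 assumes "f ~= 0" shows "~ (\<forall>\<^sub>F p in nhds 0. rep_germ f p = 0)"
proof
 assume "\<forall>\<^sub>F p in nhds 0. rep_germ f p = 0"
 then have "germ_rel (rep_germ f) (%p. 0)"
  using hol2_at0_rep_germ by (simp add: germ_rel_def hol2_at0_const)
 then have "abs_germ (rep_germ f) = abs_germ (%p. 0)"
  using Quotient_germ by (metis Quotient_rel)
 then have "f = 0" using Quotient_abs_rep[OF Quotient_germ] by (simp add: zero_germ_def)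
 then show False using assms by simp
qed

text \<open>The exponent to which |f_i|^2 enters the squared modulus of the form: for z^m = f one
  has |z^(j-(m-1))|^2 = |f|^(2((j+1)/m - 1)).\<close>

definition expo :: "('n::finite => nat) => ('n => nat) => 'n => real"
 where "expo j m i = (real (j i) + 1) / real (m i) - 1"

lemma open_fst_image: "open (N :: ((complex \<times> complex) \<times> 'b::real_normed_vector) set) ==> open (fst ` N)"
 by (rule open_image_fst)

locale chart =
 fixes F :: "'n::finite => cfun" and m :: "'n => nat"
  and V :: "'n ambient set" and X :: "'a topology" and At :: "'a atlas" and \<rho> :: "'a => 'n ambient"
  and Q :: "'a set" and \<kappa> :: "'a => complex \<times> complex"
 assumes res: "resolution V X At \<rho>" and V: "!!w i. w \<in> V ==> snd w $ i ^ m i = F i (fst w)"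
  and At: "(Q, \<kappa>) \<in> At" and m: "!!i. m i >= 1"
begin

abbreviation "D \<equiv> \<kappa> ` Q"
abbreviation "x q \<equiv> fst (fst (\<rho> (inv_into Q \<kappa> q)))"
abbreviation "y q \<equiv> snd (fst (\<rho> (inv_into Q \<kappa> q)))"
abbreviation "z i q \<equiv> snd (\<rho> (inv_into Q \<kappa> q)) $ i"

lemma surf: "complex_surface X At" using res by (simp add: resolution_def)

lemma Q_open: "openin X Q" and D_open: "open D"
 and homeo: "homeomorphic_map (subtopology X Q) (top_of_set D) \<kappa>"
 using surf At by (auto simp: complex_surface_def)

lemma Q_sub: "Q \<subseteq> topspace X" using Q_open openin_subset by auto

lemma inj: "inj_on \<kappa> Q"
 using homeomorphic_imp_injective_map[OF homeo] Q_sub by (simp add: Int_absorb1)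

lemma inv1: "p \<in> Q ==> inv_into Q \<kappa> (\<kappa> p) = p" using inj by simp

lemma inv2: "q \<in> D ==> inv_into Q \<kappa> q \<in> Q & \<kappa> (inv_into Q \<kappa> q) = q"
 by (simp add: inv_into_into f_inv_into_f)

lemma rho_V: "q \<in> D ==> \<rho> (inv_into Q \<kappa> q) \<in> V"
 using res inv2 Q_sub unfolding resolution_def by blast

lemma z_power: "q \<in> D ==> z i q ^ m i = F i (x q, y q)"
 using V[OF rho_V] by simp

lemma hol: "(%q. x q) hol2_on D" "(%q. y q) hol2_on D" "(%q. z i q) hol2_on D"
 using res At by (auto simp: resolution_def hol2_ambient_on_def)

lemma openin_chart_preimage: "open B ==> openin X {p \<in> Q. \<kappa> p \<in> B}"
proof -
 assume B: "open B"
 have "openin (top_of_set D) (D Int B)" using B by (simp add: openin_open_Int)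
 then have "openin (subtopology X Q) {p \<in> topspace (subtopology X Q). \<kappa> p \<in> D Int B}"
  by (rule openin_continuous_map_preimage[OF homeomorphic_imp_continuous_map[OF homeo]])
 moreover have "{p \<in> topspace (subtopology X Q). \<kappa> p \<in> D Int B} = {p \<in> Q. \<kappa> p \<in> B}"
  using Q_sub by auto
 ultimately show ?thesis using openin_trans_full Q_open by metis
qed

text \<open>The bridge between weights and forms: the weight times the squared Jacobian is the
  squared modulus of the coefficient of the pulled back form. Points with some
  \<open>z i q = 0\<close> are excluded, since \<open>0 powr x = 0\<close> need not agree with the
  powers of z there.\<close>

lemma wt_chart:
 assumes q: "q \<in> D" "!!i. z i q ~= 0"
 shows "wt \<phi> F (expo j m) (x q, y q) * (cmod (jac (%q. x q) (%q. y q) q))^2 =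
  (cmod (\<phi> (x q, y q) * (\<Prod>i\<in>UNIV. z i q ^ j i) / (\<Prod>i\<in>UNIV. z i q ^ (m i - 1)) * jac (%q. x q) (%q. y q) q))^2"
proof -
 have "cmod (F i (x q, y q)) powr (2 * expo j m i) = (cmod (z i q ^ j i / z i q ^ (m i - 1)))^2" for i
 proof -
  have z: "cmod (z i q) > 0" using q by simp
  have mm: "real (m i) > 0" using m[of i] by simp
  have "cmod (F i (x q, y q)) = cmod (z i q) powr real (m i)"
   using z_power[OF q(1), of i] z by (simp add: norm_power[symmetric] powr_realpow)
  then have "cmod (F i (x q, y q)) powr (2 * expo j m i) = cmod (z i q) powr (real (m i) * (2 * expo j m i))"
   by (simp add: powr_powr)
  also have "real (m i) * (2 * expo j m i) = 2 * (real (j i) - real (m i - 1))"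
   using mm m[of i] by (simp add: expo_def field_simps of_nat_diff)
  also have "cmod (z i q) powr (2 * (real (j i) - real (m i - 1))) = (cmod (z i q) powr (real (j i)) / cmod (z i q) powr real (m i - 1))^2"
   using z by (simp add: powr_diff[symmetric] power2_eq_square powr_add[symmetric])
  also have "\<dots> = (cmod (z i q ^ j i / z i q ^ (m i - 1)))^2"
   using z by (simp add: powr_realpow norm_divide norm_power)
  finally show ?thesis .
 qed
 then have "wt \<phi> F (expo j m) (x q, y q) = (cmod (\<phi> (x q, y q)))^2 * (\<Prod>i\<in>UNIV. (cmod (z i q ^ j i / z i q ^ (m i - 1)))^2)"
  by (simp add: wt_def)
 also have "(\<Prod>i\<in>UNIV. (cmod (z i q ^ j i / z i q ^ (m i - 1)))^2) = (cmod ((\<Prod>i\<in>UNIV. z i q ^ j i) / (\<Prod>i\<in>UNIV. z i q ^ (m i - 1))))^2"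
  by (simp only: prod_dividef[symmetric] prod_norm[symmetric] prod_power_distrib)
 finally show ?thesis by (simp add: norm_mult norm_divide power_mult_distrib power_divide)
qed

lemma open_nonzero: "open B ==> B \<subseteq> D ==> open {q \<in> B. ALL i. z i q ~= 0}"
proof -
 assume B: "open B" "B \<subseteq> D"
 have "{q \<in> B. ALL i. z i q ~= 0} = (\<Inter>i. B Int (%q. z i q) -` (- {0}))" by auto
 moreover have "open (\<Inter>i. B Int (%q. z i q) -` (- {0}))"
  using B by (intro open_INT continuous_open_preimage ballI continuous_on_subset[OF hol2_on_continuous[OF hol(3)]]) auto
 ultimately show ?thesis by simp
qed

end

lemma absolutely_integrable_cont_ball:
 fixes h :: "complex \<times> complex => real"
 assumes h: "continuous_on (cball c e) h" and S: "open S" "S \<subseteq> ball c e"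
 shows "h L1_on S"
proof -
 have "bounded (h ` cball c e)" by (intro compact_imp_bounded compact_continuous_image h compact_cball)
 then obtain M where M: "ALL p:cball c e. norm (h p) <= M" unfolding bounded_iff by blast
 have S': "S \<in> lmeasurable" using S bounded_subset[OF bounded_ball S(2)] by (intro lmeasurable_open)
 have M': "(%_. M) L1_on S"
  using S' by (simp add: absolutely_integrable_on_const)
 show ?thesis
 proof (rule dominated_absolutely_integrable[OF _ S(1) M' negligible_empty])
  show "h \<in> borel_measurable (lebesgue_on S)"
   by (rule continuous_imp_measurable_on_sets_lebesgue)
    (rule continuous_on_subset[OF h], use S ball_subset_cball[of c e] in auto)
 qed (use M S(2) ball_subset_cball[of c e] in auto)
qed

text \<open>The cover is finite over the base, and its roots tend to zero at the origin because
  \<open>F i 0 = 0\<close>. So over a small closed ball the whole preimage stays inside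
  \<open>N\<close>, and it is closed and bounded.\<close>

lemma roots_in_neighbourhood:
 fixes F :: "'n::finite => cfun" and N :: "'n ambient set" and T :: "(complex \<times> complex) set"
 assumes N: "open N" "0 \<in> N" and F: "!!i. F i hol2_on fst ` N" "!!i. F i 0 = 0" and m: "!!i. m i >= 1"
  and T: "open T" "0 \<in> T"
 obtains \<delta> where "\<delta> > 0" "cball 0 \<delta> \<subseteq> fst ` N" "cball 0 \<delta> \<subseteq> T"
  "!!p w. p \<in> cball 0 \<delta> ==> (!!i. w $ i ^ m i = F i p) ==> (p, w) \<in> N"
  "compact {v. fst v \<in> cball 0 \<delta> & (ALL i. snd v $ i ^ m i = F i (fst v))}"
proof -
 obtain A B where AB: "open A" "open B" "(0, 0) \<in> A \<times> B" "A \<times> B \<subseteq> N"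
  by (rule open_prod_elim[OF N(1), of "(0, 0)"]) (use N(2) in "auto simp: zero_prod_def")
 obtain e where e: "e > 0" "ball 0 e \<subseteq> B" using AB(2,3) by (auto elim: openE)
 \<comment> \<open>Coordinates of size \<open>eps\<close> give a vector of norm below
   \<open>e\<close>, because the norm is at most the sum of the moduli.\<close>
 define eps where "eps = e / (real CARD('n) + 1)"
 have eps: "eps > 0" using e by (simp add: eps_def add_pos_pos)
 have w_small: "norm w < e" if "!!i. cmod (w $ i) <= eps" for w :: "complex ^ 'n"
 proof -
  have "norm w <= (\<Sum>i\<in>UNIV. cmod (w $ i))" unfolding norm_vec_def by (rule L2_set_le_sum) simp
  also have "\<dots> <= (\<Sum>i\<in>(UNIV :: 'n set). eps)" by (intro sum_mono that)
  also have "\<dots> = real CARD('n) * eps" by simp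
  also have "\<dots> < (real CARD('n) + 1) * eps" using eps by simp
  also have "\<dots> = e" by (simp add: eps_def add_pos_pos[THEN less_imp_neq, symmetric])
  finally show ?thesis .
 qed
 have zN: "0 \<in> fst ` N" using N(2) by (force simp: zero_prod_def)
 have oN: "open (fst ` N)" using N(1) by (rule open_fst_image)
 have "isCont (F i) 0" for i
  using hol2_on_continuous[OF F(1)] continuous_on_eq_continuous_at[OF oN] zN by blast
 then have "\<forall>\<^sub>F p in nhds 0. cmod (F i p) < eps ^ m i" for i
 proof -
  assume "!!i. isCont (F i) 0"
  then have "(F i \<longlongrightarrow> 0) (nhds 0)" using F(2) by (metis isCont_def tendsto_at_iff_tendsto_nhds)
  then have "((%p. cmod (F i p)) \<longlongrightarrow> 0) (nhds 0)" by (rule tendsto_norm_zero)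
  then show ?thesis using eps by (intro order_tendstoD(2)) auto
 qed
 then have "\<forall>\<^sub>F p in nhds 0. ALL i. cmod (F i p) < eps ^ m i" by (intro eventually_all_finite) auto
 moreover have "\<forall>\<^sub>F p in nhds 0. p \<in> A Int fst ` N Int T" using AB T oN zN
  by (intro eventually_nhds_in_open open_Int) (auto simp: zero_prod_def)
 ultimately have "\<forall>\<^sub>F p in nhds 0. (ALL i. cmod (F i p) < eps ^ m i) & p \<in> A Int fst ` N Int T" by (rule eventually_conj)
 then obtain U where U: "open U" "0 \<in> U" "!!p. p \<in> U ==> (ALL i. cmod (F i p) < eps ^ m i) & p \<in> A Int fst ` N Int T"
  unfolding eventually_nhds by auto
 obtain \<delta> where \<delta>: "\<delta> > 0" "cball 0 \<delta> \<subseteq> U" using open_contains_cball_eq[OF U(1)] U(2) by blast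
 have small: "cmod (w $ i) <= eps" if "p \<in> cball 0 \<delta>" "!!i. w $ i ^ m i = F i p" for p and w :: "complex ^ 'n" and i
 proof -
  have "cmod (F i p) < eps ^ m i" using U(3) that(1) \<delta>(2) by blast
  then have "cmod (w $ i) ^ m i < eps ^ m i" using that(2)[of i] by (metis norm_power)
  then show ?thesis using eps by (intro less_imp_le) (auto intro: power_less_imp_less_base)
 qed
 show thesis
 proof (rule that[OF \<delta>(1)])
  show "cball 0 \<delta> \<subseteq> fst ` N" "cball 0 \<delta> \<subseteq> T" using U(3) \<delta>(2) by blast+
  show "(p, w) \<in> N" if "p \<in> cball 0 \<delta>" "!!i. w $ i ^ m i = F i p" for p and w :: "complex ^ 'n"
  proof -
   have "w \<in> B" using w_small[OF small[OF that]] e(2) by auto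
   moreover have "p \<in> A" using U(3) that(1) \<delta>(2) by blast
   ultimately show ?thesis using AB(4) by blast
  qed
  let ?C = "cball (0 :: complex \<times> complex) \<delta> \<times> cball (0 :: complex ^ 'n) e"
  have eq: "{v. fst v \<in> cball 0 \<delta> & (ALL i. snd v $ i ^ m i = F i (fst v))} =
   ?C Int (\<Inter>i. {v \<in> ?C. snd v $ i ^ m i - F i (fst v) = 0})"
  proof (intro set_eqI iffI)
   fix v assume v: "v \<in> {v. fst v \<in> cball 0 \<delta> & (ALL i. snd v $ i ^ m i = F i (fst v))}"
   then have "norm (snd v) < e" by (intro w_small small[of "fst v"]) auto
   then show "v \<in> ?C Int (\<Inter>i. {v \<in> ?C. snd v $ i ^ m i - F i (fst v) = 0})" using v by (auto simp: mem_Times_iff)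
  qed auto
  have cF: "continuous_on ?C (%v. F i (fst v))" for i
   by (rule continuous_on_compose2[OF hol2_on_continuous[OF F(1)]])
    (use U(3) \<delta>(2) in "auto intro!: continuous_intros")
  have "closed (\<Inter>i. {v \<in> ?C. snd v $ i ^ m i - F i (fst v) = 0})"
   by (intro closed_INT ballI continuous_closed_preimage_constant closed_Times closed_cball continuous_intros cF)
  moreover have "compact ?C" by (intro compact_Times compact_cball)
  ultimately show "compact {v. fst v \<in> cball 0 \<delta> & (ALL i. snd v $ i ^ m i = F i (fst v))}"
   unfolding eq by (rule compact_Int_closed[rotated])
 qed
qed

text \<open>In a chart the coefficient of the form is bounded near each point, so the weight is
  integrable on the image of a small ball. Properness of the resolution makes the preimage of a
  compact neighbourhood of the fibre compact; finitely many such images cover every base point at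
  which no \<open>f i\<close> vanishes.\<close>

theorem quasiadj_imp_lint:
 fixes f :: "'n::finite => germ"
 assumes \<phi>: "\<phi> \<in> quasiadj_ideal f j m" and f0: "!!i. germ_at0 (f i) = 0" and m: "!!i. m i >= 1"
 shows "lint (wt (rep_germ \<phi>) (%i. rep_germ (f i)) (expo j m))"
proof -
 let ?F = "%i. rep_germ (f i)"
 let ?w = "wt (rep_germ \<phi>) ?F (expo j m)"
 obtain N and X :: "real topology" and At \<rho> where N: "open N" "0 \<in> N" "rep_germ \<phi> hol2_on fst ` N" "!!i. ?F i hol2_on fst ` N"
  and res: "resolution (cover_surface f m N) X At \<rho>" and ext: "form_extends \<phi> j m At \<rho>"
  using \<phi> unfolding quasiadj_ideal_def by auto
 define V where "V = cover_surface f m N"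
 have F0: "?F i 0 = 0" for i using f0[of i] by (simp add: germ_at0_eq)
 obtain \<delta> where \<delta>: "\<delta> > 0" "cball 0 \<delta> \<subseteq> fst ` N"
  "!!p w. p \<in> cball 0 \<delta> ==> (!!i. w $ i ^ m i = ?F i p) ==> (p, w) \<in> N"
  "compact {v. fst v \<in> cball 0 \<delta> & (ALL i. snd v $ i ^ m i = ?F i (fst v))}"
  by (rule roots_in_neighbourhood[where F = ?F and m = m, OF N(1,2,4) F0 m open_UNIV UNIV_I]) blast
 define VK where "VK = {v. fst v \<in> cball 0 \<delta> & (ALL i. snd v $ i ^ m i = ?F i (fst v))}"
 have VKV: "VK \<subseteq> V" using \<delta>(3) by (auto simp: VK_def V_def cover_surface_def)
 define S where "S = {p \<in> topspace X. \<rho> p \<in> VK}"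
 have "compactin X S" unfolding S_def
  by (rule compactin_proper_map_preimage[where Y = "top_of_set V"])
   (use res \<delta>(4) VKV in "auto simp: resolution_def V_def VK_def compactin_subtopology")
 then have compact: "EX \<F>. finite \<F> & \<F> \<subseteq> \<U> & S \<subseteq> \<Union>\<F>" if "ALL U:\<U>. openin X U" "S \<subseteq> \<Union>\<U>" for \<U>
  using that unfolding compactin_def by auto
 \<comment> \<open>The base points of \<open>G\<close> need only lie in some measurable set on which
   the weight is integrable; this avoids asking whether the image of \<open>G\<close> itself is
   measurable. Points with some vanishing z are left out.\<close>
 define good where "good = (%G. EX T:sets lebesgue. ?w L1_on T &
  (ALL p:G. (ALL i. snd (\<rho> p) $ i ~= 0) --> fst (\<rho> p) \<in> T))"
 have cov: "EX G. openin X G & p \<in> G & good G" if p: "p \<in> S" for p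
 proof -
  have "p \<in> topspace X" using p by (simp add: S_def)
  moreover have "(\<Union>(Q, \<kappa>)\<in>At. Q) = topspace X" using res by (simp add: resolution_def complex_surface_def)
  ultimately obtain c where "c \<in> At" "p \<in> (case c of (Q, \<kappa>) => Q)" by blast
  then obtain Q \<kappa> where Q: "(Q, \<kappa>) \<in> At" "p \<in> Q" by (cases c) auto
  interpret chart ?F m V X At \<rho> Q \<kappa>
   by unfold_locales (use res Q m in "auto simp: V_def cover_surface_def")
  obtain g where g: "g hol2_on D" "!!q. q \<in> D ==> (!!i. z i q ~= 0) ==>
    g q = rep_germ \<phi> (x q, y q) * (\<Prod>i\<in>UNIV. z i q ^ j i) / (\<Prod>i\<in>UNIV. z i q ^ (m i - 1)) * jac (%q. x q) (%q. y q) q"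
   using ext Q(1) unfolding form_extends_def Let_def by fastforce
  obtain e where e: "e > 0" "cball (\<kappa> p) e \<subseteq> D" using open_contains_cball_eq[OF D_open] Q(2) by blast
  define B where "B = {q \<in> ball (\<kappa> p) e. ALL i. z i q ~= 0}"
  have BD: "B \<subseteq> D" using e(2) ball_subset_cball[of "\<kappa> p" e] by (auto simp: B_def)
  have Bo: "open B" unfolding B_def
   by (rule open_nonzero) (use e(2) ball_subset_cball[of "\<kappa> p" e] in auto)
  have "continuous_on (cball (\<kappa> p) e) (%q. (cmod (g q))^2)"
   by (intro continuous_intros continuous_on_subset[OF hol2_on_continuous[OF g(1)] e(2)])
  then have "(%q. (cmod (g q))^2) L1_on B"
   by (rule absolutely_integrable_cont_ball[OF _ Bo]) (auto simp: B_def)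
  then have "(%q. ?w (x q, y q) * (cmod (jac (%q. x q) (%q. y q) q))^2) L1_on B"
  proof (rule absolutely_integrable_cong)
   fix q assume q: "q \<in> B"
   then have "q \<in> D" "!!i. z i q ~= 0" using BD by (auto simp: B_def)
   then show "(cmod (g q))^2 = ?w (x q, y q) * (cmod (jac (%q. x q) (%q. y q) q))^2"
    using wt_chart[of q "rep_germ \<phi>" j] g(2)[of q] by simp
  qed
  then have "?w L1_on (%q. (x q, y q)) ` B"
   by (rule absolutely_integrable_image[OF hol(1,2) BD])
  moreover have "(%q. (x q, y q)) ` B \<in> sets lebesgue"
   by (rule image_sets_lebesgue[OF hol(1,2) BD]) (use Bo in auto)
  moreover have "fst (\<rho> p') \<in> (%q. (x q, y q)) ` B"
   if "p' \<in> {p' \<in> Q. \<kappa> p' \<in> ball (\<kappa> p) e}" "ALL i. snd (\<rho> p') $ i ~= 0" for p'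
   by (rule image_eqI[of _ _ "\<kappa> p'"]) (use that inv1 in "auto simp: B_def")
  ultimately have "good {p' \<in> Q. \<kappa> p' \<in> ball (\<kappa> p) e}" unfolding good_def by blast
  then show ?thesis using openin_chart_preimage[of "ball (\<kappa> p) e"] Q(2) e(1) by (intro exI[of _ "{p' \<in> Q. \<kappa> p' \<in> ball (\<kappa> p) e}"]) auto
 qed
 obtain \<F> where \<F>: "finite \<F>" "\<F> \<subseteq> {G. openin X G & good G}" "S \<subseteq> \<Union>\<F>"
  using compact[of "{G. openin X G & good G}"] cov by blast
 then have "ALL G:\<F>. good G" by auto
 then obtain T where T: "!!G. G \<in> \<F> ==> T G \<in> sets lebesgue" "!!G. G \<in> \<F> ==> ?w L1_on T G"
  "!!G p. G \<in> \<F> ==> p \<in> G ==> (!!i. snd (\<rho> p) $ i ~= 0) ==> fst (\<rho> p) \<in> T G"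
  unfolding good_def by metis
 have wT: "?w L1_on (\<Union>G\<in>\<F>. T G)" by (intro set_integrable_UN \<F> T)
 define B where "B = {p \<in> ball 0 \<delta>. ALL i. ?F i p ~= 0}"
 have "open B"
 proof -
  have "B = (\<Inter>i. ball 0 \<delta> Int ?F i -` (- {0}))" by (auto simp: B_def)
  moreover have "open (\<Inter>i. ball 0 \<delta> Int ?F i -` (- {0}))"
   using \<delta>(2) ball_subset_cball[of "0 :: complex \<times> complex" \<delta>]
   by (intro open_INT continuous_open_preimage ballI continuous_on_subset[OF hol2_on_continuous[OF N(4)]]) auto
  ultimately show ?thesis by simp
 qed
 moreover have "B \<subseteq> (\<Union>G\<in>\<F>. T G)"
 proof
  fix p assume p: "p \<in> B"
  have "EX w. w ^ m i = ?F i p" for i using exists_complex_root[of "m i" "?F i p"] m[of i] by (metis not_one_le_zero)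
  then obtain w' where w': "!!i. w' i ^ m i = ?F i p" by metis
  define v where "v = (p, \<chi> i. w' i)"
  have "v \<in> VK" using p w' by (auto simp: VK_def v_def B_def)
  moreover have "\<rho> ` topspace X = V" using res by (simp add: resolution_def V_def)
  ultimately obtain p' where p': "p' \<in> topspace X" "\<rho> p' = v" using VKV by (metis imageE subsetD)
  then have "p' \<in> S" using \<open>v \<in> VK\<close> by (simp add: S_def)
  then obtain G where G: "G \<in> \<F>" "p' \<in> G" using \<F>(3) by auto
  have "snd (\<rho> p') $ i ~= 0" for i
  proof
   assume "snd (\<rho> p') $ i = 0"
   then have "?F i p = 0" using w'[of i] m[of i] by (simp add: p'(2) v_def power_0_left)
   then show False using p by (simp add: B_def)
  qed
  then have "fst (\<rho> p') \<in> T G" by (rule T(3)[OF G])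
  then show "p \<in> (\<Union>G\<in>\<F>. T G)" using G(1) by (auto simp: p'(2) v_def)
 qed
 ultimately have wB: "?w L1_on B" using absolutely_integrable_open_subset[OF wT] by blast
 \<comment> \<open>On the zeros of the \<open>f i\<close> the weight is zero by the convention for
   \<open>powr\<close>, so nothing is lost there.\<close>
 have "?w L1_on ball 0 \<delta> \<longleftrightarrow> ?w L1_on B"
 proof (rule absolutely_integrable_spike_set_eq)
  have "{p \<in> ball 0 \<delta> - B. ?w p ~= 0} = {}" by (auto simp: B_def wt_def)
  then show "negligible {p \<in> ball 0 \<delta> - B. ?w p ~= 0}" by (simp only: negligible_empty)
  have "{p \<in> B - ball 0 \<delta>. ?w p ~= 0} = {}" by (auto simp: B_def)
  then show "negligible {p \<in> B - ball 0 \<delta>. ?w p ~= 0}" by (simp only: negligible_empty)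
 qed
 then show ?thesis using wB \<delta>(1) unfolding lint_def by (intro exI[of _ "ball 0 \<delta>"]) auto
qed

section \<open>Square integrable quotients\<close>

text \<open>Write N and M as powers of x - a times units. If the quotient had a pole, its square
  would dominate a multiple of |x - a|^(-2), whose integral over a disc is infinite.\<close>

lemma l2_quotient_extends_at:
 assumes N: "N holomorphic_on ball a R" and M: "M holomorphic_on ball a R" and R: "R > 0"
  and nz: "x1 \<in> ball a R" "M x1 ~= 0"
  and int: "(\<integral>\<^sup>+x. ennreal (indicator (ball a R) x * (cmod (N x / M x))^2) \<partial>lborel) < \<infinity>"
 obtains s G where "s > 0" "s <= R" "G holomorphic_on ball a s" "!!x. x \<in> ball a s ==> N x = G x * M x"
  "!!x. x \<in> ball a s - {a} ==> M x ~= 0"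
proof -
 have shift: "(%x. H (a + x)) holomorphic_on ball 0 R" if "H holomorphic_on ball a R" for H
 proof -
  have "(H \<circ> (%x. a + x)) holomorphic_on ball 0 R"
   by (rule holomorphic_on_compose_gen[OF _ that]) (auto intro!: holomorphic_intros simp: dist_norm)
  then show ?thesis by (simp add: o_def)
 qed
 have unshift: "(%x. H (x - a)) holomorphic_on ball a s" if "H holomorphic_on ball 0 s" for H s
 proof -
  have "(H \<circ> (%x. x - a)) holomorphic_on ball a s"
   by (rule holomorphic_on_compose_gen[OF _ that]) (auto intro!: holomorphic_intros simp: dist_norm norm_minus_commute)
  then show ?thesis by (simp add: o_def)
 qed
 have "x1 - a \<in> ball 0 R" using nz(1) by (simp add: dist_norm norm_minus_commute)
 then obtain l v s where v: "s > 0" "s <= R" "v holomorphic_on ball 0 s" "!!w. w \<in> ball 0 s ==> M (a + w) = w ^ l * v w"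
  "!!w. w \<in> ball 0 s ==> v w ~= 0"
  by (rule holomorphic_order_0[OF shift[OF M]]) (use nz in auto)
 have M0: "M x ~= 0" if "x \<in> ball a s - {a}" for x
  using v(4)[of "x - a"] v(5)[of "x - a"] that by (auto simp: dist_norm norm_minus_commute)
 show thesis
 proof (cases "EX x2:ball a R. N x2 ~= 0")
  case False
  then show thesis using v(1,2) M0 by (intro that[of s "%_. 0"]) auto
 next
  case True
  then obtain x2 where x2: "x2 \<in> ball a R" "N x2 ~= 0" by auto
  then have "x2 - a \<in> ball 0 R" by (simp add: dist_norm norm_minus_commute)
  then obtain k u s' where u: "s' > 0" "s' <= R" "u holomorphic_on ball 0 s'" "!!w. w \<in> ball 0 s' ==> N (a + w) = w ^ k * u w"
   "!!w. w \<in> ball 0 s' ==> u w ~= 0"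
   by (rule holomorphic_order_0[OF shift[OF N]]) (use x2 in auto)
  define r where "r = min s s'"
  have r: "r > 0" "r <= R" "r <= s" "r <= s'" using v u by (auto simp: r_def)
  have "l <= k"
  proof (rule ccontr)
   assume "~ l <= k"
   define q where "q = (%w. u w / v w)"
   have q: "q holomorphic_on ball 0 r" unfolding q_def using u(3) v(3,5) r
    by (intro holomorphic_intros) (auto elim!: holomorphic_on_subset)
   then have "isCont q 0" using r(1) holomorphic_on_imp_continuous_on by (force simp: continuous_on_eq_continuous_at)
   moreover have q0: "q 0 ~= 0" using u(1,5) v(1,5) by (simp add: q_def)
   ultimately have "((%w. cmod (q w)) \<longlongrightarrow> cmod (q 0)) (nhds 0)"
    by (intro tendsto_norm) (simp add: isCont_def tendsto_at_iff_tendsto_nhds)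
   then have "\<forall>\<^sub>F w in nhds 0. cmod (q 0) / 2 < cmod (q w)" using q0 by (intro order_tendstoD(1)) auto
   then obtain e where e: "e > 0" "!!w. dist w 0 < e ==> cmod (q 0) / 2 < cmod (q w)" unfolding eventually_nhds_metric by auto
   define t where "t = min 1 (min e r)"
   have t: "t > 0" "t <= 1" "t <= e" "t <= r" using e r by (auto simp: t_def)
   define c where "c = (cmod (q 0) / 2)^2"
   have c: "c > 0" using q0 by (simp add: c_def)
   have le: "ennreal c * ennreal (indicator (ball 0 t) w * cmod w powr (2 * (-1))) <= ennreal (indicator (ball a R) (a + 1 * w) * (cmod (N (a + 1 * w) / M (a + 1 * w)))^2)" for w
   proof (cases "w \<in> ball 0 t - {0}")
    case True
    then have w: "w \<in> ball 0 s" "w \<in> ball 0 s'" "a + w \<in> ball a R" "dist w 0 < e" "w ~= 0" "cmod w < 1" using t r by (auto simp: dist_norm)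
    have qw: "cmod (N (a + w) / M (a + w)) = cmod w powr (- real (l - k)) * cmod (q w)"
    proof -
     have "w ^ l = w ^ k * w ^ (l - k)" using \<open>~ l <= k\<close> by (simp flip: power_add)
     then have "N (a + w) / M (a + w) = q w / w ^ (l - k)"
      using v(4)[OF w(1)] u(4)[OF w(2)] w(5) by (simp add: q_def)
     then have "cmod (N (a + w) / M (a + w)) = cmod (q w) / cmod w ^ (l - k)" by (simp only: norm_divide norm_power)
     then show ?thesis using w(5) by (simp add: powr_minus powr_realpow divide_inverse mult.commute)
    qed
    have "cmod w powr (-1) <= cmod w powr (- real (l - k))"
     using w \<open>~ l <= k\<close> by (intro powr_mono') auto
    then have "cmod w powr (-1) * (cmod (q 0) / 2) <= cmod (N (a + w) / M (a + w))"
     unfolding qw using e(2)[OF w(4)] by (intro mult_mono) auto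
    then have "(cmod w powr (-1) * (cmod (q 0) / 2))^2 <= (cmod (N (a + w) / M (a + w)))^2"
     by (rule power_mono) simp
    moreover have "(cmod w powr (-1) * (cmod (q 0) / 2))^2 = c * cmod w powr (2 * (-1))"
     using w(5) unfolding c_def power_mult_distrib by (simp add: powr_power powr_minus powr_numeral power_inverse inverse_eq_divide power_divide)
    ultimately have "c * cmod w powr (2 * (-1)) <= (cmod (N (a + w) / M (a + w)))^2" by (simp only:)
    then show ?thesis using True w(3) c
     by (subst ennreal_mult[symmetric]) (auto intro!: ennreal_leI)
   qed (auto simp: indicator_def)
   have meas: "(%x. ennreal (indicator (ball a R) x * (cmod (N x / M x))^2)) \<in> borel_measurable borel"
   proof -
    have cN: "(%x. indicator (ball a R) x *\<^sub>R N x) \<in> borel_measurable borel"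
     by (rule borel_measurable_continuous_on_indicator) (use N holomorphic_on_imp_continuous_on in auto)
    have cM: "(%x. indicator (ball a R) x *\<^sub>R M x) \<in> borel_measurable borel"
     by (rule borel_measurable_continuous_on_indicator) (use M holomorphic_on_imp_continuous_on in auto)
    have "(%x. ennreal ((cmod ((indicator (ball a R) x *\<^sub>R N x) / (indicator (ball a R) x *\<^sub>R M x)))^2)) \<in> borel_measurable borel"
     using cN cM by measurable
    also have "(%x. ennreal ((cmod ((indicator (ball a R) x *\<^sub>R N x) / (indicator (ball a R) x *\<^sub>R M x)))^2)) =
     (%x. ennreal (indicator (ball a R) x * (cmod (N x / M x))^2))"
     by (auto simp: indicator_def)
    finally show ?thesis .
   qed
   have "\<infinity> = ennreal c * (\<integral>\<^sup>+w. ennreal (indicator (ball (0::complex) t) w * cmod w powr (2 * (-1))) \<partial>lborel)"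
    using nn_integral_disc_powr_infinite[OF t(1), of "-1"] c by (simp add: ennreal_mult_top)
   also have "\<dots> = (\<integral>\<^sup>+w. ennreal c * ennreal (indicator (ball (0::complex) t) w * cmod w powr (2 * (-1))) \<partial>lborel)"
    by (rule nn_integral_cmult[symmetric])
     (rule measurable_compose[OF _ measurable_ennreal], rule borel_measurable_times, rule borel_measurable_indicator, simp, measurable)
   also have "\<dots> <= (\<integral>\<^sup>+w. ennreal (indicator (ball a R) (a + 1 * w) * (cmod (N (a + 1 * w) / M (a + 1 * w)))^2) \<partial>lborel)"
    by (rule nn_integral_mono) (rule le)
   also have "\<dots> = (\<integral>\<^sup>+x. ennreal (indicator (ball a R) x * (cmod (N x / M x))^2) \<partial>distr lborel borel (%w. a + w))"
    using meas by (subst nn_integral_distr) auto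
   also have "distr lborel borel (%w. a + w) = lborel" using lborel_distr_plus[of a] by simp
   finally show False using int by simp
  qed
  show thesis
  proof (rule that[of r "%x. (x - a) ^ (k - l) * u (x - a) / v (x - a)"])
   show "(%x. (x - a) ^ (k - l) * u (x - a) / v (x - a)) holomorphic_on ball a r"
    using r v(5) by (intro holomorphic_intros holomorphic_on_subset[OF unshift[OF u(3)]] holomorphic_on_subset[OF unshift[OF v(3)]])
     (auto simp: dist_norm norm_minus_commute)
   fix x assume x: "x \<in> ball a r"
   then have xx: "x - a \<in> ball 0 s" "x - a \<in> ball 0 s'" using r by (auto simp: dist_norm norm_minus_commute)
   have "(x - a) ^ k = (x - a) ^ (k - l) * (x - a) ^ l" using \<open>l <= k\<close> by (simp flip: power_add)
   then show "N x = (x - a) ^ (k - l) * u (x - a) / v (x - a) * M x"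
    using v(4)[OF xx(1)] v(5)[OF xx(1)] u(4)[OF xx(2)] by simp
  qed (use r M0 in auto)
 qed
qed

text \<open>Uniqueness of quotients, used to glue local ones: if the continuous functions differed
  at \<open>q\<close> they would differ nearby, and \<open>M\<close> would vanish there
  identically.\<close>

lemma frequently_nonzero_eq:
 fixes F G M :: "'a::t2_space => complex"
 assumes F: "isCont F q" and G: "isCont G q" and M: "~ (\<forall>\<^sub>F p in nhds q. M p = 0)"
  and eq: "\<forall>\<^sub>F p in nhds q. F p * M p = G p * M p"
 shows "F q = G q"
proof (rule ccontr)
 assume "F q ~= G q"
 have "isCont (%p. F p - G p) q" using F G by (intro continuous_intros)
 then have "((%p. F p - G p) \<longlongrightarrow> F q - G q) (nhds q)"
  using tendsto_at_iff_tendsto_nhds[of "%p. F p - G p" q] by (simp add: isCont_def)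
 then have "\<forall>\<^sub>F p in nhds q. F p - G p ~= 0" by (rule tendsto_imp_eventually_ne) (use \<open>F q ~= G q\<close> in simp)
 with eq have "\<forall>\<^sub>F p in nhds q. M p = 0" by eventually_elim auto
 with M show False by simp
qed

lemma l2_quotient_extends:
 assumes N: "N holomorphic_on ball 0 R" and M: "M holomorphic_on ball 0 R"
  and nz: "x1 \<in> ball 0 R" "M x1 ~= 0"
  and int: "(\<integral>\<^sup>+x. ennreal (indicator (ball 0 R) x * (cmod (N x / M x))^2) \<partial>lborel) < \<infinity>"
 obtains G where "G holomorphic_on ball 0 R" "!!x. x \<in> ball 0 R ==> N x = G x * M x"
proof -
 have "ALL a:ball 0 R. EX s G. s > 0 & ball a s \<subseteq> ball 0 R & G holomorphic_on ball a s & (ALL x:ball a s. N x = G x * M x) & (ALL x:ball a s - {a}. M x ~= 0)"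
 proof
  fix a :: complex assume a: "a \<in> ball 0 R"
  obtain R' where R': "R' > 0" "ball a R' \<subseteq> ball 0 R" using a open_ball openE by metis
  have Na: "N holomorphic_on ball a R'" "M holomorphic_on ball a R'" using N M R'(2) holomorphic_on_subset by auto
  have "EX x:ball a R'. M x ~= 0"
  proof (rule ccontr)
   assume "~ (EX x:ball a R'. M x ~= 0)"
   then have z: "!!x. x \<in> ball a R' ==> M x = 0" by blast
   have ne: "ball a R' ~= {}" using R'(1) by simp
   have c0: "(%_. 0 :: complex) holomorphic_on ball 0 R" by (rule holomorphic_on_const)
   have "M x1 = 0"
    by (rule analytic_continuation_open[OF open_ball open_ball ne convex_connected[OF convex_ball] R'(2) M c0 z nz(1)])
   then show False using nz(2) by simp
  qed
  then obtain x2 where x2: "x2 \<in> ball a R'" "M x2 ~= 0" by auto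
  have "(\<integral>\<^sup>+x. ennreal (indicator (ball a R') x * (cmod (N x / M x))^2) \<partial>lborel) <= (\<integral>\<^sup>+x. ennreal (indicator (ball 0 R) x * (cmod (N x / M x))^2) \<partial>lborel)"
   by (rule nn_integral_mono) (use R'(2) in "auto simp: indicator_def intro!: ennreal_leI")
  then have i: "(\<integral>\<^sup>+x. ennreal (indicator (ball a R') x * (cmod (N x / M x))^2) \<partial>lborel) < \<infinity>" using int by (rule le_less_trans)
  obtain s G where "s > 0" "s <= R'" "G holomorphic_on ball a s" "!!x. x \<in> ball a s ==> N x = G x * M x"
   "!!x. x \<in> ball a s - {a} ==> M x ~= 0"
   by (rule l2_quotient_extends_at[OF Na R'(1) x2 i]) blast
  moreover have "ball a s \<subseteq> ball 0 R" using \<open>s <= R'\<close> R'(2) by (meson subset_ball subset_trans)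
  ultimately show "EX s G. s > 0 & ball a s \<subseteq> ball 0 R & G holomorphic_on ball a s & (ALL x:ball a s. N x = G x * M x) & (ALL x:ball a s - {a}. M x ~= 0)"
   by (intro exI[of _ s] exI[of _ G]) auto
 qed
 then obtain s G where sG: "!!a. a \<in> ball 0 R ==> s a > 0 & ball a (s a) \<subseteq> ball 0 R & G a holomorphic_on ball a (s a) &
  (ALL x:ball a (s a). N x = G a x * M x) & (ALL x:ball a (s a) - {a}. M x ~= 0)"
  by metis
 define H where "H = (%x. G x x)"
 have eq: "H x = G a x" if a: "a \<in> ball 0 R" and x: "x \<in> ball a (s a)" for a x
 proof -
  have xR: "x \<in> ball 0 R" using sG[OF a] x by blast
  have cont: "isCont (G b) x" if "b \<in> ball 0 R" "x \<in> ball b (s b)" for b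
   using sG[OF that(1)] that(2) by (meson continuous_on_eq_continuous_at holomorphic_on_imp_continuous_on open_ball)
  have xx: "x \<in> ball x (s x)" using sG[OF xR] by simp
  have "G x x = G a x"
  proof (rule frequently_nonzero_eq[OF cont[OF xR xx] cont[OF a x]])
   show "\<forall>\<^sub>F p in nhds x. G x p * M p = G a p * M p"
   proof -
    have "\<forall>\<^sub>F p in nhds x. p \<in> ball x (s x) Int ball a (s a)" using x xx by (intro eventually_nhds_in_open) auto
    then show ?thesis
    proof eventually_elim
     case (elim p)
     then show ?case using sG[OF xR] sG[OF a] by (metis IntD1 IntD2)
    qed
   qed
   show "~ (\<forall>\<^sub>F p in nhds x. M p = 0)"
   proof
    assume "\<forall>\<^sub>F p in nhds x. M p = 0"
    then obtain e where e: "e > 0" "!!p. dist p x < e ==> M p = 0" by (auto simp: eventually_nhds_metric)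
    define p where "p = x + of_real (min e (s x) / 2)"
    have d: "cmod (p - x) = min e (s x) / 2" using e sG[OF xR] by (simp add: p_def)
    have "p ~= x" using d e sG[OF xR] by (auto simp: min_def split: if_splits)
    moreover have "dist p x < e" "dist p x < s x" using d e(1) sG[OF xR, THEN conjunct1] by (auto simp: dist_norm min_def split: if_splits)
    ultimately show False using e(2)[of p] sG[OF xR] by (simp add: dist_commute)
   qed
  qed
  then show ?thesis by (simp add: H_def)
 qed
 show thesis
 proof (rule that[of H])
  have "H field_differentiable at a" if a: "a \<in> ball 0 R" for a
  proof -
   have "H holomorphic_on ball a (s a)"
    using sG[OF a] eq[OF a] by (metis (no_types, lifting) holomorphic_transform)
   then show ?thesis using sG[OF a] by (simp add: holomorphic_on_imp_differentiable_at)
  qed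
  then show "H holomorphic_on ball 0 R" by (simp add: holomorphic_on_def field_differentiable_at_within)
  show "N x = H x * M x" if "x \<in> ball 0 R" for x
   using sG[OF that] by (simp add: H_def)
 qed
qed

text \<open>\<open>M\<close> has no zeros on a circle in x for all small y, so a candidate
  \<open>G\<close> is defined by Cauchy's formula without dividing by zero. By Fubini almost every
  slice is square integrable, where the one-variable result gives N = G M; continuity extends this
  to all y.\<close>

lemma l2_division_regular:
 assumes N: "N hol2_on PD R" and M: "M hol2_on PD R" and nz: "x1 \<in> ball 0 R" "M (x1, 0) ~= 0"
  and int: "(%p. (cmod (N p / M p))^2) L1_on PD R"
 obtains r G where "r > 0" "r <= R" "G hol2_on PD r" "!!p. p \<in> PD r ==> N p = G p * M p"
proof -
 have R: "R > 0" using nz(1) by (metis ball_empty empty_iff not_less)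
 have slice: "(%x. H (x, y)) holomorphic_on ball 0 R" if "H hol2_on PD R" "y \<in> ball 0 R" for H y
  by (rule holomorphic_on_subset[OF hol2_on_slice1[OF that(1) open_PD]]) (use that(2) in "auto simp: PD_def")
 obtain n v s where v: "s > 0" "s <= R" "!!w. w \<in> ball 0 s ==> M (w, 0) = w ^ n * v w" "!!w. w \<in> ball 0 s ==> v w ~= 0"
  by (rule holomorphic_order_0[OF slice[OF M] nz]) (use R in auto)
 define \<rho> where "\<rho> = s / 2"
 have \<rho>: "\<rho> > 0" "\<rho> < R" using v by (auto simp: \<rho>_def)
 have sph: "M (w, 0) ~= 0" if "w \<in> sphere 0 \<rho>" for w
  using v(3)[of w] v(4)[of w] that v(1) \<rho> by (auto simp: \<rho>_def)
 define W where "W = PD R Int M -` (- {0})"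
 have "open W" unfolding W_def by (intro continuous_open_preimage hol2_on_continuous M) auto
 moreover have "sphere 0 \<rho> \<times> {0} \<subseteq> W" using sph \<rho> R by (auto simp: W_def PD_def)
 \<comment> \<open>The tube lemma: nonvanishing on the compact circle over y = 0 persists over a
   neighbourhood of y = 0.\<close>
 ultimately obtain B where B: "open B" "0 \<in> B" "sphere 0 \<rho> \<times> B \<subseteq> W"
 proof -
  assume W: "open W" "sphere 0 \<rho> \<times> {0} \<subseteq> W"
  have o: "open (prod.swap ` W)" by (rule open_swap[OF W(1)])
  have s: "{0} \<times> sphere 0 \<rho> \<subseteq> prod.swap ` W" using W(2) by force
  have c: "compact (sphere (0::complex) \<rho>)" by (rule compact_sphere)
  obtain X0 where X0: "(0::complex) \<in> X0" "open X0" "X0 \<times> sphere 0 \<rho> \<subseteq> prod.swap ` W"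
   using Elementary_Topology.tube_lemma[OF c o s] by (elim exE conjE)
  have "sphere 0 \<rho> \<times> X0 \<subseteq> W" using X0(3) by force
  then show thesis by (rule that[OF X0(2,1)])
 qed
 obtain \<delta> where \<delta>: "\<delta> > 0" "ball 0 \<delta> \<subseteq> B" using B(1,2) by (auto elim: openE)
 have \<delta>R: "ball 0 \<delta> \<subseteq> ball (0::complex) R"
 proof
  fix y :: complex assume "y \<in> ball 0 \<delta>"
  then have "(of_real \<rho>, y) \<in> W" using B(3) \<delta>(2) \<rho> by (auto simp: subset_iff)
  then show "y \<in> ball 0 R" by (simp add: W_def PD_def)
 qed
 have MW: "M (w, y) ~= 0" if "w \<in> sphere 0 \<rho>" "y \<in> ball 0 \<delta>" for w y
  using B(3) \<delta>(2) that unfolding W_def by blast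
 \<comment> \<open>The constant of Cauchy's formula is put into the kernel, so that \<open>G\<close>
   is the quotient itself.\<close>
 define k where "k = (%p. N p / M p / (2 * of_real pi * \<i>))"
 define G where "G = (%(x, y). contour_integral (circlepath 0 \<rho>) (%w. k (w, y) / (w - x)))"
 have G: "G hol2_on ball 0 \<rho> \<times> ball 0 \<delta>" unfolding G_def
 proof (rule cauchy_transform_hol2)
  have sub: "sphere 0 \<rho> \<times> ball 0 \<delta> \<subseteq> PD R" using \<rho> \<delta>R by (auto simp: PD_def)
  show "continuous_on (sphere 0 \<rho> \<times> ball 0 \<delta>) k" unfolding k_def
   by (intro continuous_intros continuous_on_subset[OF hol2_on_continuous[OF N] sub] continuous_on_subset[OF hol2_on_continuous[OF M] sub])
    (use MW in auto)
  show "(%y. k (w, y)) holomorphic_on ball 0 \<delta>" if "w \<in> sphere 0 \<rho>" for w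
  proof -
   have "(%y. H (w, y)) holomorphic_on ball 0 \<delta>" if "H hol2_on PD R" for H
    by (rule holomorphic_on_subset[OF hol2_on_slice2[OF that open_PD]]) (use sub \<open>w \<in> sphere 0 \<rho>\<close> in auto)
   then show ?thesis unfolding k_def using N M MW[OF that] by (intro holomorphic_intros) auto
  qed
 qed (use \<rho> in auto)
 define w where "w = (%p. indicator (PD R) p * (cmod (N p / M p))^2)"
 have wm: "w \<in> borel_measurable borel"
 proof -
  have c: "(%p. indicator (PD R) p *\<^sub>R H p) \<in> borel_measurable borel" if "H hol2_on PD R" for H
   by (rule borel_measurable_continuous_on_indicator) (use hol2_on_continuous[OF that] in auto)
  have "(%p. (cmod ((indicator (PD R) p *\<^sub>R N p) / (indicator (PD R) p *\<^sub>R M p)))^2) \<in> borel_measurable borel"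
   using c[OF N] c[OF M] by measurable
  also have "(%p. (cmod ((indicator (PD R) p *\<^sub>R N p) / (indicator (PD R) p *\<^sub>R M p)))^2) = w"
   by (auto simp: w_def indicator_def)
  finally show ?thesis .
 qed
 have "(\<integral>\<^sup>+p. ennreal (w p) \<partial>lborel) < \<infinity>"
  using int wm absolutely_integrable_iff_nn_integral[of "PD R" "%p. (cmod (N p / M p))^2"] by (simp add: w_def)
 moreover have wm': "(%p. ennreal (w p)) \<in> borel_measurable (lborel \<Otimes>\<^sub>M lborel)" using wm by (simp add: lborel_prod)
 ultimately have "(\<integral>\<^sup>+y. \<integral>\<^sup>+x. ennreal (w (x, y)) \<partial>lborel \<partial>lborel) ~= \<infinity>"
  using lborel_pair.nn_integral_snd[OF wm'] by (simp add: lborel_prod)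
 then have "AE y in lborel. (\<integral>\<^sup>+x. ennreal (w (x, y)) \<partial>lborel) ~= \<infinity>"
  by (rule nn_integral_PInf_AE[rotated]) (use wm' in measurable)
 moreover have good: "N (x, y) = G (x, y) * M (x, y)"
  if y: "y \<in> ball 0 \<delta>" "(\<integral>\<^sup>+x. ennreal (w (x, y)) \<partial>lborel) ~= \<infinity>" and x: "x \<in> ball 0 \<rho>" for x y
 proof -
  have yR: "y \<in> ball 0 R" using y(1) \<delta>R by auto
  have "w (x, y) = indicator (ball 0 R) x * (cmod (N (x, y) / M (x, y)))^2" for x
   using yR by (auto simp: w_def PD_def indicator_def)
  then have i: "(\<integral>\<^sup>+x. ennreal (indicator (ball 0 R) x * (cmod (N (x, y) / M (x, y)))^2) \<partial>lborel) < \<infinity>"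
   using y(2) by (simp add: less_top)
  have x0: "of_real \<rho> \<in> ball (0::complex) R" "M (of_real \<rho>, y) ~= 0" using \<rho> MW[of "of_real \<rho>" y] y(1) by auto
  obtain g where g: "g holomorphic_on ball 0 R" "!!x. x \<in> ball 0 R ==> N (x, y) = g x * M (x, y)"
   by (rule l2_quotient_extends[OF slice[OF N yR] slice[OF M yR] x0 i]) blast
  have "((%w. g w / (w - x)) has_contour_integral 2 * of_real pi * \<i> * g x) (circlepath 0 \<rho>)"
   by (rule Cauchy_integral_circlepath_simple[where f = g])
    (use g(1) \<rho> x in \<open>auto simp: dist_norm norm_minus_commute intro!: holomorphic_on_subset[of g "ball 0 R" "cball 0 \<rho>"]\<close>)
  then have "((%w. g w / (w - x) * inverse (2 * of_real pi * \<i>)) has_contour_integral 2 * of_real pi * \<i> * g x * inverse (2 * of_real pi * \<i>)) (circlepath 0 \<rho>)"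
   by (rule has_contour_integral_rmul)
  then have "((%w. k (w, y) / (w - x)) has_contour_integral 2 * of_real pi * \<i> * g x * inverse (2 * of_real pi * \<i>)) (circlepath 0 \<rho>)"
  proof (rule has_contour_integral_eq)
   fix w assume "w \<in> path_image (circlepath 0 \<rho>)"
   then have w: "w \<in> sphere 0 \<rho>" using \<rho> by simp
   then have "w \<in> ball 0 R" using \<rho> by auto
   then show "g w / (w - x) * inverse (2 * of_real pi * \<i>) = k (w, y) / (w - x)"
   proof -
    have "N (w, y) / M (w, y) = g w" using g(2)[OF \<open>w \<in> ball 0 R\<close>] MW[OF w y(1)] by (metis nonzero_mult_div_cancel_right)
    then show ?thesis unfolding k_def by (simp only: divide_inverse mult.assoc mult.commute[of "inverse (w - x)"])
   qed
  qed
  from contour_integral_unique[OF this] have "G (x, y) = 2 * of_real pi * \<i> * g x * inverse (2 * of_real pi * \<i>)"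
   unfolding G_def split .
  also have "\<dots> = g x"
  proof -
   have "c * g x * inverse c = g x" if "c ~= 0" for c using that by simp
   from this[of "2 * of_real pi * \<i>"] show ?thesis by simp
  qed
  finally have "G (x, y) = g x" .
  moreover have "x \<in> ball 0 R" using x \<rho> by auto
  ultimately show ?thesis using g(2)[of x] by metis
 qed
 \<comment> \<open>For fixed x the set of bad y is open, and it is null by the slices above; a
   nonempty open set is not null.\<close>
 have all: "N (x, y) = G (x, y) * M (x, y)" if x: "x \<in> ball 0 \<rho>" and y: "y \<in> ball 0 \<delta>" for x y
 proof (rule ccontr)
  assume ne: "N (x, y) ~= G (x, y) * M (x, y)"
  define E where "E = ball 0 \<delta> Int (%y. N (x, y) - G (x, y) * M (x, y)) -` (- {0})"
  have op: "open (ball (0::complex) \<rho> \<times> ball (0::complex) \<delta>)" by (simp add: open_Times)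
  have c: "continuous_on (ball 0 \<delta>) (%y. H (x, y))" if "H hol2_on ball 0 \<rho> \<times> ball 0 \<delta>" for H
   by (rule continuous_on_compose2[OF hol2_on_continuous[OF that]]) (use x in "auto intro!: continuous_intros")
  have sub: "ball 0 \<rho> \<times> ball 0 \<delta> \<subseteq> PD R" using \<rho> \<delta>R by (auto simp: PD_def)
  have "open E" unfolding E_def
   by (rule continuous_open_preimage[OF continuous_on_diff[OF c[OF hol2_on_subset[OF N sub]] continuous_on_mult[OF c[OF G] c[OF hol2_on_subset[OF M sub]]]]]) auto
  moreover have "E ~= {}" using ne y by (auto simp: E_def)
  moreover have "AE y in lborel. y ~: E"
   using \<open>AE y in lborel. (\<integral>\<^sup>+x. ennreal (w (x, y)) \<partial>lborel) ~= \<infinity>\<close>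
  proof eventually_elim
   case (elim y')
   then show ?case using good[of y' x] x by (auto simp: E_def)
  qed
  then have "E \<in> null_sets lborel" using \<open>open E\<close> by (subst AE_iff_null_sets) auto
  then have "negligible E" by (simp add: negligible_iff_null_sets null_sets_completionI)
  ultimately show False using open_not_negligible by blast
 qed
 show thesis
 proof (rule that[of "min \<rho> \<delta>" G])
  show "G hol2_on PD (min \<rho> \<delta>)" by (rule hol2_on_subset[OF G]) (auto simp: PD_def)
 qed (use \<rho> \<delta> all in "auto simp: PD_def")
qed

text \<open>A linear change of coordinates makes \<open>M\<close> not identically zero on the new
  x-axis; the regular case applies there, and the quotient is carried back.\<close>

lemma l2_division_at:
 assumes D: "open D" and N: "N hol2_on D" and M: "M hol2_on D" and q: "q \<in> D"
  and nz: "~ (\<forall>\<^sub>F p in nhds q. M p = 0)" and U: "open U" "q \<in> U"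
  and int: "(%p. (cmod (N p / M p))^2) L1_on U"
 obtains V G where "open V" "q \<in> V" "V \<subseteq> D" "G hol2_on V" "!!p. p \<in> V ==> N p = G p * M p"
proof -
 obtain e where e: "e > 0" "ball q e \<subseteq> D Int U" using openE[OF open_Int[OF D U(1)], of q] q U(2) by auto
 define S where "S = ball q e Int M -` (- {0})"
 have S: "open S" unfolding S_def
  by (intro continuous_open_preimage continuous_on_subset[OF hol2_on_continuous[OF M]]) (use e in auto)
 have "S ~= {}"
 proof
  assume "S = {}"
  moreover have "\<forall>\<^sub>F p in nhds q. p \<in> ball q e" using e by (intro eventually_nhds_in_open) auto
  ultimately have "\<forall>\<^sub>F p in nhds q. M p = 0" by (auto simp: S_def elim!: eventually_mono)
  then show False using nz by simp
 qed
 \<comment> \<open>A point \<open>p1\<close> with M(p1) nonzero and first coordinate different from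
   that of \<open>q\<close> exists since projections of open sets are open. It makes
   \<open>u\<close> nonzero and the coordinate change invertible.\<close>
 have "~ fst ` S \<subseteq> {fst q}"
 proof
  assume "fst ` S \<subseteq> {fst q}"
  then have "fst ` S = {fst q}" using \<open>S ~= {}\<close> by (simp add: subset_singleton_iff)
  then show False using open_image_fst[OF S] by (simp add: not_open_singleton)
 qed
 then obtain p1 where p1: "p1 \<in> S" "fst p1 ~= fst q" by auto
 define u v where "u = fst p1 - fst q" and "v = snd p1 - snd q"
 have u: "u ~= 0" using p1 by (simp add: u_def)
 define X Y :: cfun where "X = (%p. fst q + fst p * u)" and "Y = (%p. snd q + (fst p * v + snd p))"
 have XY: "X hol2_on T" "Y hol2_on T" for T unfolding X_def Y_def by (intro hol2_intros)+
 have cXY: "continuous_on UNIV (%p. (X p, Y p))" unfolding X_def Y_def by (intro continuous_intros)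
 have "open ((%p. (X p, Y p)) -` ball q e)" using cXY by (simp add: open_vimage)
 moreover have "0 \<in> (%p. (X p, Y p)) -` ball q e" using e by (simp add: X_def Y_def)
 ultimately obtain R where R: "R > 0" "PD R \<subseteq> (%p. (X p, Y p)) -` ball q e" by (rule PD_subset_open)
 have RD: "(X p, Y p) \<in> D" "(X p, Y p) \<in> U" if "p \<in> PD R" for p using R(2) e(2) that by blast+
 have hol: "(%p. H (X p, Y p)) hol2_on PD R" if "H hol2_on D" for H
  by (rule hol2_on_compose[OF that XY]) (use RD in auto)
 \<comment> \<open>\<open>M\<close> on the line from \<open>q\<close> to \<open>p1\<close>. It is
   nonzero at parameter 1, which may lie outside the polydisc; being of finite order at 0 it is also
   nonzero at small parameters such as \<open>x1\<close>.\<close>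
 define L where "L = (%s. M (X (s, 0), Y (s, 0)))"
 define R1 where "R1 = e / norm (p1 - q)"
 have p1q: "norm (p1 - q) > 0" using p1(2) by auto
 have inb: "(X (s, 0), Y (s, 0)) \<in> ball q e" if "s \<in> ball 0 R1" for s
 proof -
  have "(X (s, 0), Y (s, 0)) - q = (s * fst (p1 - q), s * snd (p1 - q))" by (simp add: X_def Y_def u_def v_def prod_eq_iff)
  then have "norm ((X (s, 0), Y (s, 0)) - q) = cmod s * norm (p1 - q)"
   by (simp add: norm_prod_def norm_mult power_mult_distrib real_sqrt_mult flip: distrib_left)
  moreover have "cmod s * norm (p1 - q) < e" using that p1q by (simp add: R1_def pos_less_divide_eq)
  ultimately show ?thesis by (simp add: dist_norm norm_minus_commute)
 qed
 have "L holomorphic_on ball 0 R1" unfolding L_def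
  by (rule hol2_on_compose_curve[OF M]) (use inb e(2) in "auto simp: X_def Y_def intro!: holomorphic_intros")
 moreover have "1 \<in> ball (0::complex) R1" using p1(1) p1q by (simp add: R1_def S_def dist_norm norm_minus_commute pos_less_divide_eq)
 moreover have "L 1 ~= 0" using p1(1) by (simp add: L_def S_def X_def Y_def u_def v_def)
 ultimately obtain n h s0 where h: "s0 > 0" "!!w. w \<in> ball 0 s0 ==> L w = w ^ n * h w" "!!w. w \<in> ball 0 s0 ==> h w ~= 0"
  by (rule holomorphic_order_0) blast
 define x1 :: complex where "x1 = of_real (min s0 R / 2)"
 have x1: "x1 \<in> ball 0 R" "x1 \<in> ball 0 s0" "x1 ~= 0" using h(1) R(1) by (auto simp: x1_def min_def)
 have nz1: "M (X (x1, 0), Y (x1, 0)) ~= 0" using h(2)[OF x1(2)] h(3)[OF x1(2)] x1(3) by (simp add: L_def)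
 have inj: "inj_on (%p. (X p, Y p)) (PD R)" using u by (intro inj_onI) (auto simp: X_def Y_def prod_eq_iff)
 have jac: "jac X Y p = u" for p
 proof -
  obtain a b where p: "p = (a, b)" by force
  have "pd1 X p = u" "pd2 X p = 0" "pd2 Y p = 1"
   unfolding X_def Y_def pd1_def pd2_def p by (auto intro!: DERIV_imp_deriv derivative_eq_intros)
  then show ?thesis by simp
 qed
 have im: "(%p. (cmod (N p / M p))^2) L1_on (%p. (X p, Y p)) ` PD R"
 proof (rule absolutely_integrable_open_subset[OF int])
  have "(%p. (X p, Y p)) ` PD R = (%p. ((fst p - fst q) / u, snd p - snd q - (fst p - fst q) / u * v)) -` PD R"
  proof (intro set_eqI iffI)
   fix p assume "p \<in> (%p. ((fst p - fst q) / u, snd p - snd q - (fst p - fst q) / u * v)) -` PD R"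
   then show "p \<in> (%p. (X p, Y p)) ` PD R" using u by (auto simp: X_def Y_def intro!: image_eqI[rotated])
  qed (use u in "auto simp: X_def Y_def")
  then show "open ((%p. (X p, Y p)) ` PD R)"
   using u by (auto intro!: open_vimage continuous_intros)
 qed (use RD in auto)
 have "(%p. (cmod (N (X p, Y p) / M (X p, Y p)))^2 * (cmod (jac X Y p))^2) L1_on PD R"
  by (rule absolutely_integrable_pullback[OF XY[of UNIV] _ im inj]) auto
 then have "(%p. (cmod (N (X p, Y p) / M (X p, Y p)))^2 * (cmod u)^2 * inverse ((cmod u)^2)) L1_on PD R"
  unfolding jac by (rule set_integrable_mult_left)
 then have int': "(%p. (cmod (N (X p, Y p) / M (X p, Y p)))^2) L1_on PD R" using u by simp
 obtain r G where G: "r > 0" "r <= R" "G hol2_on PD r" "!!p. p \<in> PD r ==> N (X p, Y p) = G p * M (X p, Y p)"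
  by (rule l2_division_regular[OF hol[OF N] hol[OF M] x1(1) nz1 int']) blast
 define A B :: cfun where "A = (%p. (fst p - fst q) / u)" and "B = (%p. snd p - snd q - (fst p - fst q) / u * v)"
 have AB: "A hol2_on T" "B hol2_on T" for T unfolding A_def B_def using u by (intro hol2_intros hol2_on_divide; simp)+
 have XYAB: "(X (A p, B p), Y (A p, B p)) = p" for p using u by (simp add: X_def Y_def A_def B_def)
 define V where "V = (%p. (A p, B p)) -` PD r"
 show thesis
 proof (rule that[of V "%p. G (A p, B p)"])
  show "open V" unfolding V_def A_def B_def using u by (intro open_vimage continuous_intros) auto
  show "q \<in> V" using G(1) by (simp add: V_def A_def B_def PD_def)
  show "V \<subseteq> D"
  proof
   fix p assume "p \<in> V"
   then have "(A p, B p) \<in> PD R" using G(2) PD_mono by (auto simp: V_def)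
   from RD(1)[OF this] show "p \<in> D" by (simp add: XYAB)
  qed
  show "(%p. G (A p, B p)) hol2_on V" by (rule hol2_on_compose[OF G(3) AB]) (auto simp: V_def)
  show "N p = G (A p, B p) * M p" if "p \<in> V" for p
   using G(4)[of "(A p, B p)"] that by (simp add: V_def XYAB)
 qed
qed

proposition l2_division:
 assumes D: "open D" and N: "N hol2_on D" and M: "M hol2_on D"
  and nz: "!!q. q \<in> D ==> ~ (\<forall>\<^sub>F p in nhds q. M p = 0)"
  and int: "!!q. q \<in> D ==> EX U. open U & q \<in> U & (%p. (cmod (N p / M p))^2) L1_on U"
 obtains g where "g hol2_on D" "!!q. q \<in> D ==> N q = g q * M q"
proof -
 have "EX V G. open V & q \<in> V & V \<subseteq> D & G hol2_on V & (ALL p:V. N p = G p * M p)" if q: "q \<in> D" for q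
 proof -
  obtain U where U: "open U" "q \<in> U" "(%p. (cmod (N p / M p))^2) L1_on U" using int[OF q] by blast
  obtain V G where "open V" "q \<in> V" "V \<subseteq> D" "G hol2_on V" "!!p. p \<in> V ==> N p = G p * M p"
   by (rule l2_division_at[OF D N M q nz[OF q] U]) blast
  then show ?thesis by blast
 qed
 then obtain V G where VG: "!!q. q \<in> D ==> open (V q) & q \<in> V q & V q \<subseteq> D & G q hol2_on V q & (ALL p:V q. N p = G q p * M p)" by metis
 define g where "g = (%q. G q q)"
 have eq: "G q p = g p" if q: "q \<in> D" and p: "p \<in> V q" for p q
 proof -
  have pD: "p \<in> D" using VG[OF q] p by auto
  have cont: "isCont (G b) p" if "b \<in> D" "p \<in> V b" for b
   using VG[OF that(1)] that(2) by (meson continuous_on_eq_continuous_at hol2_on_continuous)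
  have pp: "p \<in> V p" using VG[OF pD] by simp
  have "G q p = G p p"
  proof (rule frequently_nonzero_eq[OF cont[OF q p] cont[OF pD pp] nz[OF pD]])
   have "\<forall>\<^sub>F x in nhds p. x \<in> V q Int V p" using VG[OF q] VG[OF pD] p pp by (intro eventually_nhds_in_open) auto
   then show "\<forall>\<^sub>F x in nhds p. G q x * M x = G p x * M x"
   proof eventually_elim
    case (elim x)
    then have "N x = G q x * M x" "N x = G p x * M x" using VG[OF q] VG[OF pD] by blast+
    then show ?case by (simp only:)
   qed
  qed
  then show ?thesis by (simp add: g_def)
 qed
 show thesis
 proof (rule that[of g])
  show "g hol2_on D"
   unfolding hol2_on_def
  proof
   fix q assume q: "q \<in> D"
   have "g hol2_on V q" by (rule hol2_on_cong[of _ "G q"]) (use VG[OF q] eq[OF q] in auto)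
   then show "EX a b. (g has_derivative (%(u, v). a * u + b * v)) (at q)" using VG[OF q] unfolding hol2_on_def by blast
  qed
  show "N q = g q * M q" if "q \<in> D" for q using VG[OF that] by (simp add: g_def)
 qed
qed

section \<open>From integrability to forms\<close>

lemma hol2_ambient_cong:
 assumes "open D" "!!q. q \<in> D ==> \<sigma> q = \<sigma>' q" "hol2_ambient_on \<sigma> D" shows "hol2_ambient_on \<sigma>' D"
 using assms unfolding hol2_ambient_on_def by (auto intro: hol2_on_cong[rotated 2])

lemma hol2_ambient_subset: "hol2_ambient_on \<sigma> D ==> D' \<subseteq> D ==> hol2_ambient_on \<sigma> D'"
 unfolding hol2_ambient_on_def by (auto intro: hol2_on_subset)

lemma hol2_ambient_continuous:
 assumes "hol2_ambient_on \<sigma> D" shows "continuous_on D \<sigma>"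
proof -
 have "continuous_on D (%q. ((fst (fst (\<sigma> q)), snd (fst (\<sigma> q))), \<chi> i. snd (\<sigma> q) $ i))"
  using assms unfolding hol2_ambient_on_def by (intro continuous_intros hol2_on_continuous) auto
 then show ?thesis by (simp add: vec_lambda_eta)
qed

lemma linear_axis: "linear (axis i :: complex => complex ^ 'n)"
 by (rule linearI) (auto simp: vec_eq_iff axis_def)

lemma hol2_ambient_differentiable:
 fixes \<sigma> :: "complex \<times> complex => 'n::finite ambient"
 assumes "hol2_ambient_on \<sigma> D" "q \<in> D" shows "\<sigma> differentiable (at q)"
proof -
 have d: "f differentiable (at q)" if "f hol2_on D" for f
  using hol2_on_has_derivative[OF that assms(2)] differentiableI by blast
 have eq: "\<sigma> = (%q. ((fst (fst (\<sigma> q)), snd (fst (\<sigma> q))), \<Sum>i\<in>UNIV. axis i (snd (\<sigma> q) $ i)))"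
 proof
  have "(\<Sum>i\<in>UNIV. axis i (w $ i)) = w" for w :: "complex ^ 'n"
   by (simp add: vec_eq_iff axis_def if_distrib cong: if_cong)
  then show "\<sigma> q = ((fst (fst (\<sigma> q)), snd (fst (\<sigma> q))), \<Sum>i\<in>UNIV. axis i (snd (\<sigma> q) $ i))" for q by simp
 qed
 have "bounded_linear (axis i :: complex => complex ^ 'n)" for i by (simp add: linear_axis linear_linear)
 then have ax: "(%q. axis i (f q) :: complex ^ 'n) differentiable (at q)" if "f differentiable (at q)" for f i
  using that bounded_linear.has_derivative unfolding differentiable_def by blast
 have pair: "(%q. (f q, g q)) differentiable (at q)" if "f differentiable (at q)" "g differentiable (at q)" for f :: "_ => 'b::real_normed_vector" and g :: "_ => 'c::real_normed_vector"
  using that has_derivative_Pair unfolding differentiable_def by blast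
 show ?thesis
 proof (subst eq, intro pair differentiable_sum ballI)
  show "(%q. fst (fst (\<sigma> q))) differentiable at q" "(%q. snd (fst (\<sigma> q))) differentiable at q"
   using assms(1) by (auto simp: hol2_ambient_on_def intro!: d)
  show "(%q. axis i (snd (\<sigma> q) $ i)) differentiable at q" for i
   by (rule ax, rule d) (use assms(1) in "simp add: hol2_ambient_on_def")
 qed auto
qed

lemma local_param_cong:
 assumes "open D" "!!q. q \<in> D ==> \<sigma> q = \<sigma>' q" "local_param V D \<sigma>" shows "local_param V D \<sigma>'"
proof -
 have im: "\<sigma>' ` D = \<sigma> ` D" using assms(2) by (auto simp: image_iff)
 have hol: "hol2_ambient_on \<sigma> D" using assms(3) by (simp add: local_param_def)
 have "frechet_derivative \<sigma> (at q) = frechet_derivative \<sigma>' (at q)" if "q \<in> D" for q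
  by (rule frechet_derivative_transform_within_open[OF hol2_ambient_differentiable[OF hol that] assms(1) that assms(2)])
 moreover have "homeomorphism D (\<sigma> ` D) \<sigma>' \<tau>" if "homeomorphism D (\<sigma> ` D) \<sigma> \<tau>" for \<tau>
  by (rule homeomorphism_cong[OF that]) (use assms(2) in auto)
 ultimately show ?thesis using assms(3) hol2_ambient_cong[OF assms(1,2) hol] unfolding local_param_def im by auto
qed

lemma local_param_subset:
 assumes l: "local_param V D \<sigma>" and D': "open D'" "D' \<subseteq> D" and W: "open W" "\<sigma> ` D' = \<sigma> ` D Int W"
 shows "local_param (V Int W) D' \<sigma>"
proof -
 obtain \<tau> where \<tau>: "homeomorphism D (\<sigma> ` D) \<sigma> \<tau>" using l by (auto simp: local_param_def)
 have "openin (top_of_set V) (\<sigma> ` D)" using l by (simp add: local_param_def)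
 then obtain S where S: "open S" "\<sigma> ` D = V Int S" unfolding openin_open by auto
 have "\<sigma> ` D' = (V Int W) Int S" using S(2) W(2) by auto
 then have "openin (top_of_set (V Int W)) (\<sigma> ` D')" using S(1) by (auto simp: openin_open)
 moreover have "homeomorphism D' (\<sigma> ` D') \<sigma> \<tau>" by (rule homeomorphism_of_subsets[OF \<tau> D'(2)]) (use D'(2) in auto)
 ultimately show ?thesis using l D' hol2_ambient_subset unfolding local_param_def by blast
qed

lemma local_param_superset:
 assumes "local_param (V Int W) D \<sigma>" "open W" shows "local_param V D \<sigma>"
proof -
 have "openin (top_of_set V) (\<sigma> ` D)" using assms by (auto simp: local_param_def intro: openin_trans)
 then show ?thesis using assms(1) by (simp add: local_param_def)
qed

lemma regular_locus_restrict:
 fixes V :: "'n::finite ambient set"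
 assumes W: "open W" shows "regular_locus (V Int W) = regular_locus V Int W"
proof (intro set_eqI iffI)
 fix v assume "v \<in> regular_locus (V Int W)"
 then obtain D \<sigma> where D: "local_param (V Int W) D \<sigma>" "v \<in> \<sigma> ` D" by (auto simp: regular_locus_def)
 then have "\<sigma> ` D \<subseteq> V Int W" by (auto simp: local_param_def dest: openin_imp_subset)
 then show "v \<in> regular_locus V Int W" using D local_param_superset[OF D(1) W] by (auto simp: regular_locus_def)
next
 fix v assume "v \<in> regular_locus V Int W"
 then obtain D \<sigma> where D: "local_param V D \<sigma>" "v \<in> \<sigma> ` D" "v \<in> W" by (auto simp: regular_locus_def)
 have "open (D Int \<sigma> -` W)"
  using D(1) W by (intro continuous_open_preimage hol2_ambient_continuous) (auto simp: local_param_def)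
 then have "local_param (V Int W) (D Int \<sigma> -` W) \<sigma>" by (rule local_param_subset[OF D(1) _ _ W]) auto
 moreover have "v \<in> \<sigma> ` (D Int \<sigma> -` W)" using D(2,3) by auto
 ultimately show "v \<in> regular_locus (V Int W)" by (auto simp: regular_locus_def)
qed

text \<open>The integrability hypothesis holds only near the origin, while a resolution comes with
  its own neighbourhood. All conditions are local on the target, so they survive on the preimage of
  an open set.\<close>

proposition resolution_restrict:
 fixes V :: "'n::finite ambient set" and \<rho> :: "'a => 'n ambient"
 assumes res: "resolution V X At \<rho>" and W: "open W"
 defines "P \<equiv> {p \<in> topspace X. \<rho> p \<in> W}"
 shows "resolution (V Int W) (subtopology X P) ((%(Q, \<kappa>). (Q Int P, \<kappa>)) ` At) \<rho>"
proof -
 have surf: "complex_surface X At" using res by (simp add: resolution_def)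
 have ch: "openin X Q" "Q \<subseteq> topspace X" "open (\<kappa> ` Q)" "homeomorphic_map (subtopology X Q) (top_of_set (\<kappa> ` Q)) \<kappa>"
   "inj_on \<kappa> Q" "hol2_ambient_on (%q. \<rho> (inv_into Q \<kappa> q)) (\<kappa> ` Q)"
  if "(Q, \<kappa>) \<in> At" for Q \<kappa>
 proof -
  show a: "openin X Q" "open (\<kappa> ` Q)" "homeomorphic_map (subtopology X Q) (top_of_set (\<kappa> ` Q)) \<kappa>"
   using surf that by (auto simp: complex_surface_def)
  show b: "Q \<subseteq> topspace X" using a(1) openin_subset by auto
  show "inj_on \<kappa> Q" using homeomorphic_imp_injective_map[OF a(3)] b by (simp add: Int_absorb1)
  show "hol2_ambient_on (%q. \<rho> (inv_into Q \<kappa> q)) (\<kappa> ` Q)" using res that by (auto simp: resolution_def)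
 qed
 have PQ: "openin X (Q Int P)" if Q: "(Q, \<kappa>) \<in> At" for Q \<kappa>
 proof -
  have "continuous_map (subtopology X Q) (top_of_set (\<kappa> ` Q)) \<kappa>"
   using ch(4)[OF Q] by (rule homeomorphic_imp_continuous_map)
  moreover have "continuous_map (top_of_set (\<kappa> ` Q)) euclidean (%q. \<rho> (inv_into Q \<kappa> q))"
   using hol2_ambient_continuous[OF ch(6)[OF Q]] by simp
  ultimately have "continuous_map (subtopology X Q) euclidean ((%q. \<rho> (inv_into Q \<kappa> q)) \<circ> \<kappa>)"
   by (rule continuous_map_compose)
  then have "openin (subtopology X Q) {p \<in> topspace (subtopology X Q). ((%q. \<rho> (inv_into Q \<kappa> q)) \<circ> \<kappa>) p \<in> W}"
   by (rule openin_continuous_map_preimage) (use W in simp)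
  moreover have "{p \<in> topspace (subtopology X Q). ((%q. \<rho> (inv_into Q \<kappa> q)) \<circ> \<kappa>) p \<in> W} = Q Int P"
   using ch(2,5)[OF Q] by (auto simp: P_def)
  ultimately show ?thesis using ch(1)[OF Q] openin_trans_full by metis
 qed
 have cover: "(\<Union>(Q, \<kappa>)\<in>At. Q) = topspace X" using surf by (simp add: complex_surface_def)
 have P: "openin X P"
 proof -
  have "openin X (\<Union>(Q, \<kappa>)\<in>At. Q Int P)" using PQ by (intro openin_Union) auto
  moreover have "(\<Union>(Q, \<kappa>)\<in>At. Q Int P) = topspace X Int P" unfolding cover[symmetric] by auto
  moreover have "topspace X Int P = P" by (auto simp: P_def)
  ultimately show ?thesis by simp
 qed
 have top: "topspace (subtopology X P) = P" by (auto simp: P_def)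
 \<comment> \<open>Inverse charts are \<open>inv_into\<close> of a set and thus formally change when
   the set shrinks; injectivity on \<open>Q\<close> shows that the values do not.\<close>
 have inv: "inv_into (Q Int P) \<kappa> q = inv_into Q \<kappa> q" if Q: "(Q, \<kappa>) \<in> At" and q: "q \<in> \<kappa> ` (Q Int P)" for Q \<kappa> q
 proof -
  obtain p where p: "p \<in> Q" "p \<in> P" "q = \<kappa> p" using q by auto
  have "inj_on \<kappa> (Q Int P)" using ch(5)[OF Q] by (rule inj_on_subset) auto
  then show ?thesis using p ch(5)[OF Q] by simp
 qed
 have op: "open (\<kappa> ` G)" if Q: "(Q, \<kappa>) \<in> At" and G: "G \<subseteq> Q" "openin X G" for Q \<kappa> G
 proof -
  have "openin (subtopology X Q) G" using G by (auto simp: openin_subtopology)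
  then have "openin (top_of_set (\<kappa> ` Q)) (\<kappa> ` G)"
   using homeomorphic_imp_open_map[OF ch(4)[OF Q]] by (simp add: open_map_def)
  then show ?thesis using ch(3)[OF Q] openin_open_eq by auto
 qed
 have opP: "open (\<kappa> ` (Q Int P))" if Q: "(Q, \<kappa>) \<in> At" for Q \<kappa> by (rule op[OF Q _ PQ[OF Q]]) auto
 have hom: "homeomorphic_map (subtopology (subtopology X P) (Q Int P)) (top_of_set (\<kappa> ` (Q Int P))) \<kappa>" if Q: "(Q, \<kappa>) \<in> At" for Q \<kappa>
 proof -
  have "homeomorphic_map (subtopology (subtopology X Q) (Q Int P)) (subtopology (top_of_set (\<kappa> ` Q)) (\<kappa> ` (Q Int P))) \<kappa>"
   by (rule homeomorphic_map_subtopologies[OF ch(4)[OF Q]]) (use ch(2)[OF Q] in auto)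
  moreover have "Q Int (Q Int P) = P Int (Q Int P)" "\<kappa> ` Q Int \<kappa> ` (Q Int P) = \<kappa> ` (Q Int P)" by auto
  ultimately show ?thesis by (simp add: subtopology_subtopology)
 qed
 have tr: "(%q. fst (\<kappa>' (inv_into (Q Int P) \<kappa> q))) hol2_on \<kappa> ` ((Q Int P) Int (Q' Int P)) &
   (%q. snd (\<kappa>' (inv_into (Q Int P) \<kappa> q))) hol2_on \<kappa> ` ((Q Int P) Int (Q' Int P))"
  if Q: "(Q, \<kappa>) \<in> At" and Q': "(Q', \<kappa>') \<in> At" for Q \<kappa> Q' \<kappa>'
 proof -
  have o: "open (\<kappa> ` ((Q Int P) Int (Q' Int P)))" by (rule op[OF Q _ openin_Int[OF PQ[OF Q] PQ[OF Q']]]) auto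
  have "(%q. fst (\<kappa>' (inv_into Q \<kappa> q))) hol2_on \<kappa> ` (Q Int Q')" "(%q. snd (\<kappa>' (inv_into Q \<kappa> q))) hol2_on \<kappa> ` (Q Int Q')"
   using surf Q Q' unfolding complex_surface_def by fastforce+
  then have h: "(%q. fst (\<kappa>' (inv_into Q \<kappa> q))) hol2_on \<kappa> ` ((Q Int P) Int (Q' Int P))" "(%q. snd (\<kappa>' (inv_into Q \<kappa> q))) hol2_on \<kappa> ` ((Q Int P) Int (Q' Int P))"
   by (auto elim!: hol2_on_subset)
  have e: "inv_into Q \<kappa> q = inv_into (Q Int P) \<kappa> q" if "q \<in> \<kappa> ` ((Q Int P) Int (Q' Int P))" for q
   using inv[OF Q, of q] that by auto
  show ?thesis using hol2_on_cong[OF o _ h(1)] hol2_on_cong[OF o _ h(2)] e by simp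
 qed
 have "complex_surface (subtopology X P) ((%(Q, \<kappa>). (Q Int P, \<kappa>)) ` At)"
  unfolding complex_surface_def
 proof (intro conjI)
  show "Hausdorff_space (subtopology X P)" "second_countable (subtopology X P)"
   using surf by (auto simp: complex_surface_def Hausdorff_space_subtopology second_countable_subtopology)
  have "(\<Union>(Q, \<kappa>)\<in>At. Q Int P) = topspace X Int P" unfolding cover[symmetric] by auto
  then show "(\<Union>(Q, \<kappa>)\<in>(%(Q, \<kappa>). (Q Int P, \<kappa>)) ` At. Q) = topspace (subtopology X P)"
   by (auto simp: case_prod_beta)
  have "openin (subtopology X P) (Q Int P)" if "(Q, \<kappa>) \<in> At" for Q \<kappa>
   using ch(1)[OF that] by (auto simp: openin_subtopology)
  then show "ALL (Q, \<kappa>):(%(Q, \<kappa>). (Q Int P, \<kappa>)) ` At. openin (subtopology X P) Q & open (\<kappa> ` Q) &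
   homeomorphic_map (subtopology (subtopology X P) Q) (top_of_set (\<kappa> ` Q)) \<kappa>"
   using opP hom by auto
  show "ALL (Q, \<kappa>):(%(Q, \<kappa>). (Q Int P, \<kappa>)) ` At. ALL (Q', \<kappa>'):(%(Q, \<kappa>). (Q Int P, \<kappa>)) ` At.
   (%q. fst (\<kappa>' (inv_into Q \<kappa> q))) hol2_on \<kappa> ` (Q Int Q') &
   (%q. snd (\<kappa>' (inv_into Q \<kappa> q))) hol2_on \<kappa> ` (Q Int Q')"
   using tr by auto
 qed
 moreover have "hol2_ambient_on (%q. \<rho> (inv_into (Q Int P) \<kappa> q)) (\<kappa> ` (Q Int P))" if Q: "(Q, \<kappa>) \<in> At" for Q \<kappa>
  by (rule hol2_ambient_cong[OF opP[OF Q] _ hol2_ambient_subset[OF ch(6)[OF Q]]]) (use inv[OF Q] in auto)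
 moreover have "\<rho> ` P = V Int W" using res by (auto simp: resolution_def P_def)
 moreover have "proper_map (subtopology X P) (top_of_set (V Int W)) \<rho>"
 proof -
  have "proper_map (subtopology X P) (subtopology (top_of_set V) W) \<rho>"
   by (rule proper_map_restriction) (use res in "auto simp: resolution_def P_def")
  then show ?thesis by (simp add: subtopology_subtopology)
 qed
 moreover have reg: "{x \<in> P. \<rho> x \<in> regular_locus (V Int W)} = P Int {x \<in> topspace X. \<rho> x \<in> regular_locus V}"
  unfolding regular_locus_restrict[OF W] by (auto simp: P_def)
 moreover have "subtopology X P closure_of (P Int {x \<in> topspace X. \<rho> x \<in> regular_locus V}) = P"
 proof -
  have d: "X closure_of {x \<in> topspace X. \<rho> x \<in> regular_locus V} = topspace X" using res by (simp add: resolution_def)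
  have "subtopology X P closure_of (P Int {x \<in> topspace X. \<rho> x \<in> regular_locus V}) = P Int X closure_of (P Int {x \<in> topspace X. \<rho> x \<in> regular_locus V})"
   by (rule closure_of_subtopology_open) (use P in simp)
  also have "\<dots> = P Int X closure_of {x \<in> topspace X. \<rho> x \<in> regular_locus V}"
   by (rule openin_Int_closure_of_eq[OF P, symmetric])
  finally show ?thesis unfolding d by (auto simp: P_def)
 qed
 moreover have "inj_on \<rho> (P Int {x \<in> topspace X. \<rho> x \<in> regular_locus V})"
  using res by (auto simp: resolution_def intro: inj_on_subset)
 moreover have "local_param (V Int W) (\<kappa> ` {x \<in> Q Int P. \<rho> x \<in> regular_locus (V Int W)}) (%q. \<rho> (inv_into (Q Int P) \<kappa> q))"
  if Q: "(Q, \<kappa>) \<in> At" for Q \<kappa>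
 proof -
  let ?\<sigma> = "%q. \<rho> (inv_into Q \<kappa> q)"
  let ?D = "\<kappa> ` {x \<in> Q. \<rho> x \<in> regular_locus V}" and ?D' = "\<kappa> ` {x \<in> Q Int P. \<rho> x \<in> regular_locus (V Int W)}"
  have lp: "local_param V ?D ?\<sigma>" using res Q by (auto simp: resolution_def)
  have e: "?D' = ?D Int ?\<sigma> -` W"
   unfolding regular_locus_restrict[OF W] using ch(2,5)[OF Q] by (auto simp: P_def)
  have "open (?D Int ?\<sigma> -` W)"
   using lp W by (intro continuous_open_preimage hol2_ambient_continuous) (auto simp: local_param_def)
  then have o: "open ?D'" by (simp only: e)
  have im: "g ` (A Int g -` W) = g ` A Int W" for g :: "complex \<times> complex => 'n ambient" and A by blast
  have "local_param (V Int W) ?D' ?\<sigma>" by (rule local_param_subset[OF lp o _ W]) (simp_all only: e im Int_lower1)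
  moreover have "\<rho> (inv_into Q \<kappa> q) = \<rho> (inv_into (Q Int P) \<kappa> q)" if "q \<in> ?D'" for q
  proof -
   have "q \<in> \<kappa> ` (Q Int P)" using that by blast
   then show ?thesis by (simp only: inv[OF Q])
  qed
  ultimately show ?thesis by (rule local_param_cong[OF o, rotated])
 qed
 ultimately show ?thesis unfolding resolution_def top by auto
qed

section \<open>Points and sheets of the cyclic cover\<close>

lemma root_branch:
 assumes F: "F hol2_on U" "open U" and p0: "p0 \<in> U" and w0: "w0 ^ m = F p0" "w0 ~= 0" and m: "m >= 1"
 obtains T b where "open T" "p0 \<in> T" "T \<subseteq> U" "b hol2_on T" "b p0 = w0" "!!p. p \<in> T ==> b p ^ m = F p" "!!p. p \<in> T ==> b p ~= 0"
proof -
 have F0: "F p0 ~= 0" using w0 by (metis power_not_zero)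
 define T where "T = U Int (%p. F p / F p0) -` (- \<real>\<^sub>\<le>\<^sub>0)"
 define b where "b = (%p. w0 * exp (Ln (F p / F p0) / of_nat m))"
 have h: "(%p. F p / F p0) hol2_on U" using F0 by (intro hol2_intros F) auto
 have Th: "(%p. F p / F p0) hol2_on T" by (rule hol2_on_subset[OF h]) (auto simp: T_def)
 have T: "open T" unfolding T_def
  by (intro continuous_open_preimage hol2_on_continuous[OF h] F) auto
 show thesis
 proof (rule that[of T b])
  show "p0 \<in> T" using p0 F0 by (simp add: T_def)
  show "b hol2_on T" unfolding b_def
   by (intro hol2_intros hol2_on_compose1[where g = Ln and A = "- \<real>\<^sub>\<le>\<^sub>0", OF _ _ Th])
    (use m in "auto simp: T_def intro!: holomorphic_intros")
  show "b p0 = w0" using F0 by (simp add: b_def)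
  fix p assume p: "p \<in> T"
  then have "F p / F p0 ~= 0" by (auto simp: T_def)
  then have "exp (Ln (F p / F p0) / of_nat m) ^ m = F p / F p0" using m by (simp flip: exp_of_nat_mult)
  then show "b p ^ m = F p" using F0 w0(1) by (simp add: b_def power_mult_distrib)
  show "b p ~= 0" using w0(2) by (simp add: b_def)
 qed (use T in "auto simp: T_def")
qed

lemma root_near:
 assumes F: "F hol2_on U" "open U" and p0: "p0 \<in> U" and w0: "w0 ^ m = F p0" and m: "m >= 1" and e: "e > 0"
 shows "\<forall>\<^sub>F p in nhds p0. EX w. w ^ m = F p & cmod (w - w0) < e"
proof (cases "w0 = 0")
 case True
 have "isCont F p0" using hol2_on_continuous[OF F(1)] continuous_on_eq_continuous_at[OF F(2)] p0 by blast
 then have "(F \<longlongrightarrow> F p0) (nhds p0)" using tendsto_at_iff_tendsto_nhds[of F p0] by (simp add: isCont_def)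
 then have "((%p. cmod (F p)) \<longlongrightarrow> 0) (nhds p0)" using tendsto_norm_zero w0 True m by (metis power_0_left not_one_le_zero)
 then have "\<forall>\<^sub>F p in nhds p0. cmod (F p) < e ^ m" using e by (intro order_tendstoD(2)) auto
 then show ?thesis
 proof eventually_elim
  case (elim p)
  obtain w where w: "w ^ m = F p" using exists_complex_root[of m "F p"] m by (metis not_one_le_zero)
  then have "cmod w ^ m < e ^ m" using elim by (metis norm_power)
  then have "cmod w < e" using e by (auto intro: power_less_imp_less_base)
  then show ?case using w True by auto
 qed
next
 case False
 obtain T b where T: "open T" "p0 \<in> T" "b hol2_on T" "b p0 = w0" "!!p. p \<in> T ==> b p ^ m = F p"
  by (rule root_branch[OF F p0 w0 False m]) blast
 have "isCont b p0" using hol2_on_continuous[OF T(3)] continuous_on_eq_continuous_at[OF T(1)] T(2) by blast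
 then have "(b \<longlongrightarrow> w0) (nhds p0)" using tendsto_at_iff_tendsto_nhds[of b p0] T(4) by (simp add: isCont_def)
 then have "\<forall>\<^sub>F p in nhds p0. dist (b p) w0 < e" using e by (rule tendstoD)
 moreover have "\<forall>\<^sub>F p in nhds p0. p \<in> T" using T by (intro eventually_nhds_in_open)
 ultimately show ?thesis by eventually_elim (use T(5) in "auto simp: dist_norm")
qed

locale cyclic_cover =
 fixes F :: "'n::finite => cfun" and m :: "'n => nat" and N V :: "'n ambient set"
 assumes N: "open N" and F: "!!i. F i hol2_on fst ` N" and m1: "!!i. m i >= 1"
  and V_def: "V = {w \<in> N. ALL i. snd w $ i ^ m i = F i (fst w)}"
begin

lemma open_fstN: "open (fst ` N)" by (rule open_fst_image[OF N])

text \<open>Near such a point the roots have holomorphic branches, and the surface is the graph of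
  these over the base. The set \<open>G\<close> keeps the other sheets away.\<close>

lemma regular_of_nonzero:
 assumes v: "(v :: 'n ambient) \<in> V" "!!i. snd (v :: 'n ambient) $ i ~= 0" shows "v \<in> regular_locus V"
proof -
 have vN: "fst v \<in> fst ` N" "v \<in> N" using v by (auto simp: V_def)
 have "EX T b. open T & fst v \<in> T & b hol2_on T & b (fst v) = snd v $ i & (ALL p:T. b p ^ m i = F i p & b p ~= 0)" for i
 proof -
  have "snd v $ i ^ m i = F i (fst v)" using v(1) by (simp add: V_def)
  from root_branch[OF F open_fstN vN(1) this v(2) m1] show ?thesis by metis
 qed
 then obtain T b where Tb: "!!i. open (T i)" "!!i. fst v \<in> T i" "!!i. b i hol2_on T i" "!!i. b i (fst v) = snd v $ i"
  "!!i p. p \<in> T i ==> b i p ^ m i = F i p" "!!i p. p \<in> T i ==> b i p ~= 0" by metis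
 define \<sigma> where "\<sigma> = (%p. (p, \<chi> i. b i p))"
 define T' where "T' = (\<Inter>i. T i)"
 have T': "open T'" unfolding T'_def using Tb(1) by (intro open_INT) auto
 have h: "hol2_ambient_on \<sigma> T'"
  unfolding hol2_ambient_on_def \<sigma>_def by (auto intro!: hol2_on_fst hol2_on_snd hol2_on_subset[OF Tb(3)] simp: T'_def)
 define D where "D = T' Int \<sigma> -` N"
 have D: "open D" unfolding D_def by (intro continuous_open_preimage hol2_ambient_continuous h T' N)
 have hD: "hol2_ambient_on \<sigma> D" by (rule hol2_ambient_subset[OF h]) (auto simp: D_def)
 have "\<sigma> (fst v) = v" using Tb(4) by (simp add: \<sigma>_def vec_lambda_eta)
 then have vD: "fst v \<in> D" "v \<in> \<sigma> ` D" using vN Tb(2) by (auto simp: D_def T'_def image_iff intro: bexI[of _ "fst v"])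
 \<comment> \<open>\<open>e\<close> separates 1 from all other roots of unity involved: a ratio of
   two roots within distance \<open>e\<close> of 1 equals 1, so only the chosen branch meets
   \<open>G\<close>.\<close>
 have "finite (\<Union>i. {z::complex. z ^ m i = 1})" using m1 by (auto intro!: finite_roots_unity)
 then obtain e where e: "e > 0" "!!i z. z ^ m i = 1 ==> z ~= 1 ==> e <= dist 1 (z::complex)"
  using finite_set_avoid[of "\<Union>i. {z::complex. z ^ m i = 1}" 1] by auto
 define G where "G = (\<Inter>i. fst -` D Int (%v :: 'n ambient. cmod (snd v $ i / b i (fst v) - 1)) -` {..<e})"
 have "open G" unfolding G_def
 proof (intro open_INT ballI continuous_open_preimage)
  fix i
  have "continuous_on (fst -` D) (%v :: 'n ambient. b i (fst v))"
   by (rule continuous_on_compose2[OF hol2_on_continuous[OF Tb(3)]]) (auto intro!: continuous_intros simp: D_def T'_def)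
  then show "continuous_on (fst -` D) (%v :: 'n ambient. cmod (snd v $ i / b i (fst v) - 1))"
   by (intro continuous_intros) (use Tb(6) in "auto simp: D_def T'_def")
  show "open (fst -` D :: 'n ambient set)" using D by (intro open_vimage continuous_intros)
 qed auto
 moreover have "\<sigma> ` D = V Int G"
 proof (intro set_eqI iffI)
  fix w assume "w \<in> \<sigma> ` D"
  then obtain p where p: "p \<in> D" "w = \<sigma> p" by auto
  then have "p \<in> T i" for i by (auto simp: D_def T'_def)
  then show "w \<in> V Int G" using p Tb(5,6) e(1) by (auto simp: V_def D_def G_def \<sigma>_def)
 next
  fix w assume w: "w \<in> V Int G"
  then have wD: "fst w \<in> D" by (auto simp: G_def)
  then have wT: "fst w \<in> T i" for i by (auto simp: D_def T'_def)
  have "snd w $ i = b i (fst w)" for i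
  proof (rule ccontr)
   assume ne: "snd w $ i ~= b i (fst w)"
   have "snd w $ i ^ m i = b i (fst w) ^ m i" using w Tb(5)[OF wT] by (simp add: V_def)
   then have "(snd w $ i / b i (fst w)) ^ m i = 1" using Tb(6)[OF wT, of i] by (simp add: power_divide)
   moreover have "snd w $ i / b i (fst w) ~= 1" using ne Tb(6)[OF wT, of i] by simp
   ultimately have "e <= dist 1 (snd w $ i / b i (fst w))" by (rule e(2))
   moreover have "cmod (snd w $ i / b i (fst w) - 1) < e" using w by (auto simp: G_def)
   ultimately show False by (simp add: dist_norm norm_minus_commute)
  qed
  then have "w = \<sigma> (fst w)" by (simp add: \<sigma>_def prod_eq_iff vec_eq_iff)
  then show "w \<in> \<sigma> ` D" using wD by auto
 qed
 ultimately have oi: "openin (top_of_set V) (\<sigma> ` D)" by (auto simp: openin_open)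
 have "inj (frechet_derivative \<sigma> (at q))" if "q \<in> D" for q
 proof -
  have "(\<sigma> has_derivative frechet_derivative \<sigma> (at q)) (at q)"
   using hol2_ambient_differentiable[OF hD that] frechet_derivative_works by blast
  then have "((%p. fst (\<sigma> p)) has_derivative (%x. fst (frechet_derivative \<sigma> (at q) x))) (at q)"
   by (rule has_derivative_fst)
  moreover have "((%p. fst (\<sigma> p)) has_derivative (%x. x)) (at q)" by (simp add: \<sigma>_def has_derivative_ident)
  ultimately have "(%x. fst (frechet_derivative \<sigma> (at q) x)) = (%x. x)" by (rule has_derivative_unique)
  then show ?thesis by (metis injI)
 qed
 moreover have "homeomorphism D (\<sigma> ` D) \<sigma> fst"
  by (rule homeomorphismI[OF hol2_ambient_continuous[OF hD]]) (auto intro!: continuous_intros simp: \<sigma>_def)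
 ultimately have "local_param V D \<sigma>" using D hD oi by (auto simp: local_param_def)
 then show ?thesis using vD by (auto simp: regular_locus_def)
qed

text \<open>Openness of the projection to the base: the roots can be chosen to vary continuously
  with the base point, also where some of them are zero.\<close>

lemma roots_spread:
 assumes v: "v \<in> V" and W: "open W" "v \<in> W"
 shows "\<forall>\<^sub>F p in nhds (fst v). EX w. (p, w) \<in> V Int W"
proof -
 have vN: "fst v \<in> fst ` N" "v \<in> N" using v by (auto simp: V_def)
 obtain A B where AB: "open A" "open B" "v \<in> A \<times> B" "A \<times> B \<subseteq> N Int W"
  by (rule open_prod_elim[OF open_Int[OF N W(1)], of v]) (use vN W in auto)
 obtain e where e: "e > 0" "ball (snd v) e \<subseteq> B" using AB(2,3) by (auto elim: openE)
 define eps where "eps = e / (real CARD('n) + 1)"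
 have eps: "eps > 0" using e by (simp add: eps_def add_pos_pos)
 have "\<forall>\<^sub>F p in nhds (fst v). EX w. w ^ m i = F i p & cmod (w - snd v $ i) < eps" for i
  by (rule root_near[OF F open_fstN vN(1) _ m1 eps]) (use v in "simp add: V_def")
 then have "\<forall>\<^sub>F p in nhds (fst v). ALL i. EX w. w ^ m i = F i p & cmod (w - snd v $ i) < eps"
  by (intro eventually_all_finite) auto
 moreover have "\<forall>\<^sub>F p in nhds (fst v). p \<in> A" using AB by (intro eventually_nhds_in_open) auto
 ultimately show ?thesis
 proof eventually_elim
  case (elim p)
  then obtain w' where w': "!!i. w' i ^ m i = F i p & cmod (w' i - snd v $ i) < eps" by metis
  define w where "w = (\<chi> i. w' i)"
  have "norm (w - snd v) <= (\<Sum>i\<in>UNIV. cmod ((w - snd v) $ i))" unfolding norm_vec_def by (rule L2_set_le_sum) simp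
  also have "\<dots> <= (\<Sum>i\<in>(UNIV :: 'n set). eps)" using w' by (intro sum_mono) (auto simp: w_def less_imp_le)
  also have "\<dots> = real CARD('n) * eps" by simp
  also have "\<dots> < (real CARD('n) + 1) * eps" using eps by simp
  also have "\<dots> = e" by (simp add: eps_def add_pos_pos[THEN less_imp_neq, symmetric])
  finally have "w \<in> B" using e(2) by (auto simp: dist_norm norm_minus_commute)
  then have "(p, w) \<in> N Int W" using AB(4) elim(2) by blast
  moreover have "(p, w) \<in> V" using \<open>(p, w) \<in> N Int W\<close> w' by (simp add: V_def w_def)
  ultimately show ?case by blast
 qed
qed

end

text \<open>The resolution is taken from the membership for \<open>j1\<close>, since the surface
  does not involve \<open>j\<close>. On each chart the coefficient of the form for \<open>j2\<close>
  is a quotient of holomorphic functions, square integrable by change of variables, and the division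
  theorem extends it.\<close>

theorem quasiadj_of_lint:
 fixes f :: "'n::finite => germ"
 assumes \<phi>: "\<phi> \<in> quasiadj_ideal f j1 m" and f0: "!!i. f i ~= 0" and m: "!!i. m i >= 1"
  and int: "lint (wt (rep_germ \<phi>) (%i. rep_germ (f i)) (expo j2 m))"
 shows "\<phi> \<in> quasiadj_ideal f j2 m"
proof -
 let ?F = "%i. rep_germ (f i)"
 let ?w = "wt (rep_germ \<phi>) ?F (expo j2 m)"
 obtain N and X :: "real topology" and At \<rho> where N: "open N" "0 \<in> N" "rep_germ \<phi> hol2_on fst ` N" "!!i. ?F i hol2_on fst ` N"
  and res: "resolution (cover_surface f m N) X At \<rho>"
  using \<phi> unfolding quasiadj_ideal_def by auto
 obtain U where U: "open U" "0 \<in> U" "?w L1_on U" using int unfolding lint_def by blast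
 have "0 \<in> fst ` N" using N(2) by (force simp: zero_prod_def)
 then obtain \<delta> where \<delta>: "\<delta> > 0" "ball 0 \<delta> \<subseteq> fst ` N Int U"
  using openE[OF open_Int[OF open_fst_image[OF N(1)] U(1)], of 0] U(2) by auto
 define B0 where "B0 = ball (0 :: complex \<times> complex) \<delta>"
 have B0: "open B0" "convex B0" "0 \<in> B0" "B0 \<subseteq> fst ` N" "B0 \<subseteq> U" using \<delta> by (auto simp: B0_def)
 define W :: "'n ambient set" where "W = fst -` B0"
 have W: "open W" unfolding W_def using B0(1) by (intro open_vimage continuous_intros)
 have im: "fst ` (N Int W) = B0"
 proof -
  have "fst ` (N Int W) = fst ` N Int B0" by (force simp: W_def)
  then show ?thesis using B0(4) by blast
 qed
 have NW: "open (N Int W)" "0 \<in> N Int W" using N(1,2) W B0(3) by (auto simp: W_def)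
 define V' where "V' = cover_surface f m N Int W"
 have V': "V' = cover_surface f m (N Int W)" by (auto simp: V'_def cover_surface_def)
 define X' where "X' = subtopology X {p \<in> topspace X. \<rho> p \<in> W}"
 define At' where "At' = (%(Q, \<kappa>). (Q Int {p \<in> topspace X. \<rho> p \<in> W}, \<kappa>)) ` At"
 have res': "resolution V' X' At' \<rho>" unfolding V'_def X'_def At'_def by (rule resolution_restrict[OF res W])
 have \<phi>B: "rep_germ \<phi> hol2_on B0" and FB: "?F i hol2_on B0" for i using N(3,4) B0(4) hol2_on_subset by blast+
 interpret cyclic_cover ?F m "N Int W" V'
  by unfold_locales (use N(1) W FB m in "auto simp: im V' cover_surface_def")
 have "form_extends \<phi> j2 m At' \<rho>"
  unfolding form_extends_def Let_def
 proof (intro ballI, unfold split_paired_all split)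
  fix Q \<kappa> assume Q: "(Q, \<kappa>) \<in> At'"
  interpret chart ?F m V' X' At' \<rho> Q \<kappa>
   by unfold_locales (use res' Q m in "auto simp: V_def")
  let ?\<sigma> = "%q. \<rho> (inv_into Q \<kappa> q)"
  have inB: "(x q, y q) \<in> B0" if "q \<in> D" for q
   using rho_V[OF that] by (auto simp: V'_def W_def)
  \<comment> \<open>If z_i vanished on an open piece of a chart, density of the regular part would
    give an open piece of the surface with z_i = 0. Its projection fills a neighbourhood in the
    base, so \<open>f i\<close> would vanish there and hence as a germ.\<close>
  have znz: "EX q:E. z i q ~= 0" if E: "open E" "E \<subseteq> D" "E ~= {}" for E i
  proof (rule ccontr)
   assume "~ (EX q:E. z i q ~= 0)"
   then have z0: "!!q. q \<in> E ==> z i q = 0" by blast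
   let ?reg = "{p \<in> topspace X'. \<rho> p \<in> regular_locus V'}"
   have "openin X' {p \<in> Q. \<kappa> p \<in> E}" by (rule openin_chart_preimage[OF E(1)])
   moreover have "{p \<in> Q. \<kappa> p \<in> E} ~= {}" using E(2,3) by auto
   ultimately have "?reg Int {p \<in> Q. \<kappa> p \<in> E} ~= {}"
    using res' dense_intersects_open[of X' ?reg] by (auto simp: resolution_def)
   then obtain p where p: "p \<in> Q" "\<kappa> p \<in> E" "\<rho> p \<in> regular_locus V'" by auto
   define R where "R = \<kappa> ` {x \<in> Q. \<rho> x \<in> regular_locus V'}"
   have lp: "local_param V' R ?\<sigma>" using res' Q by (auto simp: resolution_def R_def)
   then obtain \<tau> where \<tau>: "homeomorphism R (?\<sigma> ` R) ?\<sigma> \<tau>" by (auto simp: local_param_def)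
   have "openin (top_of_set R) (R Int E)" using E(1) by (simp add: openin_open_Int)
   then have "openin (top_of_set (?\<sigma> ` R)) (?\<sigma> ` (R Int E))" by (rule homeomorphism_imp_open_map[OF \<tau>])
   moreover have "openin (top_of_set V') (?\<sigma> ` R)" using lp by (simp add: local_param_def)
   ultimately have "openin (top_of_set V') (?\<sigma> ` (R Int E))" by (rule openin_trans)
   then obtain W2 where W2: "open W2" "?\<sigma> ` (R Int E) = V' Int W2" unfolding openin_open by auto
   have "\<kappa> p \<in> R Int E" using p by (auto simp: R_def)
   then have "?\<sigma> (\<kappa> p) \<in> V' Int W2" using W2(2) by blast
   then have pV: "\<rho> p \<in> V'" "\<rho> p \<in> W2" using inv1[OF p(1)] by auto
   have "\<forall>\<^sub>F p' in nhds (fst (\<rho> p)). ?F i p' = 0"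
    using roots_spread[OF pV(1) W2(1) pV(2)]
   proof eventually_elim
    case (elim p')
    then obtain w where w: "(p', w) \<in> V' Int W2" by blast
    then obtain q where q: "q \<in> E" "(p', w) = ?\<sigma> q" using W2(2) by blast
    then have "w $ i = 0" using z0[OF q(1)] by (metis snd_conv)
    moreover have "w $ i ^ m i = ?F i p'" using w by (auto simp: V_def)
    ultimately show ?case using m[of i] by (metis power_0_left not_one_le_zero)
   qed
   then obtain T where T: "open T" "fst (\<rho> p) \<in> T" "!!p'. p' \<in> T ==> ?F i p' = 0" by (auto simp: eventually_nhds)
   have "fst (\<rho> p) \<in> B0" using pV(1) by (simp add: V'_def W_def)
   then have "?F i p' = 0" if "p' \<in> B0" for p'
    using hol2_identity[OF FB B0(1,2) open_Int[OF T(1) B0(1)] Int_lower2 _ _ that, of "fst (\<rho> p)"] T by blast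
   then have "\<forall>\<^sub>F p in nhds 0. ?F i p = 0" using B0(1,3) by (auto simp: eventually_nhds)
   then show False using rep_germ_nonzero[OF f0] by blast
  qed
  have znz_all: "EX q:E. ALL i:I. z i q ~= 0" if "finite I" "open E" "E \<subseteq> D" "E ~= {}" for E I
   using that
  proof (induction I arbitrary: E rule: finite_induct)
   case (insert i I)
   define E' where "E' = E Int (%q. z i q) -` (- {0})"
   have "open E'" unfolding E'_def
    using insert.prems by (intro continuous_open_preimage continuous_on_subset[OF hol2_on_continuous[OF hol(3)]]) auto
   moreover have "E' ~= {}" using znz[OF insert.prems, of i] by (auto simp: E'_def)
   moreover have "E' \<subseteq> D" using insert.prems(2) by (auto simp: E'_def)
   ultimately obtain q where "q \<in> E'" "ALL i:I. z i q ~= 0" using insert.IH by blast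
   then show ?case by (auto simp: E'_def)
  qed auto
  define J where "J = jac (%q. x q) (%q. y q)"
  have J: "J hol2_on D" unfolding J_def using hol2_on_jac[OF hol(1,2) D_open] by simp
  \<comment> \<open>Both numerator and denominator carry an extra factor z_i for each i, so
    \<open>M1\<close> vanishes wherever some z_i does, even if \<open>m i = 1\<close>. There the
    quotient is 0 by convention, and integrability on \<open>B\<close> gives integrability on
    \<open>D\<close>.\<close>
  define N1 where "N1 = (%q. rep_germ \<phi> (x q, y q) * (\<Prod>i\<in>UNIV. z i q ^ (j2 i + 1)) * J q)"
  define M1 where "M1 = (%q. \<Prod>i\<in>UNIV. z i q ^ m i)"
  have N1: "N1 hol2_on D" unfolding N1_def
   by (intro hol2_intros hol(3) J hol2_on_compose[OF \<phi>B hol(1,2)] inB) auto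
  have M1: "M1 hol2_on D" unfolding M1_def by (intro hol2_intros hol(3))
  define B where "B = {q \<in> D. ALL i. z i q ~= 0}"
  have Bo: "open B" unfolding B_def by (rule open_nonzero[OF D_open]) simp
  have BD: "B \<subseteq> D" by (auto simp: B_def)
  have quot: "N1 q / M1 q = rep_germ \<phi> (x q, y q) * (\<Prod>i\<in>UNIV. z i q ^ j2 i) / (\<Prod>i\<in>UNIV. z i q ^ (m i - 1)) * J q"
   if q: "q \<in> B" for q
  proof -
   have z: "z i q ~= 0" for i using q by (simp add: B_def)
   have "(\<Prod>i\<in>UNIV. z i q ^ m i) = (\<Prod>i\<in>UNIV. z i q) * (\<Prod>i\<in>UNIV. z i q ^ (m i - 1))"
    unfolding prod.distrib[symmetric] using m by (intro prod.cong refl) (metis mult.commute power_minus_mult less_le_trans zero_less_one)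
   moreover have "(\<Prod>i\<in>UNIV. z i q ^ (j2 i + 1)) = (\<Prod>i\<in>UNIV. z i q) * (\<Prod>i\<in>UNIV. z i q ^ j2 i)"
    unfolding prod.distrib[symmetric] by simp
   moreover have "(\<Prod>i\<in>UNIV. z i q) ~= 0" using z by simp
   ultimately show ?thesis by (simp add: N1_def M1_def)
  qed
  have nz: "~ (\<forall>\<^sub>F q' in nhds q. M1 q' = 0)" if "q \<in> D" for q
  proof
   assume "\<forall>\<^sub>F q' in nhds q. M1 q' = 0"
   then obtain T where T: "open T" "q \<in> T" "!!q'. q' \<in> T ==> M1 q' = 0" by (auto simp: eventually_nhds)
   have "T Int D ~= {}" using T(2) \<open>q \<in> D\<close> by blast
   from znz_all[OF finite[of "UNIV :: 'n set"] open_Int[OF T(1) D_open] Int_lower2 this]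
   obtain q' where "q' \<in> T" "!!i. z i q' ~= 0" by blast
   then have "q' \<in> T" "M1 q' ~= 0" by (auto simp: M1_def)
   then show False using T(3) by blast
  qed
  have "(%q. ?w (x q, y q) * (cmod (jac (%q. x q) (%q. y q) q))^2) L1_on B"
  proof (rule absolutely_integrable_pullback_finite[where \<iota> = "%q i. sector (m i) (z i q)" and W = B0])
   show "(%q. x q) hol2_on B" "(%q. y q) hol2_on B" by (rule hol2_on_subset[OF hol(1) BD], rule hol2_on_subset[OF hol(2) BD])
   show "open B" by (rule Bo)
   have "(%q i. sector (m i) (z i q)) ` B \<subseteq> Pi UNIV (%i. range (sector (m i)))" by auto
   moreover have "finite (PiE UNIV (%i. range (sector (m i))))" by (intro finite_PiE finite_range_sector) auto
   ultimately show "finite ((%q i. sector (m i) (z i q)) ` B)" by (simp add: PiE_UNIV_domain finite_subset)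
   \<comment> \<open>Base point and sectors determine all roots, hence the point of the surface.
     This point is regular, so it has only one preimage in the resolution.\<close>
   have same: "q = q'" if q: "q \<in> B" "q' \<in> B" "x q = x q'" "y q = y q'" "!!i. sector (m i) (z i q) = sector (m i) (z i q')" for q q'
   proof -
    have D': "q \<in> D" "q' \<in> D" using q(1,2) by (auto simp: B_def)
    have "z i q = z i q'" for i
     by (rule sector_inj[OF m _ q(5)]) (use z_power[OF D'(1), of i] z_power[OF D'(2), of i] q(3,4) in metis)
    then have eq: "?\<sigma> q = ?\<sigma> q'" using q(3,4) by (simp add: prod_eq_iff vec_eq_iff)
    have reg: "inv_into Q \<kappa> q \<in> {p \<in> topspace X'. \<rho> p \<in> regular_locus V'}" if "q \<in> B" for q
    proof -
     have qD: "q \<in> D" using that by (simp add: B_def)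
     have "?\<sigma> q \<in> regular_locus V'" by (rule regular_of_nonzero[OF rho_V[OF qD]]) (use that in "simp add: B_def")
     then show ?thesis using inv2[OF qD] Q_sub by auto
    qed
    have "inj_on \<rho> {p \<in> topspace X'. \<rho> p \<in> regular_locus V'}" using res' by (simp add: resolution_def)
    then have "inv_into Q \<kappa> q = inv_into Q \<kappa> q'" by (rule inj_onD[OF _ eq reg[OF q(1)] reg[OF q(2)]])
    then show ?thesis using inv2[OF D'(1)] inv2[OF D'(2)] by metis
   qed
   show "inj_on (%q. (x q, y q)) {q \<in> B. jac (%q. x q) (%q. y q) q ~= 0 & (%i. sector (m i) (z i q)) = j}" for j
   proof (rule inj_onI)
    fix q q' assume a: "q \<in> {q \<in> B. jac (%q. x q) (%q. y q) q ~= 0 & (%i. sector (m i) (z i q)) = j}"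
     "q' \<in> {q \<in> B. jac (%q. x q) (%q. y q) q ~= 0 & (%i. sector (m i) (z i q)) = j}" "(x q, y q) = (x q', y q')"
    then have "sector (m i) (z i q) = sector (m i) (z i q')" for i by (metis (mono_tags, lifting) mem_Collect_eq)
    then show "q = q'" using a by (intro same) (blast | (simp only: prod.inject))+
   qed
   show "{q \<in> B. jac (%q. x q) (%q. y q) q ~= 0 & (%i. sector (m i) (z i q)) = j} \<in> sets lebesgue" for j
   proof -
    have o: "open {q \<in> B. J q ~= 0}"
    proof -
     have "open (B Int J -` (- {0}))"
      by (intro continuous_open_preimage continuous_on_subset[OF hol2_on_continuous[OF J] BD] Bo) auto
     moreover have "B Int J -` (- {0}) = {q \<in> B. J q ~= 0}" by auto
     ultimately show ?thesis by simp
    qed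
    have s: "{q \<in> B. sector (m i) (z i q) = j i} \<in> sets borel" for i
    proof -
     have "(%q. indicator B q *\<^sub>R z i q) \<in> borel_measurable borel"
      by (rule borel_measurable_continuous_on_indicator) (use Bo continuous_on_subset[OF hol2_on_continuous[OF hol(3)] BD] in auto)
     then have "(%q. indicator B q *\<^sub>R z i q) -` {w. sector (m i) w = j i} Int space borel \<in> sets borel"
      by (rule measurable_sets[OF _ sector_measurable])
     then have "B Int (%q. indicator B q *\<^sub>R z i q) -` {w. sector (m i) w = j i} \<in> sets borel" using Bo by auto
     moreover have "B Int (%q. indicator B q *\<^sub>R z i q) -` {w. sector (m i) w = j i} = {q \<in> B. sector (m i) (z i q) = j i}" by auto
     ultimately show ?thesis by simp
    qed
    have "{q \<in> B. J q ~= 0} Int (\<Inter>i. {q \<in> B. sector (m i) (z i q) = j i}) \<in> sets borel" using o s by (intro sets.Int sets.finite_INT) auto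
    moreover have "{q \<in> B. J q ~= 0} Int (\<Inter>i. {q \<in> B. sector (m i) (z i q) = j i}) =
     {q \<in> B. jac (%q. x q) (%q. y q) q ~= 0 & (%i. sector (m i) (z i q)) = j}"
     by (auto simp: J_def fun_eq_iff)
    ultimately show ?thesis by (auto intro: sets_completionI_sets)
   qed
   show "?w L1_on B0" by (rule absolutely_integrable_open_subset[OF U(3) B0(5,1)])
   show "(x q, y q) \<in> B0" if "q \<in> B" for q using inB that BD by blast
  qed
  then have NB: "(%q. (cmod (N1 q / M1 q))^2) L1_on B"
  proof (rule absolutely_integrable_cong)
   fix q assume q: "q \<in> B"
   then have q': "q \<in> D" "!!i. z i q ~= 0" by (auto simp: B_def)
   show "?w (x q, y q) * (cmod (jac (%q. x q) (%q. y q) q))^2 = (cmod (N1 q / M1 q))^2"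
    unfolding quot[OF q] using wt_chart[OF q', of "rep_germ \<phi>" j2] by (simp add: J_def)
  qed
  have "(%q. (cmod (N1 q / M1 q))^2) L1_on D"
  proof -
   have "(%q. (cmod (N1 q / M1 q))^2) L1_on D \<longleftrightarrow> (%q. (cmod (N1 q / M1 q))^2) L1_on B"
   proof (rule absolutely_integrable_spike_set_eq)
    have "M1 q = 0" if "q \<in> D - B" for q
    proof -
     obtain i where "z i q = 0" using \<open>q \<in> D - B\<close> by (auto simp: B_def)
     then have "z i q ^ m i = 0" using m[of i] by (simp add: power_0_left)
     then show ?thesis unfolding M1_def by (intro prod_zero) auto
    qed
    then have "{q \<in> D - B. (cmod (N1 q / M1 q))^2 ~= 0} = {}" by auto
    then show "negligible {q \<in> D - B. (cmod (N1 q / M1 q))^2 ~= 0}" by (simp only: negligible_empty)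
    have "{q \<in> B - D. (cmod (N1 q / M1 q))^2 ~= 0} = {}" using BD by auto
    then show "negligible {q \<in> B - D. (cmod (N1 q / M1 q))^2 ~= 0}" by (simp only: negligible_empty)
   qed
   then show ?thesis using NB by simp
  qed
  then have int': "EX U. open U & q \<in> U & (%q. (cmod (N1 q / M1 q))^2) L1_on U" if "q \<in> D" for q
   using D_open that by blast
  obtain g where g: "g hol2_on D" "!!q. q \<in> D ==> N1 q = g q * M1 q"
   by (rule l2_division[OF D_open N1 M1 nz int']) auto
  have "g q = rep_germ \<phi> (x q, y q) * (\<Prod>i\<in>UNIV. z i q ^ j2 i) / (\<Prod>i\<in>UNIV. z i q ^ (m i - 1)) * J q"
   if q: "q \<in> D" "ALL i. z i q ~= 0" for q
  proof -
   have "M1 q ~= 0" using q(2) by (simp add: M1_def)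
   then have "g q = N1 q / M1 q" using g(2)[OF q(1)] by simp
   then show ?thesis using quot[of q] q by (simp add: B_def)
  qed
  then show "EX g. g hol2_on D & (ALL q:D. (ALL i. z i q ~= 0) --> g q = rep_germ \<phi> (x q, y q) * (\<Prod>i\<in>UNIV. z i q ^ j2 i) / (\<Prod>i\<in>UNIV. z i q ^ (m i - 1)) *
     jac (%q. x q) (%q. y q) q)"
   using g(1) unfolding J_def by blast
 qed
 moreover note NW
 moreover have "rep_germ \<phi> hol2_on fst ` (N Int W)" "ALL i. ?F i hol2_on fst ` (N Int W)" unfolding im using \<phi>B FB by auto
 ultimately show ?thesis unfolding quasiadj_ideal_def using res'[unfolded V'] by blast
qed

section \<open>Wirtinger derivatives and integration by parts\<close>

text \<open>The general real-linear map: \<open>a\<close> and \<open>c\<close> are the derivatives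
  in x and y, \<open>b\<close> and \<open>d\<close> those in their conjugates.\<close>

definition wder :: "complex => complex => complex => complex => cfun"
 where "wder a b c d = (%(h, k). a * h + b * cnj h + c * k + d * cnj k)"

text \<open>\<open>Cw m u S\<close>: the function \<open>u\<close> is \<open>m\<close> times continuously differentiable on \<open>S\<close> in the real sense;
 derivatives are recorded by their Wirtinger components.\<close>

fun Cw :: "nat => cfun => (complex \<times> complex) set => bool" where
 "Cw 0 u S = continuous_on S u"
| "Cw (Suc m) u S = (EX a b c d. (ALL p:S. (u has_derivative wder (a p) (b p) (c p) (d p)) (at p)) &
  Cw m a S & Cw m b S & Cw m c S & Cw m d S)"

definition wx :: "cfun => cfun"
 where "wx u p = (frechet_derivative u (at p) (1, 0) - \<i> * frechet_derivative u (at p) (\<i>, 0)) / 2"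

definition wy :: "cfun => cfun"
 where "wy u p = (frechet_derivative u (at p) (0, 1) - \<i> * frechet_derivative u (at p) (0, \<i>)) / 2"

lemma wx_wy_eq:
 assumes "(u has_derivative wder a b c d) (at p)" shows "wx u p = a" "wy u p = c"
proof -
 have e: "frechet_derivative u (at p) = wder a b c d" using frechet_derivative_at[OF assms] by simp
 have i: "\<i> * (\<i> * z) = - z" for z by (simp flip: mult.assoc)
 show "wx u p = a" "wy u p = c"
  unfolding wx_def wy_def e wder_def by (simp_all add: algebra_simps i)
qed

lemma CwI:
 assumes "!!p. p \<in> S ==> (u has_derivative wder (a p) (b p) (c p) (d p)) (at p)"
  "Cw m a S" "Cw m b S" "Cw m c S" "Cw m d S" shows "Cw (Suc m) u S"
 unfolding Cw.simps using assms by blast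

lemma CwE:
 assumes "Cw (Suc m) u S"
 obtains a b c d where "!!p. p \<in> S ==> (u has_derivative wder (a p) (b p) (c p) (d p)) (at p)"
  "Cw m a S" "Cw m b S" "Cw m c S" "Cw m d S"
 using assms unfolding Cw.simps by blast

lemma Cw_cong:
 assumes "open S" "!!p. p \<in> S ==> u p = v p" "Cw m u S" shows "Cw m v S"
proof (cases m)
 case 0
 then show ?thesis using assms continuous_on_cong[of S S u v] by simp
next
 case (Suc n)
 show ?thesis using assms(3) unfolding Suc
 proof (rule CwE)
  fix a b c d assume "!!p. p \<in> S ==> (u has_derivative wder (a p) (b p) (c p) (d p)) (at p)"
   "Cw n a S" "Cw n b S" "Cw n c S" "Cw n d S"
  then show "Cw (Suc n) v S"
   by (intro CwI[of S v a b c d]) (auto intro: has_derivative_transform_within_open[OF _ assms(1) _ assms(2)])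
 qed
qed

lemma Cw_Suc: "Cw (Suc m) u S ==> Cw m u S"
proof (induction m arbitrary: u)
 case 0
 then obtain a b c d where "!!p. p \<in> S ==> (u has_derivative wder (a p) (b p) (c p) (d p)) (at p)"
  by (rule CwE) blast
 then show ?case using has_derivative_continuous continuous_at_imp_continuous_on by (metis Cw.simps(1))
next
 case (Suc m)
 obtain a b c d where "!!p. p \<in> S ==> (u has_derivative wder (a p) (b p) (c p) (d p)) (at p)"
  "Cw (Suc m) a S" "Cw (Suc m) b S" "Cw (Suc m) c S" "Cw (Suc m) d S"
  by (rule CwE[OF Suc.prems]) blast
 then show ?case by (intro CwI[of S u a b c d] Suc.IH)
qed

lemma Cw_le: "Cw n u S ==> m <= n ==> Cw m u S"
 by (induction n) (auto simp: le_Suc_eq simp del: Cw.simps dest: Cw_Suc)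

lemma Cw_continuous: "Cw m u S ==> continuous_on S u"
 using Cw_le[of m u S 0] by simp

lemma Cw_const: "Cw m (%_. c) S"
proof (induction m arbitrary: c)
 case (Suc m)
 have "wder 0 0 0 0 = (%_. 0)" by (auto simp: wder_def)
 then show ?case by (intro CwI[of S _ "%_. 0" "%_. 0" "%_. 0" "%_. 0"] Suc.IH) simp
qed simp

lemma Cw_add: "Cw m u S ==> Cw m v S ==> Cw m (%p. u p + v p) S"
proof (induction m arbitrary: u v)
 case (Suc m)
 obtain a b c d where u: "!!p. p \<in> S ==> (u has_derivative wder (a p) (b p) (c p) (d p)) (at p)"
  "Cw m a S" "Cw m b S" "Cw m c S" "Cw m d S" by (rule CwE[OF Suc.prems(1)]) blast
 obtain a' b' c' d' where v: "!!p. p \<in> S ==> (v has_derivative wder (a' p) (b' p) (c' p) (d' p)) (at p)"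
  "Cw m a' S" "Cw m b' S" "Cw m c' S" "Cw m d' S" by (rule CwE[OF Suc.prems(2)]) blast
 show ?case
 proof (rule CwI)
  show "((%p. u p + v p) has_derivative wder (a p + a' p) (b p + b' p) (c p + c' p) (d p + d' p)) (at p)" if "p \<in> S" for p
   by (rule has_derivative_eq_rhs[OF has_derivative_add[OF u(1)[OF that] v(1)[OF that]]])
    (auto simp: wder_def algebra_simps)
 qed (intro Suc.IH u v)+
qed (auto intro: continuous_intros)

lemma Cw_mult: "Cw m u S ==> Cw m v S ==> Cw m (%p. u p * v p) S"
proof (induction m arbitrary: u v)
 case (Suc m)
 obtain a b c d where u: "!!p. p \<in> S ==> (u has_derivative wder (a p) (b p) (c p) (d p)) (at p)"
  "Cw m a S" "Cw m b S" "Cw m c S" "Cw m d S" by (rule CwE[OF Suc.prems(1)]) blast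
 obtain a' b' c' d' where v: "!!p. p \<in> S ==> (v has_derivative wder (a' p) (b' p) (c' p) (d' p)) (at p)"
  "Cw m a' S" "Cw m b' S" "Cw m c' S" "Cw m d' S" by (rule CwE[OF Suc.prems(2)]) blast
 have uv: "Cw m u S" "Cw m v S" using Suc.prems Cw_Suc by blast+
 show ?case
 proof (rule CwI)
  show "((%p. u p * v p) has_derivative wder (u p * a' p + a p * v p) (u p * b' p + b p * v p) (u p * c' p + c p * v p) (u p * d' p + d p * v p)) (at p)" if "p \<in> S" for p
   by (rule has_derivative_eq_rhs[OF has_derivative_mult[OF u(1)[OF that] v(1)[OF that]]])
    (auto simp: wder_def algebra_simps)
 qed (intro Cw_add Suc.IH u v uv)+
qed (auto intro: continuous_intros)

lemma Cw_cnj: "Cw m u S ==> Cw m (%p. cnj (u p)) S"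
proof (induction m arbitrary: u)
 case (Suc m)
 obtain a b c d where u: "!!p. p \<in> S ==> (u has_derivative wder (a p) (b p) (c p) (d p)) (at p)"
  "Cw m a S" "Cw m b S" "Cw m c S" "Cw m d S" by (rule CwE[OF Suc.prems]) blast
 show ?case
 proof (rule CwI)
  show "((%p. cnj (u p)) has_derivative wder (cnj (b p)) (cnj (a p)) (cnj (d p)) (cnj (c p))) (at p)" if "p \<in> S" for p
   by (rule has_derivative_eq_rhs[OF has_derivative_cnj[OF u(1)[OF that]]]) (auto simp: wder_def)
 qed (intro Suc.IH u)+
qed (auto intro: continuous_intros)

lemma hol2_wder: "f hol2_on S ==> p \<in> S ==> (f has_derivative wder (pd1 f p) 0 (pd2 f p) 0) (at p)"
 using hol2_on_has_derivative[of f S p] by (simp add: wder_def)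

lemma Cw_hol2: "f hol2_on S ==> open S ==> Cw m f S"
proof (induction m arbitrary: f)
 case (Suc m)
 show ?case by (rule CwI[OF hol2_wder[OF Suc.prems(1)]]) (use Suc.prems in "auto intro!: Suc.IH Cw_const hol2_on_pd1 hol2_on_pd2")
qed (auto intro: hol2_on_continuous)

lemma Cw_prod: "(!!i. i \<in> I ==> Cw m (u i) S) ==> Cw m (%p. \<Prod>i\<in>I. u i p) S"
 by (induction I rule: infinite_finite_induct) (auto intro: Cw_mult Cw_const simp del: Cw.simps)

lemma Cw_power: "Cw m u S ==> Cw m (%p. u p ^ n) S"
 by (induction n) (auto intro: Cw_mult Cw_const simp del: Cw.simps)

lemma Cw_wx_wy:
 assumes "Cw (Suc m) u S" "open S" shows "Cw m (wx u) S" "Cw m (wy u) S"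
proof -
 obtain a b c d where u: "!!p. p \<in> S ==> (u has_derivative wder (a p) (b p) (c p) (d p)) (at p)"
  "Cw m a S" "Cw m b S" "Cw m c S" "Cw m d S" by (rule CwE[OF assms(1)]) blast
 show "Cw m (wx u) S" "Cw m (wy u) S"
  by (rule Cw_cong[OF assms(2) _ u(2)], use wx_wy_eq[OF u(1)] in simp)
   (rule Cw_cong[OF assms(2) _ u(4)], use wx_wy_eq[OF u(1)] in simp)
qed

lemma Cw_funpow: "Cw (m + k) u S ==> open S ==> Cw m ((wx ^^ k) u) S" "Cw (m + k) u S ==> open S ==> Cw m ((wy ^^ k) u) S"
proof (induction k arbitrary: m)
 case (Suc k)
 {
  case 1
  then show ?case using Suc.IH(1)[of "Suc m"] Cw_wx_wy(1) by (simp del: Cw.simps)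
 next
  case 2
  then show ?case using Suc.IH(2)[of "Suc m"] Cw_wx_wy(2) by (simp del: Cw.simps)
 }
qed simp_all

lemma w_mult:
 assumes "Cw (Suc m) u S" "Cw (Suc m') v S" "p \<in> S"
 shows "wx (%p. u p * v p) p = u p * wx v p + wx u p * v p" "wy (%p. u p * v p) p = u p * wy v p + wy u p * v p"
proof -
 obtain a b c d where u: "!!p. p \<in> S ==> (u has_derivative wder (a p) (b p) (c p) (d p)) (at p)" by (rule CwE[OF assms(1)]) blast
 obtain a' b' c' d' where v: "!!p. p \<in> S ==> (v has_derivative wder (a' p) (b' p) (c' p) (d' p)) (at p)" by (rule CwE[OF assms(2)]) blast
 have "((%p. u p * v p) has_derivative wder (u p * a' p + a p * v p) (u p * b' p + b p * v p) (u p * c' p + c p * v p) (u p * d' p + d p * v p)) (at p)"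
  by (rule has_derivative_eq_rhs[OF has_derivative_mult[OF u[OF assms(3)] v[OF assms(3)]]])
   (auto simp: wder_def algebra_simps)
 from wx_wy_eq[OF this] wx_wy_eq[OF u[OF assms(3)]] wx_wy_eq[OF v[OF assms(3)]]
 show "wx (%p. u p * v p) p = u p * wx v p + wx u p * v p" "wy (%p. u p * v p) p = u p * wy v p + wy u p * v p" by simp_all
qed

lemma w_hol2_cnj:
 assumes "A hol2_on S" "B hol2_on S" "open S" "!!p. p \<in> S ==> u p = A p * cnj (B p)" "p \<in> S"
 shows "wx u p = pd1 A p * cnj (B p)" "wy u p = pd2 A p * cnj (B p)"
proof -
 have "((%p. cnj (B p)) has_derivative wder 0 (cnj (pd1 B p)) 0 (cnj (pd2 B p))) (at p)"
  by (rule has_derivative_eq_rhs[OF has_derivative_cnj[OF hol2_wder[OF assms(2,5)]]]) (auto simp: wder_def)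
 note has_derivative_mult[OF hol2_wder[OF assms(1,5)] this]
 then have "((%p. A p * cnj (B p)) has_derivative wder (pd1 A p * cnj (B p)) (A p * cnj (pd1 B p)) (pd2 A p * cnj (B p)) (A p * cnj (pd2 B p))) (at p)"
  by (rule has_derivative_eq_rhs) (auto simp: wder_def algebra_simps)
 then have "(u has_derivative wder (pd1 A p * cnj (B p)) (A p * cnj (pd1 B p)) (pd2 A p * cnj (B p)) (A p * cnj (pd2 B p))) (at p)"
  by (rule has_derivative_transform_within_open[OF _ assms(3,5)]) (use assms(4) in simp)
 from wx_wy_eq[OF this] show "wx u p = pd1 A p * cnj (B p)" "wy u p = pd2 A p * cnj (B p)" .
qed

text \<open>The conjugate of a holomorphic function is killed by both operators, so it behaves like
  a constant. In this way an equation for multivalued powers becomes one for single-valued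
  products.\<close>

lemma w_funpow_hol2_cnj:
 assumes A: "A hol2_on S" and B: "B hol2_on S" and S: "open S" and u: "!!p. p \<in> S ==> u p = A p * cnj (B p)" and p: "p \<in> S"
 shows "(wx ^^ k) ((wy ^^ l) u) p = (pd1 ^^ k) ((pd2 ^^ l) A) p * cnj (B p)"
proof -
 have y: "(wy ^^ l) u p = (pd2 ^^ l) A p * cnj (B p)" if "p \<in> S" for p
  using that by (induction l arbitrary: p) (use u w_hol2_cnj(2)[OF hol2_on_funpow_pd2[OF A S] B S] in auto)
 show ?thesis
  using p by (induction k arbitrary: p) (use y w_hol2_cnj(1)[OF hol2_on_funpow_pd1[OF hol2_on_funpow_pd2[OF A S] S] B S] in auto)
qed

text \<open>This family is closed under differentiation: |z|^2 = z cnj(z) trades one unit of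
  \<open>\<sigma>\<close> for one factor z and one factor cnj(z).\<close>

definition pw :: "real => nat => nat => complex => complex"
 where "pw \<sigma> a b z = of_real (cmod z powr (2 * \<sigma>)) * z ^ a * cnj z ^ b"

text \<open>Away from 0 this is the product rule. At 0 the function is bounded by |z|^(2\<sigma>),
  which is o(|z|) exactly because 2\<sigma> > 1, and both coefficients on the right are
  zero.\<close>

lemma pw_has_derivative:
 assumes \<sigma>: "\<sigma> > 1 / 2"
 shows "(pw \<sigma> a b has_derivative (%h. (of_real \<sigma> + of_nat a) * pw (\<sigma> - 1) a (Suc b) z * h +
  (of_real \<sigma> + of_nat b) * pw (\<sigma> - 1) (Suc a) b z * cnj h)) (at z)"
proof (cases "z = 0")
 case True
 have "(pw \<sigma> a b has_derivative (%h. 0)) (at 0)"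
 proof (rule has_derivativeI_sandwich[of 1])
  fix y :: complex assume y: "y ~= 0" "dist y 0 < 1"
  have "cmod (pw \<sigma> a b y) <= cmod y powr (2 * \<sigma>) * 1 * 1"
   unfolding pw_def norm_mult norm_power using y by (intro mult_mono power_le_one) auto
  moreover have "cmod y powr (2 * \<sigma>) = cmod y * cmod y powr (2 * \<sigma> - 1)"
   using y by (simp add: powr_diff)
  ultimately show "norm (pw \<sigma> a b y - pw \<sigma> a b 0 - 0) / norm (y - 0) <= cmod y powr (2 * \<sigma> - 1)"
   using y \<sigma> by (simp add: pw_def divide_le_eq mult.commute)
 next
  have "((%y. cmod y powr (2 * \<sigma> - 1)) \<longlongrightarrow> cmod 0 powr (2 * \<sigma> - 1)) (at (0 :: complex))"
   using \<sigma> by (intro tendsto_powr2 tendsto_norm tendsto_const tendsto_ident_at) auto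
  then show "((%y. cmod y powr (2 * \<sigma> - 1)) \<longlongrightarrow> 0) (at 0)" by simp
 qed auto
 then show ?thesis using True by (simp add: pw_def[of "\<sigma> - 1"])
next
 case False
 have n: "((%z. cmod z powr (2 * \<sigma>)) has_derivative (%h. cmod z powr (2 * \<sigma>) * ((h \<bullet> sgn z) * (2 * \<sigma>) / cmod z))) (at z)"
 proof -
  have "(cmod has_derivative (%h. h \<bullet> sgn z)) (at z)" using has_derivative_norm[OF False] by (simp add: inner_commute)
  moreover have "DERIV (%x. x powr (2 * \<sigma>)) (cmod z) :> 2 * \<sigma> * cmod z powr (2 * \<sigma> - 1)"
   using False by (intro has_real_derivative_powr) auto
  ultimately have "((%z. cmod z powr (2 * \<sigma>)) has_derivative (%h. (h \<bullet> sgn z) * (2 * \<sigma> * cmod z powr (2 * \<sigma> - 1)))) (at z)"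
   by (rule DERIV_compose_FDERIV[rotated])
  then show ?thesis by (rule has_derivative_eq_rhs) (use False in "auto simp: powr_diff")
 qed
 have "((%z. of_real (cmod z powr (2 * \<sigma>)) :: complex) has_derivative (%h. of_real \<sigma> * (pw (\<sigma> - 1) 0 1 z * h + pw (\<sigma> - 1) 1 0 z * cnj h))) (at z)"
 proof (rule has_derivative_eq_rhs[OF has_derivative_of_real[OF n]], rule ext)
  fix h
  have e: "of_real (h \<bullet> z) * 2 = cnj z * h + z * cnj h"
   by (simp add: complex_eq_iff inner_complex_def)
  have "cmod z powr (2 * \<sigma>) * ((h \<bullet> sgn z) * (2 * \<sigma>) / cmod z) = \<sigma> * cmod z powr (2 * (\<sigma> - 1)) * ((h \<bullet> z) * 2)"
  proof -
   have "cmod z powr (2 * \<sigma>) = cmod z powr (2 * (\<sigma> - 1)) * (cmod z * cmod z)"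
    using False by (simp add: right_diff_distrib powr_diff powr_numeral power2_eq_square)
   then show ?thesis using False by (simp add: sgn_div_norm field_simps)
  qed
  then have "of_real (cmod z powr (2 * \<sigma>) * ((h \<bullet> sgn z) * (2 * \<sigma>) / cmod z)) = of_real \<sigma> * of_real (cmod z powr (2 * (\<sigma> - 1))) * (of_real (h \<bullet> z) * 2 :: complex)"
   by (simp only: of_real_mult of_real_numeral)
  then show "of_real (cmod z powr (2 * \<sigma>) * ((h \<bullet> sgn z) * (2 * \<sigma>) / cmod z)) = of_real \<sigma> * (pw (\<sigma> - 1) 0 1 z * h + pw (\<sigma> - 1) 1 0 z * cnj h)"
   unfolding e pw_def by (simp add: algebra_simps)
 qed
 moreover have derp: "((%z. z ^ n) has_field_derivative of_nat n * z ^ (n - 1)) (at z)" for n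
  by (rule derivative_eq_intros refl | simp)+
 moreover have "((%z. z ^ a) has_derivative (%h. of_nat a * z ^ (a - 1) * h)) (at z)"
  using derp[of a] by (simp add: has_field_derivative_def)
 moreover have "((%z. cnj z ^ b) has_derivative (%h. of_nat b * cnj z ^ (b - 1) * cnj h)) (at z)"
 proof -
  have "((%z. cnj (z ^ b)) has_derivative (%h. cnj (of_nat b * z ^ (b - 1) * h))) (at z)"
   using derp[of b] by (intro has_derivative_cnj) (simp add: has_field_derivative_def)
  then show ?thesis by simp
 qed
 ultimately have d: "((%z. of_real (cmod z powr (2 * \<sigma>)) * z ^ a * cnj z ^ b) has_derivative
  (%h. (of_real (cmod z powr (2 * \<sigma>)) * z ^ a) * (of_nat b * cnj z ^ (b - 1) * cnj h) +
   (of_real (cmod z powr (2 * \<sigma>)) * (of_nat a * z ^ (a - 1) * h) + of_real \<sigma> * (pw (\<sigma> - 1) 0 1 z * h + pw (\<sigma> - 1) 1 0 z * cnj h) * z ^ a) * cnj z ^ b)) (at z)"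
  by (intro has_derivative_mult)
 have r: "of_real (cmod z powr (2 * \<sigma>)) = of_real (cmod z powr (2 * (\<sigma> - 1))) * (z * cnj z)"
 proof -
  have "cmod z powr (2 * \<sigma>) = cmod z powr (2 * (\<sigma> - 1)) * (cmod z)^2"
   using False by (simp add: right_diff_distrib powr_diff powr_numeral)
  then show ?thesis by (simp only: of_real_mult complex_norm_square)
 qed
 have a: "of_nat a * (z * z ^ (a - 1)) = of_nat a * z ^ a" by (cases a) auto
 have b: "of_nat b * (cnj z * cnj z ^ (b - 1)) = of_nat b * cnj z ^ b" by (cases b) auto
 show ?thesis unfolding pw_def[abs_def]
 proof (rule has_derivative_eq_rhs[OF d], rule ext)
  fix h
  define R where "R = (of_real (cmod z powr (2 * (\<sigma> - 1))) :: complex)"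
  have "(of_real (cmod z powr (2 * \<sigma>)) * z ^ a) * (of_nat b * cnj z ^ (b - 1) * cnj h) +
   (of_real (cmod z powr (2 * \<sigma>)) * (of_nat a * z ^ (a - 1) * h) + of_real \<sigma> * (pw (\<sigma> - 1) 0 1 z * h + pw (\<sigma> - 1) 1 0 z * cnj h) * z ^ a) * cnj z ^ b
   = R * z * z ^ a * (of_nat b * (cnj z * cnj z ^ (b - 1))) * cnj h + R * cnj z * (of_nat a * (z * z ^ (a - 1))) * cnj z ^ b * h
    + of_real \<sigma> * (R * cnj z * h + R * z * cnj h) * z ^ a * cnj z ^ b"
   unfolding r R_def[symmetric] pw_def by (simp add: algebra_simps)
  also have "\<dots> = (of_real \<sigma> + of_nat a) * (R * z ^ a * cnj z ^ Suc b) * h + (of_real \<sigma> + of_nat b) * (R * z ^ Suc a * cnj z ^ b) * cnj h"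
   unfolding a b by (simp add: algebra_simps)
  finally show "(of_real (cmod z powr (2 * \<sigma>)) * z ^ a) * (of_nat b * cnj z ^ (b - 1) * cnj h) +
   (of_real (cmod z powr (2 * \<sigma>)) * (of_nat a * z ^ (a - 1) * h) + of_real \<sigma> * (pw (\<sigma> - 1) 0 1 z * h + pw (\<sigma> - 1) 1 0 z * cnj h) * z ^ a) * cnj z ^ b
   = (of_real \<sigma> + of_nat a) * (of_real (cmod z powr (2 * (\<sigma> - 1))) * z ^ a * cnj z ^ Suc b) * h + (of_real \<sigma> + of_nat b) * (of_real (cmod z powr (2 * (\<sigma> - 1))) * z ^ Suc a * cnj z ^ b) * cnj h"
   by (simp only: R_def)
 qed
qed

text \<open>Each derivative costs one unit of \<open>\<sigma>\<close>. The condition keeps the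
  exponent above 1 before each step, as differentiability at zeros demands, and positive at the end,
  for continuity.\<close>

lemma Cw_pw:
 assumes f: "f hol2_on S" "open S" shows "real m < \<sigma> ==> Cw m (%p. pw \<sigma> a b (f p)) S"
proof (induction m arbitrary: \<sigma> a b)
 case 0
 then show ?case unfolding Cw.simps pw_def
  by (intro continuous_intros continuous_on_powr' hol2_on_continuous[OF f(1)]) auto
next
 case (Suc m)
 let ?A = "%p. (of_real \<sigma> + of_nat a) * pw (\<sigma> - 1) a (Suc b) (f p)"
 let ?B = "%p. (of_real \<sigma> + of_nat b) * pw (\<sigma> - 1) (Suc a) b (f p)"
 show ?case
 proof (rule CwI)
  fix p assume p: "p \<in> S"
  have "((%p. pw \<sigma> a b (f p)) has_derivative (%h. ?A p * wder (pd1 f p) 0 (pd2 f p) 0 h + ?B p * cnj (wder (pd1 f p) 0 (pd2 f p) 0 h))) (at p)"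
   by (rule has_derivative_compose[OF hol2_wder[OF f(1) p] pw_has_derivative]) (use Suc.prems in simp)
  then show "((%p. pw \<sigma> a b (f p)) has_derivative wder (?A p * pd1 f p) (?B p * cnj (pd1 f p)) (?A p * pd2 f p) (?B p * cnj (pd2 f p))) (at p)"
   by (rule has_derivative_eq_rhs) (auto simp: wder_def algebra_simps)
 next
  have A: "Cw m ?A S" and B: "Cw m ?B S" using Suc.prems by (auto intro!: Cw_mult Cw_const Suc.IH)
  have P: "Cw m (pd1 f) S" "Cw m (pd2 f) S" using f by (auto intro!: Cw_hol2 hol2_on_pd1 hol2_on_pd2)
  show "Cw m (%p. ?A p * pd1 f p) S" "Cw m (%p. ?A p * pd2 f p) S" by (rule Cw_mult[OF A P(1)], rule Cw_mult[OF A P(2)])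
  show "Cw m (%p. ?B p * cnj (pd1 f p)) S" "Cw m (%p. ?B p * cnj (pd2 f p)) S"
   by (rule Cw_mult[OF B Cw_cnj[OF P(1)]], rule Cw_mult[OF B Cw_cnj[OF P(2)]])
 qed
qed

text \<open>Difference quotients integrate to zero by translation invariance. They are bounded by
  \<open>B * norm e\<close> on a slightly larger ball and vanish outside it, so dominated
  convergence carries the integral to the limit.\<close>

lemma integral_directional_derivative:
 fixes u :: "'a::euclidean_space => complex"
 assumes d: "!!p. (u has_derivative D p) (at p)" and B: "!!p h. norm (D p h) <= B * norm h"
  and supp: "!!p. p ~: cball 0 R ==> u p = 0"
 shows "integrable lborel (%p. D p e)" "(\<integral>p. D p e \<partial>lborel) = 0"
proof -
 have cont: "continuous_on UNIV u"
  by (rule continuous_at_imp_continuous_on) (rule ballI, rule has_derivative_continuous[OF d])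
 have um: "u \<in> borel_measurable borel" using cont by (rule borel_measurable_continuous_onI)
 have "(%p. indicator (cball 0 R) p *\<^sub>R u p) = u" using supp by (auto simp: indicator_def fun_eq_iff)
 moreover have "integrable lborel (%p. indicator (cball 0 R) p *\<^sub>R u p)"
  by (rule borel_integrable_compact[OF compact_cball continuous_on_subset[OF cont]]) simp
 ultimately have ui: "integrable lborel u" by simp
 have sh: "integrable lborel (%p. u (t + p))" "(\<integral>p. u (t + p) \<partial>lborel) = (\<integral>p. u p \<partial>lborel)" for t
 proof -
  have "integrable (distr lborel borel ((+) t)) u" using ui by (simp add: lborel_distr_plus)
  then show "integrable lborel (%p. u (t + p))" by (subst (asm) integrable_distr_eq) (use um in auto)
  have "(\<integral>p. u p \<partial>lborel) = (\<integral>p. u p \<partial>distr lborel borel ((+) t))" by (simp add: lborel_distr_plus)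
  also have "\<dots> = (\<integral>p. u (t + p) \<partial>lborel)" by (rule integral_distr) (use um in auto)
  finally show "(\<integral>p. u (t + p) \<partial>lborel) = (\<integral>p. u p \<partial>lborel)" by simp
 qed
 have B0: "B * norm e >= 0" using B[of 0 e] norm_ge_zero order_trans by blast
 define g where "g = (%n p. real (Suc n) *\<^sub>R (u ((1 / real (Suc n)) *\<^sub>R e + p) - u p))"
 have lip: "norm (u q - u p) <= B * norm (q - p)" for p q
  by (rule differentiable_bound[of UNIV u D]) (use d B has_derivative_bounded_linear in "auto intro!: onorm_le")
 have lim: "(%n. g n p) \<longlonglongrightarrow> D p e" for p
 proof -
  have "((%t. u (p + t *\<^sub>R e)) has_derivative (%t. D p (t *\<^sub>R e))) (at (0 :: real))"
   by (rule has_derivative_compose[of "%t. p + t *\<^sub>R e" _ _ _ u]) (auto intro!: derivative_eq_intros d)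
  then have "(%t. norm (u (p + t *\<^sub>R e) - u p - D p (t *\<^sub>R e)) / norm t) \<midarrow>(0::real)\<rightarrow> 0"
   by (simp add: has_derivative_at)
  moreover have "\<forall>\<^sub>F t in at (0::real). norm (u (p + t *\<^sub>R e) - u p - D p (t *\<^sub>R e)) / norm t = norm ((u (p + t *\<^sub>R e) - u p) /\<^sub>R t - D p e)"
   unfolding eventually_at_filter
  proof (intro always_eventually allI impI)
   fix t :: real assume t: "t ~= 0"
   have "(u (p + t *\<^sub>R e) - u p) /\<^sub>R t - D p e = (u (p + t *\<^sub>R e) - u p - D p (t *\<^sub>R e)) /\<^sub>R t"
    using t linear_cmul[OF has_derivative_linear[OF d], of p t e] by (simp add: scaleR_diff_right)
   then show "norm (u (p + t *\<^sub>R e) - u p - D p (t *\<^sub>R e)) / norm t = norm ((u (p + t *\<^sub>R e) - u p) /\<^sub>R t - D p e)"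
    by (simp add: divide_inverse mult.commute)
  qed
  ultimately have "((%t. norm ((u (p + t *\<^sub>R e) - u p) /\<^sub>R t - D p e)) \<longlongrightarrow> 0) (at (0::real))"
   by (simp only: tendsto_cong)
  then have "((%t. (u (p + t *\<^sub>R e) - u p) /\<^sub>R t) \<longlongrightarrow> D p e) (at (0::real))"
   by (rule LIM_zero_cancel[OF tendsto_norm_zero_cancel])
  moreover have "filterlim (%n. 1 / real (Suc n)) (at 0) sequentially"
   unfolding filterlim_at using LIMSEQ_inverse_real_of_nat by (auto simp: inverse_eq_divide)
  ultimately have "(%n. (u (p + (1 / real (Suc n)) *\<^sub>R e) - u p) /\<^sub>R (1 / real (Suc n))) \<longlonglongrightarrow> D p e"
   by (rule filterlim_compose)
  then show ?thesis by (simp add: g_def add.commute)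
 qed
 have bd: "norm (g n p) <= B * norm e * indicator (cball 0 (R + norm e)) p" for n p
 proof (cases "p \<in> cball 0 (R + norm e)")
  case True
  have "norm (g n p) = real (Suc n) * norm (u ((1 / real (Suc n)) *\<^sub>R e + p) - u p)" by (simp add: g_def)
  also have "\<dots> <= real (Suc n) * (B * norm ((1 / real (Suc n)) *\<^sub>R e + p - p))" by (intro mult_left_mono lip) auto
  also have "\<dots> = B * norm e" by simp
  finally show ?thesis using True by simp
 next
  case False
  have le: "norm ((1 / real (Suc n)) *\<^sub>R e) <= norm e" by (simp add: divide_le_eq mult_le_cancel_left1)
  have "norm p <= norm ((1 / real (Suc n)) *\<^sub>R e + p) + norm ((1 / real (Suc n)) *\<^sub>R e)"
   using norm_triangle_ineq4[of "(1 / real (Suc n)) *\<^sub>R e + p" "(1 / real (Suc n)) *\<^sub>R e"] by simp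
  then have "(1 / real (Suc n)) *\<^sub>R e + p ~: cball 0 R" "p ~: cball 0 R"
   using le False norm_ge_zero[of e] unfolding mem_cball_0 by linarith+
  then have "u ((1 / real (Suc n)) *\<^sub>R e + p) = 0" "u p = 0" using supp by blast+
  then show ?thesis using False by (simp add: g_def)
 qed
 have w: "integrable lborel (%p. B * norm e * indicator (cball 0 (R + norm e)) p :: real)"
  by (intro integrable_mult_right integrable_real_indicator emeasure_bounded_finite) auto
 have gm: "g n \<in> borel_measurable lborel" for n unfolding g_def using um by measurable
 have Dm: "(%p. D p e) \<in> borel_measurable lborel" by (rule borel_measurable_LIMSEQ_metric[OF gm lim])
 show "integrable lborel (%p. D p e)"
  by (rule integrable_dominated_convergence[where s = g, OF Dm gm w]) (use lim bd in auto)
 have "(%n. \<integral>p. g n p \<partial>lborel) \<longlonglongrightarrow> (\<integral>p. D p e \<partial>lborel)"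
  by (rule integral_dominated_convergence[where s = g, OF Dm gm w]) (use lim bd in auto)
 moreover have "(\<integral>p. g n p \<partial>lborel) = 0" for n
  unfolding g_def using Bochner_Integration.integral_diff[OF sh(1) ui] sh(2) by simp
 ultimately show "(\<integral>p. D p e \<partial>lborel) = 0" by (simp add: LIMSEQ_const_iff)
qed

text \<open>A polynomial in the coordinates and their conjugates, positive inside
  \<open>PD r\<close> and zero on its boundary. It is not cut off itself; the integrals carry the
  indicator, and high powers provide the flatness at the boundary.\<close>

definition bump :: "real => cfun"
 where "bump r p = (of_real (r^2) - fst p * cnj (fst p)) * (of_real (r^2) - snd p * cnj (snd p))"

lemma bump_real: "bump r p = of_real ((r^2 - (cmod (fst p))^2) * (r^2 - (cmod (snd p))^2))"
 unfolding bump_def complex_norm_square[symmetric] by simp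

lemma Cw_bump: "open S ==> Cw m (bump r) S"
proof -
 assume S: "open S"
 have c: "Cw m (%p. fst p) S" "Cw m (%p. snd p) S" using S by (auto intro!: Cw_hol2 hol2_on_fst hol2_on_snd simp del: Cw.simps)
 have "Cw m (%p. (of_real (r^2) + (- 1) * (fst p * cnj (fst p))) * (of_real (r^2) + (- 1) * (snd p * cnj (snd p)))) S"
  by (intro Cw_mult Cw_add Cw_const Cw_cnj c)
 then show ?thesis by (simp add: bump_def[abs_def] del: Cw.simps)
qed

lemma bump_bound:
 assumes q: "q \<in> PD r" and p: "p ~: PD r" shows "cmod (bump r q) <= 2 * r ^ 3 * norm (q - p)"
proof -
 have r: "r > 0" using q by (auto simp: PD_def intro: le_less_trans[OF norm_ge_zero])
 have le: "(r^2 - (cmod a)^2) * (r^2 - (cmod b)^2) <= 2 * r ^ 3 * d"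
  if "cmod a < r" "cmod b < r" "r - cmod a <= d" for a b d
 proof -
  have "r^2 - (cmod a)^2 = (r - cmod a) * (r + cmod a)" by (simp add: power2_eq_square algebra_simps)
  also have "\<dots> <= d * (2 * r)" using that r by (intro mult_mono) auto
  finally have "(r^2 - (cmod a)^2) * (r^2 - (cmod b)^2) <= (d * (2 * r)) * r^2"
   using that r by (intro mult_mono) (auto intro: power_mono simp: power_mono)
  then show ?thesis by (simp add: power2_eq_square power3_eq_cube mult_ac)
 qed
 have q': "cmod (fst q) < r" "cmod (snd q) < r" using q by (auto simp: PD_def)
 have nn: "0 <= (r^2 - (cmod (fst q))^2) * (r^2 - (cmod (snd q))^2)"
  using q' by (intro mult_nonneg_nonneg) (auto intro: power_mono)
 have n: "cmod (fst q - fst p) <= norm (q - p)" "cmod (snd q - snd p) <= norm (q - p)"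
  using norm_fst_le[of "fst (q - p)" "snd (q - p)"] norm_snd_le[of "snd (q - p)" "fst (q - p)"] by (simp_all add: minus_prod_def)
 consider "cmod (fst p) >= r" | "cmod (snd p) >= r" using p by (cases p) (auto simp: PD_def not_less)
 then have "(r^2 - (cmod (fst q))^2) * (r^2 - (cmod (snd q))^2) <= 2 * r ^ 3 * norm (q - p)"
 proof cases
  case 1
  then have "r - cmod (fst q) <= norm (q - p)" using norm_triangle_ineq3[of "fst p" "fst q"] n(1) by (simp add: norm_minus_commute)
  then show ?thesis by (rule le[OF q'])
 next
  case 2
  then have "r - cmod (snd q) <= norm (q - p)" using norm_triangle_ineq3[of "snd p" "snd q"] n(2) by (simp add: norm_minus_commute)
  then show ?thesis using le[OF q'(2,1)] by (simp add: mult.commute)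
 qed
 then show ?thesis using nn unfolding bump_real norm_of_real by simp
qed

text \<open>Two factors of \<open>bump\<close> make the function cut off at the boundary of order |q
  - p|^2 near every outside or boundary point \<open>p\<close>, hence differentiable there with
  derivative 0. So the integral of a derivative of a compactly supported function is at
  hand.\<close>

lemma integral_wx_zero:
 assumes h: "Cw 1 h S" and S: "open S" "cball 0 r \<times> cball 0 r \<subseteq> S" and r: "r > 0"
 defines "u \<equiv> %p. (bump r p)^2 * h p"
 shows "(\<integral>p. indicator (PD r) p *\<^sub>R wx u p \<partial>lborel) = 0" "(\<integral>p. indicator (PD r) p *\<^sub>R wy u p \<partial>lborel) = 0"
proof -
 let ?K = "cball (0::complex) r \<times> cball (0::complex) r"
 have K: "compact ?K" by (intro compact_Times compact_cball)
 have PK: "PD r \<subseteq> ?K" by (auto simp: PD_def)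
 have bd: "EX B>=0. ALL p:?K. cmod (g p) <= B" if "continuous_on S g" for g :: cfun
 proof -
  have "bounded (g ` ?K)" by (intro compact_imp_bounded compact_continuous_image K continuous_on_subset[OF that S(2)])
  then obtain B where B: "!!p. p \<in> ?K ==> cmod (g p) <= B" unfolding bounded_iff by blast
  then show ?thesis by (intro exI[of _ "max B 0"]) (auto intro: order_trans[OF B])
 qed
 have "Cw (Suc 0) u S" unfolding u_def using h by (intro Cw_mult Cw_power Cw_bump S) simp
 then obtain a b c d where D: "!!p. p \<in> S ==> (u has_derivative wder (a p) (b p) (c p) (d p)) (at p)"
  and cont: "Cw 0 a S" "Cw 0 b S" "Cw 0 c S" "Cw 0 d S" by (rule CwE) blast
 define ind where "ind = (%p. indicator (PD r) p :: complex)"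
 define v where "v = (%p. ind p * u p)"
 define E where "E = (%p. wder (ind p * a p) (ind p * b p) (ind p * c p) (ind p * d p))"
 obtain Bh where Bh: "Bh >= 0" "!!p. p \<in> ?K ==> cmod (h p) <= Bh" using bd[OF Cw_continuous[OF h]] by blast
 have vE: "(v has_derivative E p) (at p)" for p
 proof (cases "p \<in> PD r")
  case True
  then have "(v has_derivative wder (a p) (b p) (c p) (d p)) (at p)"
   by (intro has_derivative_transform_within_open[OF D open_PD True]) (use PK S(2) in "auto simp: v_def ind_def")
  then show ?thesis using True by (simp add: E_def ind_def)
 next
  case False
  have "(v has_derivative (%_. 0)) (at p)"
  proof (rule has_derivativeI_sandwich[of 1])
   fix q assume "q ~= p"
   have "cmod (v q) <= (2 * r ^ 3)^2 * Bh * (norm (q - p))^2"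
   proof (cases "q \<in> PD r")
    case True
    have "cmod (v q) = (cmod (bump r q))^2 * cmod (h q)" using True by (simp add: v_def u_def ind_def norm_mult norm_power)
    also have "\<dots> <= (2 * r ^ 3 * norm (q - p))^2 * Bh"
     using True PK by (intro mult_mono power_mono bump_bound False Bh) auto
    finally show ?thesis by (simp add: power_mult_distrib mult_ac)
   qed (use Bh in "simp add: v_def ind_def")
   moreover have "v p = 0" using False by (simp add: v_def ind_def)
   ultimately show "norm (v q - v p - 0) / norm (q - p) <= (2 * r ^ 3)^2 * Bh * norm (q - p)"
    using \<open>q ~= p\<close> by (simp add: divide_le_eq power2_eq_square mult_ac)
  next
   show "((%q. (2 * r ^ 3)^2 * Bh * norm (q - p)) \<longlongrightarrow> 0) (at p)"
    by (auto intro!: tendsto_eq_intros)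
  qed auto
  moreover have "E p = (%_. 0)" using False by (auto simp: E_def ind_def wder_def)
  ultimately show ?thesis by simp
 qed
 have "continuous_on S a" "continuous_on S b" "continuous_on S c" "continuous_on S d" using cont by simp_all
 from bd[OF this(1)] bd[OF this(2)] bd[OF this(3)] bd[OF this(4)]
 obtain Ba Bb Bc Bd where B: "Ba >= 0" "Bb >= 0" "Bc >= 0" "Bd >= 0" "!!p. p \<in> ?K ==> cmod (a p) <= Ba" "!!p. p \<in> ?K ==> cmod (b p) <= Bb"
  "!!p. p \<in> ?K ==> cmod (c p) <= Bc" "!!p. p \<in> ?K ==> cmod (d p) <= Bd" by metis
 have EB: "norm (E p e) <= (Ba + Bb + Bc + Bd) * norm e" for p e
 proof (cases "p \<in> PD r")
  case True
  then have pK: "p \<in> ?K" using PK by blast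
  have n: "cmod (fst e) <= norm e" "cmod (snd e) <= norm e"
   using norm_fst_le[of "fst e" "snd e"] norm_snd_le[of "snd e" "fst e"] by simp_all
  have "E p e = a p * fst e + b p * cnj (fst e) + c p * snd e + d p * cnj (snd e)"
   using True by (simp add: E_def ind_def wder_def case_prod_beta)
  also have "norm \<dots> <= cmod (a p) * cmod (fst e) + cmod (b p) * cmod (fst e) + cmod (c p) * cmod (snd e) + cmod (d p) * cmod (snd e)"
   by (intro norm_triangle_le add_mono) (simp_all add: norm_mult)
  also have "\<dots> <= Ba * norm e + Bb * norm e + Bc * norm e + Bd * norm e"
   by (intro add_mono mult_mono B n pK) (use B in auto)
  finally show ?thesis by (simp add: algebra_simps)
 next
  case False
  then show ?thesis using B by (simp add: E_def ind_def wder_def case_prod_beta)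
 qed
 have supp: "v p = 0" if "p ~: cball 0 (2 * r)" for p
 proof -
  have "norm p <= cmod (fst p) + cmod (snd p)" using norm_Pair_le[of "fst p" "snd p"] by simp
  then have "p ~: PD r" using that by (auto simp: PD_def)
  then show ?thesis by (simp add: v_def ind_def)
 qed
 note I = integral_directional_derivative[OF vE EB supp]
 have wxy: "indicator (PD r) p *\<^sub>R wx u p = (E p (1, 0) - \<i> * E p (\<i>, 0)) / 2" "indicator (PD r) p *\<^sub>R wy u p = (E p (0, 1) - \<i> * E p (0, \<i>)) / 2" for p
 proof -
  have i: "\<i> * (\<i> * z) = - z" for z by (simp flip: mult.assoc)
  show "indicator (PD r) p *\<^sub>R wx u p = (E p (1, 0) - \<i> * E p (\<i>, 0)) / 2" "indicator (PD r) p *\<^sub>R wy u p = (E p (0, 1) - \<i> * E p (0, \<i>)) / 2"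
   using wx_wy_eq[OF D, of p] PK S(2) by (cases "p \<in> PD r"; auto simp: E_def wder_def ind_def algebra_simps i)+
 qed
 show "(\<integral>p. indicator (PD r) p *\<^sub>R wx u p \<partial>lborel) = 0" "(\<integral>p. indicator (PD r) p *\<^sub>R wy u p \<partial>lborel) = 0"
  unfolding wxy using I by simp_all
qed

section \<open>The functional equation and integrability\<close>

lemma w_power:
 assumes "Cw (Suc m) u S" "p \<in> S"
 shows "wx (%p. u p ^ Suc n) p = of_nat (Suc n) * u p ^ n * wx u p" "wy (%p. u p ^ Suc n) p = of_nat (Suc n) * u p ^ n * wy u p"
proof (induction n)
 case (Suc n)
 note C = Cw_power[OF assms(1), of "Suc n"]
 {
  case 1
  show ?case using w_mult(1)[OF assms(1) C assms(2)] Suc.IH(1) by (simp add: algebra_simps)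
 next
  case 2
  show ?case using w_mult(2)[OF assms(1) C assms(2)] Suc.IH(2) by (simp add: algebra_simps)
 }
qed simp_all

locale bumped =
 fixes r :: real and S :: "(complex \<times> complex) set"
 assumes S: "open S" "cball 0 r \<times> cball 0 r \<subseteq> S" and r: "r > 0"
begin

abbreviation I :: "cfun => complex" where "I g \<equiv> \<integral>p. indicator (PD r) p *\<^sub>R g p \<partial>lborel"

lemma PDS: "PD r \<subseteq> S" using S(2) by (auto simp: PD_def)

lemma cont_bump: "continuous_on S (bump r)" by (rule Cw_continuous[OF Cw_bump[OF S(1)]])

lemma measurable_ind:
 fixes g :: "complex \<times> complex => 'b::real_normed_vector"
 shows "continuous_on S g ==> (%p. indicator (PD r) p *\<^sub>R g p) \<in> borel_measurable borel"
 by (rule borel_measurable_continuous_on_indicator) (use continuous_on_subset[OF _ PDS] in auto)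

lemma bounded_PD:
 assumes "continuous_on S (g :: cfun)" obtains B where "B >= 0" "!!p. p \<in> PD r ==> cmod (g p) <= B"
proof -
 have "compact (cball (0::complex) r \<times> cball (0::complex) r)" by (intro compact_Times compact_cball)
 then have "bounded (g ` (cball 0 r \<times> cball 0 r))"
  by (intro compact_imp_bounded compact_continuous_image continuous_on_subset[OF assms S(2)])
 then obtain B where B: "!!p. p \<in> cball 0 r \<times> cball 0 r ==> cmod (g p) <= B" unfolding bounded_iff by blast
 moreover have "PD r \<subseteq> cball 0 r \<times> cball 0 r" by (auto simp: PD_def)
 ultimately show thesis by (intro that[of "max B 0"]) (auto intro: order_trans[OF B])
qed

lemma finite_PD: "emeasure lborel (PD r) < \<infinity>"
 by (rule emeasure_bounded_finite) (simp add: PD_def bounded_Times)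

lemma integrable_PD: "continuous_on S (g :: cfun) ==> integrable lborel (%p. indicator (PD r) p *\<^sub>R g p)"
proof -
 assume g: "continuous_on S g"
 obtain B where B: "B >= 0" "!!p. p \<in> PD r ==> cmod (g p) <= B" by (rule bounded_PD[OF g]) blast
 have "integrable lborel (%p. B * indicator (PD r) p :: real)"
  by (intro integrable_mult_right integrable_real_indicator finite_PD) auto
 then show ?thesis by (rule Bochner_Integration.integrable_bound) (use measurable_ind[OF g] B in "auto simp: indicator_def")
qed

text \<open>The derivative of bump^(n+2) h u integrates to zero. Differentiating the power lowers it
  by one only, so one factor of \<open>bump\<close> is the price of moving one derivative off
  \<open>u\<close>.\<close>

lemma ibp_1:
 fixes n :: nat
 assumes u: "Cw (Suc m) u S" and h: "Cw (Suc m) h S"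
 defines "L \<equiv> %D p. - (bump r p * D h p + of_nat (Suc (Suc n)) * D (bump r) p * h p)"
 shows "I (%p. bump r p ^ Suc (Suc n) * h p * wx u p) = I (%p. bump r p ^ Suc n * L wx p * u p)" "Cw m (L wx) S"
  "I (%p. bump r p ^ Suc (Suc n) * h p * wy u p) = I (%p. bump r p ^ Suc n * L wy p * u p)" "Cw m (L wy) S"
proof -
 have B: "Cw k (bump r) S" for k by (rule Cw_bump[OF S(1)])
 have u1: "Cw (Suc 0) u S" and h1: "Cw (Suc 0) h S" using u h Cw_le[of "Suc m" _ S "Suc 0"] by auto
 have c: "continuous_on S u" "continuous_on S h" "continuous_on S (wx u)" "continuous_on S (wy u)" "continuous_on S (wx h)" "continuous_on S (wy h)"
  "continuous_on S (bump r)" "continuous_on S (wx (bump r))" "continuous_on S (wy (bump r))"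
  using Cw_continuous Cw_wx_wy[OF u1 S(1)] Cw_wx_wy[OF h1 S(1)] Cw_wx_wy[OF B S(1), of 0] B u1 h1 by blast+
 have hu: "Cw 1 (%p. bump r p ^ n * (h p * u p)) S" using u1 h1 B by (auto intro!: Cw_mult Cw_power simp del: Cw.simps)
 have Bh: "Cw (Suc 0) (%p. bump r p ^ Suc (Suc n) * h p) S" by (intro Cw_mult Cw_power B h1)
 have eq: "(%p. (bump r p)^2 * (bump r p ^ n * (h p * u p))) = (%p. (bump r p ^ Suc (Suc n) * h p) * u p)"
  by (auto simp: power2_eq_square mult_ac)
 have L: "D (%p. (bump r p ^ Suc (Suc n) * h p) * u p) p = bump r p ^ Suc (Suc n) * h p * D u p - bump r p ^ Suc n * L D p * u p"
  if p: "p \<in> S" and D: "D = wx | D = wy" for D p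
  using D w_mult[OF Bh u1 p] w_mult[OF Cw_power[OF B[of "Suc 0"], of "Suc (Suc n)"] h1 p] w_power[OF B[of "Suc 0"] p, of "Suc n"]
  by (auto simp: L_def algebra_simps)
 have I0: "0 = I (%p. bump r p ^ Suc (Suc n) * h p * D u p) - I (%p. bump r p ^ Suc n * L D p * u p)"
  if D: "D = wx | D = wy" for D
 proof -
  have "0 = I (D (%p. (bump r p ^ Suc (Suc n) * h p) * u p))"
   using D integral_wx_zero[OF hu S r] unfolding eq by auto
  also have "\<dots> = (\<integral>p. indicator (PD r) p *\<^sub>R (bump r p ^ Suc (Suc n) * h p * D u p) - indicator (PD r) p *\<^sub>R (bump r p ^ Suc n * L D p * u p) \<partial>lborel)"
  proof (rule Bochner_Integration.integral_cong[OF refl])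
   fix p show "indicator (PD r) p *\<^sub>R D (%p. (bump r p ^ Suc (Suc n) * h p) * u p) p = indicator (PD r) p *\<^sub>R (bump r p ^ Suc (Suc n) * h p * D u p) - indicator (PD r) p *\<^sub>R (bump r p ^ Suc n * L D p * u p)"
    using L[OF _ D, of p] PDS by (cases "p \<in> PD r") auto
  qed
  also have "\<dots> = I (%p. bump r p ^ Suc (Suc n) * h p * D u p) - I (%p. bump r p ^ Suc n * L D p * u p)"
   by (rule Bochner_Integration.integral_diff; rule integrable_PD) (use D c in "auto simp: L_def intro!: continuous_intros")
  finally show ?thesis .
 qed
 show "I (%p. bump r p ^ Suc (Suc n) * h p * wx u p) = I (%p. bump r p ^ Suc n * L wx p * u p)"
  "I (%p. bump r p ^ Suc (Suc n) * h p * wy u p) = I (%p. bump r p ^ Suc n * L wy p * u p)"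
  using I0[of wx] I0[of wy] by simp_all
 have hm: "Cw m h S" using h by (rule Cw_Suc)
 have "Cw m (%p. (- 1) * (bump r p * D h p + of_nat (Suc (Suc n)) * D (bump r) p * h p)) S" if D: "D = wx | D = wy" for D
 proof -
  have "Cw m (D h) S" "Cw m (D (bump r)) S" using D Cw_wx_wy[OF h S(1)] Cw_wx_wy[OF B S(1)] by auto
  then show ?thesis by (intro Cw_mult Cw_add Cw_const B hm)
 qed
 from this[of wx] this[of wy] show "Cw m (L wx) S" "Cw m (L wy) S" unfolding L_def by (simp_all del: Cw.simps of_nat_Suc)
qed

text \<open>The order of quantifiers is the point: \<open>h'\<close> depends on \<open>h\<close> and
  on the operator but not on \<open>u\<close>, and therefore not on the exponents that enter
  later.\<close>

lemma ibp_funpow: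
 assumes D: "D = wx | D = wy"
 shows "Cw (k + m) h S ==> EX h'. Cw m h' S &
  (ALL u. Cw k u S --> I (%p. bump r p ^ Suc (n + k) * h p * (D ^^ k) u p) = I (%p. bump r p ^ Suc n * h' p * u p))"
proof (induction k arbitrary: h)
 case (Suc k)
 let ?h1 = "%p. - (bump r p * D h p + of_nat (Suc (Suc (n + k))) * D (bump r) p * h p)"
 have h: "Cw (Suc (k + m)) h S" using Suc.prems by (simp del: Cw.simps)
 have "Cw (k + m) ?h1 S" using D ibp_1(2,4)[OF h h] by blast
 from Suc.IH[OF this] obtain h' where h': "Cw m h' S"
  "!!u. Cw k u S ==> I (%p. bump r p ^ Suc (n + k) * ?h1 p * (D ^^ k) u p) = I (%p. bump r p ^ Suc n * h' p * u p)" by blast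
 have "I (%p. bump r p ^ Suc (n + Suc k) * h p * (D ^^ Suc k) u p) = I (%p. bump r p ^ Suc n * h' p * u p)" if u: "Cw (Suc k) u S" for u
 proof -
  have "Cw (Suc 0 + k) u S" using u by (simp del: Cw.simps)
  then have "Cw (Suc 0) ((D ^^ k) u) S" using D Cw_funpow[of "Suc 0" k u S] S(1) by blast
  moreover have "Cw (Suc 0) h S" using h by (rule Cw_le) simp
  ultimately have "I (%p. bump r p ^ Suc (Suc (n + k)) * h p * D ((D ^^ k) u) p) = I (%p. bump r p ^ Suc (n + k) * ?h1 p * (D ^^ k) u p)"
   using D ibp_1(1,3) by blast
  then show ?thesis using h'(2)[OF Cw_Suc[OF u]] by simp
 qed
 then show ?case using h'(1) by blast
qed auto

text \<open>The powers are uniform in k and l: from 2D+2 down to D+1, surplus factors going into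
  \<open>h'\<close>. The first is twice the second, as the later splitting of the integrand into X *
  Y requires.\<close>

lemma ibp:
 assumes h: "Cw (k + l) h S" and D: "k + l <= D"
 shows "EX h'. continuous_on S h' & (ALL u. Cw D u S -->
  I (%p. bump r p ^ (2 * D + 2) * h p * (wx ^^ k) ((wy ^^ l) u) p) = I (%p. bump r p ^ Suc D * h' p * u p))"
proof -
 \<comment> \<open>Chosen so that k + l integrations by parts start exactly from the power
   2D+2.\<close>
 define n where "n = 2 * D + 1 - k - l"
 have n: "Suc (n + l + k) = 2 * D + 2" "Suc n = Suc D + (D + 1 - k - l)" using D by (simp_all add: n_def)
 obtain h1 where h1: "Cw l h1 S"
  "!!u. Cw k u S ==> I (%p. bump r p ^ Suc (n + l + k) * h p * (wx ^^ k) u p) = I (%p. bump r p ^ Suc (n + l) * h1 p * u p)"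
  using ibp_funpow[OF disjI1[OF refl] h, of "n + l"] by blast
 obtain h2 where h2: "Cw 0 h2 S"
  "!!u. Cw l u S ==> I (%p. bump r p ^ Suc (n + l) * h1 p * (wy ^^ l) u p) = I (%p. bump r p ^ Suc n * h2 p * u p)"
  using ibp_funpow[OF disjI2[OF refl], of l 0 h1 n] h1(1) by auto
 have "I (%p. bump r p ^ (2 * D + 2) * h p * (wx ^^ k) ((wy ^^ l) u) p) = I (%p. bump r p ^ Suc D * (bump r p ^ (D + 1 - k - l) * h2 p) * u p)"
  if u: "Cw D u S" for u
 proof -
  have ukl: "Cw (k + l) u S" by (rule Cw_le[OF u D])
  have "I (%p. bump r p ^ (2 * D + 2) * h p * (wx ^^ k) ((wy ^^ l) u) p) = I (%p. bump r p ^ Suc (n + l) * h1 p * (wy ^^ l) u p)"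
   using h1(2)[OF Cw_funpow(2)[OF ukl S(1)]] unfolding n .
  also have "\<dots> = I (%p. bump r p ^ Suc n * h2 p * u p)" by (rule h2(2)[OF Cw_le[OF ukl]]) simp
  finally show ?thesis unfolding n(2) power_add by (simp add: mult.assoc)
 qed
 moreover have "continuous_on S (%p. bump r p ^ (D + 1 - k - l) * h2 p)"
  using h2(1) cont_bump by (auto intro!: continuous_intros)
 ultimately show ?thesis by blast
qed

text \<open>For exponents above \<open>D\<close> the function \<open>u s\<close> is \<open>D\<close>
  times differentiable and all derivatives can be moved off it. The functions \<open>h j\<close> are
  found before \<open>s\<close>; the exponents enter only through \<open>e\<close>, \<open>b\<close>
  and \<open>u s\<close>.\<close>

lemma regular_identity:
 fixes F :: "'n::finite => cfun" and e :: "'j => ('n => complex) => complex"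
 assumes \<phi>: "\<phi> hol2_on S" and F: "!!i. F i hol2_on S" and J: "finite J" and g: "!!j. j \<in> J ==> g j hol2_on S"
  and D: "!!j. j \<in> J ==> k j + l j <= D"
 defines "u \<equiv> %s p. (\<Prod>i\<in>UNIV. pw (s i) 1 0 (F i p)) * cnj (\<phi> p)"
 assumes eq: "!!s p. (!!i. real D < s i) ==> p \<in> S ==>
   (\<Sum>j\<in>J. e j (%i. of_real (s i)) * g j p * (wx ^^ k j) ((wy ^^ l j) (u s)) p) =
   b (%i. of_real (s i)) * (\<Prod>i\<in>UNIV. pw (s i) 0 0 (F i p)) * cnj (\<phi> p)"
 obtains h where "!!j. j \<in> J ==> continuous_on S (h j)" "!!s. (!!i. real D < s i) ==>
   b (%i. of_real (s i)) * I (%p. bump r p ^ (2 * D + 2) * \<phi> p * (\<Prod>i\<in>UNIV. pw (s i) 0 0 (F i p)) * cnj (\<phi> p)) =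
   (\<Sum>j\<in>J. e j (%i. of_real (s i)) * I (%p. bump r p ^ Suc D * h j p * u s p))"
proof -
 have "ALL j:J. EX h'. continuous_on S h' & (ALL u. Cw D u S -->
  I (%p. bump r p ^ (2 * D + 2) * (\<phi> p * g j p) * (wx ^^ k j) ((wy ^^ l j) u) p) = I (%p. bump r p ^ Suc D * h' p * u p))"
 proof
  fix j assume j: "j \<in> J"
  show "EX h'. continuous_on S h' & (ALL u. Cw D u S -->
   I (%p. bump r p ^ (2 * D + 2) * (\<phi> p * g j p) * (wx ^^ k j) ((wy ^^ l j) u) p) = I (%p. bump r p ^ Suc D * h' p * u p))"
   by (rule ibp[OF _ D[OF j]]) (intro Cw_mult Cw_hol2 \<phi> g[OF j] S(1))
 qed
 from bchoice[OF this] obtain h where h: "!!j. j \<in> J ==> continuous_on S (h j)" "!!j u. j \<in> J ==> Cw D u S ==>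
  I (%p. bump r p ^ (2 * D + 2) * (\<phi> p * g j p) * (wx ^^ k j) ((wy ^^ l j) u) p) = I (%p. bump r p ^ Suc D * h j p * u p)"
  by blast
 show thesis
 proof (rule that[OF h(1)])
  fix s :: "'n => real" assume s: "!!i. real D < s i"
  let ?e = "%j. e j (%i. of_real (s i))"
  have u: "Cw D (u s) S" unfolding u_def
   by (intro Cw_mult Cw_prod Cw_pw Cw_cnj Cw_hol2 \<phi> F S(1) s)
  have ci: "integrable lborel (%p. indicator (PD r) p *\<^sub>R (bump r p ^ (2 * D + 2) * (\<phi> p * g j p) * (wx ^^ k j) ((wy ^^ l j) (u s)) p))" if j: "j \<in> J" for j
  proof -
   have "Cw (0 + k j) ((wy ^^ l j) (u s)) S" by (rule Cw_funpow(2)) (use Cw_le[OF u D[OF j]] S(1) in "simp_all del: Cw.simps")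
   then have "Cw 0 ((wx ^^ k j) ((wy ^^ l j) (u s))) S" by (rule Cw_funpow(1)[OF _ S(1)])
   then have "continuous_on S ((wx ^^ k j) ((wy ^^ l j) (u s)))" by simp
   then show ?thesis
    by (intro integrable_PD continuous_on_mult continuous_on_power cont_bump hol2_on_continuous[OF \<phi>] hol2_on_continuous[OF g[OF j]])
  qed
  have "b (%i. of_real (s i)) * I (%p. bump r p ^ (2 * D + 2) * \<phi> p * (\<Prod>i\<in>UNIV. pw (s i) 0 0 (F i p)) * cnj (\<phi> p)) =
   I (%p. bump r p ^ (2 * D + 2) * \<phi> p * (b (%i. of_real (s i)) * (\<Prod>i\<in>UNIV. pw (s i) 0 0 (F i p)) * cnj (\<phi> p)))"
   unfolding integral_mult_right_zero[symmetric] by (rule Bochner_Integration.integral_cong) (auto simp: mult_ac)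
  also have "\<dots> = (\<integral>p. (\<Sum>j\<in>J. ?e j * (indicator (PD r) p *\<^sub>R (bump r p ^ (2 * D + 2) * (\<phi> p * g j p) * (wx ^^ k j) ((wy ^^ l j) (u s)) p))) \<partial>lborel)"
  proof (rule Bochner_Integration.integral_cong[OF refl])
   fix p
   show "indicator (PD r) p *\<^sub>R (bump r p ^ (2 * D + 2) * \<phi> p * (b (%i. of_real (s i)) * (\<Prod>i\<in>UNIV. pw (s i) 0 0 (F i p)) * cnj (\<phi> p))) =
    (\<Sum>j\<in>J. ?e j * (indicator (PD r) p *\<^sub>R (bump r p ^ (2 * D + 2) * (\<phi> p * g j p) * (wx ^^ k j) ((wy ^^ l j) (u s)) p)))"
   proof (cases "p \<in> PD r")
    case True
    then have pS: "p \<in> S" using PDS by blast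
    show ?thesis using True unfolding eq[OF s pS, symmetric] by (simp add: sum_distrib_left mult_ac)
   qed simp
  qed
  also have "\<dots> = (\<Sum>j\<in>J. \<integral>p. ?e j * (indicator (PD r) p *\<^sub>R (bump r p ^ (2 * D + 2) * (\<phi> p * g j p) * (wx ^^ k j) ((wy ^^ l j) (u s)) p)) \<partial>lborel)"
   by (rule Bochner_Integration.integral_sum) (rule integrable_mult_right, rule ci)
  also have "\<dots> = (\<Sum>j\<in>J. ?e j * I (%p. bump r p ^ Suc D * h j p * u s p))"
   by (rule sum.cong[OF refl]) (simp only: integral_mult_right_zero h(2)[OF _ u])
  finally show "b (%i. of_real (s i)) * I (%p. bump r p ^ (2 * D + 2) * \<phi> p * (\<Prod>i\<in>UNIV. pw (s i) 0 0 (F i p)) * cnj (\<phi> p)) = \<dots>" .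
 qed
qed

end

text \<open>Expand around \<open>t0\<close>: the norms of the terms sum to at most exp(|z - t0| w -
  t0 w) |H|, which is at most |H| inside this disc. So sum and integral may be exchanged and a power
  series results.\<close>

lemma laplace_holomorphic:
 fixes H :: "'a => complex" and w :: "'a => real"
 assumes H: "integrable M H" and w: "w \<in> borel_measurable M" "!!x. 0 <= w x" and t0: "t0 > 0"
 shows "(%z. \<integral>x. exp (- z * of_real (w x)) * H x \<partial>M) holomorphic_on ball (of_real t0) t0"
proof (rule power_series_holomorphic)
 fix z :: complex assume z: "z \<in> ball (of_real t0) t0"
 define d where "d = z - of_real t0"
 have d: "cmod d < t0" using z by (simp add: d_def dist_norm norm_minus_commute)
 define f where "f = (%n x. ((- d * of_real (w x)) ^ n /\<^sub>R fact n) * (exp (- of_real t0 * of_real (w x)) * H x))"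
 define c where "c = (%n. \<integral>x. ((- of_real (w x)) ^ n /\<^sub>R fact n) * (exp (- of_real t0 * of_real (w x)) * H x) \<partial>M)"
 have Hm: "H \<in> borel_measurable M" using H by simp
 have nf: "norm (f n x) = ((cmod d * w x) ^ n /\<^sub>R fact n) * (exp (- t0 * w x) * cmod (H x))" for n x
  using w(2)[of x] by (simp add: f_def norm_mult norm_power)
 have s1: "(%n. norm (f n x)) sums (exp (cmod d * w x) * (exp (- t0 * w x) * cmod (H x)))" for x
  unfolding nf by (intro sums_mult2 exp_converges)
 have le: "exp (cmod d * w x) * (exp (- t0 * w x) * cmod (H x)) <= cmod (H x)" for x
 proof -
  have "cmod d * w x <= t0 * w x" using d w(2)[of x] by (intro mult_right_mono) auto
  then have "exp (cmod d * w x) * exp (- t0 * w x) <= 1" by (simp flip: exp_add)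
  then show ?thesis using mult_right_mono[of "exp (cmod d * w x) * exp (- t0 * w x)" 1 "cmod (H x)"] by (simp add: mult.assoc)
 qed
 have part: "(\<Sum>n<N. norm (f n x)) <= cmod (H x)" for N x
 proof -
  have "(\<Sum>n<N. norm (f n x)) <= exp (cmod d * w x) * (exp (- t0 * w x) * cmod (H x))"
   using sum_le_suminf[OF sums_summable[OF s1[of x]], of "{..<N}"] sums_unique[OF s1[of x]] by simp
  then show ?thesis using le[of x] by linarith
 qed
 have fm: "f n \<in> borel_measurable M" for n unfolding f_def using w(1) Hm by measurable
 have fi: "integrable M (f n)" for n
 proof (rule Bochner_Integration.integrable_bound[OF H fm])
  have "norm (f n x) <= norm (H x)" for x
   using part[where N = "Suc n" and x = x] sum_nonneg[of "{..<n}" "%n. norm (f n x)"] by simp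
  then show "AE x in M. norm (f n x) <= norm (H x)" by simp
 qed
 have sm: "summable (%n. \<integral>x. norm (f n x) \<partial>M)"
 proof (rule summableI_nonneg_bounded)
  fix N show "(\<Sum>n<N. \<integral>x. norm (f n x) \<partial>M) <= (\<integral>x. norm (H x) \<partial>M)"
  proof -
   have "(\<Sum>n<N. \<integral>x. norm (f n x) \<partial>M) = (\<integral>x. (\<Sum>n<N. norm (f n x)) \<partial>M)"
    by (rule Bochner_Integration.integral_sum[symmetric]) (use fi in simp)
   also have "\<dots> <= (\<integral>x. norm (H x) \<partial>M)"
    by (rule integral_mono) (use fi H part in "simp_all add: Bochner_Integration.integrable_sum")
   finally show ?thesis .
  qed
 qed simp
 have "AE x in M. summable (%n. norm (f n x))" using s1 sums_summable by blast
 from sums_integral[OF fi this sm]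
 have "(%n. integral\<^sup>L M (f n)) sums (\<integral>x. (suminf (%n. f n x)) \<partial>M)" .
 moreover have "suminf (%n. f n x) = exp (- z * of_real (w x)) * H x" for x
 proof -
  have "(%n. f n x) sums (exp (- d * of_real (w x)) * (exp (- of_real t0 * of_real (w x)) * H x))"
   unfolding f_def by (intro sums_mult2 exp_converges)
  moreover have "exp (- d * of_real (w x)) * exp (- of_real t0 * of_real (w x)) = exp (- z * of_real (w x))"
   by (simp add: d_def algebra_simps flip: exp_add)
  ultimately show ?thesis by (simp add: sums_unique[symmetric] flip: mult.assoc)
 qed
 moreover have "integral\<^sup>L M (f n) = c n * (z - of_real t0) ^ n" for n
 proof -
  have "f n = (%x. d ^ n * (((- of_real (w x)) ^ n /\<^sub>R fact n) * (exp (- of_real t0 * of_real (w x)) * H x)))"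
   by (auto simp: f_def fun_eq_iff power_mult_distrib scaleR_conv_of_real mult_ac power_minus[of "d * _"] power_minus[of "of_real _"])
  then show ?thesis by (simp add: c_def d_def mult.commute)
 qed
 ultimately show "(%n. c n * (z - of_real t0) ^ n) sums (\<integral>x. exp (- z * of_real (w x)) * H x \<partial>M)" by simp
qed

text \<open>An identity known for large t propagates through a disc that touches 0, and reaches the
  boundary point 0 by dominated convergence, since \<open>w\<close> is nonnegative.\<close>

lemma laplace_continuation:
 fixes H :: "'j => 'a => complex" and w :: "'a => real"
 assumes J: "finite J" and H: "!!j. j \<in> J ==> integrable M (H j)" and w: "w \<in> borel_measurable M" "!!x. 0 <= w x"
  and e: "!!j. j \<in> J ==> e j holomorphic_on UNIV"
  and zero: "!!t::real. t >= T ==> (\<Sum>j\<in>J. e j (of_real t) * (\<integral>x. exp (- of_real t * of_real (w x)) * H j x \<partial>M)) = 0"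
 shows "(\<Sum>j\<in>J. e j 0 * (\<integral>x. H j x \<partial>M)) = 0"
proof -
 define t0 where "t0 = max T 1"
 have t0: "t0 > 0" "t0 >= 1" "t0 >= T" by (auto simp: t0_def)
 define G where "G = (%z. \<Sum>j\<in>J. e j z * (\<integral>x. exp (- z * of_real (w x)) * H j x \<partial>M))"
 have G: "G holomorphic_on ball (of_real t0) t0" unfolding G_def
  by (intro holomorphic_intros laplace_holomorphic H w t0 holomorphic_on_subset[OF e]) auto
 have G0: "G z = 0" if z: "z \<in> ball (of_real t0) t0" for z
 proof (rule analytic_continuation[OF G open_ball convex_connected[OF convex_ball], where U = "{z \<in> ball (of_real t0) t0. EX t>=t0. z = of_real t}" and \<xi> = "of_real t0"])
  show "complex_of_real t0 islimpt {z \<in> ball (of_real t0) t0. EX t>=t0. z = of_real t}"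
   unfolding islimpt_approachable
  proof (intro allI impI)
   fix eps :: real assume eps: "eps > 0"
   define t where "t = t0 + min eps t0 / 2"
   have "dist (complex_of_real t) (of_real t0) = min eps t0 / 2" using eps t0 by (simp add: t_def dist_norm flip: of_real_diff)
   moreover have "0 < min eps t0 / 2" "min eps t0 / 2 < eps" "min eps t0 / 2 < t0" using eps t0 by auto
   ultimately have "complex_of_real t \<in> ball (of_real t0) t0" "t0 <= t" "complex_of_real t ~= of_real t0" "dist (complex_of_real t) (of_real t0) < eps"
    by (auto simp: dist_commute t_def)
   then show "EX x':{z \<in> ball (of_real t0) t0. EX t>=t0. z = of_real t}. x' ~= complex_of_real t0 & dist x' (complex_of_real t0) < eps"
    by (intro bexI[of _ "of_real t"] CollectI conjI exI[of _ t]) simp_all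
  qed
  show "G z = 0" if "z \<in> {z \<in> ball (of_real t0) t0. EX t>=t0. z = of_real t}" for z
   using that zero t0(3) by (auto simp: G_def)
 qed (use z t0 in auto)
 \<comment> \<open>Points tending to 0 inside the disc; this is why \<open>t0\<close> was taken at
   least 1.\<close>
 define z where "z = (%n. complex_of_real (1 / real (Suc n)))"
 have zb: "z n \<in> ball (of_real t0) t0" for n
 proof -
  have "0 < 1 / real (Suc n)" "1 / real (Suc n) <= 1" by auto
  then have "\<bar>t0 - 1 / real (Suc n)\<bar> < t0" using t0(2) by linarith
  then show ?thesis unfolding z_def mem_ball dist_norm of_real_diff[symmetric] norm_of_real by simp
 qed
 have z0: "z \<longlonglongrightarrow> 0" unfolding z_def using tendsto_of_real[OF LIMSEQ_inverse_real_of_nat, where 'a = complex] by (simp add: inverse_eq_divide)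
 have "(%n. \<integral>x. exp (- z n * of_real (w x)) * H j x \<partial>M) \<longlonglongrightarrow> (\<integral>x. H j x \<partial>M)" if j: "j \<in> J" for j
 proof (rule integral_dominated_convergence[where w = "%x. norm (H j x)"])
  have Hm: "H j \<in> borel_measurable M" using H[OF j] by simp
  then show "H j \<in> borel_measurable M" "(%x. exp (- z n * of_real (w x)) * H j x) \<in> borel_measurable M" for n
   using w(1) by measurable
  show "integrable M (%x. norm (H j x))" using H[OF j] by simp
  have "(%n. exp (- z n * of_real (w x)) * H j x) \<longlonglongrightarrow> exp (- 0 * of_real (w x)) * H j x" for x
   by (intro tendsto_intros z0)
  then show "AE x in M. (%n. exp (- z n * of_real (w x)) * H j x) \<longlonglongrightarrow> H j x" by simp
  have "norm (exp (- z n * of_real (w x)) * H j x) <= norm (H j x)" for n x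
  proof -
   have "norm (exp (- z n * of_real (w x))) <= 1" using w(2)[of x] by (simp add: z_def)
   then show ?thesis using mult_right_mono[of _ 1 "norm (H j x)"] by (simp add: norm_mult)
  qed
  then show "AE x in M. norm (exp (- z n * of_real (w x)) * H j x) <= norm (H j x)" for n by simp
 qed
 moreover have "(%n. e j (z n)) \<longlonglongrightarrow> e j 0" if "j \<in> J" for j
  using holomorphic_on_imp_continuous_on[OF e[OF that]] z0 by (intro continuous_on_tendsto_compose[of UNIV "e j"]) auto
 ultimately have "(%n. G (z n)) \<longlonglongrightarrow> (\<Sum>j\<in>J. e j 0 * (\<integral>x. H j x \<partial>M))"
  unfolding G_def by (intro tendsto_sum tendsto_mult) auto
 then show ?thesis using G0[OF zb] by (simp add: LIMSEQ_const_iff)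
qed

section \<open>From the functional equation to a uniform estimate\<close>

lemma pw_0 [simp]: "pw \<sigma> a b 0 = 0" by (simp add: pw_def)

lemma measurable_pw [measurable]: "pw \<sigma> a b \<in> borel_measurable borel"
proof -
 have "(%z. cnj z ^ b) \<in> borel_measurable borel" by (intro borel_measurable_continuous_onI continuous_intros)
 then show ?thesis unfolding pw_def[abs_def] by measurable
qed

lemma norm_pw: "cmod (pw \<sigma> a b z) = cmod z powr (2 * \<sigma>) * cmod z ^ (a + b)"
 by (simp add: pw_def norm_mult norm_power power_add)

lemma pw_shift: "z ~= 0 ==> pw (\<sigma> + t) a b z = of_real (cmod z powr (2 * t)) * pw \<sigma> a b z"
 by (simp add: pw_def powr_add distrib_left)

text \<open>By the identity theorem no zero set contains a nonempty open set, so the finitely many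
  zero sets can be removed from \<open>T\<close> one after the other.\<close>

lemma common_nonzero:
 assumes "finite I" and F: "!!i. F i hol2_on S" and S: "open S" "convex S" and nz: "!!i. EX p:S. F i p ~= 0"
 shows "open T ==> T \<subseteq> S ==> T ~= {} ==> EX p:T. ALL i:I. F i p ~= 0"
 using assms(1)
proof (induction I arbitrary: T rule: finite_induct)
 case (insert i I)
 define T' where "T' = T Int F i -` (- {0})"
 have "open T'" unfolding T'_def
  using insert.prems by (intro continuous_open_preimage continuous_on_subset[OF hol2_on_continuous[OF F]]) auto
 moreover have "T' ~= {}"
 proof
  assume "T' = {}"
  then have z: "!!p. p \<in> T ==> F i p = 0" by (auto simp: T'_def)
  obtain p0 where "p0 \<in> T" using insert.prems by blast
  have "F i p = 0" if "p \<in> S" for p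
   by (rule hol2_identity[OF F S insert.prems(1,2) \<open>p0 \<in> T\<close> z that])
  then show False using nz by blast
 qed
 moreover have "T' \<subseteq> S" using insert.prems by (auto simp: T'_def)
 ultimately obtain p where "p \<in> T'" "ALL i:I. F i p ~= 0" using insert.IH by blast
 then show ?case by (auto simp: T'_def)
qed auto

lemma hol2_at0_finite:
 assumes "finite J" "!!j. j \<in> J ==> hol2_at0 (g j)"
 shows "EX R>0. ALL j:J. g j hol2_on PD R"
 using assms
proof (induction J rule: finite_induct)
 case empty
 show ?case by (auto intro: exI[of _ 1])
next
 case (insert j J)
 obtain R1 where R1: "R1 > 0" "ALL j:J. g j hol2_on PD R1" using insert by blast
 obtain R2 where R2: "R2 > 0" "g j hol2_on PD R2" using insert.prems[of j] by (auto simp: hol2_at0_PD)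
 show ?case
  by (rule exI[of _ "min R1 R2"]) (use R1 R2 hol2_on_subset[OF _ PD_mono] in auto)
qed

text \<open>Near a point where no \<open>F i\<close> vanishes there are logarithms. With A = f^(s+1)
  and B = f^s \<phi> the product of A with the conjugate of B is single-valued for real s, and
  multiplying the equation for A by the conjugate of B gives the claim.\<close>

lemma functional_identity:
 fixes F :: "'n::finite => cfun" and P :: "'n diffop" and s :: "'n => real"
 assumes P: "!!W \<l>. open W ==> W \<subseteq> V ==> (!!i. \<l> i hol2_on W) ==> (!!i p. p \<in> W ==> exp (\<l> i p) = F i p) ==>
   (ALL s. ALL p:W. diffop_apply P s (%q. exp (\<Sum>i\<in>UNIV. (s i + 1) * \<l> i q)) p = mpol_eval (%c. c) b s * exp (\<Sum>i\<in>UNIV. s i * \<l> i p))"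
  and S: "open S" "S \<subseteq> V" and F: "!!i. F i hol2_on S" and \<phi>: "\<phi> hol2_on S" and p: "p \<in> S" "!!i. F i p ~= 0"
 shows "(\<Sum>(k, l)\<in>Poly_Mapping.keys P. mpol_eval (%g. rep_germ g p) (Poly_Mapping.lookup P (k, l)) (%i. of_real (s i)) *
   (wx ^^ k) ((wy ^^ l) (%p. (\<Prod>i\<in>UNIV. pw (s i) 1 0 (F i p)) * cnj (\<phi> p))) p) =
  mpol_eval (%c. c) b (%i. of_real (s i)) * (\<Prod>i\<in>UNIV. pw (s i) 0 0 (F i p)) * cnj (\<phi> p)"
proof -
 define W where "W = (\<Inter>i. S Int (%q. F i q / F i p) -` (- \<real>\<^sub>\<le>\<^sub>0))"
 have h: "(%q. F i q / F i p) hol2_on S" for i using p(2) by (intro hol2_intros F) auto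
 have W: "open W" unfolding W_def
  by (intro open_INT ballI continuous_open_preimage hol2_on_continuous[OF h] S(1)) auto
 have WS: "W \<subseteq> S" and pW: "p \<in> W" using p by (auto simp: W_def)
 define \<l> where "\<l> = (%i q. Ln (F i q / F i p) + Ln (F i p))"
 have \<l>: "\<l> i hol2_on W" for i unfolding \<l>_def
  by (intro hol2_intros hol2_on_compose1[where g = Ln and A = "- \<real>\<^sub>\<le>\<^sub>0", OF _ _ hol2_on_subset[OF h WS]])
   (auto simp: W_def intro!: holomorphic_intros)
 have ex: "exp (\<l> i q) = F i q" if "q \<in> W" for i q
 proof -
  have "z ~= 0" if "z ~: \<real>\<^sub>\<le>\<^sub>0" for z :: complex using that by auto
  moreover have "F i q / F i p ~: \<real>\<^sub>\<le>\<^sub>0" using that by (auto simp: W_def)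
  ultimately have "F i q / F i p ~= 0" by blast
  then show ?thesis using p(2) by (simp add: \<l>_def exp_add)
 qed
 let ?s = "%i. complex_of_real (s i)"
 define A where "A = (%q. exp (\<Sum>i\<in>UNIV. (?s i + 1) * \<l> i q))"
 define B where "B = (%q. exp (\<Sum>i\<in>UNIV. ?s i * \<l> i q) * \<phi> q)"
 have A: "A hol2_on W" and B: "B hol2_on W" unfolding A_def B_def
  by (intro hol2_intros \<l> hol2_on_subset[OF \<phi> WS])+
 have pwe: "pw (s i) 0 0 (F i q) = exp (?s i * \<l> i q) * cnj (exp (?s i * \<l> i q))" if "q \<in> W" for i q
 proof -
  have F': "cmod (F i q) = exp (Re (\<l> i q))" using ex[OF that, of i] by (metis norm_exp_eq_Re)
  have "exp (?s i * \<l> i q) * cnj (exp (?s i * \<l> i q)) = of_real ((cmod (exp (?s i * \<l> i q)))^2)" by (rule complex_norm_square[symmetric])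
  also have "(cmod (exp (?s i * \<l> i q)))^2 = exp (2 * (s i * Re (\<l> i q)))" by (simp flip: exp_double)
  also have "\<dots> = cmod (F i q) powr (2 * s i)" unfolding F' by (simp add: powr_def)
  finally show ?thesis by (simp add: pw_def)
 qed
 have pw1: "pw (s i) 1 0 z = z * pw (s i) 0 0 z" for i z by (simp add: pw_def)
 have E: "exp (\<Sum>i\<in>UNIV. ?s i * \<l> i q) * cnj (exp (\<Sum>i\<in>UNIV. ?s i * \<l> i q)) = (\<Prod>i\<in>UNIV. pw (s i) 0 0 (F i q))" if "q \<in> W" for q
  unfolding exp_sum[OF finite] cnj_prod prod.distrib[symmetric] by (rule prod.cong) (use pwe[OF that] in simp_all)
 have u: "(\<Prod>i\<in>UNIV. pw (s i) 1 0 (F i q)) * cnj (\<phi> q) = A q * cnj (B q)" if q: "q \<in> W" for q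
 proof -
  have "A q = (\<Prod>i\<in>UNIV. F i q) * exp (\<Sum>i\<in>UNIV. ?s i * \<l> i q)"
   unfolding A_def exp_sum[OF finite] prod.distrib[symmetric] by (rule prod.cong) (use ex[OF q] in "simp_all add: distrib_right exp_add")
  then have "A q * cnj (B q) = (\<Prod>i\<in>UNIV. F i q) * (exp (\<Sum>i\<in>UNIV. ?s i * \<l> i q) * cnj (exp (\<Sum>i\<in>UNIV. ?s i * \<l> i q))) * cnj (\<phi> q)"
   unfolding B_def complex_cnj_mult by (simp only: mult_ac)
  then show ?thesis unfolding E[OF q] pw1 prod.distrib by simp
 qed
 have "(wx ^^ k) ((wy ^^ l) (%p. (\<Prod>i\<in>UNIV. pw (s i) 1 0 (F i p)) * cnj (\<phi> p))) p = (pd1 ^^ k) ((pd2 ^^ l) A) p * cnj (B p)" for k l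
  by (rule w_funpow_hol2_cnj[OF A B W u pW])
 then have "(\<Sum>(k, l)\<in>Poly_Mapping.keys P. mpol_eval (%g. rep_germ g p) (Poly_Mapping.lookup P (k, l)) ?s *
   (wx ^^ k) ((wy ^^ l) (%p. (\<Prod>i\<in>UNIV. pw (s i) 1 0 (F i p)) * cnj (\<phi> p))) p) = diffop_apply P ?s A p * cnj (B p)"
  by (simp add: diffop_apply_def sum_distrib_right case_prod_beta mult.assoc)
 also have "diffop_apply P ?s A p = mpol_eval (%c. c) b ?s * exp (\<Sum>i\<in>UNIV. ?s i * \<l> i p)"
 proof -
  have "W \<subseteq> V" using WS S(2) by blast
  from P[OF W this \<l> ex] show ?thesis using pW unfolding A_def by blast
 qed
 also have "mpol_eval (%c. c) b ?s * exp (\<Sum>i\<in>UNIV. ?s i * \<l> i p) * cnj (B p) =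
  mpol_eval (%c. c) b ?s * (exp (\<Sum>i\<in>UNIV. ?s i * \<l> i p) * cnj (exp (\<Sum>i\<in>UNIV. ?s i * \<l> i p))) * cnj (\<phi> p)"
  unfolding B_def complex_cnj_mult by (simp only: mult_ac)
 finally show ?thesis unfolding E[OF pW] .
qed

context bumped
begin

text \<open>The identity for large exponents is continued along s + t(1,...,1): the shift multiplies
  the integrands by exp(-t v) with v >= 0 because |F i| <= 1, a Laplace transform in t. At t = 0
  each term on the right is estimated by a product X * Y with X^2 equal to
  \<open>G s\<close>.\<close>

lemma shifted_bound:
 fixes F :: "'n::finite => cfun" and e :: "'j => ('n => complex) => complex"
 assumes \<phi>: "\<phi> hol2_on S" and F: "!!i. F i hol2_on S" and F1: "!!i p. p \<in> S ==> cmod (F i p) <= 1" and J: "finite J"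
  and h: "!!j. j \<in> J ==> continuous_on S (h j)" and id: "!!s. (!!i. real D < s i) ==>
   b (%i. of_real (s i)) * I (%p. bump r p ^ (2 * D + 2) * \<phi> p * (\<Prod>i\<in>UNIV. pw (s i) 0 0 (F i p)) * cnj (\<phi> p)) =
   (\<Sum>j\<in>J. e j (%i. of_real (s i)) * I (%p. bump r p ^ Suc D * h j p * ((\<Prod>i\<in>UNIV. pw (s i) 1 0 (F i p)) * cnj (\<phi> p))))"
  and ehol: "!!j s. j \<in> J ==> (%z. e j (%i. s i + z)) holomorphic_on UNIV" "!!s. (%z. b (%i. s i + z)) holomorphic_on UNIV"
  and e1: "!!j s. j \<in> J ==> (!!i. cmod (s i) <= 1) ==> cmod (e j s) <= 1"
 defines "G \<equiv> %s p. indicator (PD r) p * (cmod (bump r p) ^ (2 * D + 2) * wt \<phi> F s p)"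
 obtains C where "C >= 0" "!!s eps. (!!i. -1 <= s i & s i <= 1) ==> wt \<phi> F s L1_on PD r ==> eps > 0 ==>
  integrable lborel (G s) & cmod (b (%i. of_real (s i))) * (\<integral>p. G s p \<partial>lborel) <= C * (eps * (\<integral>p. G s p \<partial>lborel) + 1 / eps)"
proof -
 let ?ind = "%p. indicator (PD r) p :: real"
 have "ALL j:J. EX c>=0. ALL p:PD r. cmod (h j p) <= c"
 proof
  fix j assume "j \<in> J"
  then obtain c where "c >= 0" "!!p. p \<in> PD r ==> cmod (h j p) <= c" using bounded_PD[OF h] by blast
  then show "EX c>=0. ALL p:PD r. cmod (h j p) <= c" by blast
 qed
 from bchoice[OF this] obtain c where c: "!!j. j \<in> J ==> c j >= 0" "!!j p. j \<in> J ==> p \<in> PD r ==> cmod (h j p) <= c j" by blast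
 define vol where "vol = measure lborel (PD r)"
 define C where "C = (\<Sum>j\<in>J. c j) * (1 + vol)"
 obtain BB where BB: "BB >= 0" "!!p. p \<in> PD r ==> cmod (bump r p) <= BB" by (rule bounded_PD[OF cont_bump]) blast
 define F' where "F' = (%i p. indicator (PD r) p *\<^sub>R F i p)"
 have F'm [measurable]: "F' i \<in> borel_measurable borel" for i unfolding F'_def by (rule measurable_ind[OF hol2_on_continuous[OF F]])
 have F'1: "cmod (F' i p) <= 1" for i p using F1[of p i] PDS by (auto simp: F'_def indicator_def)
 show thesis
 proof (rule that[of C])
  show "C >= 0" unfolding C_def vol_def using c by (intro mult_nonneg_nonneg sum_nonneg) auto
  fix s :: "'n => real" and eps :: real
  assume s: "!!i. -1 <= s i & s i <= 1" and int: "wt \<phi> F s L1_on PD r" and eps: "eps > 0"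
  define A where "A = (%p. indicator (PD r) p *\<^sub>R (bump r p ^ (2 * D + 2) * \<phi> p * cnj (\<phi> p)))"
  define A' where "A' = (%j p. indicator (PD r) p *\<^sub>R (bump r p ^ Suc D * h j p * cnj (\<phi> p)))"
  \<comment> \<open>The whole identity is brought to one side: \<open>None\<close> stands for the
    term with \<open>b\<close>, \<open>Some j\<close> for the terms on the right with their sign
    changed.\<close>
  define H where "H = (%j'. case j' of None => (%p. A p * (\<Prod>i\<in>UNIV. pw (s i) 0 0 (F' i p)))
    | Some j => (%p. - (A' j p * (\<Prod>i\<in>UNIV. pw (s i) 1 0 (F' i p)))))"
  have \<phi>c: "continuous_on S \<phi>" by (rule hol2_on_continuous[OF \<phi>])
  have Am [measurable]: "A \<in> borel_measurable borel" unfolding A_def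
   by (rule measurable_ind) (intro continuous_intros cont_bump \<phi>c)
  have A'm: "A' j \<in> borel_measurable borel" if "j \<in> J" for j unfolding A'_def
   by (rule measurable_ind) (intro continuous_intros cont_bump \<phi>c h that)
  have Hm: "H j' \<in> borel_measurable lborel" if "j' \<in> insert None (Some ` J)" for j'
  proof -
   consider "j' = None" | j where "j \<in> J" "j' = Some j" using \<open>j' \<in> insert None (Some ` J)\<close> by blast
   then show ?thesis
   proof cases
    case 1
    then show ?thesis by (simp add: H_def)
   next
    case 2
    note [measurable] = A'm[OF 2(1)]
    show ?thesis by (simp add: H_def 2)
   qed
  qed
  define w where "w = (%p. ?ind p * wt \<phi> F s p)"
  have wm: "w \<in> borel_measurable borel"
  proof -
   have "(%p. (cmod (indicator (PD r) p *\<^sub>R \<phi> p))^2 * (\<Prod>i\<in>UNIV. cmod (F' i p) powr (2 * s i))) \<in> borel_measurable borel"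
    using measurable_ind[OF \<phi>c] by measurable
   moreover have "(%p. (cmod (indicator (PD r) p *\<^sub>R \<phi> p))^2 * (\<Prod>i\<in>UNIV. cmod (F' i p) powr (2 * s i))) = w"
    by (auto simp: w_def F'_def wt_def indicator_def)
   ultimately show ?thesis by simp
  qed
  have wi: "integrable lborel w"
  proof -
   have "(\<integral>\<^sup>+p. ennreal (w p) \<partial>lborel) < \<infinity>"
    using int absolutely_integrable_iff_nn_integral[of "PD r" "wt \<phi> F s"] wm by (simp add: w_def[abs_def] wt_nonneg)
   then show ?thesis using wm by (intro integrableI_nonneg) (auto simp: w_def wt_nonneg)
  qed
  have Gw: "G s p = cmod (bump r p) ^ (2 * D + 2) * w p" for p by (simp add: G_def w_def)
  have Gm: "G s \<in> borel_measurable borel"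
  proof -
   have "(%p. cmod (indicator (PD r) p *\<^sub>R bump r p) ^ (2 * D + 2) * w p) \<in> borel_measurable borel"
    using measurable_ind[OF cont_bump] wm by measurable
   moreover have "(%p. cmod (indicator (PD r) p *\<^sub>R bump r p) ^ (2 * D + 2) * w p) = G s"
    by (auto simp: Gw w_def indicator_def)
   ultimately show ?thesis by simp
  qed
  have Gi: "integrable lborel (G s)"
  proof (rule Bochner_Integration.integrable_bound[of _ "%p. BB ^ (2 * D + 2) * w p"])
   show "integrable lborel (%p. BB ^ (2 * D + 2) * w p)" using wi by simp
   have "norm (G s p) <= norm (BB ^ (2 * D + 2) * w p)" for p
   proof (cases "p \<in> PD r")
    case True
    have "cmod (bump r p) ^ (2 * D + 2) <= BB ^ (2 * D + 2)" by (rule power_mono[OF BB(2)[OF True] norm_ge_zero])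
    then show ?thesis unfolding Gw norm_mult
     by (intro mult_right_mono) (simp_all only: norm_power real_norm_def power_abs abs_norm_cancel abs_of_nonneg[OF BB(1)] abs_ge_zero)
   qed (simp add: Gw w_def)
   then show "AE p in lborel. norm (G s p) <= norm (BB ^ (2 * D + 2) * w p)" by simp
  qed (use Gm in simp)
  have indi: "integrable lborel ?ind" "(\<integral>p. ?ind p \<partial>lborel) = vol"
   using finite_PD by (auto simp: vol_def intro!: integrable_real_indicator)
  have H0: "H None p = of_real (G s p)" for p
  proof (cases "p \<in> PD r")
   case True
   have "bump r p ^ (2 * D + 2) = of_real (cmod (bump r p) ^ (2 * D + 2))"
   proof -
    have "bump r p ^ 2 = of_real ((cmod (bump r p))^2)" unfolding bump_real norm_of_real by simp
    then have "(bump r p ^ 2) ^ Suc D = of_real (((cmod (bump r p))^2) ^ Suc D)" by simp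
    then show ?thesis by (simp only: power_mult[symmetric]) (simp add: mult.commute)
   qed
   moreover have "\<phi> p * cnj (\<phi> p) = of_real ((cmod (\<phi> p))^2)" by (rule complex_norm_square[symmetric])
   ultimately show ?thesis using True by (simp add: H_def A_def F'_def G_def wt_def pw_def mult.assoc)
  qed (simp add: H_def A_def G_def)
  have Hj: "cmod (H (Some j) p) <= c j * (eps * G s p + 1 / eps * ?ind p)" if j: "j \<in> J" for j p
  proof (cases "p \<in> PD r")
   case True
   \<comment> \<open>The extra factor F_i gives |F|^(2s+1) = |F|^s |F|^(s+1). All of |\<phi>| and
     bump^(D+1) goes to \<open>X\<close>, while \<open>Y\<close> is at most 1 since s >= -1.\<close>
   define X where "X = cmod (bump r p) ^ Suc D * cmod (\<phi> p) * (\<Prod>i\<in>UNIV. cmod (F i p) powr (s i))"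
   define Y where "Y = (\<Prod>i\<in>UNIV. cmod (F i p) powr (s i + 1))"
   have XY: "0 <= X" "0 <= Y" unfolding X_def Y_def
    by (intro mult_nonneg_nonneg prod_nonneg zero_le_power norm_ge_zero powr_ge_zero)+
   have "cmod (pw (s i) 1 0 (F i p)) = cmod (F i p) powr (s i) * cmod (F i p) powr (s i + 1)" for i
   proof (cases "F i p = 0")
    case False
    then have "cmod (F i p) powr (s i) * cmod (F i p) powr (s i + 1) = cmod (F i p) powr (2 * s i + 1)" by (simp flip: powr_add)
    then show ?thesis using False by (simp add: norm_pw powr_add)
   qed simp
   then have "cmod (H (Some j) p) = cmod (h j p) * (X * Y)"
    using True by (simp add: H_def A'_def F'_def norm_mult norm_power X_def Y_def prod.distrib flip: prod_norm)
   also have "\<dots> <= c j * (X * Y)"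
    using c(2)[OF j True] XY by (intro mult_right_mono mult_nonneg_nonneg) auto
   also have "X * Y <= eps * X^2 + 1 / eps * Y^2"
   proof -
    have "0 <= (eps * X - Y)^2 / eps" using eps by simp
    also have "\<dots> = eps * X^2 + 1 / eps * Y^2 - 2 * (X * Y)" using eps by (simp add: power2_eq_square field_simps)
    finally have "2 * (X * Y) <= eps * X^2 + 1 / eps * Y^2" by simp
    moreover have "0 <= X * Y" using XY by simp
    ultimately show ?thesis by linarith
   qed
   also have "X^2 = G s p"
   proof -
    have "(cmod (F i p) powr (s i))^2 = cmod (F i p) powr (2 * s i)" for i by (simp add: power2_eq_square flip: powr_add)
    then have "(\<Prod>i\<in>UNIV. cmod (F i p) powr (s i))^2 = (\<Prod>i\<in>UNIV. cmod (F i p) powr (2 * s i))" by (simp add: prod_power_distrib)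
    moreover have "(cmod (bump r p) ^ Suc D)^2 = cmod (bump r p) ^ (2 * D + 2)" unfolding power_mult[symmetric] by (simp add: mult.commute)
    ultimately show ?thesis using True by (simp add: X_def G_def wt_def power_mult_distrib mult_ac)
   qed
   also have "c j * (eps * G s p + 1 / eps * Y^2) <= c j * (eps * G s p + 1 / eps * ?ind p)"
   proof -
    have "cmod (F i p) powr (s i + 1) <= 1" for i using F1[of p i] PDS True s[of i] by (intro powr_le1) auto
    then have "Y <= 1" unfolding Y_def by (intro prod_le_1) auto
    then have "Y^2 <= 1" using XY(2) by (simp add: power_le_one)
    then show ?thesis using True eps c(1)[OF j] by (intro mult_left_mono add_left_mono) auto
   qed
   finally show ?thesis using c(1)[OF j] by (simp add: mult_left_mono)
  qed (simp add: H_def A'_def G_def)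
  have Hi: "integrable lborel (H j')" if j': "j' \<in> insert None (Some ` J)" for j'
  proof (cases j')
   case None
   have "integrable lborel (%p. complex_of_real (G s p))" using Gi by (rule integrable_of_real)
   moreover have "H None = (%p. complex_of_real (G s p))" using H0 by (rule ext)
   ultimately show ?thesis using None by (simp only:)
  next
   case (Some j)
   then have j: "j \<in> J" using j' by auto
   have "integrable lborel (%p. c j * (eps * G s p + 1 / eps * ?ind p))" using Gi indi by simp
   then show ?thesis
   proof (rule Bochner_Integration.integrable_bound[OF _ Hm[OF j']])
    have "norm (H j' p) <= norm (c j * (eps * G s p + 1 / eps * ?ind p))" for p
     using Hj[OF j, of p] unfolding Some real_norm_def by (rule order_trans[OF _ abs_ge_self])
    then show "AE p in lborel. norm (H j' p) <= norm (c j * (eps * G s p + 1 / eps * ?ind p))" by simp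
   qed
  qed
  define e' where "e' = (%j'. case j' of None => (%z. b (%i. of_real (s i) + z)) | Some j => (%z. e j (%i. of_real (s i) + z)))"
  \<comment> \<open>At zeros of some \<open>F' i\<close> the value of \<open>v\<close> is a mere
    convention; the products of \<open>pw\<close> vanish there before and after the shift.\<close>
  define v where "v = (%p. - 2 * ln (\<Prod>i\<in>UNIV. cmod (F' i p)))"
  have v: "v \<in> borel_measurable lborel" "0 <= v p" for p
  proof -
   show "v \<in> borel_measurable lborel" unfolding v_def by measurable
   define \<pi> where "\<pi> = (\<Prod>i\<in>UNIV. cmod (F' i p))"
   have "0 <= \<pi>" "\<pi> <= 1" unfolding \<pi>_def by (intro prod_nonneg prod_le_1 conjI ballI norm_ge_zero F'1)+
   then have "ln \<pi> <= 0" by (cases "\<pi> = 0") (auto simp: less_le)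
   then show "0 <= v p" by (simp add: v_def \<pi>_def)
  qed
  have shift: "exp (- of_real t * of_real (v p)) * (\<Prod>i\<in>UNIV. pw (s i) a 0 (F' i p)) = (\<Prod>i\<in>UNIV. pw (s i + t) a 0 (F' i p))" for t a p
  proof (cases "EX i. F' i p = 0")
   case True
   then obtain i where "F' i p = 0" by blast
   then have "pw (s i) a 0 (F' i p) = 0" "pw (s i + t) a 0 (F' i p) = 0" by simp_all
   then have "(\<Prod>i\<in>UNIV. pw (s i) a 0 (F' i p)) = 0" "(\<Prod>i\<in>UNIV. pw (s i + t) a 0 (F' i p)) = 0"
    unfolding prod_zero_iff[OF finite] by blast+
   then show ?thesis by (simp only: mult_zero_right)
  next
   case False
   then have nz: "F' i p ~= 0" for i by blast
   have "v p = (\<Sum>i\<in>UNIV. - 2 * ln (cmod (F' i p)))" unfolding v_def using nz by (subst ln_prod) (auto simp: sum_distrib_left)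
   then have "- t * v p = (\<Sum>i\<in>UNIV. 2 * t * ln (cmod (F' i p)))" by (simp add: sum_distrib_left algebra_simps)
   then have "exp (- t * v p) = (\<Prod>i\<in>UNIV. cmod (F' i p) powr (2 * t))" using nz by (simp add: exp_sum powr_def)
   moreover have "exp (- of_real t * of_real (v p) :: complex) = of_real (exp (- t * v p))" by (simp add: exp_of_real[symmetric])
   ultimately have "exp (- of_real t * of_real (v p) :: complex) = (\<Prod>i\<in>UNIV. of_real (cmod (F' i p) powr (2 * t)))" by simp
   then show ?thesis unfolding pw_shift[OF nz] prod.distrib by simp
  qed
  have "(\<Sum>j'\<in>insert None (Some ` J). e' j' 0 * (\<integral>p. H j' p \<partial>lborel)) = 0"
  proof (rule laplace_continuation[where T = "real D + 2", OF _ Hi v])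
   show "finite (insert None (Some ` J))" using J by simp
   show "e' j' holomorphic_on UNIV" if "j' \<in> insert None (Some ` J)" for j'
    using that ehol by (auto simp: e'_def)
   fix t :: real assume t: "real D + 2 <= t"
   have st: "real D < s i + t" for i using s[of i] t by linarith
   have N: "(\<integral>p. exp (- of_real t * of_real (v p)) * H None p \<partial>lborel) =
    I (%p. bump r p ^ (2 * D + 2) * \<phi> p * (\<Prod>i\<in>UNIV. pw (s i + t) 0 0 (F i p)) * cnj (\<phi> p))"
   proof (rule Bochner_Integration.integral_cong[OF refl])
    fix p
    have "exp (- of_real t * of_real (v p)) * H None p = A p * (exp (- of_real t * of_real (v p)) * (\<Prod>i\<in>UNIV. pw (s i) 0 0 (F' i p)))"
     by (simp add: H_def mult_ac)
    then show "exp (- of_real t * of_real (v p)) * H None p = indicator (PD r) p *\<^sub>R (bump r p ^ (2 * D + 2) * \<phi> p * (\<Prod>i\<in>UNIV. pw (s i + t) 0 0 (F i p)) * cnj (\<phi> p))"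
     unfolding shift by (cases "p \<in> PD r") (auto simp: A_def F'_def mult_ac)
   qed
   have Sj: "(\<integral>p. exp (- of_real t * of_real (v p)) * H (Some j) p \<partial>lborel) =
    - I (%p. bump r p ^ Suc D * h j p * ((\<Prod>i\<in>UNIV. pw (s i + t) 1 0 (F i p)) * cnj (\<phi> p)))" for j
    unfolding Bochner_Integration.integral_minus[symmetric]
   proof (rule Bochner_Integration.integral_cong[OF refl])
    fix p
    have "exp (- of_real t * of_real (v p)) * H (Some j) p = - (A' j p * (exp (- of_real t * of_real (v p)) * (\<Prod>i\<in>UNIV. pw (s i) 1 0 (F' i p))))"
     by (simp add: H_def mult_ac)
    then show "exp (- of_real t * of_real (v p)) * H (Some j) p = - (indicator (PD r) p *\<^sub>R (bump r p ^ Suc D * h j p * ((\<Prod>i\<in>UNIV. pw (s i + t) 1 0 (F i p)) * cnj (\<phi> p))))"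
     unfolding shift by (cases "p \<in> PD r") (auto simp: A'_def F'_def mult_ac)
   qed
   have n: "None ~: Some ` J" by auto
   show "(\<Sum>j'\<in>insert None (Some ` J). e' j' (of_real t) * (\<integral>p. exp (- of_real t * of_real (v p)) * H j' p \<partial>lborel)) = 0"
    unfolding sum.insert[OF finite_imageI[OF J] n] sum.reindex[OF inj_Some] o_def N Sj
    using id[of "%i. s i + t", OF st] by (simp add: e'_def sum_negf)
  qed
  then have "b (%i. of_real (s i)) * (\<integral>p. H None p \<partial>lborel) = - (\<Sum>j\<in>J. e j (%i. of_real (s i)) * (\<integral>p. H (Some j) p \<partial>lborel))"
   using J by (subst (asm) sum.insert) (auto simp: sum.reindex e'_def add_eq_0_iff2)
  moreover have "(\<integral>p. H None p \<partial>lborel) = of_real (\<integral>p. G s p \<partial>lborel)" unfolding H0 by simp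
  ultimately have "cmod (b (%i. of_real (s i))) * (\<integral>p. G s p \<partial>lborel) = cmod (\<Sum>j\<in>J. e j (%i. of_real (s i)) * (\<integral>p. H (Some j) p \<partial>lborel))"
  proof -
   assume a: "b (%i. of_real (s i)) * (\<integral>p. H None p \<partial>lborel) = - (\<Sum>j\<in>J. e j (%i. of_real (s i)) * (\<integral>p. H (Some j) p \<partial>lborel))"
    "(\<integral>p. H None p \<partial>lborel) = of_real (\<integral>p. G s p \<partial>lborel)"
   have "0 <= (\<integral>p. G s p \<partial>lborel)" by (rule Bochner_Integration.integral_nonneg) (simp add: G_def wt_nonneg)
   then show ?thesis using arg_cong[OF a(1), of cmod] by (simp add: a(2) norm_mult)
  qed
  also have "\<dots> <= (\<Sum>j\<in>J. c j * (eps * (\<integral>p. G s p \<partial>lborel) + 1 / eps * vol))"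
  proof (rule sum_norm_le)
   fix j assume j: "j \<in> J"
   have "cmod (e j (%i. of_real (s i))) <= 1" using s by (intro e1 j) (auto simp: abs_le_iff)
   moreover have "cmod (\<integral>p. H (Some j) p \<partial>lborel) <= (\<integral>p. c j * (eps * G s p + 1 / eps * ?ind p) \<partial>lborel)"
    by (rule order_trans[OF integral_norm_bound integral_mono]) (use Hi[of "Some j"] j Hj[OF j] Gi indi in auto)
   moreover have "(\<integral>p. c j * (eps * G s p + 1 / eps * ?ind p) \<partial>lborel) = c j * (eps * (\<integral>p. G s p \<partial>lborel) + 1 / eps * vol)"
    using Gi indi by simp
   ultimately show "norm (e j (%i. of_real (s i)) * (\<integral>p. H (Some j) p \<partial>lborel)) <= c j * (eps * (\<integral>p. G s p \<partial>lborel) + 1 / eps * vol)"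
    unfolding norm_mult
    using mult_right_mono[of "cmod (e j (%i. of_real (s i)))" 1 "cmod (\<integral>p. H (Some j) p \<partial>lborel)"] norm_ge_zero[of "\<integral>p. H (Some j) p \<partial>lborel"] by linarith
  qed
  also have "\<dots> <= C * (eps * (\<integral>p. G s p \<partial>lborel) + 1 / eps)"
  proof -
   have G0: "0 <= (\<integral>p. G s p \<partial>lborel)" by (rule Bochner_Integration.integral_nonneg) (simp add: G_def wt_nonneg)
   have v0: "vol >= 0" by (simp add: vol_def)
   have "eps * (\<integral>p. G s p \<partial>lborel) + 1 / eps * vol <= (1 + vol) * (eps * (\<integral>p. G s p \<partial>lborel) + 1 / eps)"
   proof -
    have "0 <= 1 / eps + vol * (eps * (\<integral>p. G s p \<partial>lborel))" using G0 v0 eps by (intro add_nonneg_nonneg mult_nonneg_nonneg) auto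
    moreover have "(1 + vol) * (eps * (\<integral>p. G s p \<partial>lborel) + 1 / eps) = eps * (\<integral>p. G s p \<partial>lborel) + 1 / eps * vol + (1 / eps + vol * (eps * (\<integral>p. G s p \<partial>lborel)))"
     by (simp add: distrib_left distrib_right add_divide_distrib)
    ultimately show ?thesis by linarith
   qed
   then show ?thesis unfolding C_def sum_distrib_right[symmetric] mult.assoc using c(1) by (intro mult_left_mono sum_nonneg) auto
  qed
  finally show "integrable lborel (G s) & cmod (b (%i. of_real (s i))) * (\<integral>p. G s p \<partial>lborel) <= C * (eps * (\<integral>p. G s p \<partial>lborel) + 1 / eps)"
   using Gi by blast
 qed
qed

end

text \<open>The constant \<open>C\<close> does not depend on the exponents, so the cut-off integrals
  along \<open>xs\<close> stay bounded as soon as |b| is bounded below. Fatou's lemma bounds the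
  limit, and on a smaller polydisc the cut-off can be divided out.\<close>

theorem bernstein_lint:
 fixes f :: "'n::finite => germ" and xs :: "nat => 'n => real"
 assumes b: "b \<in> bernstein_ideal f" and fnz: "!!i. f i ~= 0" and f0: "!!i. germ_at0 (f i) = 0"
  and \<phi>: "hol2_at0 \<phi>" and U: "open U" "0 \<in> U"
  and int: "!!k. wt \<phi> (%i. rep_germ (f i)) (xs k) L1_on U"
  and xs: "!!k i. -1 <= xs k i & xs k i <= 1" and lim: "!!i. (%k. xs k i) \<longlonglongrightarrow> s i"
  and nz: "mpol_eval (%c. c) b (%i. of_real (s i)) ~= 0"
 shows "lint (wt \<phi> (%i. rep_germ (f i)) s)"
proof -
 let ?F = "%i. rep_germ (f i)"
 let ?b = "%s :: 'n => real. mpol_eval (%c. c) b (%i. of_real (s i))"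
 obtain P :: "'n diffop" and V where V: "open V" "0 \<in> V" and P': "ALL W \<l>. open W & W \<subseteq> V &
    (ALL i. \<l> i hol2_on W & (ALL p:W. exp (\<l> i p) = ?F i p)) -->
   (ALL s. ALL p:W. diffop_apply P s (%q. exp (\<Sum>i\<in>UNIV. (s i + 1) * \<l> i q)) p =
    mpol_eval (%c. c) b s * exp (\<Sum>i\<in>UNIV. s i * \<l> i p))"
  using b unfolding bernstein_ideal_def by blast
 \<comment> \<open>One index for each monomial in s of each coefficient of \<open>P\<close>:
   \<open>e\<close> is the monomial and \<open>g\<close> the germ in front of it, so that the
   dependence on s and on the point separate.\<close>
 define J where "J = (SIGMA kl:Poly_Mapping.keys P. Poly_Mapping.keys (Poly_Mapping.lookup P kl))"
 define e where "e = (%(kl :: nat \<times> nat, \<mu> :: 'n \<Rightarrow>\<^sub>0 nat) (s :: 'n => complex). \<Prod>i\<in>UNIV. s i ^ Poly_Mapping.lookup \<mu> i)"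
 define g where "g = (%(kl, \<mu>). rep_germ (Poly_Mapping.lookup (Poly_Mapping.lookup P kl) \<mu>))"
 define D where "D = (\<Sum>kl\<in>Poly_Mapping.keys P. fst kl + snd kl)"
 have J: "finite J" by (simp add: J_def)
 have jD: "fst (fst j) + snd (fst j) <= D" if "j \<in> J" for j
  unfolding D_def by (rule member_le_sum[of "fst j" _ "%kl. fst kl + snd kl"]) (use that in "auto simp: J_def")
 obtain R1 where R1: "R1 > 0" "ALL j:J. g j hol2_on PD R1"
  using hol2_at0_finite[OF J, of g] hol2_at0_rep_germ by (auto simp: g_def case_prod_beta)
 obtain R2 where R2: "R2 > 0" "ALL i:UNIV. ?F i hol2_on PD R2"
  using hol2_at0_finite[of UNIV ?F] hol2_at0_rep_germ by auto
 obtain R3 where R3: "R3 > 0" "\<phi> hol2_on PD R3" using \<phi> by (auto simp: hol2_at0_PD)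
 have "\<forall>\<^sub>F p in nhds 0. cmod (?F i p) < 1" for i
 proof -
  have "continuous_on (PD R2) (?F i)" using R2(2) by (intro hol2_on_continuous) simp
  then have "isCont (?F i) 0" using continuous_on_interior[of "PD R2" "?F i" 0] R2(1) by (simp add: interior_open)
  moreover have "?F i 0 = 0" using f0[of i] by (simp add: germ_at0_eq)
  ultimately have "(?F i \<longlongrightarrow> 0) (nhds 0)" using tendsto_at_iff_tendsto_nhds[of "?F i" 0] by (simp add: isCont_def)
  then have "((%p. cmod (?F i p)) \<longlongrightarrow> 0) (nhds 0)" by (rule tendsto_norm_zero)
  then show ?thesis by (rule order_tendstoD(2)) simp
 qed
 then have "\<forall>\<^sub>F p in nhds 0. ALL i. cmod (?F i p) < 1" by (intro eventually_all_finite) auto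
 moreover have "\<forall>\<^sub>F p in nhds 0. p \<in> V Int U" using V U by (intro eventually_nhds_in_open) auto
 ultimately have "\<forall>\<^sub>F p in nhds 0. (ALL i. cmod (?F i p) < 1) & p \<in> V Int U" by (rule eventually_conj)
 then obtain R4 where R4: "R4 > 0" "!!p. p \<in> PD R4 ==> (ALL i. cmod (?F i p) < 1) & p \<in> V Int U" unfolding eventually_nhds_0_PD by blast
 define R where "R = min (min R1 R2) (min R3 R4)"
 have R: "R > 0" "R <= R1" "R <= R2" "R <= R3" "R <= R4" using R1 R2 R3 R4 by (auto simp: R_def)
 define S where "S = PD R"
 have SS: "open S" "convex S" "0 \<in> S" "S \<subseteq> V" "S \<subseteq> U"
 proof -
  show "open S" "convex S" "0 \<in> S" using R(1) by (simp_all add: S_def) (simp add: PD_def convex_Times)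
  show "S \<subseteq> V" "S \<subseteq> U" using R4(2) PD_mono[OF R(5)] unfolding S_def by blast+
 qed
 have Fh: "?F i hol2_on S" for i using hol2_on_subset[OF _ PD_mono[OF R(3)]] R2(2) by (simp add: S_def)
 have \<phi>h: "\<phi> hol2_on S" using hol2_on_subset[OF R3(2) PD_mono[OF R(4)]] by (simp add: S_def)
 have gh: "g j hol2_on S" if "j \<in> J" for j using hol2_on_subset[OF _ PD_mono[OF R(2)]] R1(2) that by (simp add: S_def)
 have F1: "cmod (?F i p) <= 1" if "p \<in> S" for i p
  using R4(2)[of p] that PD_mono[OF R(5)] unfolding S_def by (meson less_imp_le subsetD)
 have Fnz: "EX p:S. ?F i p ~= 0" for i
 proof (rule ccontr)
  assume "~ (EX p:S. ?F i p ~= 0)"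
  then have "\<forall>\<^sub>F p in nhds 0. ?F i p = 0" using SS(1,3) by (auto simp: eventually_nhds)
  then show False using rep_germ_nonzero[OF fnz] by blast
 qed
 define r where "r = R / 2"
 have r: "r > 0" using R by (simp add: r_def)
 interpret bumped r S
  by unfold_locales (use SS r in "auto simp: S_def PD_def r_def")
 define u where "u = (%(s :: 'n => real) p. (\<Prod>i\<in>UNIV. pw (s i) 1 0 (?F i p)) * cnj (\<phi> p))"
 \<comment> \<open>Logarithms exist only where no \<open>f i\<close> vanishes. Both sides are
   continuous for exponents above \<open>D\<close>, and the remaining points are limits of such
   points.\<close>
 have eq: "(\<Sum>j\<in>J. e j (%i. of_real (s i)) * g j p * (wx ^^ fst (fst j)) ((wy ^^ snd (fst j)) (u s)) p) =
   ?b s * (\<Prod>i\<in>UNIV. pw (s i) 0 0 (?F i p)) * cnj (\<phi> p)" (is "?L p = ?R p")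
  if s: "!!i. real D < s i" and p: "p \<in> S" for s p
 proof (rule ccontr)
  assume ne: "?L p ~= ?R p"
  have u: "Cw D (u s) S" unfolding u_def by (intro Cw_mult Cw_prod Cw_pw Cw_cnj Cw_hol2 \<phi>h Fh SS(1) s)
  have cu: "continuous_on S ((wx ^^ fst (fst j)) ((wy ^^ snd (fst j)) (u s)))" if "j \<in> J" for j
  proof -
   have "Cw (0 + fst (fst j)) ((wy ^^ snd (fst j)) (u s)) S"
    by (rule Cw_funpow(2)) (use Cw_le[OF u jD[OF that]] SS(1) in "simp_all del: Cw.simps")
   then have "Cw 0 ((wx ^^ fst (fst j)) ((wy ^^ snd (fst j)) (u s))) S" by (rule Cw_funpow(1)[OF _ SS(1)])
   then show ?thesis by simp
  qed
  have cL: "continuous_on S ?L"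
   by (intro continuous_on_sum continuous_on_mult continuous_on_const hol2_on_continuous[OF gh] cu)
  have cp: "continuous_on S (%p. pw (s i) 0 0 (?F i p))" for i
   by (rule Cw_continuous[of 0]) (intro Cw_pw Fh SS(1), use s[of i] in simp)
  have cR: "continuous_on S ?R" by (intro continuous_intros hol2_on_continuous[OF \<phi>h] cp)
  define T where "T = S Int (%p. ?L p - ?R p) -` (- {0})"
  have oT: "open T" unfolding T_def by (intro continuous_open_preimage continuous_on_diff cL cR SS(1)) auto
  have neT: "T ~= {}" using ne p by (auto simp: T_def)
  have TS: "T \<subseteq> S" by (auto simp: T_def)
  from common_nonzero[where F = ?F, OF finite[of "UNIV :: 'n set"] Fh SS(1,2) Fnz oT TS neT]
  obtain q where q: "q \<in> T" "!!i. ?F i q ~= 0" by blast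
  then have qS: "q \<in> S" by (simp add: T_def)
  have "?L q = (\<Sum>(k, l)\<in>Poly_Mapping.keys P. mpol_eval (%g. rep_germ g q) (Poly_Mapping.lookup P (k, l)) (%i. of_real (s i)) *
   (wx ^^ k) ((wy ^^ l) (u s)) q)"
   unfolding J_def mpol_eval_def sum_distrib_right case_prod_beta prod.collapse
   by (subst sum.Sigma) (auto simp: e_def g_def case_prod_beta mult_ac intro!: sum.cong)
  also have "\<dots> = ?R q" unfolding u_def
   by (rule functional_identity[OF _ SS(1,4) Fh \<phi>h qS q(2)]) (use P' in blast)
  finally show False using q(1) by (simp add: T_def)
 qed
 obtain h where h: "!!j. j \<in> J ==> continuous_on S (h j)" "!!s. (!!i. real D < s i) ==>
   ?b s * I (%p. bump r p ^ (2 * D + 2) * \<phi> p * (\<Prod>i\<in>UNIV. pw (s i) 0 0 (?F i p)) * cnj (\<phi> p)) =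
   (\<Sum>j\<in>J. e j (%i. of_real (s i)) * I (%p. bump r p ^ Suc D * h j p * ((\<Prod>i\<in>UNIV. pw (s i) 1 0 (?F i p)) * cnj (\<phi> p))))"
  by (rule regular_identity[where F = ?F and \<phi> = \<phi> and J = J and g = g and k = "%j. fst (fst j)" and l = "%j. snd (fst j)" and D = D
    and e = e and b = "mpol_eval (%c. c) b", OF \<phi>h Fh J gh jD eq[unfolded u_def]]) blast+
 define G where "G = (%s p. indicator (PD r) p * (cmod (bump r p) ^ (2 * D + 2) * wt \<phi> ?F s p))"
 have eh: "(%z. e j (%i. s i + z)) holomorphic_on UNIV" for j s
  unfolding e_def case_prod_beta by (intro holomorphic_intros)
 have bh: "(%z. mpol_eval (%c. c) b (%i. s i + z)) holomorphic_on UNIV" for s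
  unfolding mpol_eval_def by (intro holomorphic_intros)
 have e1: "cmod (e j s) <= 1" if "!!i. cmod (s i) <= 1" for j s
  unfolding e_def case_prod_beta prod_norm[symmetric] norm_power using that by (intro prod_le_1 conjI zero_le_power power_le_one) auto
 obtain C where C: "C >= 0" "!!s eps. (!!i. -1 <= s i & s i <= 1) ==> wt \<phi> ?F s L1_on PD r ==> eps > 0 ==>
  integrable lborel (G s) & cmod (?b s) * (\<integral>p. G s p \<partial>lborel) <= C * (eps * (\<integral>p. G s p \<partial>lborel) + 1 / eps)"
  unfolding G_def
  by (rule shifted_bound[where F = ?F and \<phi> = \<phi> and J = J and D = D and e = e and b = "mpol_eval (%c. c) b" and h = h, OF \<phi>h Fh F1 J h(1,2) eh bh e1]) blast+
 have intr: "wt \<phi> ?F (xs k) L1_on PD r" for k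
  by (rule absolutely_integrable_open_subset[OF int]) (use PDS SS(5) in auto)
 define \<beta> where "\<beta> = cmod (?b s) / 2"
 have \<beta>: "\<beta> > 0" using nz by (simp add: \<beta>_def)
 have "(%k. cmod (?b (xs k))) \<longlonglongrightarrow> cmod (?b s)"
  unfolding mpol_eval_def by (intro tendsto_intros lim)
 then have ev: "\<forall>\<^sub>F k in sequentially. \<beta> < cmod (?b (xs k))"
  by (rule order_tendstoD(1)) (use \<beta> in "simp add: \<beta>_def")
 \<comment> \<open>With this choice C * eps <= \<beta>/2, so the integral on the right is absorbed
   by half of the one on the left, which leaves the bound \<open>K\<close>.\<close>
 define eps where "eps = \<beta> / (2 * (C + 1))"
 have eps: "eps > 0" using \<beta> C(1) by (simp add: eps_def)
 define K where "K = 2 * C / (eps * \<beta>)"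
 have Gi: "integrable lborel (G (xs k))" for k using C(2)[OF xs intr eps] by blast
 have Gnn: "0 <= G s p" for s p by (simp add: G_def wt_nonneg)
 have GK: "(\<integral>\<^sup>+p. ennreal (G (xs k) p) \<partial>lborel) <= ennreal K" if k: "\<beta> < cmod (?b (xs k))" for k
 proof -
  define X where "X = (\<integral>p. G (xs k) p \<partial>lborel)"
  have X0: "X >= 0" unfolding X_def by (rule Bochner_Integration.integral_nonneg) (rule Gnn)
  have "\<beta> * X <= cmod (?b (xs k)) * X" using k X0 by (intro mult_right_mono) auto
  also have "\<dots> <= C * (eps * X + 1 / eps)" using C(2)[OF xs intr eps, of k] by (simp add: X_def)
  also have "\<dots> = (C * eps) * X + C / eps" by (simp add: distrib_left)
  also have "(C * eps) * X <= (\<beta> / 2) * X"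
   using C(1) \<beta> X0 by (intro mult_right_mono) (auto simp: eps_def field_simps)
  finally have "X <= K" using \<beta> eps by (simp add: K_def field_simps)
  moreover have "(\<integral>\<^sup>+p. ennreal (G (xs k) p) \<partial>lborel) = ennreal X"
   unfolding X_def by (rule nn_integral_eq_integral[OF Gi]) (use Gnn in simp)
  ultimately show ?thesis by (simp add: ennreal_leI)
 qed
 have Gl: "(%k. G (xs k) p) \<longlonglongrightarrow> G s p" for p
 proof -
  have cF: "(%k. cmod (?F i p) powr (2 * xs k i)) \<longlonglongrightarrow> cmod (?F i p) powr (2 * s i)" for i
  proof (cases "?F i p = 0")
   case False
   then show ?thesis by (intro tendsto_powr tendsto_intros lim) auto
  qed simp
  show ?thesis unfolding G_def wt_def by (intro tendsto_mult tendsto_prod tendsto_const cF)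
 qed
 have Gm: "G s \<in> borel_measurable lborel"
  by (rule borel_measurable_LIMSEQ_real[OF Gl]) (use Gi in blast)
 have "(\<integral>\<^sup>+p. ennreal (G s p) \<partial>lborel) = (\<integral>\<^sup>+p. liminf (%k. ennreal (G (xs k) p)) \<partial>lborel)"
 proof (rule nn_integral_cong)
  fix p
  have "(%k. ennreal (G (xs k) p)) \<longlonglongrightarrow> ennreal (G s p)" by (rule tendsto_ennrealI[OF Gl])
  then show "ennreal (G s p) = liminf (%k. ennreal (G (xs k) p))" using lim_imp_Liminf by (metis sequentially_bot)
 qed
 also have "\<dots> <= liminf (%k. \<integral>\<^sup>+p. ennreal (G (xs k) p) \<partial>lborel)"
  by (rule nn_integral_liminf) (use Gi in simp)
 also have "\<dots> <= limsup (%k. \<integral>\<^sup>+p. ennreal (G (xs k) p) \<partial>lborel)" by (rule Liminf_le_Limsup) simp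
 also have "\<dots> <= ennreal K" by (rule Limsup_bounded) (use ev GK in "auto elim: eventually_mono")
 finally have "(\<integral>\<^sup>+p. ennreal (G s p) \<partial>lborel) < \<infinity>" by (simp add: order_le_less_trans)
 then have Gs: "integrable lborel (G s)" using Gm Gnn by (intro integrableI_nonneg) auto
 \<comment> \<open>A lower bound for the power of the cut-off on the polydisc of half the
   radius.\<close>
 define c where "c = ((r^2 - (r / 2)^2) * (r^2 - (r / 2)^2)) ^ (2 * D + 2)"
 have rr: "r^2 - (r / 2)^2 > 0" using r by (simp add: power_divide)
 then have c: "c > 0" unfolding c_def by simp
 have "integrable lebesgue (%p. G s p / c)" using Gs Gm by (simp add: integrable_completion)
 then have Gc: "(%p. G s p / c) L1_on PD (r / 2)"
  unfolding set_integrable_def by (rule integrable_mult_indicator[rotated]) simp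
 have "wt \<phi> ?F s L1_on PD (r / 2)"
 proof (rule dominated_absolutely_integrable[OF _ open_PD Gc negligible_empty])
  have sub: "PD (r / 2) \<subseteq> S" using PDS r PD_mono[of "r / 2" r] by auto
  show "wt \<phi> ?F s \<in> borel_measurable (lebesgue_on (PD (r / 2)))"
   by (rule measurable_wt[OF hol2_on_subset[OF \<phi>h sub] hol2_on_subset[OF Fh sub] open_PD])
  fix p assume "p \<in> PD (r / 2) - {}"
  then have p: "cmod (fst p) < r / 2" "cmod (snd p) < r / 2" by (auto simp: PD_def)
  have "(r^2 - (r / 2)^2) * (r^2 - (r / 2)^2) <= (r^2 - (cmod (fst p))^2) * (r^2 - (cmod (snd p))^2)"
   using p rr r by (intro mult_mono diff_left_mono power_mono diff_ge_0_iff_ge[THEN iffD2]) auto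
  also have "\<dots> <= cmod (bump r p)" unfolding bump_real norm_of_real by (rule abs_ge_self)
  finally have "c <= cmod (bump r p) ^ (2 * D + 2)" unfolding c_def using rr by (intro power_mono) auto
  then have "c * wt \<phi> ?F s p <= cmod (bump r p) ^ (2 * D + 2) * wt \<phi> ?F s p" by (intro mult_right_mono wt_nonneg)
  moreover have "p \<in> PD r" using p r by (cases p) (auto simp: PD_def)
  ultimately have "c * wt \<phi> ?F s p <= G s p" by (simp add: G_def)
  then show "\<bar>wt \<phi> ?F s p\<bar> <= G s p / c" using c by (simp add: wt_nonneg pos_le_divide_eq mult.commute)
 qed
 then show ?thesis unfolding lint_def using r by (intro exI[of _ "PD (r / 2)"]) auto
qed

section \<open>Polynomials vanishing on hyperplanes\<close>

abbreviation ev :: "('n::finite, complex) mpol => ('n => complex) => complex"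
 where "ev \<equiv> mpol_eval (%c. c)"

abbreviation mono_at :: "('n::finite \<Rightarrow>\<^sub>0 nat) => ('n => complex) => complex"
 where "mono_at \<mu> s \<equiv> \<Prod>i\<in>UNIV. s i ^ Poly_Mapping.lookup \<mu> i"

lemma ev_superset:
 "finite K ==> Poly_Mapping.keys q \<subseteq> K ==> ev q s = (\<Sum>\<mu>\<in>K. Poly_Mapping.lookup q \<mu> * mono_at \<mu> s)"
 unfolding mpol_eval_def by (rule sum.mono_neutral_left) (auto simp: in_keys_iff)

lemma ev_zero [simp]: "ev 0 s = 0" by (simp add: mpol_eval_def)

lemma ev_add: "ev (p + q) s = ev p s + ev q s"
proof -
 let ?K = "Poly_Mapping.keys p Un Poly_Mapping.keys q"
 have K: "finite ?K" "Poly_Mapping.keys p \<subseteq> ?K" "Poly_Mapping.keys q \<subseteq> ?K" by auto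
 show ?thesis
  unfolding ev_superset[OF K(1) keys_add] ev_superset[OF K(1,2)] ev_superset[OF K(1,3)]
  by (simp add: lookup_add distrib_right sum.distrib)
qed

lemma ev_sum: "ev (sum f A) s = (\<Sum>a\<in>A. ev (f a) s)"
 by (induction A rule: infinite_finite_induct) (simp_all add: ev_add)

lemma ev_single: "ev (Poly_Mapping.single \<mu> c) s = c * mono_at \<mu> s"
 using ev_superset[of "{\<mu>}" "Poly_Mapping.single \<mu> c" s] by simp

lemma sum_singles:
 fixes p :: "('n::finite, complex) mpol"
 shows "p = (\<Sum>\<mu>\<in>Poly_Mapping.keys p. Poly_Mapping.single \<mu> (Poly_Mapping.lookup p \<mu>))"
 by (rule poly_mapping_eqI) (simp add: lookup_sum lookup_single when_def in_keys_iff)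

lemma ev_mult: "ev (p * q) s = ev p s * ev q s"
proof -
 let ?m = "%p \<mu>. Poly_Mapping.single \<mu> (Poly_Mapping.lookup p \<mu>)"
 have p: "p = (\<Sum>\<mu>\<in>Poly_Mapping.keys p. ?m p \<mu>)" for p :: "('n::finite, complex) mpol"
  by (rule sum_singles)
 have "ev (?m p \<mu> * ?m q \<nu>) s = ev (?m p \<mu>) s * ev (?m q \<nu>) s" for \<mu> \<nu>
  by (simp add: mult_single ev_single lookup_add power_add prod.distrib)
 then have "ev ((\<Sum>\<mu>\<in>Poly_Mapping.keys p. ?m p \<mu>) * (\<Sum>\<nu>\<in>Poly_Mapping.keys q. ?m q \<nu>)) s =
   ev (\<Sum>\<mu>\<in>Poly_Mapping.keys p. ?m p \<mu>) s * ev (\<Sum>\<nu>\<in>Poly_Mapping.keys q. ?m q \<nu>) s"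
  by (simp add: sum_product ev_sum)
 then show ?thesis by (simp flip: p)
qed

lemma ev_const [simp]: "ev (mpol_const c) s = c"
 by (simp add: mpol_const_def ev_single)

lemma ev_one [simp]: "ev 1 s = 1"
 using ev_const[of 1 s] by (simp add: mpol_const_def)

lemma ev_var [simp]: "ev (mpol_var i) s = s i"
proof -
 have "mono_at (Poly_Mapping.single i 1) s = (\<Prod>k\<in>UNIV. if k = i then s i else 1)"
  by (rule prod.cong) (auto simp: lookup_single when_def)
 then show ?thesis by (simp add: mpol_var_def ev_single)
qed

lemma ev_diff: "ev (p - q) s = ev p s - ev q s"
 using ev_add[of "p - q" q s] by simp

lemma ev_prod: "ev (prod f A) s = (\<Prod>a\<in>A. ev (f a) s)"
 by (induction A rule: infinite_finite_induct) (simp_all add: ev_mult)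

lemma ev_power: "ev (p ^ n) s = ev p s ^ n"
 by (induction n) (simp_all add: ev_mult)

lemma ev_shifted_form:
 "ev (shifted_form a c) (%i. of_real (x $ i - 1)) = of_real (a \<bullet> x - c)"
 by (simp add: shifted_form_def ev_diff ev_sum ev_mult ev_add inner_vec_def)

text \<open>The coefficients are compared one variable at a time.\<close>

lemma coefficients_zero:
 fixes c :: "('n::finite \<Rightarrow>\<^sub>0 nat) => complex" and B :: "'n => complex set"
 assumes "finite A" "finite K" "!!i. infinite (B i)"
  and "!!s. (!!i. s i \<in> B i) ==> (\<Sum>\<mu>\<in>K. c \<mu> * (\<Prod>i\<in>A. s i ^ Poly_Mapping.lookup \<mu> i)) = 0"
 shows "(\<Sum>\<mu>\<in>{\<mu> \<in> K. ALL i:A. Poly_Mapping.lookup \<mu> i = \<nu> i}. c \<mu>) = 0"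
 using assms(1,2,4)
proof (induction A arbitrary: K rule: finite_induct)
 case empty
 have "EX x. x \<in> B i" for i using assms(3)[of i] infinite_imp_nonempty by blast
 then obtain s where "!!i. s i \<in> B i" by metis
 then show ?case using empty.prems(2)[of s] by simp
next
 case (insert a A)
 have K: "finite K" by (rule insert.prems(1))
 define N where "N = Max (insert (\<nu> a) ((%\<mu>. Poly_Mapping.lookup \<mu> a) ` K))"
 have N: "\<nu> a <= N" "!!\<mu>. \<mu> \<in> K ==> Poly_Mapping.lookup \<mu> a <= N" using K by (auto simp: N_def)
 have "(\<Sum>\<mu>\<in>{\<mu> \<in> K. Poly_Mapping.lookup \<mu> a = \<nu> a}. c \<mu> * (\<Prod>i\<in>A. s i ^ Poly_Mapping.lookup \<mu> i)) = 0"
  if s: "!!i. s i \<in> B i" for s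
 proof -
  define d where "d = (%k. \<Sum>\<mu>\<in>{\<mu> \<in> K. Poly_Mapping.lookup \<mu> a = k}. c \<mu> * (\<Prod>i\<in>A. s i ^ Poly_Mapping.lookup \<mu> i))"
  have "(\<Sum>k\<le>N. d k * t ^ k) = 0" if t: "t \<in> B a" for t
  proof -
   have "(\<Sum>k\<le>N. d k * t ^ k) = (\<Sum>k\<le>N. \<Sum>\<mu>\<in>{\<mu> \<in> K. Poly_Mapping.lookup \<mu> a = k}. c \<mu> * (\<Prod>i\<in>A. s i ^ Poly_Mapping.lookup \<mu> i) * t ^ Poly_Mapping.lookup \<mu> a)"
    by (simp add: d_def sum_distrib_right)
   also have "\<dots> = (\<Sum>\<mu>\<in>K. c \<mu> * (\<Prod>i\<in>A. s i ^ Poly_Mapping.lookup \<mu> i) * t ^ Poly_Mapping.lookup \<mu> a)"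
    by (rule sum.group) (use K N in auto)
   also have "\<dots> = (\<Sum>\<mu>\<in>K. c \<mu> * (\<Prod>i\<in>insert a A. (s(a := t)) i ^ Poly_Mapping.lookup \<mu> i))"
   proof (rule sum.cong[OF refl])
    fix \<mu>
    have "(\<Prod>i\<in>A. (s(a := t)) i ^ Poly_Mapping.lookup \<mu> i) = (\<Prod>i\<in>A. s i ^ Poly_Mapping.lookup \<mu> i)"
     by (rule prod.cong) (use insert.hyps(2) in auto)
    then show "c \<mu> * (\<Prod>i\<in>A. s i ^ Poly_Mapping.lookup \<mu> i) * t ^ Poly_Mapping.lookup \<mu> a = c \<mu> * (\<Prod>i\<in>insert a A. (s(a := t)) i ^ Poly_Mapping.lookup \<mu> i)"
     using insert.hyps by simp
   qed
   also have "\<dots> = 0" by (rule insert.prems(2)) (use s t in auto)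
   finally show ?thesis .
  qed
  then have "B a \<subseteq> {t. (\<Sum>k\<le>N. d k * t ^ k) = 0}" by blast
  then have "~ finite {t. (\<Sum>k\<le>N. d k * t ^ k) = 0}" using assms(3) finite_subset by blast
  then have "ALL k<=N. d k = 0" by (simp add: polyfun_finite_roots)
  then show ?thesis using N(1) by (simp add: d_def)
 qed
 from insert.IH[OF _ this] have "(\<Sum>\<mu>\<in>{\<mu> \<in> {\<mu> \<in> K. Poly_Mapping.lookup \<mu> a = \<nu> a}. ALL i:A. Poly_Mapping.lookup \<mu> i = \<nu> i}. c \<mu>) = 0"
  using K by simp
 moreover have "{\<mu> \<in> {\<mu> \<in> K. Poly_Mapping.lookup \<mu> a = \<nu> a}. ALL i:A. Poly_Mapping.lookup \<mu> i = \<nu> i} = {\<mu> \<in> K. ALL i:insert a A. Poly_Mapping.lookup \<mu> i = \<nu> i}" by auto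
 ultimately show ?case by simp
qed

text \<open>All exponents are prescribed at once, so the sum in \<open>coefficients_zero\<close>
  reduces to a single coefficient. Inserting \<open>\<nu>\<close> into the index set covers
  exponents that do not occur in \<open>q\<close>.\<close>

lemma mpol_zero_on_box:
 assumes "!!i. infinite (B i)" "!!s. (!!i. s i \<in> B i) ==> ev q s = 0" shows "q = 0"
proof (rule poly_mapping_eqI)
 fix \<nu>
 have "(\<Sum>\<mu>\<in>{\<mu> \<in> insert \<nu> (Poly_Mapping.keys q). ALL i:UNIV. Poly_Mapping.lookup \<mu> i = Poly_Mapping.lookup \<nu> i}. Poly_Mapping.lookup q \<mu>) = 0"
 proof (rule coefficients_zero[OF _ _ assms(1)])
  fix s assume "!!i. s i \<in> B i"
  then have "ev q s = 0" by (rule assms(2))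
  then show "(\<Sum>\<mu>\<in>insert \<nu> (Poly_Mapping.keys q). Poly_Mapping.lookup q \<mu> * mono_at \<mu> s) = 0"
   using ev_superset[of "insert \<nu> (Poly_Mapping.keys q)" q s] by auto
 qed auto
 moreover have "{\<mu> \<in> insert \<nu> (Poly_Mapping.keys q). ALL i:UNIV. Poly_Mapping.lookup \<mu> i = Poly_Mapping.lookup \<nu> i} = {\<nu>}"
  by (auto intro: poly_mapping_eqI)
 ultimately show "Poly_Mapping.lookup q \<nu> = Poly_Mapping.lookup 0 \<nu>" by simp
qed

lemma dvd_power_diff: "(x - y :: 'a::comm_ring_1) dvd x ^ n - y ^ n"
proof (induction n)
 case (Suc n)
 have "x ^ Suc n - y ^ Suc n = x * (x ^ n - y ^ n) + (x - y) * y ^ n" by (simp add: algebra_simps)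
 then show ?case using Suc by simp
qed simp

lemma mono_single: "Poly_Mapping.single (\<mu> :: 'n::finite \<Rightarrow>\<^sub>0 nat) (1::complex) = (\<Prod>i\<in>UNIV. mpol_var i ^ Poly_Mapping.lookup \<mu> i)"
proof -
 have "mpol_var i ^ k = Poly_Mapping.single (Poly_Mapping.single i k) (1::complex)" for i :: 'n and k
  by (induction k) (auto simp: mpol_var_def mult_single single_add[symmetric])
 moreover have "(\<Prod>i\<in>A. Poly_Mapping.single (g i) (1::complex)) = Poly_Mapping.single (\<Sum>i\<in>A. g i) 1" for A and g :: "'n => ('n \<Rightarrow>\<^sub>0 nat)"
  by (induction A rule: infinite_finite_induct) (auto simp: mult_single)
 moreover have "(\<Sum>i\<in>UNIV. Poly_Mapping.single i (Poly_Mapping.lookup \<mu> i)) = \<mu>"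
  by (rule poly_mapping_eqI) (simp add: lookup_sum lookup_single when_def)
 ultimately show ?thesis by simp
qed

text \<open>Modulo \<open>L\<close> each variable equals its substitute, and congruences are
  compatible with sums and products.\<close>

lemma subst_dvd:
 fixes b :: "('n::finite, complex) mpol" and v :: "'n => ('n, complex) mpol"
 assumes "!!i. L dvd mpol_var i - v i"
 defines "r \<equiv> \<Sum>\<mu>\<in>Poly_Mapping.keys b. mpol_const (Poly_Mapping.lookup b \<mu>) * (\<Prod>i\<in>UNIV. v i ^ Poly_Mapping.lookup \<mu> i)"
 shows "L dvd b - r" "ev r s = ev b (%i. ev (v i) s)"
proof -
 have pd: "L dvd (\<Prod>i\<in>A. mpol_var i ^ g i) - (\<Prod>i\<in>A. v i ^ g i)" for A and g :: "'n => nat"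
 proof (induction A rule: infinite_finite_induct)
  case (insert i A)
  have "(\<Prod>i\<in>insert i A. mpol_var i ^ g i) - (\<Prod>i\<in>insert i A. v i ^ g i) =
   mpol_var i ^ g i * ((\<Prod>i\<in>A. mpol_var i ^ g i) - (\<Prod>i\<in>A. v i ^ g i)) + (mpol_var i ^ g i - v i ^ g i) * (\<Prod>i\<in>A. v i ^ g i)"
   using insert.hyps by (simp add: algebra_simps)
  moreover have "L dvd mpol_var i ^ g i - v i ^ g i" using assms(1)[of i] dvd_power_diff dvd_trans by blast
  ultimately show ?case using insert.IH by simp
 qed auto
 have "b = (\<Sum>\<mu>\<in>Poly_Mapping.keys b. Poly_Mapping.single \<mu> (Poly_Mapping.lookup b \<mu>))"
  by (rule sum_singles)
 also have "\<dots> = (\<Sum>\<mu>\<in>Poly_Mapping.keys b. mpol_const (Poly_Mapping.lookup b \<mu>) * (\<Prod>i\<in>UNIV. mpol_var i ^ Poly_Mapping.lookup \<mu> i))"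
  by (simp add: mpol_const_def mult_single flip: mono_single)
 finally have "b - r = (\<Sum>\<mu>\<in>Poly_Mapping.keys b. mpol_const (Poly_Mapping.lookup b \<mu>) *
   ((\<Prod>i\<in>UNIV. mpol_var i ^ Poly_Mapping.lookup \<mu> i) - (\<Prod>i\<in>UNIV. v i ^ Poly_Mapping.lookup \<mu> i)))"
  unfolding r_def by (simp add: right_diff_distrib sum_subtractf)
 then show "L dvd b - r" using pd by (auto intro!: dvd_sum)
 show "ev r s = ev b (%i. ev (v i) s)"
  by (simp add: r_def ev_sum ev_mult ev_prod ev_power mpol_eval_def[of "%c. c" b])
qed

definition vanishes_on_piece :: "(real ^ 'n::finite) set => ('n, complex) mpol => bool"
 where "vanishes_on_piece H b \<longleftrightarrow> (EX x0:H. EX \<rho>>0. ALL x:H Int ball x0 \<rho>. ev b (%i. of_real (x $ i - 1)) = 0)"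

text \<open>Solve the equation of the hyperplane for a variable that occurs in it. The substitution
  changes \<open>b\<close> by a multiple of the form, and evaluates \<open>b\<close> at the
  projection to the hyperplane along that axis; hence the result vanishes on an open box and is
  zero.\<close>

lemma shifted_form_dvd:
 fixes a :: "real ^ 'n::finite"
 assumes a: "a ~= 0" and v: "vanishes_on_piece {x. a \<bullet> x = c} b" shows "shifted_form a c dvd b"
proof -
 obtain k where k: "a $ k ~= 0" using a by (auto simp: vec_eq_iff)
 obtain x0 \<rho> where x0: "a \<bullet> x0 = c" "\<rho> > 0" "!!x. a \<bullet> x = c ==> x \<in> ball x0 \<rho> ==> ev b (%i. of_real (x $ i - 1)) = 0"
  using v unfolding vanishes_on_piece_def by auto
 let ?L = "shifted_form a c"
 define v where "v = (%i. if i = k then mpol_var k - mpol_const (of_real (1 / a $ k)) * ?L else mpol_var i)"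
 define r where "r = (\<Sum>\<mu>\<in>Poly_Mapping.keys b. mpol_const (Poly_Mapping.lookup b \<mu>) * (\<Prod>i\<in>UNIV. v i ^ Poly_Mapping.lookup \<mu> i))"
 have "?L dvd mpol_var i - v i" for i by (simp add: v_def)
 from subst_dvd[OF this, of b] have r: "?L dvd b - r" "!!s. ev r s = ev b (%i. ev (v i) s)" by (auto simp: r_def)
 \<comment> \<open>The geometric counterpart of the substitution \<open>v\<close>. It fixes
   \<open>x0\<close> and is continuous, so a whole box around \<open>x0\<close> is mapped into the
   piece on which \<open>b\<close> vanishes.\<close>
 define pr where "pr = (%x :: real ^ 'n. x - ((a \<bullet> x - c) / a $ k) *\<^sub>R axis k 1)"
 have pr: "a \<bullet> pr x = c" for x using k by (simp add: pr_def inner_diff_right inner_axis)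
 have vpr: "ev (v i) (%i. of_real (x $ i - 1)) = of_real (pr x $ i - 1)" for x i
  using ev_shifted_form[of a c x] by (simp add: v_def ev_diff ev_mult pr_def axis_def)
 have "continuous_on UNIV pr" unfolding pr_def by (intro continuous_intros) (use k in auto)
 then have "open (pr -` ball x0 \<rho>)" by (simp add: open_vimage)
 moreover have "x0 \<in> pr -` ball x0 \<rho>" using x0 by (simp add: pr_def)
 ultimately obtain \<delta> where \<delta>: "\<delta> > 0" "ball x0 \<delta> \<subseteq> pr -` ball x0 \<rho>" by (rule openE) blast
 define \<eta> where "\<eta> = \<delta> / (real CARD('n) + 1)"
 have \<eta>: "\<eta> > 0" using \<delta> by (simp add: \<eta>_def add_pos_pos)
 define B where "B = (%i. (%t. complex_of_real t) ` {x0 $ i - 1<..<x0 $ i - 1 + \<eta>})"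
 have inj: "inj_on complex_of_real T" for T by (simp add: inj_on_def)
 have inf: "infinite (B i)" for i
  unfolding B_def finite_image_iff[OF inj] using \<eta> by (simp add: infinite_Ioo)
 have ev0: "ev r s = 0" if s: "!!i. s i \<in> B i" for s
 proof -
  have "ALL i. EX t. s i = of_real t & x0 $ i - 1 < t & t < x0 $ i - 1 + \<eta>" using s unfolding B_def by fastforce
  then obtain t where t: "!!i. s i = of_real (t i)" "!!i. x0 $ i - 1 < t i" "!!i. t i < x0 $ i - 1 + \<eta>" by metis
  define x :: "real ^ 'n" where "x = (\<chi> i. t i + 1)"
  have s_x: "s = (%i. of_real (x $ i - 1))" using t(1) by (auto simp: x_def)
  have "norm (x - x0) <= (\<Sum>i\<in>UNIV. norm ((x - x0) $ i))" unfolding norm_vec_def by (rule L2_set_le_sum) simp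
  also have "\<dots> <= (\<Sum>i\<in>(UNIV :: 'n set). \<eta>)"
  proof (rule sum_mono)
   fix i show "norm ((x - x0) $ i) <= \<eta>" using t(2,3)[of i] by (simp add: x_def abs_le_iff)
  qed
  also have "\<dots> = real CARD('n) * \<eta>" by simp
  also have "\<dots> < (real CARD('n) + 1) * \<eta>" using \<eta> by simp
  also have "\<dots> = \<delta>" by (simp add: \<eta>_def add_pos_pos[THEN less_imp_neq, symmetric])
  finally have "x \<in> ball x0 \<delta>" by (simp add: dist_norm norm_minus_commute)
  then have "pr x \<in> ball x0 \<rho>" using \<delta>(2) by blast
  then show ?thesis unfolding r(2) s_x vpr using x0(3)[OF pr] by blast
 qed
 have "r = 0" by (rule mpol_zero_on_box[where B = B, OF inf], rule ev0, blast)
 then show ?thesis using r(1) by simp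
qed

text \<open>Distinct hyperplanes do not share an open piece, so some point of the given piece lies
  off the other hyperplane. Near it the form is nonzero and can be cancelled.\<close>

lemma vanishes_peel:
 fixes a a' :: "real ^ 'n::finite"
 assumes a: "a ~= 0" "a' ~= 0" and ne: "{x. a \<bullet> x = c} ~= {x. a' \<bullet> x = c'}"
  and v: "vanishes_on_piece {x. a' \<bullet> x = c'} (shifted_form a c * q)"
 shows "vanishes_on_piece {x. a' \<bullet> x = c'} q"
proof -
 obtain x0 \<rho> where x0: "a' \<bullet> x0 = c'" "\<rho> > 0" "!!x. a' \<bullet> x = c' ==> x \<in> ball x0 \<rho> ==> ev (shifted_form a c * q) (%i. of_real (x $ i - 1)) = 0"
  using v unfolding vanishes_on_piece_def by auto
 have "EX y:ball x0 \<rho>. a' \<bullet> y = c' & a \<bullet> y ~= c"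
 proof (rule ccontr)
  assume "~ (EX y:ball x0 \<rho>. a' \<bullet> y = c' & a \<bullet> y ~= c)"
  then have in_H: "!!y. y \<in> ball x0 \<rho> ==> a' \<bullet> y = c' ==> a \<bullet> y = c" by blast
  have x0c: "a \<bullet> x0 = c" using in_H[of x0] x0 by simp
  \<comment> \<open>\<open>w\<close> is the component of \<open>a\<close> orthogonal to
    \<open>a'\<close>. Moving along it stays in the second hyperplane, so it must be zero if the
    first contains the piece; then the two hyperplanes coincide.\<close>
  define l where "l = (a \<bullet> a') / (a' \<bullet> a')"
  define w where "w = a - l *\<^sub>R a'"
  have w0: "a' \<bullet> w = 0" using a(2) by (simp add: w_def l_def inner_diff_right inner_commute)
  have "w = 0"
  proof (rule ccontr)
   assume "w ~= 0"
   define t where "t = \<rho> / (2 * norm w)"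
   have t: "t > 0" using x0 \<open>w ~= 0\<close> by (simp add: t_def)
   have "x0 + t *\<^sub>R w \<in> ball x0 \<rho>" using x0 \<open>w ~= 0\<close> by (simp add: t_def dist_norm)
   moreover have "a' \<bullet> (x0 + t *\<^sub>R w) = c'" using w0 x0 by (simp add: inner_add_right)
   ultimately have "a \<bullet> (x0 + t *\<^sub>R w) = c" by (rule in_H)
   then have "a \<bullet> w = 0" using x0c t by (simp add: inner_add_right)
   moreover have "w \<bullet> w = a \<bullet> w - l * (a' \<bullet> w)" by (simp add: w_def inner_diff_left)
   ultimately show False using w0 \<open>w ~= 0\<close> by simp
  qed
  then have al: "a = l *\<^sub>R a'" by (simp add: w_def)
  then have l: "l ~= 0" using a(1) by auto
  have "c = l * c'" using x0c x0(1) al by simp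
  then have "{x. a \<bullet> x = c} = {x. a' \<bullet> x = c'}" using al l by auto
  then show False using ne by simp
 qed
 then obtain y where y: "y \<in> ball x0 \<rho>" "a' \<bullet> y = c'" "a \<bullet> y ~= c" by blast
 have "open (ball x0 \<rho> Int {x. a \<bullet> x ~= c})"
  by (intro open_Int open_ball open_Collect_neq continuous_intros)
 then obtain \<delta> where \<delta>: "\<delta> > 0" "ball y \<delta> \<subseteq> ball x0 \<rho> Int {x. a \<bullet> x ~= c}" using y openE by blast
 have "ev q (%i. of_real (x $ i - 1)) = 0" if x: "a' \<bullet> x = c'" "x \<in> ball y \<delta>" for x
 proof -
  have "x \<in> ball x0 \<rho>" "a \<bullet> x ~= c" using \<delta>(2) x(2) by blast+
  moreover have "of_real (a \<bullet> x - c) * ev q (%i. of_real (x $ i - 1)) = 0"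
   using x0(3)[OF x(1) \<open>x \<in> ball x0 \<rho>\<close>] unfolding ev_mult ev_shifted_form .
  ultimately show ?thesis by simp
 qed
 then show ?thesis unfolding vanishes_on_piece_def using y(2) \<delta>(1) by blast
qed

text \<open>The forms are split off one at a time. The cofactor still vanishes on a piece of each
  remaining hyperplane, because the factors already taken out belong to other hyperplanes.\<close>

proposition prod_shifted_form_dvd:
 fixes a :: "(real ^ 'n::finite) set => real ^ 'n"
 assumes fin: "finite \<H>" and H: "!!H. H \<in> \<H> ==> a H ~= 0 & H = {x. a H \<bullet> x = c H}"
  and v: "!!H. H \<in> \<H> ==> vanishes_on_piece H b"
 shows "(\<Prod>H\<in>\<H>. shifted_form (a H) (c H)) dvd b"
proof -
 have peel: "vanishes_on_piece H' q"
  if "finite \<G>" "\<G> \<subseteq> \<H>" "H' \<in> \<H>" "H' ~: \<G>" "vanishes_on_piece H' ((\<Prod>H\<in>\<G>. shifted_form (a H) (c H)) * q)" for \<G> H' q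
  using that
 proof (induction \<G> rule: finite_induct)
  case (insert H \<G>)
  have HH: "H \<in> \<H>" "H' \<in> \<H>" "H ~= H'" using insert.prems by auto
  have eqs: "H = {x. a H \<bullet> x = c H}" "H' = {x. a H' \<bullet> x = c H'}" using H HH by blast+
  have "vanishes_on_piece {x. a H' \<bullet> x = c H'} (shifted_form (a H) (c H) * ((\<Prod>H\<in>\<G>. shifted_form (a H) (c H)) * q))"
   using insert.prems(4) insert.hyps eqs(2) by (simp add: mult.assoc)
  then have "vanishes_on_piece {x. a H' \<bullet> x = c H'} ((\<Prod>H\<in>\<G>. shifted_form (a H) (c H)) * q)"
   by (rule vanishes_peel[rotated 3]) (use H HH eqs in auto)
  then have "vanishes_on_piece H' ((\<Prod>H\<in>\<G>. shifted_form (a H) (c H)) * q)" using eqs(2) by simp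
  then show ?case using insert.IH insert.prems by blast
 qed simp
 have "(\<Prod>H\<in>\<G>. shifted_form (a H) (c H)) dvd b" if "finite \<G>" "\<G> \<subseteq> \<H>" for \<G>
  using that
 proof (induction \<G> rule: finite_induct)
  case (insert H \<G>)
  then obtain q where q: "b = (\<Prod>H\<in>\<G>. shifted_form (a H) (c H)) * q" by (auto elim: dvdE)
  have "vanishes_on_piece H q"
   by (rule peel[of \<G>]) (use insert v q in auto)
  then have "shifted_form (a H) (c H) dvd q"
   using H[of H] insert.prems by (intro shifted_form_dvd) auto
  then show ?case using insert.hyps q by (simp add: mult.commute mult_dvd_mono)
 qed simp
 then show ?thesis using fin by blast
qed

section \<open>Faces of quasiadjunction\<close>

definition open_cube :: "(real ^ 'n::finite) set"
 where "open_cube = {x. ALL i. 0 < x $ i & x $ i < 1}"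

text \<open>All coordinates have the same denominator, so that two grid points with one
  \<open>M\<close> belong to the same surface and can exchange a resolution.\<close>

definition grid :: "nat => (real ^ 'n::finite) => ('n => nat) => bool"
 where "grid M y j \<longleftrightarrow> (ALL i. j i < M & y $ i = (real (j i) + 1) / real M)"

definition val :: "('n::finite => nat) => int => real ^ 'n => real"
 where "val \<alpha> k x = (\<Sum>i\<in>UNIV. real (\<alpha> i) * (x $ i - 1)) + of_int k"

lemma open_open_cube: "open (open_cube :: (real ^ 'n::finite) set)"
proof -
 have "open_cube = (\<Inter>i. {x :: real ^ 'n. 0 < x $ i} Int {x. x $ i < 1})" by (auto simp: open_cube_def)
 moreover have "open (\<Inter>i. {x :: real ^ 'n. 0 < x $ i} Int {x. x $ i < 1})"
  by (intro open_INT ballI open_Int open_Collect_less continuous_intros) auto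
 ultimately show ?thesis by simp
qed

lemma continuous_val: "continuous_on UNIV (val \<alpha> k)"
 unfolding val_def[abs_def] by (intro continuous_intros)

lemma pos_val: "pos C (%i. x $ i - 1) \<longleftrightarrow> (ALL (\<alpha>, k):C. val \<alpha> k x > 0)"
 by (simp add: pos_def val_def)

lemma norm_le_of_components:
 fixes v :: "real ^ 'n::finite"
 assumes "!!i. \<bar>v $ i\<bar> <= \<eta>" shows "norm v <= real CARD('n) * \<eta>"
proof -
 have "norm v <= (\<Sum>i\<in>UNIV. norm (v $ i))" unfolding norm_vec_def by (rule L2_set_le_sum) simp
 also have "\<dots> <= (\<Sum>i\<in>(UNIV :: 'n set). \<eta>)" by (rule sum_mono) (simp add: assms)
 finally show ?thesis by simp
qed

text \<open>Every sufficiently large denominator works, not just some: two open sets can then be met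
  by grids of a common \<open>M\<close>. Rounding up moves a coordinate by at most 1/M.\<close>

lemma grid_dense:
 fixes T :: "(real ^ 'n::finite) set"
 assumes T: "open T" "T \<subseteq> open_cube" "T ~= {}"
 obtains M0 where "!!M. M >= M0 ==> M >= 1 & (EX y:T. EX j. grid M y j)"
proof -
 obtain x where x: "x \<in> T" using T(3) by blast
 obtain e where e: "e > 0" "ball x e \<subseteq> T" using T(1) x openE by blast
 obtain M0 :: nat where M0: "real CARD('n) / e < real M0" using reals_Archimedean2 by blast
 show thesis
 proof (rule that[of M0])
  fix M assume M: "M0 <= M"
  have "0 <= real CARD('n) / e" using e by simp
  then have Mp: "real M > 0" using M0 M by linarith
  have Me: "real CARD('n) * (1 / real M) < e"
  proof -
   have "real CARD('n) / e < real M" using M0 M by linarith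
   then show ?thesis using e Mp by (simp add: field_simps)
  qed
  define j where "j = (%i. nat (\<lceil>real M * x $ i\<rceil> - 1))"
  define y :: "real ^ 'n" where "y = (\<chi> i. (real (j i) + 1) / real M)"
  have xi: "0 < x $ i" "x $ i < 1" for i using x T(2) by (auto simp: open_cube_def)
  have j1: "real (j i) + 1 = of_int \<lceil>real M * x $ i\<rceil>" for i
  proof -
   have "0 < real M * x $ i" using Mp xi by simp
   then have "1 <= \<lceil>real M * x $ i\<rceil>" by linarith
   then show ?thesis by (simp add: j_def)
  qed
  have "\<bar>(y - x) $ i\<bar> <= 1 / real M" for i
  proof -
   have "real M * x $ i <= real (j i) + 1" "real (j i) + 1 <= real M * x $ i + 1" unfolding j1 by linarith+
   then have "x $ i <= y $ i" "y $ i <= x $ i + 1 / real M" using Mp by (simp_all add: y_def field_simps)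
   then show ?thesis by simp
  qed
  then have "norm (y - x) <= real CARD('n) * (1 / real M)" by (rule norm_le_of_components)
  then have "norm (y - x) < e" using Me by linarith
  then have yT: "y \<in> T" using e(2) by (auto simp: dist_norm norm_minus_commute)
  have "j i < M" for i
  proof -
   have "y $ i < 1" using yT T(2) by (auto simp: open_cube_def)
   then have "real (j i) + 1 < real M" using Mp by (simp add: y_def field_simps)
   then show ?thesis by linarith
  qed
  then have "grid M y j" by (simp add: grid_def y_def)
  then show "M >= 1 & (EX y:T. EX j. grid M y j)" using yT Mp by auto
 qed
qed

lemma finite_bounded_functions: "finite {\<alpha> :: 'n::finite => nat. ALL i. \<alpha> i <= K}"
proof -
 have "{\<alpha> :: 'n => nat. ALL i. \<alpha> i <= K} = PiE UNIV (%_. {..K})" by (auto simp: PiE_UNIV_domain)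
 then show ?thesis by (simp add: finite_PiE)
qed

text \<open>The values \<open>val \<alpha> k x\<close> for fixed \<open>\<alpha>\<close> form a coset of the integers, so the positive ones are bounded away from zero.\<close>

lemma val_gap:
 fixes x :: "real ^ 'n::finite"
 obtains \<delta> where "\<delta> > 0" "!!\<alpha> k. (!!i. \<alpha> i <= K) ==> val \<alpha> k x > 0 ==> val \<alpha> k x >= \<delta>"
proof -
 define \<gamma> where "\<gamma> = (%\<alpha> :: 'n => nat. if frac (val \<alpha> 0 x) = 0 then 1 else frac (val \<alpha> 0 x))"
 let ?A = "{\<alpha> :: 'n => nat. ALL i. \<alpha> i <= K}"
 have g0: "\<gamma> \<alpha> > 0" for \<alpha> using frac_ge_0[of "val \<alpha> 0 x"] by (auto simp: \<gamma>_def less_le)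
 have g1: "\<gamma> \<alpha> <= val \<alpha> k x" if "val \<alpha> k x > 0" for \<alpha> k
 proof -
  have v: "val \<alpha> k x = frac (val \<alpha> 0 x) + of_int (\<lfloor>val \<alpha> 0 x\<rfloor> + k)" by (simp add: val_def frac_def)
  define m where "m = \<lfloor>val \<alpha> 0 x\<rfloor> + k"
  have f: "frac (val \<alpha> 0 x) < 1" "0 <= frac (val \<alpha> 0 x)" by (simp_all add: frac_lt_1)
  have pos: "frac (val \<alpha> 0 x) + of_int m > 0" using that v by (simp add: m_def)
  then have "of_int m > (-1 :: real)" using f by linarith
  then have "m >= 0" by linarith
  show ?thesis
  proof (cases "frac (val \<alpha> 0 x) = 0")
   case True
   then have "(0 :: real) < of_int m" using pos by linarith
   then have "0 < m" by (simp only: of_int_0_less_iff)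
   then have "of_int m >= (1 :: real)" by linarith
   moreover have "\<gamma> \<alpha> = 1" using True by (simp only: \<gamma>_def if_True simp_thms)
   moreover have "val \<alpha> k x = of_int m" using v True by (simp only: m_def add_0)
   ultimately show ?thesis by linarith
  next
   case False
   then have "\<gamma> \<alpha> = frac (val \<alpha> 0 x)" by (simp only: \<gamma>_def if_False)
   moreover have "of_int m >= (0 :: real)" using \<open>m >= 0\<close> by simp
   moreover have "val \<alpha> k x = frac (val \<alpha> 0 x) + of_int m" using v by (simp only: m_def)
   ultimately show ?thesis by linarith
  qed
 qed
 have fin: "finite ?A" by (rule finite_bounded_functions)
 show thesis
 proof (rule that[of "Min (\<gamma> ` ?A)"])
  have ne: "?A ~= {}" by (auto intro: exI[of _ "%_. 0"])
  show "0 < Min (\<gamma> ` ?A)" using fin ne g0 by simp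
  show "Min (\<gamma> ` ?A) <= val \<alpha> k x" if "!!i. \<alpha> i <= K" "val \<alpha> k x > 0" for \<alpha> k
   using that fin g1 by (intro order_trans[OF Min_le g1]) auto
 qed
qed

section \<open>The geometry of a single face\<close>

locale face =
 fixes f :: "'n::finite => germ" and \<A> :: "germ set" and P F :: "(real ^ 'n) set" and K :: nat
  and C :: "germ => (('n => nat) \<times> int) set" and U :: "germ => (complex \<times> complex) set"
 assumes fnz: "!!i. f i ~= 0" and f0: "!!i. germ_at0 (f i) = 0"
  and P: "is_quasiadj_polytope f \<A> P" and F: "F face_of closure P" "F ~= {}" "F ~= closure P"
  and walls: "!!i. ~ F \<subseteq> {x. x $ i = 0} & ~ F \<subseteq> {x. x $ i = 1}"
  and C: "!!\<phi>. describes K (%i. rep_germ (f i)) (rep_germ \<phi>) (C \<phi>) (U \<phi>)"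
begin

lemma C_le: "(\<alpha>, k) \<in> C \<phi> ==> \<alpha> i <= K" using describesD(2)[OF C] by blast

lemma U_open: "open (U \<phi>)" "0 \<in> U \<phi>" using describesD(3,4)[OF C] by blast+

definition Q where "Q = P Int open_cube"

lemma open_Q: "open Q"
proof -
 obtain \<H> :: "((real ^ 'n) \<times> real) set" where H: "finite \<H>" "P = {x \<in> cube. ALL (a, c):\<H>. a \<bullet> x > c}"
  using P unfolding is_quasiadj_polytope_def rel_open_polytope_def by blast
 have "Q = open_cube Int (\<Inter>h\<in>\<H>. {x. fst h \<bullet> x > snd h})"
 proof -
  have "Q = {x \<in> cube. ALL (a, c):\<H>. a \<bullet> x > c} Int open_cube"
   unfolding Q_def using arg_cong[OF H(2), of "%S. S Int open_cube"] .
  then show ?thesis by (auto simp: cube_def open_cube_def less_imp_le case_prod_beta)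
 qed
 moreover have "open (\<Inter>h\<in>\<H>. {x. fst h \<bullet> x > snd h})"
  by (intro open_INT H(1) ballI open_Collect_less continuous_intros)
 ultimately show ?thesis by (simp only: open_Int open_open_cube)
qed

lemma P_cube: "P \<subseteq> cube" using P unfolding is_quasiadj_polytope_def rel_open_polytope_def by auto

lemma closure_Q: "closure P Int open_cube \<subseteq> closure Q"
 using open_Int_closure_subset[OF open_open_cube, of P] by (simp add: Q_def Int_commute)

lemma closure_P_bounds: "x \<in> closure P ==> 0 <= x $ i & x $ i <= 1"
proof -
 assume x: "x \<in> closure P"
 have "P \<subseteq> {x. 0 <= x $ i} Int {x. x $ i <= 1}" using P_cube by (auto simp: cube_def less_imp_le)
 moreover have "closed ({x :: real ^ 'n. 0 <= x $ i} Int {x. x $ i <= 1})"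
  by (intro closed_Int closed_Collect_le continuous_intros)
 ultimately show ?thesis using closure_minimal x by blast
qed

lemma F_sub: "F \<subseteq> closure P" using F(1) face_of_imp_subset by blast

lemma grid_P:
 assumes "grid M y j" "M >= 1" "y \<in> open_cube"
 shows "\<A> \<subseteq> quasiadj_ideal f j (%_. M) \<longleftrightarrow> y \<in> P"
proof -
 have "(\<chi> i. (real (j i) + 1) / real M) = y" using assms(1) by (simp add: grid_def vec_eq_iff)
 moreover have "y \<in> cube" using assms(3) by (auto simp: cube_def open_cube_def less_imp_le)
 moreover have "ALL i. M >= 1 & j i < M" using assms(1,2) by (simp add: grid_def)
 moreover have "ALL j m. (ALL i. m i >= 1 & j i < m i) & (\<chi> i. (real (j i) + 1) / real (m i)) \<in> cube -->
   (\<A> \<subseteq> quasiadj_ideal f j m \<longleftrightarrow> (\<chi> i. (real (j i) + 1) / real (m i)) \<in> P)"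
  using P unfolding is_quasiadj_polytope_def by blast
 from spec[OF spec[OF this, of j], of "%_. M"]
 have "(ALL i. M >= 1 & j i < M) & (\<chi> i. (real (j i) + 1) / real M) \<in> cube -->
   (\<A> \<subseteq> quasiadj_ideal f j (%_. M) \<longleftrightarrow> (\<chi> i. (real (j i) + 1) / real M) \<in> P)" .
 ultimately show ?thesis by simp
qed

lemma expo_grid: "grid M y j ==> expo j (%_. M) = (%i. y $ i - 1)"
 by (auto simp: grid_def expo_def)

lemma pos_grid:
 assumes "grid M y j" "M >= 1" "y \<in> Q" "\<phi> \<in> \<A>" shows "pos (C \<phi>) (%i. y $ i - 1)"
proof -
 have "\<phi> \<in> quasiadj_ideal f j (%_. M)" using grid_P[OF assms(1,2)] assms(3,4) by (auto simp: Q_def)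
 from quasiadj_imp_lint[OF this f0] have "lint (wt (rep_germ \<phi>) (%i. rep_germ (f i)) (%i. y $ i - 1))"
  using assms(2) unfolding expo_grid[OF assms(1)] by blast
 then show ?thesis by (rule describesD(6)[OF C])
qed

lemma Q_grid: "open T ==> T \<subseteq> Q ==> T ~= {} ==> EX y:T. EX M>=1. EX j. grid M y j"
proof -
 assume T: "open T" "T \<subseteq> Q" "T ~= {}"
 obtain M0 where "!!M. M >= M0 ==> M >= 1 & (EX y:T. EX j. grid M y j)"
  by (rule grid_dense[OF T(1) _ T(3)]) (use T(2) in "auto simp: Q_def")
 from this[of M0] show ?thesis by blast
qed

text \<open>At grid points of \<open>Q\<close> the expressions are positive, since membership in the
  ideal implies integrability. Such points are dense in \<open>Q\<close>, and continuity does the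
  rest.\<close>

lemma val_nonneg:
 assumes y: "y \<in> closure Q" and \<phi>: "\<phi> \<in> \<A>" "(\<alpha>, k) \<in> C \<phi>" shows "val \<alpha> k y >= 0"
proof (rule ccontr)
 assume "~ val \<alpha> k y >= 0"
 define W where "W = {x. val \<alpha> k x < 0}"
 have W: "open W" unfolding W_def by (intro open_Collect_less continuous_val continuous_on_const)
 have "y \<in> W" using \<open>~ val \<alpha> k y >= 0\<close> by (simp add: W_def)
 then have "W Int Q ~= {}" using y W by (simp add: closure_iff_nhds_not_empty) blast
 then obtain y' M j where y': "y' \<in> W Int Q" "M >= 1" "grid M y' j" using Q_grid[OF open_Int[OF W open_Q]] by blast
 then have "val \<alpha> k y' > 0" using pos_grid[OF y'(3,2) _ \<phi>(1)] \<phi>(2) by (auto simp: pos_val)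
 then show False using y'(1) by (simp add: W_def)
qed

text \<open>Otherwise all expressions of all elements of the ideal have a common positive lower
  bound at \<open>x\<close> and, as \<open>\<alpha>\<close> is bounded, stay positive on a common
  ball. Then every grid point of that ball lies in the polytope, which makes \<open>x\<close>
  interior to its closure; but a proper face contains no interior point.\<close>

lemma val_zero:
 assumes x: "x \<in> F" "x \<in> open_cube" shows "EX \<phi>:\<A>. EX (\<alpha>, k):C \<phi>. val \<alpha> k x = 0"
proof (rule ccontr)
 assume no: "~ (EX \<phi>:\<A>. EX (\<alpha>, k):C \<phi>. val \<alpha> k x = 0)"
 have xQ: "x \<in> closure Q" using closure_Q F_sub x by blast
 obtain \<delta> where \<delta>: "\<delta> > 0" "!!\<alpha> k. (!!i. \<alpha> i <= K) ==> val \<alpha> k x > 0 ==> val \<alpha> k x >= \<delta>" by (rule val_gap) blast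
 have ge: "val \<alpha> k x >= \<delta>" if \<phi>: "\<phi> \<in> \<A>" "(\<alpha>, k) \<in> C \<phi>" for \<phi> \<alpha> k
 proof -
  have "val \<alpha> k x ~= 0" using no \<phi> by blast
  then have "val \<alpha> k x > 0" using val_nonneg[OF xQ \<phi>] by linarith
  then show ?thesis using \<delta>(2) C_le[OF \<phi>(2)] by blast
 qed
 define n where "n = real CARD('n)"
 \<comment> \<open>Within this radius an expression changes by at most n K \<rho> < \<delta>,
   whatever \<open>\<alpha>\<close> is; the added 1 avoids division by zero.\<close>
 define \<rho> where "\<rho> = \<delta> / (n * K + 1)"
 have nK: "n * K >= 0" by (simp add: n_def)
 then have \<rho>: "\<rho> > 0" using \<delta> by (simp add: \<rho>_def add_nonneg_pos)
 have n\<rho>: "n * K * \<rho> < \<delta>"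
 proof -
  have "n * K * \<rho> < (n * K + 1) * \<rho>" using \<rho> by simp
  also have "\<dots> = \<delta>" using nK by (simp add: \<rho>_def)
  finally show ?thesis .
 qed
 have near: "pos (C \<phi>) (%i. y $ i - 1)" if \<phi>: "\<phi> \<in> \<A>" and y: "y \<in> ball x \<rho>" for \<phi> y
  unfolding pos_val
 proof clarify
  fix \<alpha> k assume k: "(\<alpha>, k) \<in> C \<phi>"
  have "val \<alpha> k x - val \<alpha> k y = (\<Sum>i\<in>UNIV. real (\<alpha> i) * (x $ i - y $ i))"
   by (simp add: val_def sum_subtractf[symmetric] algebra_simps)
  also have "\<dots> <= (\<Sum>i\<in>(UNIV :: 'n set). real K * \<rho>)"
  proof (rule sum_mono)
   fix i
   have "x $ i - y $ i <= norm (x - y)" using component_le_norm_cart[of "x - y" i] by simp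
   then have "x $ i - y $ i <= \<rho>" using y by (simp add: dist_norm)
   then have "real (\<alpha> i) * (x $ i - y $ i) <= real (\<alpha> i) * \<rho>" by (intro mult_left_mono) auto
   also have "\<dots> <= real K * \<rho>" using C_le[OF k] \<rho> by (intro mult_right_mono) auto
   finally show "real (\<alpha> i) * (x $ i - y $ i) <= real K * \<rho>" .
  qed
  also have "\<dots> = n * K * \<rho>" by (simp add: n_def)
  finally show "0 < val \<alpha> k y" using ge[OF \<phi> k] n\<rho> by linarith
 qed
 have Qne: "Q ~= {}" using xQ by auto
 obtain M1 where M1: "!!M. M >= M1 ==> M >= 1 & (EX y:Q. EX j. grid M y j)"
  by (rule grid_dense[OF open_Q _ Qne]) (auto simp: Q_def)
 define T where "T = ball x \<rho> Int open_cube"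
 have T: "open T" unfolding T_def using open_open_cube by (intro open_Int) auto
 have TP: "T \<subseteq> closure P"
 proof (rule ccontr)
  assume "~ T \<subseteq> closure P"
  then have ne: "T - closure P ~= {}" by blast
  have sub: "T - closure P \<subseteq> open_cube" by (auto simp: T_def)
  obtain M0 where M0: "!!M. M >= M0 ==> M >= 1 & (EX y:T - closure P. EX j. grid M y j)"
   by (rule grid_dense[OF open_Diff[OF T closed_closure] sub ne]) blast
  \<comment> \<open>A common denominator for a point \<open>y\<close> near the face and a point
    \<open>y1\<close> of the polytope: the latter provides the resolutions for the former.\<close>
  define M where "M = max M0 M1"
  have M: "M >= 1" using M0[of M] by (simp add: M_def)
  obtain y j where y: "y \<in> T - closure P" "grid M y j" using M0[of M] by (auto simp: M_def)
  obtain y1 j1 where y1: "y1 \<in> Q" "grid M y1 j1" using M1[of M] by (auto simp: M_def)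
  have "\<phi> \<in> quasiadj_ideal f j (%_. M)" if \<phi>: "\<phi> \<in> \<A>" for \<phi>
  proof (rule quasiadj_of_lint[OF _ fnz])
   show "\<phi> \<in> quasiadj_ideal f j1 (%_. M)" using grid_P[OF y1(2) M] y1(1) \<phi> by (auto simp: Q_def)
   have "pos (C \<phi>) (%i. y $ i - 1)" by (rule near[OF \<phi>]) (use y(1) in "simp add: T_def")
   then have "wt (rep_germ \<phi>) (%i. rep_germ (f i)) (%i. y $ i - 1) L1_on U \<phi>" by (rule describesD(5)[OF C])
   then show "lint (wt (rep_germ \<phi>) (%i. rep_germ (f i)) (expo j (%_. M)))"
    unfolding expo_grid[OF y(2)] lint_def using U_open by blast
  qed (rule M)
  then have "y \<in> P" using grid_P[OF y(2) M] y(1) by (auto simp: T_def)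
  then show False using y(1) closure_subset by blast
 qed
 have "x \<in> T" using x \<rho> by (simp add: T_def)
 then have "x \<in> interior (closure P)" by (rule interiorI[OF T _ TP])
 then show False using face_of_disjoint_interior[OF F(1,3)] x(1) by blast
qed

text \<open>Approach \<open>x\<close> by grid points of the polytope, where the weight of a suitable
  \<open>\<phi>\<close> is integrable on a fixed neighbourhood. If \<open>b\<close> did not vanish
  at \<open>x\<close>, the weight would be integrable there too, although one of its inequalities is
  an equality.\<close>

lemma bernstein_zero:
 assumes b: "b \<in> bernstein_ideal f" and x: "x \<in> F" "x \<in> open_cube"
 shows "ev b (%i. of_real (x $ i - 1)) = 0"
proof (rule ccontr)
 assume nz: "ev b (%i. of_real (x $ i - 1)) ~= 0"
 obtain \<phi> \<alpha> k where \<phi>: "\<phi> \<in> \<A>" "(\<alpha>, k) \<in> C \<phi>" "val \<alpha> k x = 0" using val_zero[OF x] by blast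
 have xQ: "x \<in> closure Q" using closure_Q F_sub x by blast
 have "EX y:ball x (1 / real (Suc n)) Int Q. EX M>=1. EX j. grid M y j" for n
 proof (rule Q_grid)
  show "open (ball x (1 / real (Suc n)) Int Q)" using open_Q by (intro open_Int) auto
  have "x \<in> ball x (1 / real (Suc n))" by simp
  then show "ball x (1 / real (Suc n)) Int Q ~= {}" using xQ by (metis Int_commute closure_iff_nhds_not_empty open_ball subset_refl)
 qed auto
 then obtain y M j where y: "!!n. y n \<in> ball x (1 / real (Suc n))" "!!n. y n \<in> Q" "!!n. M n >= 1" "!!n. grid (M n) (y n) (j n)"
  by (metis IntD1 IntD2)
 have "y \<longlonglongrightarrow> x"
 proof (rule Lim_null_comparison[THEN LIM_zero_cancel])
  show "\<forall>\<^sub>F n in sequentially. norm (y n - x) <= 1 / real (Suc n)"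
   using y(1) by (intro always_eventually allI) (simp add: dist_norm norm_minus_commute less_imp_le)
  show "(%n. 1 / real (Suc n)) \<longlonglongrightarrow> 0" using LIMSEQ_inverse_real_of_nat by (simp add: inverse_eq_divide)
 qed
 have "lint (wt (rep_germ \<phi>) (%i. rep_germ (f i)) (%i. x $ i - 1))"
 proof (rule bernstein_lint[OF b fnz f0 hol2_at0_rep_germ U_open, where xs = "%n i. y n $ i - 1"])
  show "wt (rep_germ \<phi>) (%i. rep_germ (f i)) (%i. y n $ i - 1) L1_on U \<phi>" for n
   by (rule describesD(5)[OF C pos_grid[OF y(4,3,2) \<phi>(1)]])
  show "- 1 <= y n $ i - 1 & y n $ i - 1 <= 1" for n i
   using y(2)[of n] by (auto simp: Q_def open_cube_def less_imp_le intro: order_trans[OF less_imp_le])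
  show "(%n. y n $ i - 1) \<longlonglongrightarrow> x $ i - 1" for i
   using \<open>y \<longlonglongrightarrow> x\<close> by (intro tendsto_intros)
  show "ev b (%i. of_real (x $ i - 1)) ~= 0" by (rule nz)
 qed
 then have "pos (C \<phi>) (%i. x $ i - 1)" by (rule describesD(6)[OF C])
 then show False using \<phi>(2,3) by (auto simp: pos_val)
qed

text \<open>A point of the relative interior is taken. The face has points off each wall, and a
  segment from such a point can be prolonged inside the face beyond \<open>x0\<close>; if
  \<open>x0\<close> lay on the wall, the prolongation would leave the closed cube.\<close>

lemma rel_interior_face:
 obtains x0 \<rho> where "x0 \<in> F" "\<rho> > 0" "affine hull F Int ball x0 \<rho> \<subseteq> F Int open_cube"
proof -
 have "convex F" using F(1) by (rule face_of_imp_convex)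
 then obtain x0 where x0: "x0 \<in> rel_interior F" using F(2) rel_interior_eq_empty by blast
 obtain e where e: "e > 0" "x0 \<in> F" "ball x0 e Int affine hull F \<subseteq> F" using x0 unfolding mem_rel_interior_ball by blast
 have step: "EX t>0. x0 + t *\<^sub>R (x0 - y) \<in> F" if y: "y \<in> F" for y
 proof -
  define t where "t = e / (2 * (norm (x0 - y) + 1))"
  have t: "t > 0" using e by (simp add: t_def add_nonneg_pos)
  have "t * norm (x0 - y) <= t * (norm (x0 - y) + 1)" using t by simp
  also have "\<dots> = e / 2" using norm_ge_zero[of "x0 - y"] by (simp add: t_def field_simps add_nonneg_eq_0_iff)
  finally have "x0 + t *\<^sub>R (x0 - y) \<in> ball x0 e" using e(1) t by (simp add: dist_norm)
  moreover have "x0 + t *\<^sub>R (x0 - y) = (1 + t) *\<^sub>R x0 + (- t) *\<^sub>R y" by (simp add: algebra_simps)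
  moreover have "(1 + t) *\<^sub>R x0 + (- t) *\<^sub>R y \<in> affine hull F"
   by (rule mem_affine[OF affine_affine_hull]) (use e(2) y hull_subset[of F affine] in auto)
  ultimately have "x0 + t *\<^sub>R (x0 - y) \<in> ball x0 e Int affine hull F" by (simp only: Int_iff)
  then show ?thesis using e(3) t by blast
 qed
 have "x0 \<in> open_cube"
  unfolding open_cube_def
 proof (intro CollectI allI conjI)
  fix i
  have b: "0 <= (y :: real ^ 'n) $ i" "(y :: real ^ 'n) $ i <= 1" if "y \<in> F" for y using closure_P_bounds F_sub that by blast+
  obtain y where y: "y \<in> F" "y $ i ~= 0" using walls[of i] by blast
  obtain t where t: "t > 0" "x0 + t *\<^sub>R (x0 - y) \<in> F" using step[OF y(1)] by blast
  show "0 < x0 $ i"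
  proof (rule ccontr)
   assume "~ 0 < x0 $ i"
   then have "x0 $ i = 0" using b(1)[OF e(2)] by simp
   moreover have "0 < t * y $ i" using b(1)[OF y(1)] y(2) t(1) by (intro mult_pos_pos) simp_all
   ultimately show False using b(1)[OF t(2)] by simp
  qed
  obtain y where y: "y \<in> F" "y $ i ~= 1" using walls[of i] by blast
  obtain t where t: "t > 0" "x0 + t *\<^sub>R (x0 - y) \<in> F" using step[OF y(1)] by blast
  show "x0 $ i < 1"
  proof (rule ccontr)
   assume "~ x0 $ i < 1"
   then have "x0 $ i = 1" using b(2)[OF e(2)] by simp
   moreover have "y $ i < 1" using b(2)[OF y(1)] y(2) by simp
   ultimately show False using b(2)[OF t(2)] t(1) by (simp add: mult_le_0_iff)
  qed
 qed
 then obtain e' where e': "e' > 0" "ball x0 e' \<subseteq> open_cube" using open_open_cube openE by blast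
 show thesis
 proof (rule that[of x0 "min e e'"])
  show "affine hull F Int ball x0 (min e e') \<subseteq> F Int open_cube"
   using e(3) e'(2) by (auto simp: subset_iff)
 qed (use e e' in auto)
qed

lemma vanishes_on_face: "b \<in> bernstein_ideal f ==> vanishes_on_piece (affine hull F) b"
proof -
 assume b: "b \<in> bernstein_ideal f"
 obtain x0 \<rho> where x0: "x0 \<in> F" "\<rho> > 0" "affine hull F Int ball x0 \<rho> \<subseteq> F Int open_cube" by (rule rel_interior_face) blast
 have "ev b (%i. of_real (x $ i - 1)) = 0" if "x \<in> affine hull F Int ball x0 \<rho>" for x
  using bernstein_zero[OF b] x0(3) that by blast
 then show ?thesis unfolding vanishes_on_piece_def using x0(1,2) hull_subset[of F affine] by blast
qed

text \<open>An expression that vanishes at a relative interior point of the face and is nonnegative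
  on the closure of \<open>Q\<close> vanishes on the whole affine hull. In codimension one the hull
  is therefore its zero set, and only finitely many \<open>\<alpha>\<close> and \<open>k\<close> are
  possible.\<close>

lemma face_hyperplane:
 assumes dim: "aff_dim F = int CARD('n) - 1"
 shows "EX \<alpha> k. (ALL i. \<alpha> i <= K) & k \<in> {0..int (CARD('n) * K)} & affine hull F = {x. val \<alpha> k x = 0}"
proof -
 obtain x0 \<rho> where x0: "x0 \<in> F" "\<rho> > 0" "affine hull F Int ball x0 \<rho> \<subseteq> F Int open_cube" by (rule rel_interior_face) blast
 have "x0 \<in> affine hull F Int ball x0 \<rho>" using x0(1,2) hull_subset[of F affine] by auto
 then have x0c: "x0 \<in> open_cube" using x0(3) by blast
 obtain \<phi> \<alpha> k where \<phi>: "\<phi> \<in> \<A>" "(\<alpha>, k) \<in> C \<phi>" "val \<alpha> k x0 = 0" using val_zero[OF x0(1) x0c] by blast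
 have \<alpha>K: "\<alpha> i <= K" for i by (rule C_le[OF \<phi>(2)])
 define a :: "real ^ 'n" where "a = (\<chi> i. real (\<alpha> i))"
 have val_a: "val \<alpha> k x = a \<bullet> x - ((\<Sum>i\<in>UNIV. real (\<alpha> i)) - of_int k)" for x
  by (simp add: val_def a_def inner_vec_def right_diff_distrib sum_subtractf)
 \<comment> \<open>A constant expression would be zero everywhere, while at grid points of
   \<open>Q\<close> it is positive.\<close>
 have "a ~= 0"
 proof
  assume "a = 0"
  then have "\<alpha> i = 0" for i by (simp add: a_def vec_eq_iff)
  then have v: "val \<alpha> k x = of_int k" for x by (simp add: val_def)
  have "x0 \<in> closure Q" using closure_Q F_sub x0(1) x0c by blast
  then have "Q ~= {}" by auto
  then obtain y M j where y: "y \<in> Q" "M >= 1" "grid M y j" using Q_grid[OF open_Q] by blast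
  then have "val \<alpha> k y > 0" using pos_grid[OF y(3,2,1) \<phi>(1)] \<phi>(2) by (auto simp: pos_val)
  then show False using \<phi>(3) v by simp
 qed
 have "affine hull F \<subseteq> {x. val \<alpha> k x = 0}"
 proof
  fix y assume y: "y \<in> affine hull F"
  \<comment> \<open>Applied to small \<open>t\<close> of both signs: the line through
    \<open>x0\<close> and \<open>y\<close> can be followed in both directions without leaving the
    face.\<close>
  have nn: "t * val \<alpha> k y >= 0" if t: "\<bar>t\<bar> * (norm (y - x0) + 1) < \<rho>" for t
  proof -
   let ?z = "(1 - t) *\<^sub>R x0 + t *\<^sub>R y"
   have "?z \<in> affine hull F" by (rule mem_affine[OF affine_affine_hull]) (use x0(1) y hull_subset[of F affine] in auto)
   moreover have "?z \<in> ball x0 \<rho>"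
   proof -
    have "x0 - ?z = - t *\<^sub>R (y - x0)" by (simp add: algebra_simps)
    then have "norm (x0 - ?z) = \<bar>t\<bar> * norm (y - x0)" by (simp only: norm_scaleR abs_minus_cancel)
    also have "\<dots> <= \<bar>t\<bar> * (norm (y - x0) + 1)" by (intro mult_left_mono) auto
    finally show ?thesis using t by (simp add: dist_norm)
   qed
   ultimately have "?z \<in> F" "?z \<in> open_cube" using x0(3) by blast+
   then have "?z \<in> closure Q" using closure_Q F_sub by blast
   then have "val \<alpha> k ?z >= 0" by (rule val_nonneg[OF _ \<phi>(1,2)])
   moreover have "val \<alpha> k ?z = (1 - t) * val \<alpha> k x0 + t * val \<alpha> k y"
    unfolding val_a by (simp add: inner_add_right algebra_simps)
   ultimately show ?thesis using \<phi>(3) by simp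
  qed
  define N where "N = norm (y - x0) + 1"
  have N: "N > 0" unfolding N_def using norm_ge_zero[of "y - x0"] by linarith
  define t where "t = \<rho> / (2 * N)"
  have "t * N = \<rho> / 2" using N by (simp add: t_def)
  then have t: "t > 0" "t * (norm (y - x0) + 1) < \<rho>" using x0(2) N by (simp_all add: t_def flip: N_def)
  have "t * val \<alpha> k y >= 0" "(- t) * val \<alpha> k y >= 0" using nn[of t] nn[of "- t"] t by auto
  then have "t * val \<alpha> k y = 0" by simp
  then show "y \<in> {x. val \<alpha> k x = 0}" using t(1) by simp
 qed
 moreover have eq: "{x. val \<alpha> k x = 0} = {x. a \<bullet> x = (\<Sum>i\<in>UNIV. real (\<alpha> i)) - of_int k}" unfolding val_a by auto
 ultimately have "affine hull F = {x. val \<alpha> k x = 0}"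
  using \<open>a ~= 0\<close> dim F(2) unfolding eq
  by (intro affine_dim_equal) (auto simp: affine_hyperplane aff_dim_hyperplane)
 \<comment> \<open>At \<open>x0\<close> the equation reads k = sum of \<alpha>_i (1 - x_i), with
   each 1 - x_i between 0 and 1.\<close>
 moreover have "k \<in> {0..int (CARD('n) * K)}"
 proof -
  have k: "real_of_int k = (\<Sum>i\<in>UNIV. real (\<alpha> i) * (1 - x0 $ i))"
   using \<phi>(3) by (simp add: val_def right_diff_distrib sum_subtractf)
  have b: "0 <= real (\<alpha> i) * (1 - x0 $ i)" "real (\<alpha> i) * (1 - x0 $ i) <= real K * 1" for i
  proof -
   have xi: "0 < x0 $ i" "x0 $ i < 1" using x0c by (auto simp: open_cube_def)
   show "0 <= real (\<alpha> i) * (1 - x0 $ i)" using xi by simp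
   show "real (\<alpha> i) * (1 - x0 $ i) <= real K * 1" using xi \<alpha>K[of i] by (intro mult_mono) auto
  qed
  have "0 <= real_of_int k" unfolding k by (intro sum_nonneg b)
  moreover have "real_of_int k <= (\<Sum>i\<in>(UNIV :: 'n set). real K * 1)" unfolding k by (intro sum_mono b)
  then have "real_of_int k <= real_of_int (int (CARD('n) * K))" by simp
  ultimately show ?thesis by (simp only: of_int_le_iff of_int_0_le_iff atLeastAtMost_iff)
 qed
 ultimately show ?thesis using \<alpha>K by blast
qed

end

theorem theorem4p1:
  fixes f :: "'n::finite \<Rightarrow> germ"
    and a :: "(real ^ 'n) set \<Rightarrow> real ^ 'n"
    and c :: "(real ^ 'n) set \<Rightarrow> real"
  assumes "\<And>i. irreducible (f i)"
    and "\<And>i. germ_at0 (f i) = 0"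
    and "\<And>i k. i \<noteq> k \<Longrightarrow> \<not> (f i dvd f k \<and> f k dvd f i)"
    and "\<And>H. H \<in> quasiadj_hyperplanes f \<Longrightarrow> a H \<noteq> 0 \<and> H = {x. a H \<bullet> x = c H}"
  shows "finite (quasiadj_hyperplanes f) \<and>
    (\<forall>b\<in>bernstein_ideal f. (\<Prod>H\<in>quasiadj_hyperplanes f. shifted_form (a H) (c H)) dvd b)"
proof -
 have fnz: "f i ~= 0" for i using assms(1)[of i] by auto
 obtain K where K: "polyhedral K (%i. rep_germ (f i))"
  using polyhedral_exists[of "%i. rep_germ (f i)"] hol2_at0_rep_germ rep_germ_nonzero[OF fnz] by blast
 have "ALL \<phi>. EX C U. describes K (%i. rep_germ (f i)) (rep_germ \<phi>) C U"
  using K hol2_at0_rep_germ unfolding polyhedral_def by blast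
 then obtain C U where CU: "!!\<phi>. describes K (%i. rep_germ (f i)) (rep_germ \<phi>) (C \<phi>) (U \<phi>)" by metis
 have face: "EX \<A> P. face f \<A> P F K C U" if "quasiadj_face f F" for F
  using that fnz assms(2) CU unfolding quasiadj_face_def face_def by blast
 \<comment> \<open>A finite list of candidates that does not depend on the face. Finiteness also
   gives the product its meaning, as a product over an infinite set is 1 by convention.\<close>
 let ?S = "(%(\<alpha>, k). {x. val \<alpha> k x = 0}) ` ({\<alpha>. ALL i. \<alpha> i <= K} \<times> {0..int (CARD('n) * K)})"
 have "quasiadj_hyperplanes f \<subseteq> ?S"
 proof
  fix H assume "H \<in> quasiadj_hyperplanes f"
  then obtain F where F: "H = affine hull F" "quasiadj_face f F" "aff_dim F = int CARD('n) - 1"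
   unfolding quasiadj_hyperplanes_def by blast
  obtain \<A> P where "face f \<A> P F K C U" using face[OF F(2)] by blast
  from face.face_hyperplane[OF this F(3)] obtain \<alpha> k where
   "ALL i. \<alpha> i <= K" "k \<in> {0..int (CARD('n) * K)}" "affine hull F = {x. val \<alpha> k x = 0}" by blast
  then show "H \<in> ?S" unfolding F(1) by (intro image_eqI[of _ _ "(\<alpha>, k)"]) auto
 qed
 moreover have "finite ?S" using finite_bounded_functions by (intro finite_imageI finite_cartesian_product) auto
 ultimately have fin: "finite (quasiadj_hyperplanes f)" by (rule finite_subset)
 moreover have "(\<Prod>H\<in>quasiadj_hyperplanes f. shifted_form (a H) (c H)) dvd b" if b: "b \<in> bernstein_ideal f" for b
 proof (rule prod_shifted_form_dvd[OF fin assms(4)])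
  fix H assume "H \<in> quasiadj_hyperplanes f"
  then obtain F where F: "H = affine hull F" "quasiadj_face f F" unfolding quasiadj_hyperplanes_def by blast
  obtain \<A> P where "face f \<A> P F K C U" using face[OF F(2)] by blast
  from face.vanishes_on_face[OF this b] show "vanishes_on_piece H b" by (simp add: F(1))
 qed
 ultimately show ?thesis by blast
qed

end
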